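(* Let $s<-\frac14$. Then for any $T>0$, the data-to-solution map $u_0\mapsto u$ of the Cauchy problem $$\partial_t u+(\partial_x^3+\partial_y^3)u=4^{-\frac13}(\partial_x+\partial_y)(u^2),\qquad u(0,\cdot)=u_0,$$ for real-valued $u=u(t,x,y)$ on $[0,T]\times\mathbb{R}^2$, as a map from the unit ball in $H^s(\mathbb{R}^2)$ to $C([0,T];H^s(\mathbb{R}^2))$, fails to be $C^2$.
   Context: $H^s(\mathbb{R}^2)$ is the usual $L^2$-based Sobolev space. $C^2$ refers to Fréchet differentiability. "Fails to be $C^2$" is meant in the usual sense for such ill-posedness statements: there is no map from the unit ball of $H^s(\mathbb{R}^2)$ to $C([0,T];H^s(\mathbb{R}^2))$ which sends each initial datum $u_0$ to a solution $u$ of the Duhamel equation $u(t)=e^{-t(\partial_x^3+\partial_y^3)}u_0+4^{-1/3}\int_0^te^{-(t-t')(\partial_x^3+\partial_y^3)}(\partial_x+\partial_y)(u(t')^2)\,dt'$ and which is of class $C^2$ (already at the origin $u_0=0$, where $u=0$). *)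

theory Defs
  imports "HOL-Analysis.Analysis" "HOL-Library.Function_Algebras"
begin

section \<open>Schwartz functions and tempered distributions on the plane\<close>

type_synonym plane = "real \<times> real"

definition pdx :: "(plane \<Rightarrow> complex) \<Rightarrow> plane \<Rightarrow> complex" where
  "pdx \<phi> z = frechet_derivative \<phi> (at z) (1, 0)"

definition pdy :: "(plane \<Rightarrow> complex) \<Rightarrow> plane \<Rightarrow> complex" where
  "pdy \<phi> z = frechet_derivative \<phi> (at z) (0, 1)"

definition pderivs :: "nat \<Rightarrow> nat \<Rightarrow> (plane \<Rightarrow> complex) \<Rightarrow> plane \<Rightarrow> complex" where
  "pderivs j k \<phi> = (pdx ^^ j) ((pdy ^^ k) \<phi>)"

definition schwartz :: "(plane \<Rightarrow> complex) \<Rightarrow> bool" where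
  "schwartz \<phi> \<longleftrightarrow>
     (\<forall>j k z. pderivs j k \<phi> differentiable (at z)) \<and>
     (\<forall>j k l. \<exists>B. \<forall>z. norm z ^ l * cmod (pderivs j k \<phi> z) \<le> B)"

text \<open>
  The second conjunct of \<open>tempered\<close> is continuity on the Schwartz space: \<open>u \<phi>\<close> is
  controlled by finitely many of the seminorms of \<open>\<phi>\<close>.  The last one makes equality of
  functionals equality on Schwartz functions.
\<close>

definition tempered :: "((plane \<Rightarrow> complex) \<Rightarrow> complex) \<Rightarrow> bool" where
  "tempered u \<longleftrightarrow>
     (\<forall>\<phi> \<psi> a b. schwartz \<phi> \<longrightarrow> schwartz \<psi> \<longrightarrow>
        u (\<lambda>z. a * \<phi> z + b * \<psi> z) = a * u \<phi> + b * u \<psi>) \<and>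
     (\<exists>C m. \<forall>\<phi> B. schwartz \<phi> \<longrightarrow>
        (\<forall>j\<le>m. \<forall>k\<le>m. \<forall>l\<le>m. \<forall>z. norm z ^ l * cmod (pderivs j k \<phi> z) \<le> B) \<longrightarrow>
        cmod (u \<phi>) \<le> C * B) \<and>
     (\<forall>\<phi>. \<not> schwartz \<phi> \<longrightarrow> u \<phi> = 0)"

lemma tempered_zero: "tempered (\<lambda>\<phi>. 0)"
  unfolding tempered_def by (auto intro!: exI[of _ 0])

lemma tempered_add:
  assumes "tempered u" "tempered v"
  shows "tempered (\<lambda>\<phi>. u \<phi> + v \<phi>)"
proof -
  obtain C m where 1: "\<And>\<phi> B. schwartz \<phi> \<Longrightarrow>
      (\<forall>j\<le>m. \<forall>k\<le>m. \<forall>l\<le>m. \<forall>z. norm z ^ l * cmod (pderivs j k \<phi> z) \<le> B) \<Longrightarrow>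
      cmod (u \<phi>) \<le> C * B"
    using assms(1) unfolding tempered_def by metis
  obtain D n where 2: "\<And>\<phi> B. schwartz \<phi> \<Longrightarrow>
      (\<forall>j\<le>n. \<forall>k\<le>n. \<forall>l\<le>n. \<forall>z. norm z ^ l * cmod (pderivs j k \<phi> z) \<le> B) \<Longrightarrow>
      cmod (v \<phi>) \<le> D * B"
    using assms(2) unfolding tempered_def by metis
  have "cmod (u \<phi> + v \<phi>) \<le> (C + D) * B"
    if "schwartz \<phi>" and *: "\<forall>j\<le>max m n. \<forall>k\<le>max m n. \<forall>l\<le>max m n. \<forall>z.
          norm z ^ l * cmod (pderivs j k \<phi> z) \<le> B" for \<phi> B
  proof -
    have "cmod (u \<phi>) \<le> C * B" "cmod (v \<phi>) \<le> D * B"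
      using that by (auto intro!: 1 2)
    then show ?thesis
      using norm_triangle_ineq[of "u \<phi>" "v \<phi>"] by (simp add: algebra_simps)
  qed
  then have "\<exists>C m. \<forall>\<phi> B. schwartz \<phi> \<longrightarrow>
      (\<forall>j\<le>m. \<forall>k\<le>m. \<forall>l\<le>m. \<forall>z. norm z ^ l * cmod (pderivs j k \<phi> z) \<le> B) \<longrightarrow>
      cmod (u \<phi> + v \<phi>) \<le> C * B"
    by blast
  then show ?thesis
    using assms unfolding tempered_def by (auto simp: algebra_simps)
qed

lemma tempered_scaleR:
  assumes "tempered u"
  shows "tempered (\<lambda>\<phi>. c *\<^sub>R u \<phi>)"
proof -
  obtain C m where 1: "\<And>\<phi> B. schwartz \<phi> \<Longrightarrow>
      (\<forall>j\<le>m. \<forall>k\<le>m. \<forall>l\<le>m. \<forall>z. norm z ^ l * cmod (pderivs j k \<phi> z) \<le> B) \<Longrightarrow>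
      cmod (u \<phi>) \<le> C * B"
    using assms unfolding tempered_def by metis
  have "cmod (c *\<^sub>R u \<phi>) \<le> (\<bar>c\<bar> * C) * B"
    if "schwartz \<phi>" and "\<forall>j\<le>m. \<forall>k\<le>m. \<forall>l\<le>m. \<forall>z.
          norm z ^ l * cmod (pderivs j k \<phi> z) \<le> B" for \<phi> B
    using 1[OF that] by (simp add: mult.assoc mult_left_mono)
  then have "\<exists>C m. \<forall>\<phi> B. schwartz \<phi> \<longrightarrow>
      (\<forall>j\<le>m. \<forall>k\<le>m. \<forall>l\<le>m. \<forall>z. norm z ^ l * cmod (pderivs j k \<phi> z) \<le> B) \<longrightarrow>
      cmod (c *\<^sub>R u \<phi>) \<le> C * B"
    by blast
  then show ?thesis
    using assms unfolding tempered_def by (auto simp: algebra_simps)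
qed

typedef tdist = "{u. tempered u}"
  morphisms apply_tdist Abs_tdist
  using tempered_zero by auto

setup_lifting type_definition_tdist

instantiation tdist :: real_vector
begin

lift_definition zero_tdist :: tdist is "\<lambda>\<phi>. 0"
  by (rule tempered_zero)

lift_definition plus_tdist :: "tdist \<Rightarrow> tdist \<Rightarrow> tdist" is "\<lambda>u v \<phi>. u \<phi> + v \<phi>"
  by (rule tempered_add)

lift_definition scaleR_tdist :: "real \<Rightarrow> tdist \<Rightarrow> tdist" is "\<lambda>c u \<phi>. c *\<^sub>R u \<phi>"
  by (rule tempered_scaleR)

definition uminus_tdist :: "tdist \<Rightarrow> tdist" where
  "uminus_tdist u = (-1) *\<^sub>R u"

definition minus_tdist :: "tdist \<Rightarrow> tdist \<Rightarrow> tdist" where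
  "minus_tdist u v = u + (- v)"

instance
  by standard
    (unfold uminus_tdist_def minus_tdist_def,
     (transfer, auto simp: algebra_simps fun_eq_iff)+)

end

text \<open>
  \<open>tdist_of L\<close> is meant for functionals \<open>L\<close> that are linear and continuous on Schwartz
  functions; their values elsewhere are discarded.
\<close>

definition tdist_of :: "((plane \<Rightarrow> complex) \<Rightarrow> complex) \<Rightarrow> tdist" where
  "tdist_of L = Abs_tdist (\<lambda>\<phi>. if schwartz \<phi> then L \<phi> else 0)"

definition real_valued :: "tdist \<Rightarrow> bool" where
  "real_valued u \<longleftrightarrow>
     (\<forall>\<phi>. schwartz \<phi> \<longrightarrow> range \<phi> \<subseteq> \<real> \<longrightarrow> apply_tdist u \<phi> \<in> \<real>)"

text \<open>\<open>u\<close> is the distribution given by the function \<open>g\<close>.\<close>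

definition has_density :: "tdist \<Rightarrow> (plane \<Rightarrow> complex) \<Rightarrow> bool" where
  "has_density u g \<longleftrightarrow> g \<in> borel_measurable lborel \<and>
     (\<forall>\<phi>. schwartz \<phi> \<longrightarrow> integrable lborel (\<lambda>z. g z * \<phi> z) \<and>
        apply_tdist u \<phi> = (LINT z|lborel. g z * \<phi> z))"

definition dist_dx :: "tdist \<Rightarrow> tdist" where
  "dist_dx u = tdist_of (\<lambda>\<phi>. - apply_tdist u (pdx \<phi>))"

definition dist_dy :: "tdist \<Rightarrow> tdist" where
  "dist_dy u = tdist_of (\<lambda>\<phi>. - apply_tdist u (pdy \<phi>))"

section \<open>Fourier transform and Sobolev spaces\<close>

definition fourier :: "(plane \<Rightarrow> complex) \<Rightarrow> plane \<Rightarrow> complex" where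
  "fourier \<phi> \<zeta> = (LINT z|lborel. cis (- (z \<bullet> \<zeta>)) * \<phi> z) / complex_of_real (2 * pi)"

text \<open>
  The Fourier transform of \<open>u\<close>, which is the distribution mapping \<open>\<phi>\<close> to
  \<open>apply_tdist u (fourier \<phi>)\<close>, is the function \<open>f\<close>.
\<close>

definition has_fourier :: "tdist \<Rightarrow> (plane \<Rightarrow> complex) \<Rightarrow> bool" where
  "has_fourier u f \<longleftrightarrow> f \<in> borel_measurable lborel \<and>
     (\<forall>\<phi>. schwartz \<phi> \<longrightarrow> integrable lborel (\<lambda>\<zeta>. f \<zeta> * \<phi> \<zeta>) \<and>
        apply_tdist u (fourier \<phi>) = (LINT \<zeta>|lborel. f \<zeta> * \<phi> \<zeta>))"

definition sobolev :: "real \<Rightarrow> tdist set" where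
  "sobolev s = {u. \<exists>f. has_fourier u f \<and>
     integrable lborel (\<lambda>\<zeta>. (1 + (norm \<zeta>)\<^sup>2) powr s * (cmod (f \<zeta>))\<^sup>2)}"

text \<open>The function \<open>f\<close> chosen here is unique up to null sets, so the norm does not depend on it.\<close>

definition sobolev_norm :: "real \<Rightarrow> tdist \<Rightarrow> real" where
  "sobolev_norm s u = (let f = (SOME f. has_fourier u f) in
     sqrt (LINT \<zeta>|lborel. (1 + (norm \<zeta>)\<^sup>2) powr s * (cmod (f \<zeta>))\<^sup>2))"

definition real_sobolev :: "real \<Rightarrow> tdist set" where
  "real_sobolev s = {u \<in> sobolev s. real_valued u}"

text \<open>
  The space \<open>C([0,T]; H\<^sup>s)\<close> of real-valued paths.  Paths are set to \<open>0\<close> outside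
  \<open>[0,T]\<close>, so that the sup norm over \<open>[0,T]\<close> is a norm and not just a seminorm.
\<close>

definition paths :: "real \<Rightarrow> real \<Rightarrow> (real \<Rightarrow> tdist) set" where
  "paths s T = {u. (\<forall>t\<in>{0..T}. u t \<in> real_sobolev s) \<and>
     (\<forall>t\<in>{0..T}. ((\<lambda>t'. sobolev_norm s (u t' - u t)) \<longlongrightarrow> 0) (at t within {0..T})) \<and>
     (\<forall>t. t \<notin> {0..T} \<longrightarrow> u t = 0)}"

definition paths_norm :: "real \<Rightarrow> real \<Rightarrow> (real \<Rightarrow> tdist) \<Rightarrow> real" where
  "paths_norm s T u = (SUP t\<in>{0..T}. sobolev_norm s (u t))"

definition paths_converge :: "real \<Rightarrow> real \<Rightarrow> (nat \<Rightarrow> real \<Rightarrow> tdist) \<Rightarrow> (real \<Rightarrow> tdist) \<Rightarrow> bool" where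
  "paths_converge s T v u \<longleftrightarrow> (\<forall>e>0. \<forall>\<^sub>F n in sequentially. \<forall>t\<in>{0..T}.
     v n t - u t \<in> sobolev s \<and> sobolev_norm s (v n t - u t) < e)"

section \<open>The Duhamel equation\<close>

text \<open>
  \<open>exp (- t (\<partial>\<^sub>x^3 + \<partial>\<^sub>y^3))\<close> is the Fourier multiplier with symbol
  \<open>exp (- t ((\<i>\<xi>)^3 + (\<i>\<eta>)^3)) = exp (\<i>t (\<xi>^3 + \<eta>^3))\<close>.  It is only applied to distributions
  whose Fourier transform is a function.
\<close>

definition propagator :: "real \<Rightarrow> tdist \<Rightarrow> tdist" where
  "propagator t u = (THE w. \<exists>f. has_fourier u f \<and>
     has_fourier w (\<lambda>(\<xi>, \<eta>). cis (t * (\<xi> ^ 3 + \<eta> ^ 3)) * f (\<xi>, \<eta>)))"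

definition dist_square :: "tdist \<Rightarrow> tdist" where
  "dist_square u = (let g = (SOME g. has_density u g) in
     tdist_of (\<lambda>\<phi>. LINT z|lborel. (g z)\<^sup>2 * \<phi> z))"

text \<open>
  The integral over time is taken weakly, i.e. after pairing with Schwartz functions.  The
  definition is meant for \<open>u\<close> in \<open>C([0,T]; H\<^sup>2)\<close>; then \<open>u t\<close> is a bounded continuous
  function, \<open>u(t)\<^sup>2\<close> is its pointwise square, and the integrand is continuous in time.
\<close>

definition duhamel_term :: "(real \<Rightarrow> tdist) \<Rightarrow> real \<Rightarrow> tdist" where
  "duhamel_term u t = tdist_of (\<lambda>\<phi>. complex_of_real (4 powr (- 1 / 3)) *
     integral {0..t} (\<lambda>t'. apply_tdist
       (propagator (t - t') (dist_dx (dist_square (u t')) + dist_dy (dist_square (u t')))) \<phi>))"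

text \<open>
  For \<open>s < 0\<close> the square of an element of \<open>H\<^sup>s\<close> is not defined, so the nonlinear term of the
  Duhamel equation needs an interpretation.  A path \<open>u\<close> in \<open>C([0,T]; H\<^sup>s)\<close> is a solution with
  datum \<open>u\<^sub>0\<close> if it satisfies the equation with the nonlinear term read as the limit of
  \<open>duhamel_term (v n)\<close> along regular paths \<open>v n\<close> converging to \<open>u\<close>.  For smooth data (all
  Sobolev norms finite) the equation makes classical sense and is required literally, for a
  path that is regular itself; without this the solution map could pick spurious limits
  even for smooth data.
\<close>

definition regular_solution :: "real \<Rightarrow> tdist \<Rightarrow> (real \<Rightarrow> tdist) \<Rightarrow> bool" where
  "regular_solution T u\<^sub>0 u \<longleftrightarrow> u \<in> paths 2 T \<and>
     (\<forall>t\<in>{0..T}. u t = propagator t u\<^sub>0 + duhamel_term u t)"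

definition solution :: "real \<Rightarrow> real \<Rightarrow> tdist \<Rightarrow> (real \<Rightarrow> tdist) \<Rightarrow> bool" where
  "solution s T u\<^sub>0 u \<longleftrightarrow> u \<in> paths s T \<and>
     (\<exists>v. (\<forall>n. v n \<in> paths 2 T) \<and> paths_converge s T v u \<and>
        (\<exists>r\<le>s. paths_converge r T (\<lambda>n t. propagator t u\<^sub>0 + duhamel_term (v n) t) u)) \<and>
     ((\<forall>\<sigma>. u\<^sub>0 \<in> sobolev \<sigma>) \<longrightarrow> regular_solution T u\<^sub>0 u)"

section \<open>Maps of class \<open>C\<^sup>2\<close> between normed spaces given by carrier and norm\<close>

instantiation "fun" :: (type, real_vector) real_vector
begin

definition scaleR_fun :: "real \<Rightarrow> ('a \<Rightarrow> 'b) \<Rightarrow> 'a \<Rightarrow> 'b" where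
  "scaleR_fun c f = (\<lambda>x. c *\<^sub>R f x)"

instance
  by standard (auto simp: scaleR_fun_def fun_eq_iff algebra_simps)

end

definition bounded_linear_between ::
  "'a::real_vector set \<Rightarrow> ('a \<Rightarrow> real) \<Rightarrow> 'b::real_vector set \<Rightarrow> ('b \<Rightarrow> real) \<Rightarrow>
   ('a \<Rightarrow> 'b) \<Rightarrow> bool" where
  "bounded_linear_between X nX Y nY L \<longleftrightarrow>
     (\<forall>h\<in>X. L h \<in> Y) \<and>
     (\<forall>h\<in>X. \<forall>k\<in>X. L (h + k) = L h + L k) \<and>
     (\<forall>c. \<forall>h\<in>X. L (c *\<^sub>R h) = c *\<^sub>R L h) \<and>
     (\<exists>K. \<forall>h\<in>X. nY (L h) \<le> K * nX h)"

definition bounded_bilinear_between ::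
  "'a::real_vector set \<Rightarrow> ('a \<Rightarrow> real) \<Rightarrow> 'b::real_vector set \<Rightarrow> ('b \<Rightarrow> real) \<Rightarrow>
   ('a \<Rightarrow> 'a \<Rightarrow> 'b) \<Rightarrow> bool" where
  "bounded_bilinear_between X nX Y nY B \<longleftrightarrow>
     (\<forall>h\<in>X. bounded_linear_between X nX Y nY (B h)) \<and>
     (\<forall>k\<in>X. bounded_linear_between X nX Y nY (\<lambda>h. B h k)) \<and>
     (\<exists>K. \<forall>h\<in>X. \<forall>k\<in>X. nY (B h k) \<le> K * nX h * nX k)"

text \<open>
  Below \<open>U\<close> is open in \<open>X\<close>, \<open>D x\<close> is the Frechet derivative of \<open>F\<close> at \<open>x\<close>, and \<open>D2 x\<close> the
  Frechet derivative of \<open>D\<close> at \<open>x\<close> with respect to the operator norm; the last conjunct is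
  continuity of \<open>D2\<close> with respect to the norm of bounded bilinear maps.
\<close>

definition C2_on ::
  "'a::real_vector set \<Rightarrow> ('a \<Rightarrow> real) \<Rightarrow> 'b::real_vector set \<Rightarrow> ('b \<Rightarrow> real) \<Rightarrow>
   'a set \<Rightarrow> ('a \<Rightarrow> 'b) \<Rightarrow> bool" where
  "C2_on X nX Y nY U F \<longleftrightarrow> (\<exists>D D2. \<forall>x\<in>U.
     F x \<in> Y \<and>
     bounded_linear_between X nX Y nY (D x) \<and>
     bounded_bilinear_between X nX Y nY (D2 x) \<and>
     (\<forall>e>0. \<exists>d>0. \<forall>h\<in>X. nX h < d \<and> x + h \<in> U \<longrightarrow>
        nY (F (x + h) - F x - D x h) \<le> e * nX h) \<and>
     (\<forall>e>0. \<exists>d>0. \<forall>h\<in>X. nX h < d \<and> x + h \<in> U \<longrightarrow>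
        (\<forall>k\<in>X. nY (D (x + h) k - D x k - D2 x h k) \<le> e * nX h * nX k)) \<and>
     (\<forall>e>0. \<exists>d>0. \<forall>y\<in>U. nX (y - x) < d \<longrightarrow>
        (\<forall>h\<in>X. \<forall>k\<in>X. nY (D2 y h k - D2 x h k) \<le> e * nX h * nX k)))"

definition C2_at ::
  "'a::real_vector set \<Rightarrow> ('a \<Rightarrow> real) \<Rightarrow> 'b::real_vector set \<Rightarrow> ('b \<Rightarrow> real) \<Rightarrow>
   'a \<Rightarrow> ('a \<Rightarrow> 'b) \<Rightarrow> bool" where
  "C2_at X nX Y nY a F \<longleftrightarrow> (\<exists>r>0. C2_on X nX Y nY {x \<in> X. nX (x - a) < r} F)"

end

theory Submission
  imports Defs "HOL-Probability.Characteristic_Functions" "HOL-Probability.Sinc_Integral"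
begin

text \<open>
  Suppose that the solution map \<open>\<Phi>\<close> is \<open>C\<^sup>2\<close> at the origin, and let \<open>h\<close> be a datum whose Fourier
  transform is bounded with compact support.  For small \<open>\<tau>\<close> the path \<open>u\<^sub>\<tau> = \<Phi>(\<tau> h)\<close> solves the Duhamel
  equation literally.  On the Fourier side the equation conserves the \<open>L\<^sup>2\<close> norm, so \<open>u\<^sub>\<tau> / \<tau>\<close> has
  the norm of the free flow of \<open>h\<close>; the Duhamel formula gives \<open>u\<^sub>\<tau> = \<tau> U(t) h + O(\<tau>\<^sup>2)\<close> weakly, hence
  \<open>u\<^sub>\<tau> / \<tau> \<longlongrightarrow> U(t) h\<close> strongly in \<open>L\<^sup>2\<close> with a rate.  Inserted into the quadratic term this yields
  \<open>u\<^sub>\<tau> = \<tau> U(t) h + \<tau>\<^sup>2 W\<^sub>h(t) + o(\<tau>\<^sup>2)\<close>, where \<open>W\<^sub>h\<close> is the second Picard iterate, so that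
  \<open>D\<^sup>2\<Phi>(0)(h, h) = 2 W\<^sub>h\<close> and \<open>W\<^sub>h\<close> is bounded by a multiple of the square of the \<open>H\<^sup>s\<close> norm of \<open>h\<close>.

  This bound fails when the Fourier transform of \<open>h\<close> is the indicator of two parallelograms of size
  \<open>N\<^sup>-\<^sup>1\<^sup>/\<^sup>2 \<times> N\<^sup>-\<^sup>2\<close> at frequency \<open>N\<close> (and their reflections), placed where the resonance function
  vanishes and its two gradients are parallel, with the long sides orthogonal to them: the
  interaction is then resonant up to \<open>O(1)\<close>, and letting \<open>N = d\<^sup>-\<^sup>2\<close> tend to infinity forces
  \<open>s \<ge> -1/4\<close>.
\<close>

section \<open>Schwartz functions\<close>

text \<open>The hypothesis controls solutions only in \<open>H^s\<close> with \<open>s < 0\<close>,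
  where squaring is not continuous, and for a small multiple of a smooth datum it yields a path in
  \<open>H^2\<close> with no bound uniform in the multiple. The conserved \<open>L^2\<close> norm
  supplies what is missing: by \<open>|a - b|^2 = |a|^2 - |b|^2 - 2 Re ((a - b) cnj b)\<close> the
  squared distance to the free flow is a pairing with the fixed free flow, for which the weak bound
  \<open>O(\<tau>^2)\<close> suffices. Two \<open>L^2\<close> factors already bound a convolution
  pointwise, so closeness in \<open>L^2\<close> is all that the quadratic term needs.

  The box sizes balance the resonance function. Its gradient has size \<open>N^2\<close>, which
  forces the width \<open>N^(-2)\<close> across; its Hessian has size \<open>N\<close>, which allows
  the length \<open>N^(-1/2)\<close> along the common level direction. With the area
  \<open>\<mu> = N^(-5/2)\<close> the estimate reads, up to constants,
  \<open>N^s * N * \<mu> * \<mu>^(1/2) <= K * N^(2 s) * \<mu>\<close>, that is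
  \<open>N^(-1/4) <= K * N^s\<close>; this is the threshold.\<close>

lemma pdx_eqI: "(f has_derivative D) (at z) \<Longrightarrow> pdx f z = D (1, 0)"
  unfolding pdx_def by (metis frechet_derivative_at)

lemma pdy_eqI: "(f has_derivative D) (at z) \<Longrightarrow> pdy f z = D (0, 1)"
  unfolding pdy_def by (metis frechet_derivative_at)

lemma has_derivative_pd:
  fixes f :: "plane \<Rightarrow> complex"
  assumes "f differentiable (at z)"
  shows "(f has_derivative (\<lambda>h. fst h *\<^sub>R pdx f z + snd h *\<^sub>R pdy f z)) (at z)"
proof -
  let ?D = "frechet_derivative f (at z)"
  have D: "(f has_derivative ?D) (at z)"
    using assms frechet_derivative_works by blast
  interpret bounded_linear ?D using D by (rule has_derivative_bounded_linear)
  have "?D h = fst h *\<^sub>R pdx f z + snd h *\<^sub>R pdy f z" for h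
  proof -
    have "h = fst h *\<^sub>R (1, 0) + snd h *\<^sub>R (0, 1)" by (cases h) simp
    then have "?D h = fst h *\<^sub>R ?D (1, 0) + snd h *\<^sub>R ?D (0, 1)"
      by (metis add scale)
    then show ?thesis by (simp add: pdx_def pdy_def)
  qed
  then show ?thesis using D by (metis (no_types, lifting) ext)
qed

lemma pdx_pdy_eqI:
  assumes "(f has_derivative (\<lambda>h. fst h *\<^sub>R a + snd h *\<^sub>R b)) (at z)"
  shows "pdx f z = a" "pdy f z = b"
  using pdx_eqI[OF assms] pdy_eqI[OF assms] by auto

lemma has_vector_derivative_pdx:
  assumes "f differentiable (at (x, y))"
  shows "((\<lambda>s. f (s, y)) has_vector_derivative pdx f (x, y)) (at x)"
proof -
  have 1: "((\<lambda>s. (s, y)) has_derivative (\<lambda>h. (h, 0))) (at x)"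
    by (auto intro!: derivative_eq_intros)
  show ?thesis
    using has_derivative_compose[OF 1 has_derivative_pd[OF assms]]
    by (simp add: has_vector_derivative_def)
qed

lemma has_vector_derivative_pdy:
  assumes "f differentiable (at (x, y))"
  shows "((\<lambda>s. f (x, s)) has_vector_derivative pdy f (x, y)) (at y)"
proof -
  have 1: "((\<lambda>s. (x, s)) has_derivative (\<lambda>h. (0, h))) (at y)"
    by (auto intro!: derivative_eq_intros)
  show ?thesis
    using has_derivative_compose[OF 1 has_derivative_pd[OF assms]]
    by (simp add: has_vector_derivative_def)
qed

lemma vector_derivative_bound:
  fixes g :: "real \<Rightarrow> complex"
  assumes "\<And>s. s \<in> closed_segment a b \<Longrightarrow> (g has_vector_derivative g' s) (at s)"
    and "\<And>s. s \<in> closed_segment a b \<Longrightarrow> norm (g' s) \<le> B"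
  shows "norm (g b - g a) \<le> B * \<bar>b - a\<bar>"
proof -
  have "norm (g b - g a) \<le> B * norm (b - a)"
  proof (rule differentiable_bound[where S = "closed_segment a b" and f' = "\<lambda>s h. h *\<^sub>R g' s"])
    show "(g has_derivative (\<lambda>h. h *\<^sub>R g' s)) (at s within closed_segment a b)"
      if "s \<in> closed_segment a b" for s
      using assms(1)[OF that] unfolding has_vector_derivative_def
      by (rule has_derivative_at_withinI)
    show "onorm (\<lambda>h. h *\<^sub>R g' s) \<le> B" if "s \<in> closed_segment a b" for s
      using assms(2)[OF that] onorm_scaleR_left[of "\<lambda>h::real. h" "g' s"]
      by (simp add: onorm_id bounded_linear_ident)
  qed auto
  then show ?thesis by simp
qed

text \<open>A bound on increments that is uniform for small \<open>h\<close> survives division by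
  \<open>h\<close> and the limit. It converts mean value estimates into estimates for
  derivatives.\<close>

lemma vector_derivative_close:
  fixes F :: "real \<Rightarrow> complex"
  assumes F: "(F has_vector_derivative V) (at x)" and "d > 0"
    and le: "\<And>h. \<bar>h\<bar> < d \<Longrightarrow> norm (F (x + h) - F x - h *\<^sub>R c) \<le> B * \<bar>h\<bar>"
  shows "norm (V - c) \<le> B"
proof -
  have "((\<lambda>h. norm (F (x + h) - F x - h *\<^sub>R V) / norm h) \<longlongrightarrow> 0) (at 0)"
    using F unfolding has_vector_derivative_def has_derivative_at by blast
  then have lim: "((\<lambda>h. B + norm (F (x + h) - F x - h *\<^sub>R V) / norm h) \<longlongrightarrow> B + 0) (at 0)"
    by (intro tendsto_intros)
  have ev: "\<forall>\<^sub>F h in at 0. norm (V - c) \<le> B + norm (F (x + h) - F x - h *\<^sub>R V) / norm h"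
    unfolding eventually_at
  proof (intro exI[of _ d] conjI ballI impI)
    fix h :: real assume "h \<noteq> 0 \<and> dist h 0 < d"
    then have h: "h \<noteq> 0" "\<bar>h\<bar> < d" by auto
    have "\<bar>h\<bar> * norm (V - c) = norm (h *\<^sub>R (V - c))" by simp
    also have "h *\<^sub>R (V - c) = (F (x + h) - F x - h *\<^sub>R c) - (F (x + h) - F x - h *\<^sub>R V)"
      by (simp add: algebra_simps)
    also have "norm \<dots> \<le> B * \<bar>h\<bar> + norm (F (x + h) - F x - h *\<^sub>R V)"
      by (rule order_trans[OF norm_triangle_ineq4 add_right_mono[OF le[OF h(2)]]])
    finally show "norm (V - c) \<le> B + norm (F (x + h) - F x - h *\<^sub>R V) / norm h"
      using h by (simp add: field_simps)
  qed (rule \<open>d > 0\<close>)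
  show ?thesis
    using tendsto_lowerbound[OF lim ev] by simp
qed

text \<open>The hypotheses are asymmetric because \<open>pderivs\<close> applies \<open>pdy\<close>
  first: the definition of \<open>schwartz\<close> asserts regularity of
  \<open>pdx (pdy \<phi>)\<close> but not of \<open>pdy (pdx \<phi>)\<close>. The second difference
  of \<open>\<phi>\<close> is compared with \<open>h * k * c\<close> by two mean value estimates;
  then \<open>h\<close> and after it \<open>k\<close> tend to zero.\<close>

lemma pdy_pdx_commute:
  assumes d0: "\<And>z. \<phi> differentiable (at z)" and dx: "\<And>z. pdx \<phi> differentiable (at z)"
    and dy: "\<And>z. pdy \<phi> differentiable (at z)" and cont: "isCont (pdx (pdy \<phi>)) z"
  shows "pdy (pdx \<phi>) z = pdx (pdy \<phi>) z"
proof -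
  obtain x y where z: "z = (x, y)" by (cases z)
  define c where "c = pdx (pdy \<phi>) z"
  have "norm (pdy (pdx \<phi>) z - c) \<le> e" if "e > 0" for e
  proof -
    obtain d where d: "d > 0" "\<And>w. dist w z < d \<Longrightarrow> dist (pdx (pdy \<phi>) w) c < e"
      using cont[unfolded continuous_at_eps_delta, rule_format, OF \<open>e > 0\<close>] unfolding c_def by auto
    have near: "norm (pdx (pdy \<phi>) (x + h, y + k) - c) \<le> e" if "\<bar>h\<bar> < d/2" "\<bar>k\<bar> < d/2" for h k
    proof -
      have "dist (x + h, y + k) z \<le> \<bar>h\<bar> + \<bar>k\<bar>"
        using z sqrt_sum_squares_le_sum_abs[of h k] by (simp add: dist_Pair_Pair dist_real_def)
      then show ?thesis using d(2)[of "(x + h, y + k)"] that by (simp add: dist_norm)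
    qed
    have 1: "norm (pdy \<phi> (x + h, y + k) - pdy \<phi> (x, y + k) - h *\<^sub>R c) \<le> e * \<bar>h\<bar>"
      if "\<bar>h\<bar> < d/2" "\<bar>k\<bar> < d/2" for h k
    proof -
      let ?g = "\<lambda>s. pdy \<phi> (s, y + k) - s *\<^sub>R c"
      have "norm (?g (x + h) - ?g x) \<le> e * \<bar>x + h - x\<bar>"
      proof (rule vector_derivative_bound[where g' = "\<lambda>s. pdx (pdy \<phi>) (s, y + k) - c"])
        fix s assume "s \<in> closed_segment x (x + h)"
        then have s: "\<bar>s - x\<bar> \<le> \<bar>h\<bar>" by (auto simp: closed_segment_eq_real_ivl split: if_splits)
        show "(?g has_vector_derivative pdx (pdy \<phi>) (s, y + k) - c) (at s)"
          by (auto intro!: derivative_eq_intros has_vector_derivative_pdx dy)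
        show "norm (pdx (pdy \<phi>) (s, y + k) - c) \<le> e"
          using near[of "s - x" k] s that by simp
      qed
      then show ?thesis by (simp add: algebra_simps)
    qed
    have 2: "norm ((\<phi> (x + h, y + k) - \<phi> (x + h, y)) - (\<phi> (x, y + k) - \<phi> (x, y)) - h *\<^sub>R (k *\<^sub>R c))
        \<le> (e * \<bar>k\<bar>) * \<bar>h\<bar>" if hk: "\<bar>h\<bar> < d/2" "\<bar>k\<bar> < d/2" for h k
    proof -
      let ?g = "\<lambda>s. \<phi> (x + h, s) - \<phi> (x, s) - s *\<^sub>R (h *\<^sub>R c)"
      have "norm (?g (y + k) - ?g y) \<le> (e * \<bar>h\<bar>) * \<bar>y + k - y\<bar>"
      proof (rule vector_derivative_bound[where g' = "\<lambda>s. pdy \<phi> (x + h, s) - pdy \<phi> (x, s) - h *\<^sub>R c"])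
        fix s assume "s \<in> closed_segment y (y + k)"
        then have s: "\<bar>s - y\<bar> \<le> \<bar>k\<bar>" by (auto simp: closed_segment_eq_real_ivl split: if_splits)
        show "(?g has_vector_derivative pdy \<phi> (x + h, s) - pdy \<phi> (x, s) - h *\<^sub>R c) (at s)"
          by (auto intro!: derivative_eq_intros has_vector_derivative_pdy d0)
        show "norm (pdy \<phi> (x + h, s) - pdy \<phi> (x, s) - h *\<^sub>R c) \<le> e * \<bar>h\<bar>"
          using 1[of h "s - y"] s hk by simp
      qed
      then show ?thesis by (simp add: algebra_simps)
    qed
    have 3: "norm (pdx \<phi> (x, y + k) - pdx \<phi> (x, y) - k *\<^sub>R c) \<le> e * \<bar>k\<bar>" if "\<bar>k\<bar> < d/2" for k
    proof (rule vector_derivative_close[where d = "d/2" and F = "\<lambda>s. \<phi> (s, y + k) - \<phi> (s, y)" and x = x])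
      show "((\<lambda>s. \<phi> (s, y + k) - \<phi> (s, y)) has_vector_derivative
          pdx \<phi> (x, y + k) - pdx \<phi> (x, y)) (at x)"
        by (auto intro!: derivative_eq_intros has_vector_derivative_pdx d0)
    qed (use d(1) 2 that in auto)
    show ?thesis
      unfolding z
    proof (rule vector_derivative_close[where d = "d/2" and F = "\<lambda>s. pdx \<phi> (x, s)" and x = y])
      show "((\<lambda>s. pdx \<phi> (x, s)) has_vector_derivative pdy (pdx \<phi>) (x, y)) (at y)"
        by (auto intro!: derivative_eq_intros has_vector_derivative_pdy dx)
    qed (use d(1) 3 in auto)
  qed
  then have "norm (pdy (pdx \<phi>) z - c) \<le> 0"
    by (meson field_le_epsilon add_0 dense_ge)
  then show ?thesis by (simp add: c_def)
qed

text \<open>All \<open>pderivs j k \<phi>\<close> stay inside a class closed under both derivatives,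
  so differentiability and decay have to be known only for its members. This avoids formulas for
  iterated derivatives of sums, products and transforms.\<close>

lemma schwartz_classI:
  assumes "\<phi> \<in> \<C>" and diff: "\<And>\<phi> z. \<phi> \<in> \<C> \<Longrightarrow> \<phi> differentiable (at z)"
    and pd: "\<And>\<phi>. \<phi> \<in> \<C> \<Longrightarrow> pdx \<phi> \<in> \<C>" "\<And>\<phi>. \<phi> \<in> \<C> \<Longrightarrow> pdy \<phi> \<in> \<C>"
    and bd: "\<And>\<phi> l. \<phi> \<in> \<C> \<Longrightarrow> \<exists>B. \<forall>z. norm z ^ l * cmod (\<phi> z) \<le> B"
  shows "schwartz \<phi>"
proof -
  have y: "(pdy ^^ k) \<phi> \<in> \<C>" for k by (induction k) (auto simp: assms(1) pd)
  have "(pdx ^^ j) ((pdy ^^ k) \<phi>) \<in> \<C>" for j k by (induction j) (auto simp: y pd)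
  then show ?thesis unfolding schwartz_def pderivs_def using diff bd by blast
qed

lemma schwartz_differentiable: "schwartz \<phi> \<Longrightarrow> \<phi> differentiable (at z)"
  unfolding schwartz_def pderivs_def by (metis funpow_0)

lemma schwartz_bound: "schwartz \<phi> \<Longrightarrow> \<exists>B. \<forall>z. norm z ^ l * cmod (\<phi> z) \<le> B"
  unfolding schwartz_def pderivs_def by (metis funpow_0)

lemma schwartz_pdy: "schwartz \<phi> \<Longrightarrow> schwartz (pdy \<phi>)"
  unfolding schwartz_def pderivs_def
  by (metis funpow_swap1 comp_apply funpow.simps(2))

lemma schwartz_pdx_differentiable: "schwartz \<phi> \<Longrightarrow> pdx \<phi> differentiable (at z)"
  unfolding schwartz_def pderivs_def
  by (metis funpow_0 funpow.simps(2) comp_apply)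

lemma schwartz_pdy_pdx: "schwartz \<phi> \<Longrightarrow> pdy (pdx \<phi>) = pdx (pdy \<phi>)"
  by (intro ext pdy_pdx_commute schwartz_differentiable schwartz_pdx_differentiable schwartz_pdy
      differentiable_imp_continuous_within)

text \<open>Harder than the case of \<open>pdy\<close>: in \<open>pderivs\<close> the new
  \<open>pdx\<close> has to be moved past all the \<open>pdy\<close>, which is what the commutation
  of derivatives is for.\<close>

lemma schwartz_pdx:
  assumes "schwartz \<phi>" shows "schwartz (pdx \<phi>)"
proof -
  have s: "schwartz ((pdy ^^ k) \<phi>)" for k
    by (induction k) (auto simp: assms schwartz_pdy)
  have c: "(pdy ^^ k) (pdx \<phi>) = pdx ((pdy ^^ k) \<phi>)" for k
    by (induction k) (auto simp: schwartz_pdy_pdx s)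
  have "pderivs j k (pdx \<phi>) = pderivs (Suc j) k \<phi>" for j k
    unfolding pderivs_def c by (simp add: funpow_swap1)
  then show ?thesis using assms unfolding schwartz_def by metis
qed

section \<open>Leibniz rules and closure of the Schwartz class under polynomial factors\<close>

lemma pd_add:
  assumes "f differentiable (at z)" "g differentiable (at z)"
  shows "pdx (\<lambda>z. f z + g z) z = pdx f z + pdx g z" "pdy (\<lambda>z. f z + g z) z = pdy f z + pdy g z"
  using pdx_eqI[OF has_derivative_add[OF has_derivative_pd[OF assms(1)] has_derivative_pd[OF assms(2)]]] pdy_eqI[OF has_derivative_add[OF has_derivative_pd[OF assms(1)] has_derivative_pd[OF assms(2)]]]
  by (simp_all add: scaleR_conv_of_real)

lemma pd_cmult:
  fixes f :: "plane \<Rightarrow> complex"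
  assumes "f differentiable (at z)"
  shows "pdx (\<lambda>z. c * f z) z = c * pdx f z" "pdy (\<lambda>z. c * f z) z = c * pdy f z"
  using pdx_eqI[OF has_derivative_mult_right[OF has_derivative_pd[OF assms(1)]]] pdy_eqI[OF has_derivative_mult_right[OF has_derivative_pd[OF assms(1)]]]
  by (simp_all add: scaleR_conv_of_real)

lemma pd_cnj:
  fixes f :: "plane \<Rightarrow> complex"
  assumes "f differentiable (at z)"
  shows "pdx (\<lambda>z. cnj (f z)) z = cnj (pdx f z)" "pdy (\<lambda>z. cnj (f z)) z = cnj (pdy f z)"
  using pdx_eqI[OF bounded_linear.has_derivative[OF bounded_linear_cnj has_derivative_pd[OF assms(1)]]] pdy_eqI[OF bounded_linear.has_derivative[OF bounded_linear_cnj has_derivative_pd[OF assms(1)]]]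
  by (simp_all add: scaleR_conv_of_real)

lemma has_derivative_coords:
  "((\<lambda>z::plane. complex_of_real (fst z)) has_derivative (\<lambda>h. complex_of_real (fst h))) (at z)"
  "((\<lambda>z::plane. complex_of_real (snd z)) has_derivative (\<lambda>h. complex_of_real (snd h))) (at z)"
  by (auto intro!: derivative_eq_intros)

lemma pd_fst:
  fixes f :: "plane \<Rightarrow> complex"
  assumes "f differentiable (at z)"
  shows "pdx (\<lambda>z. complex_of_real (fst z) * f z) z = complex_of_real (fst z) * pdx f z + f z"
    "pdy (\<lambda>z. complex_of_real (fst z) * f z) z = complex_of_real (fst z) * pdy f z"
  using pdx_eqI[OF has_derivative_mult[OF has_derivative_coords(1) has_derivative_pd[OF assms(1)]]] pdy_eqI[OF has_derivative_mult[OF has_derivative_coords(1) has_derivative_pd[OF assms(1)]]]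
  by (simp_all add: scaleR_conv_of_real)

lemma pd_snd:
  fixes f :: "plane \<Rightarrow> complex"
  assumes "f differentiable (at z)"
  shows "pdx (\<lambda>z. complex_of_real (snd z) * f z) z = complex_of_real (snd z) * pdx f z"
    "pdy (\<lambda>z. complex_of_real (snd z) * f z) z = complex_of_real (snd z) * pdy f z + f z"
  using pdx_eqI[OF has_derivative_mult[OF has_derivative_coords(2) has_derivative_pd[OF assms(1)]]] pdy_eqI[OF has_derivative_mult[OF has_derivative_coords(2) has_derivative_pd[OF assms(1)]]]
  by (simp_all add: scaleR_conv_of_real)

lemma differentiable_coords_mult:
  fixes f :: "plane \<Rightarrow> complex"
  assumes "f differentiable (at z)"
  shows "(\<lambda>z. complex_of_real (fst z) * f z) differentiable (at z)"
    "(\<lambda>z. complex_of_real (snd z) * f z) differentiable (at z)"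
  using has_derivative_mult[OF has_derivative_coords(1) has_derivative_pd[OF assms(1)]]
    has_derivative_mult[OF has_derivative_coords(2) has_derivative_pd[OF assms(1)]]
  unfolding differentiable_def by blast+

lemma differentiable_cnj:
  fixes f :: "plane \<Rightarrow> complex"
  assumes "f differentiable (at z)"
  shows "(\<lambda>z. cnj (f z)) differentiable (at z)"
  using bounded_linear.has_derivative[OF bounded_linear_cnj has_derivative_pd[OF assms(1)]]
  unfolding differentiable_def by blast

text \<open>The decay half of \<open>schwartz\<close> for the function alone; this is what gets
  checked on generators below.\<close>

definition rapid :: "(plane \<Rightarrow> complex) \<Rightarrow> bool" where
  "rapid \<phi> \<longleftrightarrow> (\<forall>l. \<exists>B. \<forall>z. norm z ^ l * cmod (\<phi> z) \<le> B)"

lemma rapid_add: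
  assumes "rapid f" "rapid g" shows "rapid (\<lambda>z. f z + g z)"
  unfolding rapid_def
proof
  fix l
  obtain A B where AB: "\<And>z. norm z ^ l * cmod (f z) \<le> A" "\<And>z. norm z ^ l * cmod (g z) \<le> B"
    using assms unfolding rapid_def by metis
  have "norm z ^ l * cmod (f z + g z) \<le> A + B" for z
    using mult_left_mono[OF norm_triangle_ineq[of "f z" "g z"], of "norm z ^ l"] AB[of z]
    by (simp add: distrib_left)
  then show "\<exists>B. \<forall>z. norm z ^ l * cmod (f z + g z) \<le> B" by blast
qed

lemma rapid_cmult:
  assumes "rapid f" shows "rapid (\<lambda>z. c * f z)"
  unfolding rapid_def
proof
  fix l
  obtain A where A: "\<And>z. norm z ^ l * cmod (f z) \<le> A"
    using assms unfolding rapid_def by metis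
  have "norm z ^ l * cmod (c * f z) \<le> cmod c * A" for z
    using mult_left_mono[OF A[of z], of "cmod c"]
    by (simp add: norm_mult algebra_simps)
  then show "\<exists>B. \<forall>z. norm z ^ l * cmod (c * f z) \<le> B" by blast
qed

lemma rapid_mono:
  assumes "rapid f" "\<And>z. cmod (g z) \<le> norm z * cmod (f z)" shows "rapid g"
  unfolding rapid_def
proof
  fix l
  obtain A where A: "\<And>z. norm z ^ Suc l * cmod (f z) \<le> A"
    using assms unfolding rapid_def by metis
  have "norm z ^ l * cmod (g z) \<le> A" for z
    using order_trans[OF mult_left_mono[OF assms(2)[of z], of "norm z ^ l"]] A[of z]
    by (simp add: algebra_simps)
  then show "\<exists>B. \<forall>z. norm z ^ l * cmod (g z) \<le> B" by blast
qed

lemma rapid_fst: "rapid f \<Longrightarrow> rapid (\<lambda>z. complex_of_real (fst z) * f z)"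
  by (erule rapid_mono)
    (metis mult_right_mono norm_mult norm_of_real norm_fst_le prod.collapse real_norm_def norm_ge_zero)

lemma rapid_snd: "rapid f \<Longrightarrow> rapid (\<lambda>z. complex_of_real (snd z) * f z)"
  by (erule rapid_mono)
    (metis mult_right_mono norm_mult norm_of_real norm_snd_le prod.collapse real_norm_def norm_ge_zero)

lemma schwartz_rapid: "schwartz f \<Longrightarrow> rapid f"
  using schwartz_bound unfolding rapid_def by blast

text \<open>The module over polynomials generated by \<open>S\<close>. By the Leibniz rule it is
  closed under both derivatives as soon as it contains the derivatives of the generators, so
  membership in the Schwartz class can be decided on generators: \<open>S\<close> is the whole
  Schwartz space for the closure properties, and a single bump for the test functions.\<close>

inductive_set polymult :: "(plane \<Rightarrow> complex) set \<Rightarrow> (plane \<Rightarrow> complex) set" for S where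
  base: "e \<in> S \<Longrightarrow> e \<in> polymult S"
| add: "f \<in> polymult S \<Longrightarrow> g \<in> polymult S \<Longrightarrow> (\<lambda>z. f z + g z) \<in> polymult S"
| cmult: "f \<in> polymult S \<Longrightarrow> (\<lambda>z. c * f z) \<in> polymult S"
| fst: "f \<in> polymult S \<Longrightarrow> (\<lambda>z. complex_of_real (fst z) * f z) \<in> polymult S"
| snd: "f \<in> polymult S \<Longrightarrow> (\<lambda>z. complex_of_real (snd z) * f z) \<in> polymult S"

lemma schwartz_polymult:
  assumes S: "\<And>e z. e \<in> S \<Longrightarrow> e differentiable (at z)" "\<And>e. e \<in> S \<Longrightarrow> pdx e \<in> polymult S"
    "\<And>e. e \<in> S \<Longrightarrow> pdy e \<in> polymult S" "\<And>e. e \<in> S \<Longrightarrow> rapid e"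
    and f: "f \<in> polymult S"
  shows "schwartz f"
proof (rule schwartz_classI[OF f])
  fix f assume f: "f \<in> polymult S"
  show d: "f differentiable (at z)" for z
    using f by induction (auto intro: S differentiable_coords_mult)
  have "(\<forall>z. f differentiable (at z)) \<and> pdx f \<in> polymult S \<and> pdy f \<in> polymult S"
    using f
  proof induction
    case (base e) then show ?case by (auto simp: S)
  next
    case (add f g)
    then have "pdx (\<lambda>z. f z + g z) = (\<lambda>z. pdx f z + pdx g z)"
      "pdy (\<lambda>z. f z + g z) = (\<lambda>z. pdy f z + pdy g z)"
      by (auto simp: pd_add)
    with add show ?case by (auto intro: polymult.intros)
  next
    case (cmult f c)
    then have "pdx (\<lambda>z. c * f z) = (\<lambda>z. c * pdx f z)" "pdy (\<lambda>z. c * f z) = (\<lambda>z. c * pdy f z)"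
      by (auto simp: pd_cmult)
    with cmult show ?case by (auto intro: polymult.intros)
  next
    case (fst f)
    then have "pdx (\<lambda>z. complex_of_real (fst z) * f z) = (\<lambda>z. complex_of_real (fst z) * pdx f z + f z)"
      "pdy (\<lambda>z. complex_of_real (fst z) * f z) = (\<lambda>z. complex_of_real (fst z) * pdy f z)"
      by (auto simp: pd_fst)
    with fst show ?case by (auto intro: polymult.intros differentiable_coords_mult)
  next
    case (snd f)
    then have "pdx (\<lambda>z. complex_of_real (snd z) * f z) = (\<lambda>z. complex_of_real (snd z) * pdx f z)"
      "pdy (\<lambda>z. complex_of_real (snd z) * f z) = (\<lambda>z. complex_of_real (snd z) * pdy f z + f z)"
      by (auto simp: pd_snd)
    with snd show ?case by (auto intro: polymult.intros differentiable_coords_mult)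
  qed
  then show "pdx f \<in> polymult S" "pdy f \<in> polymult S" by auto
  have "rapid f" using f
    by induction (auto intro: S rapid_add rapid_cmult rapid_fst rapid_snd)
  then show "\<exists>B. \<forall>z. norm z ^ l * cmod (f z) \<le> B" for l by (simp add: rapid_def)
qed

lemma schwartz_polymult_schwartz: "f \<in> polymult (Collect schwartz) \<Longrightarrow> schwartz f"
  by (rule schwartz_polymult)
    (auto intro: schwartz_differentiable schwartz_pdx schwartz_pdy schwartz_rapid polymult.base)

lemma schwartz_add: "schwartz f \<Longrightarrow> schwartz g \<Longrightarrow> schwartz (\<lambda>z. f z + g z)"
  and schwartz_cmult: "schwartz f \<Longrightarrow> schwartz (\<lambda>z. c * f z)"
  and schwartz_fst: "schwartz f \<Longrightarrow> schwartz (\<lambda>z. complex_of_real (fst z) * f z)"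
  and schwartz_snd: "schwartz f \<Longrightarrow> schwartz (\<lambda>z. complex_of_real (snd z) * f z)"
  by (rule schwartz_polymult_schwartz, blast intro: polymult.intros)+

lemma schwartz_cnj:
  assumes "schwartz f" shows "schwartz (\<lambda>z. cnj (f z))"
proof (rule schwartz_classI[where \<C> = "{\<lambda>z. cnj (g z) | g. schwartz g}"])
  fix \<phi> assume "\<phi> \<in> {\<lambda>z. cnj (g z) | g. schwartz g}"
  then obtain g where g: "\<phi> = (\<lambda>z. cnj (g z))" "schwartz g" by auto
  show "\<phi> differentiable (at z)" for z
    unfolding g by (intro differentiable_cnj schwartz_differentiable g)
  have "pdx \<phi> = (\<lambda>z. cnj (pdx g z))" "pdy \<phi> = (\<lambda>z. cnj (pdy g z))"
    unfolding g(1) by (auto simp: pd_cnj schwartz_differentiable g)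
  then show "pdx \<phi> \<in> {\<lambda>z. cnj (g z) | g. schwartz g}" "pdy \<phi> \<in> {\<lambda>z. cnj (g z) | g. schwartz g}"
    using schwartz_pdx[OF g(2)] schwartz_pdy[OF g(2)] by blast+
  show "\<exists>B. \<forall>z. norm z ^ l * cmod (\<phi> z) \<le> B" for l
    using schwartz_bound[OF g(2)] by (simp add: g)
qed (use assms in auto)

section \<open>Integrals over the plane\<close>

lemma integrable_tensor:
  fixes f :: "'a::euclidean_space \<Rightarrow> 'c::{banach, second_countable_topology, real_normed_field}"
    and g :: "'b::euclidean_space \<Rightarrow> 'c"
  assumes f: "integrable lborel f" and g: "integrable lborel g"
  shows "integrable lborel (\<lambda>z. f (fst z) * g (snd z))"
proof -
  have "integrable (lborel \<Otimes>\<^sub>M lborel) (\<lambda>z. f (fst z) * g (snd z))"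
  proof (rule lborel_pair.Fubini_integrable)
    have [measurable]: "f \<in> borel_measurable borel" "g \<in> borel_measurable borel"
      using f g by auto
    show "(\<lambda>z. f (fst z) * g (snd z)) \<in> borel_measurable (lborel \<Otimes>\<^sub>M lborel)" by measurable
    show "integrable lborel (\<lambda>x. LINT y|lborel. norm (f (fst (x, y)) * g (snd (x, y))))"
      using f by (simp add: norm_mult)
    show "AE x in lborel. integrable lborel (\<lambda>y. f (fst (x, y)) * g (snd (x, y)))"
      using g by simp
  qed
  then show ?thesis by (simp add: lborel_prod)
qed

lemma integrable_inverse_1_plus_square_lborel: "integrable lborel (\<lambda>x::real. inverse (1 + x\<^sup>2))"
  using integrable_inverse_1_plus_square by (simp add: set_integrable_def)

text \<open>The squared weight dominates \<open>(1 + x^2) * (1 + y^2)\<close>, so the planar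
  integral reduces to a tensor of two arctangent integrals.\<close>

lemma integrable_weight: "integrable lborel (\<lambda>z::plane. inverse ((1 + (norm z)\<^sup>2)\<^sup>2))"
proof (rule Bochner_Integration.integrable_bound)
  show "integrable lborel (\<lambda>z::plane. inverse (1 + (fst z)\<^sup>2) * inverse (1 + (snd z)\<^sup>2))"
    by (intro integrable_tensor integrable_inverse_1_plus_square_lborel)
  have *: "(1 + x\<^sup>2) * (1 + y\<^sup>2) \<le> (1 + (x\<^sup>2 + y\<^sup>2))\<^sup>2" for x y :: real
  proof -
    have "(1 + (x\<^sup>2 + y\<^sup>2))\<^sup>2 - (1 + x\<^sup>2) * (1 + y\<^sup>2) = x\<^sup>2 + y\<^sup>2 + x^4 + y^4 + x\<^sup>2 * y\<^sup>2"
      by (simp add: power2_eq_square power4_eq_xxxx algebra_simps)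
    moreover have "\<dots> \<ge> 0" by simp
    ultimately show ?thesis by linarith
  qed
  have "inverse ((1 + (x\<^sup>2 + y\<^sup>2))\<^sup>2) \<le> inverse (1 + x\<^sup>2) * inverse (1 + y\<^sup>2)" for x y :: real
    unfolding inverse_mult_distrib[symmetric]
    by (rule le_imp_inverse_le[OF *]) (simp add: add_pos_nonneg)
  then show "AE z in lborel. norm (inverse ((1 + (norm z)\<^sup>2)\<^sup>2)) \<le>
      norm (inverse (1 + (fst z)\<^sup>2) * inverse (1 + (snd (z::plane))\<^sup>2))"
    by (intro AE_I2) (auto simp: norm_Pair)
qed simp

lemma lborel_distr_affine:
  fixes t :: "'a::euclidean_space"
  assumes c: "\<bar>c\<bar> = 1"
  shows "distr lborel borel (\<lambda>x. t + c *\<^sub>R x) = lborel"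
  using lborel_affine[of c t] c by (simp add: density_1 abs_if split: if_splits)

lemma
  fixes f :: "'a::euclidean_space \<Rightarrow> 'b::{banach, second_countable_topology}"
  assumes c: "\<bar>c\<bar> = 1" and [measurable]: "f \<in> borel_measurable lborel"
  shows lborel_integral_affine: "(LINT x|lborel. f (t + c *\<^sub>R x)) = integral\<^sup>L lborel f"
    and lborel_integrable_affine: "integrable lborel (\<lambda>x. f (t + c *\<^sub>R x)) \<longleftrightarrow> integrable lborel f"
  using integral_distr[of "\<lambda>x. t + c *\<^sub>R x" lborel borel f]
    integrable_distr_eq[of "\<lambda>x. t + c *\<^sub>R x" lborel borel f]
  by (simp_all add: lborel_distr_affine[OF c])

lemma lborel_integral_scale:
  fixes f :: "plane \<Rightarrow> 'b::{banach, second_countable_topology}"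
  assumes c: "c \<noteq> 0" and [measurable]: "f \<in> borel_measurable lborel"
  shows "integral\<^sup>L lborel f = c\<^sup>2 *\<^sub>R (LINT x|lborel. f (t + c *\<^sub>R x))"
proof -
  have "integral\<^sup>L lborel f = integral\<^sup>L (density (distr lborel borel (\<lambda>x. t + c *\<^sub>R x)) (\<lambda>_. ennreal (\<bar>c\<bar>\<^sup>2))) f"
    using arg_cong[OF lborel_affine[OF c, of t], of "\<lambda>M. integral\<^sup>L M f"]
    by (simp add: power2_eq_square)
  also have "\<dots> = c\<^sup>2 *\<^sub>R (LINT x|lborel. f (t + c *\<^sub>R x))"
    by (subst integral_density) (auto simp: integral_distr)
  finally show ?thesis .
qed

lemma schwartz_measurable [measurable]: "schwartz \<phi> \<Longrightarrow> \<phi> \<in> borel_measurable borel"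
  by (rule borel_measurable_continuous_onI)
    (auto intro!: continuous_at_imp_continuous_on differentiable_imp_continuous_within
      schwartz_differentiable)

text \<open>Expanding \<open>(1 + r^2)^2 = 1 + 2 r^2 + r^4\<close> uses the bounds for
  \<open>l = 0, 2, 4\<close> and produces the factor 4. The result is linear in \<open>B\<close>, as
  the continuity clause of \<open>tempered\<close> requires.\<close>

lemma decay_of_bounds:
  fixes \<phi> :: "plane \<Rightarrow> complex"
  assumes "\<And>l z. l \<le> 4 \<Longrightarrow> norm z ^ l * cmod (\<phi> z) \<le> B"
  shows "cmod (\<phi> z) \<le> 4 * B * inverse ((1 + (norm z)\<^sup>2)\<^sup>2)"
proof -
  have "(1 + (norm z)\<^sup>2)\<^sup>2 * cmod (\<phi> z) = norm z ^ 0 * cmod (\<phi> z) + 2 * (norm z ^ 2 * cmod (\<phi> z)) + norm z ^ 4 * cmod (\<phi> z)"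
    by (simp add: power2_eq_square power4_eq_xxxx algebra_simps)
  also have "\<dots> \<le> B + 2 * B + B"
    using assms[of 0 z] assms[of 2 z] assms[of 4 z] by linarith
  finally show ?thesis
    using zero_less_power[of "1 + (norm z)\<^sup>2" 2] by (simp add: field_simps add_pos_nonneg)
qed

lemma schwartz_decay:
  assumes "schwartz \<phi>" obtains B where "B \<ge> 0" "\<And>z. cmod (\<phi> z) \<le> B * inverse ((1 + (norm z)\<^sup>2)\<^sup>2)"
proof -
  obtain b where b: "\<And>l z. norm z ^ l * cmod (\<phi> z) \<le> b l"
    using schwartz_bound[OF assms] by metis
  define B where "B = Max (b ` {..4})"
  have "norm z ^ l * cmod (\<phi> z) \<le> B" if "l \<le> 4" for l z
    using order_trans[OF b[of z l] Max_ge[of "b ` {..4}" "b l"]] that by (simp add: B_def)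
  note dec = decay_of_bounds[of \<phi> B, OF this]
  have "0 \<le> 4 * B" using order_trans[OF norm_ge_zero dec[of 0]] by simp
  then show ?thesis using that[of "4 * B"] dec by blast
qed

lemma integrable_weight_bound:
  fixes f :: "plane \<Rightarrow> 'b::{banach, second_countable_topology}"
  assumes "f \<in> borel_measurable lborel" "\<And>z. norm (f z) \<le> B * inverse ((1 + (norm z)\<^sup>2)\<^sup>2)"
  shows "integrable lborel f"
  by (rule Bochner_Integration.integrable_bound[OF integrable_mult_right[OF integrable_weight, of B]])
    (use assms(1) order_trans[OF assms(2) abs_ge_self] in simp_all)

lemma schwartz_integrable: assumes "schwartz \<phi>" shows "integrable lborel \<phi>"
proof -
  obtain B where "\<And>z. cmod (\<phi> z) \<le> B * inverse ((1 + (norm z)\<^sup>2)\<^sup>2)"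
    using schwartz_decay[OF assms] by metis
  then show ?thesis
    by (intro integrable_weight_bound) (simp_all add: schwartz_measurable[OF assms])
qed

lemma integrable_bounded_mult:
  fixes f g :: "'a \<Rightarrow> complex"
  assumes "integrable M \<phi>" "g \<in> borel_measurable M" "\<And>z. cmod (g z) \<le> C"
  shows "integrable M (\<lambda>z. g z * \<phi> z)"
proof (rule Bochner_Integration.integrable_bound[OF integrable_mult_right[OF assms(1), of "complex_of_real C"]])
  show "AE z in M. norm (g z * \<phi> z) \<le> norm (complex_of_real C * \<phi> z)"
    using assms(3) order_trans[OF assms(3) abs_ge_self] by (auto simp: norm_mult intro!: mult_right_mono)
qed (use assms in auto)

section \<open>A function is determined by its pairings with Schwartz functions\<close>

text \<open>A product of super-Gaussians. For suitable coefficients the affine maps send a given box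
  to the square \<open>[-1, 1]^2\<close>; inside it the even powers tend to 0 with \<open>n\<close>,
  outside at least one tends to infinity, so the bumps approximate the indicator of the box. Their
  derivatives are polynomial multiples of themselves.\<close>

definition bump :: "nat \<Rightarrow> real \<Rightarrow> real \<Rightarrow> real \<Rightarrow> real \<Rightarrow> plane \<Rightarrow> complex" where
  "bump n a b c d z =
     complex_of_real (exp (- ((a * fst z + b) ^ (2 * n) + (c * snd z + d) ^ (2 * n))))"

lemma power_le_fact_exp: "x \<ge> 0 \<Longrightarrow> x ^ l \<le> fact l * exp (x::real)"
proof -
  assume x: "x \<ge> 0"
  have "(\<Sum>n\<in>{l}. x ^ n /\<^sub>R fact n) \<le> (\<Sum>n. x ^ n /\<^sub>R fact n)"
    by (rule sum_le_suminf) (use x summable_exp_generic[of x] in auto)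
  then show ?thesis by (simp add: exp_def field_simps)
qed

lemma rapid_bump:
  assumes "a \<noteq> 0" "c \<noteq> 0" "n > 0" shows "rapid (bump n a b c d)"
  unfolding rapid_def
proof (intro allI exI)
  fix l z
  \<comment> \<open>\<open>K\<close> collects the losses of the AM-GM estimate and of the shift in
    each coordinate; the summand 2 pays for using \<open>q ^ (2 * n) >= q^2 - 1\<close>
    twice.\<close>
  define K where "K = (1 / \<bar>a\<bar>)\<^sup>2 + \<bar>b\<bar>/\<bar>a\<bar> + (1 / \<bar>c\<bar>)\<^sup>2 + \<bar>d\<bar>/\<bar>c\<bar> + 2"
  have p: "q ^ (2 * n) \<ge> q\<^sup>2 - 1" for q :: real
  proof (cases "q\<^sup>2 \<ge> 1")
    case True
    then have "(q\<^sup>2) ^ 1 \<le> (q\<^sup>2) ^ n" using assms(3) by (intro power_increasing) auto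
    then show ?thesis by (simp add: power_mult)
  next
    case False then show ?thesis using zero_le_even_power'[of q "n"] by linarith
  qed
  have x: "\<bar>x\<bar> \<le> (a * x + b)\<^sup>2 + (1 / \<bar>a\<bar>)\<^sup>2 + \<bar>b\<bar>/\<bar>a\<bar>" if "a \<noteq> 0" for x a b :: real
  proof -
    have "\<bar>x\<bar> = \<bar>(a * x + b) - b\<bar> / \<bar>a\<bar>" using that by (simp add: abs_mult)
    also have "\<dots> \<le> (\<bar>a * x + b\<bar> + \<bar>b\<bar>) / \<bar>a\<bar>" by (intro divide_right_mono) auto
    also have "\<dots> = \<bar>a * x + b\<bar> * (1/\<bar>a\<bar>) + \<bar>b\<bar>/\<bar>a\<bar>" by (simp add: add_divide_distrib)
    also have "\<bar>a * x + b\<bar> * (1/\<bar>a\<bar>) \<le> (a * x + b)\<^sup>2 + (1 / \<bar>a\<bar>)\<^sup>2"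
    proof -
      have "2 * (\<bar>a * x + b\<bar> * (1/\<bar>a\<bar>)) \<le> \<bar>a * x + b\<bar>\<^sup>2 + (1 / \<bar>a\<bar>)\<^sup>2"
        using sum_squares_bound[of "\<bar>a * x + b\<bar>" "1/\<bar>a\<bar>"] by (simp add: mult.assoc)
      moreover have "0 \<le> \<bar>a * x + b\<bar> * (1/\<bar>a\<bar>)" by simp
      ultimately show ?thesis unfolding power2_abs by linarith
    qed
    finally show ?thesis by simp
  qed
  have "norm z \<le> \<bar>fst z\<bar> + \<bar>snd z\<bar>"
    using norm_Pair_le[of "fst z" "snd z"] by simp
  then have le: "norm z \<le> (a * fst z + b) ^ (2 * n) + (c * snd z + d) ^ (2 * n) + K"
    using x[of a "fst z" b] x[of c "snd z" d] assms p[of "a * fst z + b"] p[of "c * snd z + d"]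
    by (simp add: K_def)
  have "norm z ^ l * cmod (bump n a b c d z) \<le> (fact l * exp (norm z)) *
      exp (- ((a * fst z + b) ^ (2 * n) + (c * snd z + d) ^ (2 * n)))"
    unfolding bump_def norm_of_real abs_exp_cancel
    by (intro mult_right_mono power_le_fact_exp) auto
  also have "\<dots> \<le> fact l * exp K"
    using le by (simp add: mult.assoc exp_add[symmetric])
  finally show "norm z ^ l * cmod (bump n a b c d z) \<le> fact l * exp K" .
qed

lemma polymult_fst_power:
  assumes "f \<in> polymult S"
  shows "(\<lambda>z. complex_of_real ((a * fst z + b) ^ k) * f z) \<in> polymult S"
proof (induction k)
  case (Suc k)
  let ?g = "\<lambda>z. complex_of_real ((a * fst z + b) ^ k) * f z"
  have "(\<lambda>z. complex_of_real a * (complex_of_real (fst z) * ?g z) + complex_of_real b * ?g z) \<in> polymult S"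
    by (intro polymult.intros Suc)
  then show ?case by (simp add: algebra_simps)
qed (use assms in simp)

lemma polymult_snd_power:
  assumes "f \<in> polymult S"
  shows "(\<lambda>z. complex_of_real ((a * snd z + b) ^ k) * f z) \<in> polymult S"
proof (induction k)
  case (Suc k)
  let ?g = "\<lambda>z. complex_of_real ((a * snd z + b) ^ k) * f z"
  have "(\<lambda>z. complex_of_real a * (complex_of_real (snd z) * ?g z) + complex_of_real b * ?g z) \<in> polymult S"
    by (intro polymult.intros Suc)
  then show ?case by (simp add: algebra_simps)
qed (use assms in simp)

lemma schwartz_bump:
  assumes "a \<noteq> 0" "c \<noteq> 0" "n > 0" shows "schwartz (bump n a b c d)"
proof (rule schwartz_polymult[of "{bump n a b c d}"])
  let ?e = "bump n a b c d"
  have der: "(?e has_derivative (\<lambda>h. fst h *\<^sub>R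
      (complex_of_real (- real (2*n) * a) * (complex_of_real ((a * fst z + b) ^ (2 * n - 1)) * ?e z)) +
      snd h *\<^sub>R (complex_of_real (- real (2*n) * c) * (complex_of_real ((c * snd z + d) ^ (2 * n - 1)) * ?e z)))) (at z)" for z
    unfolding bump_def
    by (rule has_derivative_eq_rhs, (rule derivative_intros)+)
      (simp add: fun_eq_iff algebra_simps scaleR_conv_of_real)
  then show "e differentiable (at z)" if "e \<in> {?e}" for e z
    using that unfolding differentiable_def by blast
  have 1: "pdx ?e = (\<lambda>z. complex_of_real (- real (2*n) * a) * (complex_of_real ((a * fst z + b) ^ (2 * n - 1)) * ?e z))"
    "pdy ?e = (\<lambda>z. complex_of_real (- real (2*n) * c) * (complex_of_real ((c * snd z + d) ^ (2 * n - 1)) * ?e z))"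
    using pdx_pdy_eqI[OF der] by auto
  show "pdx e \<in> polymult {?e}" "pdy e \<in> polymult {?e}" if "e \<in> {?e}" for e
    using that unfolding singleton_iff
    by (simp only: 1, intro polymult.cmult polymult_fst_power polymult_snd_power polymult.base singletonI)+
  show "rapid e" if "e \<in> {?e}" for e
    using that rapid_bump[OF assms] by simp
qed (intro polymult.base singletonI)

text \<open>\<open>ennreal\<close> cuts off at zero, so the two densities are the measures of the
  positive and of the negative part of \<open>g\<close>. They are finite and equal on open boxes,
  which are stable under intersection and generate the Borel sets; hence they coincide, and
  uniqueness of densities applies.\<close>

lemma AE_eq_0_if_box_integrals_0:
  fixes g :: "'a::euclidean_space \<Rightarrow> real"
  assumes [measurable]: "g \<in> borel_measurable lborel"
    and int: "\<And>l u. integrable lborel (\<lambda>z. indicator (box l u) z * g z)"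
    and zero: "\<And>l u. (LINT z|lborel. indicator (box l u) z * g z) = 0"
  shows "AE z in lborel. g z = 0"
proof -
  let ?M = "density lborel (\<lambda>z. ennreal (g z))" and ?N = "density lborel (\<lambda>z. ennreal (- g z))"
  have fin: "emeasure ?M (box l u) \<noteq> \<infinity>" "emeasure ?M (box l u) = emeasure ?N (box l u)" for l u
  proof -
    let ?h = "\<lambda>z. indicator (box l u) z * g z"
    have 1: "emeasure ?M (box l u) = (\<integral>\<^sup>+z. ennreal (?h z) \<partial>lborel)"
      by (subst emeasure_density) (auto intro!: nn_integral_cong simp: indicator_def)
    have 2: "emeasure ?N (box l u) = (\<integral>\<^sup>+z. ennreal (- ?h z) \<partial>lborel)"
      by (subst emeasure_density) (auto intro!: nn_integral_cong simp: indicator_def)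
    have 3: "(\<integral>\<^sup>+z. ennreal (?h z) \<partial>lborel) \<noteq> \<infinity>" "(\<integral>\<^sup>+z. ennreal (- ?h z) \<partial>lborel) \<noteq> \<infinity>"
      using int[of l u] by (auto simp: real_integrable_def)
    show "emeasure ?M (box l u) \<noteq> \<infinity>" using 1 3 by simp
    have "enn2real (\<integral>\<^sup>+z. ennreal (?h z) \<partial>lborel) = enn2real (\<integral>\<^sup>+z. ennreal (- ?h z) \<partial>lborel)"
      using zero[of l u] real_lebesgue_integral_def[OF int[of l u]] by simp
    then have "ennreal (enn2real (\<integral>\<^sup>+z. ennreal (?h z) \<partial>lborel)) = ennreal (enn2real (\<integral>\<^sup>+z. ennreal (- ?h z) \<partial>lborel))"
      by simp
    then show "emeasure ?M (box l u) = emeasure ?N (box l u)"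
      unfolding 1 2 ennreal_enn2real_if using 3 by (simp only: infinity_ennreal_def if_False)
  qed
  have "?M = ?N"
  proof (rule measure_eqI_generator_eq)
    let ?E = "range (\<lambda>(a, b). box a b::'a set)"
    let ?A = "\<lambda>n::nat. box (- (real n *\<^sub>R One)) (real n *\<^sub>R One) :: 'a set"
    show "Int_stable ?E" by (auto simp: Int_stable_def box_Int_box)
    show "?E \<subseteq> Pow UNIV" "sets ?M = sigma_sets UNIV ?E" "sets ?N = sigma_sets UNIV ?E"
      by (simp_all add: borel_eq_box)
    show "range ?A \<subseteq> ?E" "(\<Union>i. ?A i) = UNIV"
      unfolding UN_box_eq_UNIV by auto
    show "emeasure ?M (?A i) \<noteq> \<infinity>" for i by (rule fin)
    show "emeasure ?M X = emeasure ?N X" if "X \<in> ?E" for X using that fin(2) by auto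
  qed
  then have "AE z in lborel. ennreal (g z) = ennreal (- g z)"
    by (intro sigma_finite_measure.density_unique[OF sigma_finite_lborel]) auto
  then show ?thesis
  proof eventually_elim
    case (elim z)
    show ?case
    proof (cases "g z \<ge> 0")
      case True
      then have "ennreal (g z) = 0" using elim by (simp add: ennreal_neg)
      then show ?thesis using True by simp
    next
      case False
      then have "ennreal (- g z) = 0" using elim by (simp add: ennreal_neg)
      then show ?thesis using False by simp
    qed
  qed
qed

lemma even_power_tendsto_0: "\<bar>q\<bar> < 1 \<Longrightarrow> (\<lambda>n. (q::real) ^ (2 * Suc n)) \<longlonglongrightarrow> 0"
proof -
  assume "\<bar>q\<bar> < 1"
  then have "(\<lambda>n. (q\<^sup>2) ^ n) \<longlonglongrightarrow> 0"
    by (intro LIMSEQ_realpow_zero) (auto simp: abs_square_less_1)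
  then show ?thesis unfolding power_mult by (rule LIMSEQ_Suc)
qed

lemma even_power_at_top: "\<bar>q\<bar> > 1 \<Longrightarrow> filterlim (\<lambda>n. (q::real) ^ (2 * Suc n)) at_top sequentially"
proof -
  assume "\<bar>q\<bar> > 1"
  then have q: "1 < norm (q\<^sup>2)" using one_less_power[of "\<bar>q\<bar>" 2] by simp
  have "filterlim (\<lambda>n. (q\<^sup>2) ^ n) at_top sequentially"
  proof (rule filterlim_at_infinity_imp_filterlim_at_top)
    have "q\<^sup>2 > 0" using q by (cases "q = 0") auto
    then show "\<forall>\<^sub>F n in sequentially. (q\<^sup>2) ^ n > 0" by (intro always_eventually allI) (rule zero_less_power)
  qed (rule filterlim_realpow_sequentially_gt1[OF q])
  then show ?thesis unfolding power_mult by (rule filterlim_compose[OF _ filterlim_Suc])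
qed

text \<open>The boundary is excluded because there some rescaled coordinate is \<open>1\<close> or
  \<open>-1\<close> and the limit is \<open>exp (- 1)\<close> or \<open>exp (- 2)\<close>.\<close>

lemma bump_tendsto_indicator:
  fixes l u :: plane
  assumes lu: "fst l < fst u" "snd l < snd u"
  defines "a \<equiv> 2 / (fst u - fst l)" and "b \<equiv> - (fst l + fst u) / (fst u - fst l)"
    and "c \<equiv> 2 / (snd u - snd l)" and "d \<equiv> - (snd l + snd u) / (snd u - snd l)"
  assumes z: "z \<notin> cbox l u - box l u"
  shows "(\<lambda>n. bump (Suc n) a b c d z) \<longlonglongrightarrow> indicator (box l u) z"
proof -
  have e: "a * fst z + b = (2 * fst z - fst l - fst u) / (fst u - fst l)"
    "c * snd z + d = (2 * snd z - snd l - snd u) / (snd u - snd l)"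
    using lu by (simp_all add: a_def b_def c_def d_def divide_simps)
  have in1: "\<bar>a * fst z + b\<bar> < 1 \<longleftrightarrow> fst l < fst z \<and> fst z < fst u"
    "\<bar>c * snd z + d\<bar> < 1 \<longleftrightarrow> snd l < snd z \<and> snd z < snd u"
    "\<bar>a * fst z + b\<bar> > 1 \<longleftrightarrow> fst z < fst l \<or> fst z > fst u"
    "\<bar>c * snd z + d\<bar> > 1 \<longleftrightarrow> snd z < snd l \<or> snd z > snd u"
    unfolding e using lu by (auto simp: abs_divide less_divide_eq divide_less_eq abs_less_iff)
  have box: "z \<in> box l u \<longleftrightarrow> fst l < fst z \<and> fst z < fst u \<and> snd l < snd z \<and> snd z < snd u"
    "z \<in> cbox l u \<longleftrightarrow> fst l \<le> fst z \<and> fst z \<le> fst u \<and> snd l \<le> snd z \<and> snd z \<le> snd u"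
    by (auto simp: box_def cbox_def Basis_prod_def inner_prod_def)
  show ?thesis
  proof (cases "z \<in> box l u")
    case True
    then have "\<bar>a * fst z + b\<bar> < 1" "\<bar>c * snd z + d\<bar> < 1" using in1 box by auto
    note even_power_tendsto_0[OF this(1)] even_power_tendsto_0[OF this(2)]
    then have "(\<lambda>n. bump (Suc n) a b c d z) \<longlonglongrightarrow> complex_of_real (exp (- (0 + 0)))"
      unfolding bump_def by (intro tendsto_intros)
    then show ?thesis using True by simp
  next
    case False
    then have "z \<notin> cbox l u" using z by auto
    then have "fst z < fst l \<or> fst z > fst u \<or> snd z < snd l \<or> snd z > snd u"
      unfolding box(2) by linarith
    then have "\<bar>a * fst z + b\<bar> > 1 \<or> \<bar>c * snd z + d\<bar> > 1"
      unfolding in1(3,4) by blast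
    then have "filterlim (\<lambda>n. (a * fst z + b) ^ (2 * Suc n) + (c * snd z + d) ^ (2 * Suc n)) at_top sequentially"
    proof
      assume "\<bar>a * fst z + b\<bar> > 1"
      then show ?thesis
        by (rule filterlim_at_top_mono[OF even_power_at_top], intro always_eventually allI)
          (metis add.commute le_add_same_cancel2 le_add_same_cancel1 zero_le_even_power even_mult_iff even_numeral)
    next
      assume "\<bar>c * snd z + d\<bar> > 1"
      then show ?thesis
        by (rule filterlim_at_top_mono[OF even_power_at_top], intro always_eventually allI)
          (metis add.commute le_add_same_cancel2 le_add_same_cancel1 zero_le_even_power even_mult_iff even_numeral)
    qed
    then have "(\<lambda>n. exp (- ((a * fst z + b) ^ (2 * Suc n) + (c * snd z + d) ^ (2 * Suc n)))) \<longlonglongrightarrow> 0"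
      by (intro filterlim_compose[OF exp_at_bot] filterlim_compose[OF filterlim_uminus_at_bot_at_top])
    then have "(\<lambda>n. complex_of_real (exp (- ((a * fst z + b) ^ (2 * Suc n) + (c * snd z + d) ^ (2 * Suc n))))) \<longlonglongrightarrow> complex_of_real 0"
      by (rule tendsto_of_real)
    then show ?thesis using False by (simp add: bump_def)
  qed
qed

text \<open>The dominating function has to be a multiple of a Schwartz function, because
  \<open>f\<close> below is known to be integrable only against those; the first bump serves. Each
  coordinate loses at most 1 in the exponent, whence \<open>exp 2\<close>.\<close>

lemma bump_le: "cmod (bump (Suc n) a b c d z) \<le> exp 2 * cmod (bump 1 a b c d z)"
proof -
  have p: "q ^ (2 * Suc n) \<ge> q\<^sup>2 - 1" for q :: real
  proof (cases "q\<^sup>2 \<ge> 1")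
    case True
    then have "(q\<^sup>2) ^ 1 \<le> (q\<^sup>2) ^ Suc n" by (intro power_increasing) auto
    then show ?thesis unfolding power_mult power_one_right by linarith
  next
    case False then show ?thesis using zero_le_even_power'[of q "Suc n"] by linarith
  qed
  have two: "2 * (1::nat) = 2" by simp
  show ?thesis
    using p[of "a * fst z + b"] p[of "c * snd z + d"]
    unfolding bump_def norm_of_real abs_exp_cancel exp_add[symmetric] two exp_le_cancel_iff
    by linarith
qed

theorem AE_eq_0_if_schwartz_orthogonal:
  assumes f[measurable]: "f \<in> borel_measurable lborel"
    and int: "\<And>\<phi>. schwartz \<phi> \<Longrightarrow> integrable lborel (\<lambda>z. f z * \<phi> z)"
    and zero: "\<And>\<phi>. schwartz \<phi> \<Longrightarrow> (LINT z|lborel. f z * \<phi> z) = 0"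
  shows "AE z in lborel. f z = 0"
proof -
  have *: "integrable lborel (\<lambda>z. f z * indicator (box l u) z) \<and>
    (LINT z|lborel. f z * indicator (box l u) z) = 0" for l u :: plane
  proof (cases "fst l < fst u \<and> snd l < snd u")
    case False
    then have "box l u = {}"
      by (auto simp: box_def Basis_prod_def inner_prod_def)
    then show ?thesis by simp
  next
    case lu: True
    define a b c d where abcd: "a = 2 / (fst u - fst l)" "b = - (fst l + fst u) / (fst u - fst l)"
     "c = 2 / (snd u - snd l)" "d = - (snd l + snd u) / (snd u - snd l)"
    have nz: "a \<noteq> 0" "c \<noteq> 0" using lu by (auto simp: abcd)
    have sch: "schwartz (bump (Suc n) a b c d)" for n
      using schwartz_bump[OF nz, of "Suc n"] by simp
    have [measurable]: "bump (Suc n) a b c d \<in> borel_measurable borel" for n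
      by (rule schwartz_measurable[OF sch])
    \<comment> \<open>Convergence of the bumps is known off the boundary only, and the boundary is
      null because the open and the closed box have the same measure.\<close>
    have "emeasure lborel (cbox l u - box l u) = 0"
      using lu by (subst emeasure_Diff)
        (auto simp: emeasure_lborel_cbox_eq emeasure_lborel_box_eq box_subset_cbox)
    then have ae: "AE z in lborel. z \<notin> cbox l u - box l u"
      by (intro AE_not_in) (auto simp: null_sets_def)
    have lim: "AE z in lborel. (\<lambda>n. f z * bump (Suc n) a b c d z) \<longlonglongrightarrow> f z * indicator (box l u) z"
      using ae
    proof eventually_elim
      case (elim z)
      show ?case
        unfolding abcd by (intro tendsto_intros bump_tendsto_indicator) (use lu elim in auto)
    qed
    have dom: "integrable lborel (\<lambda>z. exp 2 * cmod (f z * bump 1 a b c d z))"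
      using int[OF sch[of 0]] by auto
    have bd: "AE z in lborel. norm (f z * bump (Suc n) a b c d z) \<le> exp 2 * cmod (f z * bump 1 a b c d z)" for n
      using mult_left_mono[OF bump_le, of "cmod (f _)"] by (auto simp: norm_mult algebra_simps)
    have m: "(\<lambda>z. f z * indicator (box l u) z) \<in> borel_measurable lborel"
      "\<And>n. (\<lambda>z. f z * bump (Suc n) a b c d z) \<in> borel_measurable lborel" by measurable
    have "(\<lambda>n. LINT z|lborel. f z * bump (Suc n) a b c d z) \<longlonglongrightarrow> (LINT z|lborel. f z * indicator (box l u) z)"
      by (rule integral_dominated_convergence[OF m dom lim bd])
    then have "(LINT z|lborel. f z * indicator (box l u) z) = 0"
      using zero[OF sch] by (simp add: LIMSEQ_const_iff)
    moreover have "integrable lborel (\<lambda>z. f z * indicator (box l u) z)"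
      by (rule integrable_dominated_convergence[OF m dom lim bd])
    ultimately show ?thesis by simp
  qed
  have re: "indicator (box l u) z * Re (f z) = Re (f z * indicator (box l u) z)"
    and im: "indicator (box l u) z * Im (f z) = Im (f z * indicator (box l u) z)" for z l u
    by (auto simp: indicator_def)
  have "AE z in lborel. Re (f z) = 0"
    by (rule AE_eq_0_if_box_integrals_0; (unfold re)?)
      (simp_all only: integral_Re integrable_Re *, simp_all)
  moreover have "AE z in lborel. Im (f z) = 0"
    by (rule AE_eq_0_if_box_integrals_0; (unfold im)?)
      (simp_all only: integral_Im integrable_Im *, simp_all)
  ultimately show ?thesis by eventually_elim (simp add: complex_eq_iff)
qed

section \<open>The Fourier transform on Schwartz functions\<close>

lemma fourier_eq: "(LINT z|lborel. cis (- (z \<bullet> \<zeta>)) * \<phi> z) = complex_of_real (2 * pi) * fourier \<phi> \<zeta>"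
  by (simp add: fourier_def)

lemma measurable_cis [measurable]: "cis \<in> borel_measurable borel"
  by (rule borel_measurable_continuous_onI) (rule continuous_on_cis[OF continuous_on_id, unfolded id_def])

lemma integrable_cis_mult:
  assumes "integrable M f" "g \<in> borel_measurable M"
  shows "integrable M (\<lambda>z. cis (g z) * f z)"
  using assms by (intro integrable_bounded_mult[where C = 1]) auto

lemma integrable_cis_mult_lborel [simp, intro]:
  "integrable lborel f \<Longrightarrow> integrable lborel (\<lambda>z::plane. cis (- (z \<bullet> \<zeta>)) * f z)"
  "integrable lborel f \<Longrightarrow> integrable lborel (\<lambda>z::plane. cis (z \<bullet> \<zeta>) * f z)"
  by (rule integrable_cis_mult, assumption, measurable)+

lemma fourier_bound:
  assumes "integrable lborel \<phi>"
  shows "cmod (fourier \<phi> \<zeta>) \<le> (LINT z|lborel. cmod (\<phi> z)) / (2 * pi)"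
proof -
  have "cmod (LINT z|lborel. cis (- (z \<bullet> \<zeta>)) * \<phi> z) \<le> (LINT z|lborel. cmod (cis (- (z \<bullet> \<zeta>)) * \<phi> z))"
    by (rule integral_norm_bound)
  then show ?thesis by (simp add: fourier_def norm_divide norm_mult divide_right_mono)
qed

lemma fourier_add:
  "integrable lborel f \<Longrightarrow> integrable lborel g \<Longrightarrow> fourier (\<lambda>z. f z + g z) \<zeta> = fourier f \<zeta> + fourier g \<zeta>"
  by (simp add: fourier_def distrib_left add_divide_distrib)

lemma fourier_cmult: "fourier (\<lambda>z. c * f z) \<zeta> = c * fourier f \<zeta>"
proof -
  have "(\<lambda>z. cis (- (z \<bullet> \<zeta>)) * (c * f z)) = (\<lambda>z. c * (cis (- (z \<bullet> \<zeta>)) * f z))"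
    by (auto simp: algebra_simps)
  then show ?thesis by (simp add: fourier_def)
qed

text \<open>Differentiation of a transform becomes multiplication by \<open>- \<i>\<close> times the
  coordinate; the sign is that of \<open>cis (- (z \<bullet> \<zeta>))\<close>.\<close>

definition mul_x :: "(plane \<Rightarrow> complex) \<Rightarrow> plane \<Rightarrow> complex" where
  "mul_x \<phi> z = - \<i> * (complex_of_real (fst z) * \<phi> z)"

definition mul_y :: "(plane \<Rightarrow> complex) \<Rightarrow> plane \<Rightarrow> complex" where
  "mul_y \<phi> z = - \<i> * (complex_of_real (snd z) * \<phi> z)"

lemma schwartz_mul_x: "schwartz \<phi> \<Longrightarrow> schwartz (mul_x \<phi>)"
  and schwartz_mul_y: "schwartz \<phi> \<Longrightarrow> schwartz (mul_y \<phi>)"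
  unfolding mul_x_def[abs_def] mul_y_def[abs_def]
  by (rule schwartz_cmult, erule schwartz_fst schwartz_snd)+

lemma cmod_cis_approx: "cmod (cis x - 1 - \<i> * x) \<le> x\<^sup>2 / 2"
  using iexp_approx1[of x 1] by (simp add: cis_conv_exp algebra_simps power2_eq_square diff_diff_eq fact_numeral)

lemma integrable_norm_sq_schwartz:
  assumes "schwartz \<phi>"
  shows "integrable lborel (\<lambda>z. (norm z)\<^sup>2 * cmod (\<phi> z))"
proof -
  have x: "schwartz (\<lambda>z. complex_of_real (fst z) * (complex_of_real (fst z) * \<phi> z))"
    and y: "schwartz (\<lambda>z. complex_of_real (snd z) * (complex_of_real (snd z) * \<phi> z))"
    by (intro schwartz_fst schwartz_snd assms)+
  have "integrable lborel (\<lambda>z. cmod (complex_of_real (fst z) * (complex_of_real (fst z) * \<phi> z)) +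
      cmod (complex_of_real (snd z) * (complex_of_real (snd z) * \<phi> z)))"
    by (intro Bochner_Integration.integrable_add integrable_norm schwartz_integrable x y)
  also have "(\<lambda>z. cmod (complex_of_real (fst z) * (complex_of_real (fst z) * \<phi> z)) +
      cmod (complex_of_real (snd z) * (complex_of_real (snd z) * \<phi> z))) = (\<lambda>z. (norm z)\<^sup>2 * cmod (\<phi> z))"
    by (auto simp: norm_mult norm_Pair fun_eq_iff algebra_simps power2_eq_square abs_mult_self_eq)
  finally show ?thesis .
qed

text \<open>The first-order Taylor error of \<open>cis\<close> is at most
  \<open>(z \<bullet> h)^2 / 2\<close>, and \<open>(norm z)^2 * cmod (\<phi> z)\<close> is
  integrable, so the error of the difference quotient is linear in \<open>norm h\<close>.\<close>

lemma fourier_has_derivative: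
  assumes s: "schwartz \<phi>"
  shows "(fourier \<phi> has_derivative
    (\<lambda>h. fst h *\<^sub>R fourier (mul_x \<phi>) \<zeta> + snd h *\<^sub>R fourier (mul_y \<phi>) \<zeta>)) (at \<zeta>)"
proof (rule has_derivativeI_sandwich[where e = 1])
  let ?C = "(LINT z|lborel. (norm z)\<^sup>2 * cmod (\<phi> z)) / (4 * pi)"
  let ?D = "\<lambda>h. fst h *\<^sub>R fourier (mul_x \<phi>) \<zeta> + snd h *\<^sub>R fourier (mul_y \<phi>) \<zeta>"
  show "bounded_linear ?D"
    by (intro bounded_linear_add bounded_linear_scaleR_left[THEN bounded_linear_compose]
        bounded_linear_fst bounded_linear_snd)
  note i = schwartz_integrable[OF s] schwartz_integrable[OF schwartz_mul_x[OF s]]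
    schwartz_integrable[OF schwartz_mul_y[OF s]]
  fix w :: plane assume w: "w \<noteq> \<zeta>"
  define h where "h = w - \<zeta>"
  have hp: "norm h > 0" using w by (simp add: h_def)
  have D: "?D h = (LINT z|lborel. cis (- (z \<bullet> \<zeta>)) * (fst h * mul_x \<phi> z + snd h * mul_y \<phi> z)) / complex_of_real (2 * pi)"
    using i by (simp add: fourier_add[symmetric] fourier_cmult[symmetric] scaleR_conv_of_real) (simp add: fourier_def)
  have "(fourier \<phi> w - fourier \<phi> \<zeta>) - ?D h =
    (LINT z|lborel. cis (- (z \<bullet> w)) * \<phi> z - cis (- (z \<bullet> \<zeta>)) * \<phi> z
      - cis (- (z \<bullet> \<zeta>)) * (fst h * mul_x \<phi> z + snd h * mul_y \<phi> z)) / complex_of_real (2 * pi)"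
    unfolding D unfolding fourier_def using i
    by (subst Bochner_Integration.integral_diff, (auto intro!: Bochner_Integration.integrable_diff)[2])+
      (auto simp: diff_divide_distrib)
  also have "cmod \<dots> \<le> (LINT z|lborel. (norm h)\<^sup>2 / 2 * ((norm z)\<^sup>2 * cmod (\<phi> z))) / (2 * pi)"
  proof -
    have "cmod (LINT z|lborel. cis (- (z \<bullet> w)) * \<phi> z - cis (- (z \<bullet> \<zeta>)) * \<phi> z
        - cis (- (z \<bullet> \<zeta>)) * (fst h * mul_x \<phi> z + snd h * mul_y \<phi> z)) \<le>
        (LINT z|lborel. (norm h)\<^sup>2 / 2 * ((norm z)\<^sup>2 * cmod (\<phi> z)))"
    proof (rule Bochner_Integration.integral_norm_bound_integral)
      fix z
      have wz: "cis (- (z \<bullet> w)) = cis (- (z \<bullet> \<zeta>)) * cis (- (z \<bullet> h))"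
        by (simp add: h_def inner_diff_right cis_mult)
      have "cis (- (z \<bullet> w)) * \<phi> z - cis (- (z \<bullet> \<zeta>)) * \<phi> z
        - cis (- (z \<bullet> \<zeta>)) * (fst h * mul_x \<phi> z + snd h * mul_y \<phi> z)
        = cis (- (z \<bullet> \<zeta>)) * \<phi> z * (cis (- (z \<bullet> h)) - 1 - \<i> * complex_of_real (- (z \<bullet> h)))"
        unfolding wz by (simp add: mul_x_def mul_y_def inner_prod_def algebra_simps)
      also have "cmod \<dots> \<le> cmod (\<phi> z) * ((z \<bullet> h)\<^sup>2 / 2)"
        unfolding norm_mult norm_cis mult_1
        using cmod_cis_approx[of "- (z \<bullet> h)"] by (intro mult_left_mono) auto
      also have "\<dots> \<le> cmod (\<phi> z) * ((norm z * norm h)\<^sup>2 / 2)"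
        using Cauchy_Schwarz_ineq2[of z h] by (intro mult_left_mono divide_right_mono) (auto simp: abs_le_square_iff[symmetric] abs_mult)
      finally show "cmod (cis (- (z \<bullet> w)) * \<phi> z - cis (- (z \<bullet> \<zeta>)) * \<phi> z
        - cis (- (z \<bullet> \<zeta>)) * (fst h * mul_x \<phi> z + snd h * mul_y \<phi> z)) \<le> (norm h)\<^sup>2 / 2 * ((norm z)\<^sup>2 * cmod (\<phi> z))"
        by (simp add: power_mult_distrib algebra_simps)
    next
      show "integrable lborel (\<lambda>z. (norm h)\<^sup>2 / 2 * ((norm z)\<^sup>2 * cmod (\<phi> z)))"
        by (intro integrable_mult_right integrable_norm_sq_schwartz s)
      show "integrable lborel (\<lambda>z. cis (- (z \<bullet> w)) * \<phi> z - cis (- (z \<bullet> \<zeta>)) * \<phi> z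
        - cis (- (z \<bullet> \<zeta>)) * (fst h * mul_x \<phi> z + snd h * mul_y \<phi> z))"
        using i by auto
    qed
    then have "cmod (LINT z|lborel. cis (- (z \<bullet> w)) * \<phi> z - cis (- (z \<bullet> \<zeta>)) * \<phi> z
        - cis (- (z \<bullet> \<zeta>)) * (fst h * mul_x \<phi> z + snd h * mul_y \<phi> z)) / (2 * pi) \<le>
        (LINT z|lborel. (norm h)\<^sup>2 / 2 * ((norm z)\<^sup>2 * cmod (\<phi> z))) / (2 * pi)"
       by (rule divide_right_mono) simp
    moreover have "norm (complex_of_real (2 * pi)) = 2 * pi" by (simp only: norm_of_real) simp
    ultimately show ?thesis by (simp only: norm_divide)
  qed
  also have "\<dots> = ?C * (norm h)\<^sup>2" by simp
  finally have "norm ((fourier \<phi> w - fourier \<phi> \<zeta>) - ?D h) \<le> ?C * (norm h)\<^sup>2" .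
  then show "norm ((fourier \<phi> w - fourier \<phi> \<zeta>) - ?D (w - \<zeta>)) / norm (w - \<zeta>) \<le> ?C * norm (w - \<zeta>)"
    unfolding h_def[symmetric] pos_divide_le_eq[OF hp] by (simp only: power2_eq_square mult.assoc)
next
  show "((\<lambda>w. (LINT z|lborel. (norm z)\<^sup>2 * cmod (\<phi> z)) / (4 * pi) * norm (w - \<zeta>)) \<longlongrightarrow> 0) (at \<zeta>)"
    by (auto intro!: tendsto_eq_intros)
qed simp

lemma pd_fourier:
  assumes "schwartz \<phi>"
  shows "pdx (fourier \<phi>) = fourier (mul_x \<phi>)" "pdy (fourier \<phi>) = fourier (mul_y \<phi>)"
  using pdx_pdy_eqI[OF fourier_has_derivative[OF assms]] by auto

text \<open>
  Differentiating \<open>\<integral> cis(-z\<bullet>\<zeta>) \<phi>(z + h v) dz = cis(h v\<bullet>\<zeta>) \<integral> cis(-z\<bullet>\<zeta>) \<phi>(z) dz\<close> in \<open>h\<close>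
  replaces the integration by parts.
\<close>

lemma fourier_directional_derivative:
  fixes v :: plane
  assumes s: "schwartz \<phi>" "schwartz \<psi>" and v: "norm v \<le> 1"
    and der: "\<And>z t. ((\<lambda>t. \<phi> (z + t *\<^sub>R v)) has_vector_derivative \<psi> (z + t *\<^sub>R v)) (at t)"
  shows "fourier \<psi> \<zeta> = \<i> * complex_of_real (v \<bullet> \<zeta>) * fourier \<phi> \<zeta>"
proof -
  define h where "h n = 1 / real (Suc n)" for n
  have h: "h n > 0" "h n \<le> 1" for n by (auto simp: h_def)
  have "h \<longlonglongrightarrow> 0" unfolding h_def using LIMSEQ_Suc[OF lim_1_over_n] by simp
  then have hlim: "filterlim h (at 0) sequentially"
    unfolding filterlim_at using h(1) by (auto intro!: always_eventually simp: less_imp_neq[symmetric])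
  have quot: "(\<lambda>n. (f (h n) - f 0) / complex_of_real (h n)) \<longlonglongrightarrow> D"
    if "(f has_vector_derivative D) (at 0)" for f :: "real \<Rightarrow> complex" and D
  proof -
    have "((\<lambda>t. norm (f (0 + t) - f 0 - t *\<^sub>R D) / norm t) \<longlongrightarrow> 0) (at 0)"
      using that unfolding has_vector_derivative_def has_derivative_at by blast
    then have "(\<lambda>n. norm (f (0 + h n) - f 0 - h n *\<^sub>R D) / norm (h n)) \<longlonglongrightarrow> 0"
      by (rule filterlim_compose[OF _ hlim])
    also have "(\<lambda>n. norm (f (0 + h n) - f 0 - h n *\<^sub>R D) / norm (h n))
        = (\<lambda>n. norm ((f (h n) - f 0) / complex_of_real (h n) - D))"
    proof
      fix n
      have "(f (h n) - f 0) / complex_of_real (h n) - D = (f (0 + h n) - f 0 - h n *\<^sub>R D) / complex_of_real (h n)"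
        using h(1)[of n] by (simp add: field_simps scaleR_conv_of_real)
      then show "norm (f (0 + h n) - f 0 - h n *\<^sub>R D) / norm (h n) = norm ((f (h n) - f 0) / complex_of_real (h n) - D)"
        using h(1)[of n] by (simp add: norm_divide)
    qed
    finally show ?thesis by (simp only: tendsto_norm_zero_iff LIM_zero_iff)
  qed
  note [measurable] = schwartz_measurable[OF s(1)] schwartz_measurable[OF s(2)]
  have i: "integrable lborel \<phi>" "integrable lborel \<psi>" using s by (auto intro: schwartz_integrable)
  \<comment> \<open>The transform of the difference quotient, evaluated in two ways:
    \<open>A1\<close> translates the variable of integration, \<open>L2\<close> uses dominated
    convergence.\<close>
  define A where "A n = (LINT z|lborel. cis (- (z \<bullet> \<zeta>)) * ((\<phi> (z + h n *\<^sub>R v) - \<phi> z) / complex_of_real (h n)))" for n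
  have shift: "integrable lborel (\<lambda>z. \<phi> (z + w))" for w
    using lborel_integrable_affine[of 1 \<phi> w] i by (simp add: add.commute)
  have A1: "A n = (cis (h n * (v \<bullet> \<zeta>)) - cis (0 * (v \<bullet> \<zeta>))) / complex_of_real (h n) * (complex_of_real (2 * pi) * fourier \<phi> \<zeta>)" for n
  proof -
    have "(LINT z|lborel. cis (- (z \<bullet> \<zeta>)) * \<phi> (z + h n *\<^sub>R v)) =
        (LINT z|lborel. cis (- ((z - h n *\<^sub>R v) \<bullet> \<zeta>)) * \<phi> z)"
      using lborel_integral_affine[of 1 "\<lambda>z. cis (- ((z - h n *\<^sub>R v) \<bullet> \<zeta>)) * \<phi> z" "h n *\<^sub>R v"]
      by (simp add: add.commute)
    also have "(\<lambda>z. cis (- ((z - h n *\<^sub>R v) \<bullet> \<zeta>)) * \<phi> z) = (\<lambda>z. cis (h n * (v \<bullet> \<zeta>)) * (cis (- (z \<bullet> \<zeta>)) * \<phi> z))"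
      by (auto simp: inner_diff_left cis_mult algebra_simps)
    finally have e: "(LINT z|lborel. cis (- (z \<bullet> \<zeta>)) * \<phi> (z + h n *\<^sub>R v)) =
        cis (h n * (v \<bullet> \<zeta>)) * (complex_of_real (2 * pi) * fourier \<phi> \<zeta>)"
      by (simp only: integral_mult_right_zero fourier_eq)
    have "A n = (LINT z|lborel. (cis (- (z \<bullet> \<zeta>)) * \<phi> (z + h n *\<^sub>R v) - cis (- (z \<bullet> \<zeta>)) * \<phi> z) / complex_of_real (h n))"
      unfolding A_def by (simp add: right_diff_distrib)
    also have "\<dots> = (cis (h n * (v \<bullet> \<zeta>)) * (complex_of_real (2 * pi) * fourier \<phi> \<zeta>) - complex_of_real (2 * pi) * fourier \<phi> \<zeta>) / complex_of_real (h n)"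
      unfolding integral_divide_zero
      by (subst Bochner_Integration.integral_diff) (use i shift in \<open>auto simp: e fourier_eq simp del: of_real_mult\<close>)
    finally show ?thesis by (simp add: algebra_simps diff_divide_distrib)
  qed
  have "((\<lambda>t. cis (t * (v \<bullet> \<zeta>))) has_vector_derivative \<i> * complex_of_real (v \<bullet> \<zeta>)) (at 0)"
    unfolding cis_conv_exp of_real_mult
    by (rule has_vector_derivative_real_field) (auto intro!: derivative_eq_intros)
  note quot[OF this]
  then have L1: "A \<longlonglongrightarrow> \<i> * complex_of_real (v \<bullet> \<zeta>) * (complex_of_real (2 * pi) * fourier \<phi> \<zeta>)"
    unfolding A1[abs_def] by (intro tendsto_mult tendsto_const)
  obtain B where B: "B \<ge> 0" "\<And>z. cmod (\<psi> z) \<le> B * inverse ((1 + (norm z)\<^sup>2)\<^sup>2)"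
    using schwartz_decay[OF s(2)] by blast
  \<comment> \<open>A shift by at most 1 changes \<open>1 + (norm z)^2\<close> by at most the factor
    3, hence its square by at most 9. One dominating function then serves all
    \<open>n\<close>.\<close>
  have near: "cmod (\<psi> (z + t *\<^sub>R v)) \<le> 9 * B * inverse ((1 + (norm z)\<^sup>2)\<^sup>2)" if "0 \<le> t" "t \<le> 1" for z t
  proof -
    let ?w = "z + t *\<^sub>R v"
    have "norm z \<le> norm ?w + norm (t *\<^sub>R v)" by (metis add_diff_cancel norm_triangle_ineq4)
    moreover have "norm (t *\<^sub>R v) \<le> 1" using that v by (simp add: mult_le_one)
    ultimately have "norm z \<le> norm ?w + 1" by linarith
    then have "(norm z)\<^sup>2 \<le> (norm ?w + 1)\<^sup>2" by (intro power_mono) auto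
    also have "\<dots> \<le> 2 * (norm ?w)\<^sup>2 + 2" using sum_squares_bound[of "norm ?w" 1] by (simp add: power2_sum)
    finally have "1 + (norm z)\<^sup>2 \<le> 3 * (1 + (norm ?w)\<^sup>2)"
      using zero_le_power2[of "norm ?w"] by argo
    then have "(1 + (norm z)\<^sup>2)\<^sup>2 \<le> (3 * (1 + (norm ?w)\<^sup>2))\<^sup>2" by (intro power_mono) auto
    then have le: "(1 + (norm z)\<^sup>2)\<^sup>2 \<le> 9 * (1 + (norm ?w)\<^sup>2)\<^sup>2" unfolding power_mult_distrib by simp
    have p: "0 < (1 + (norm z)\<^sup>2)\<^sup>2" "0 < (1 + (norm ?w)\<^sup>2)\<^sup>2" by (intro zero_less_power add_pos_nonneg; simp)+
    have "inverse ((1 + (norm ?w)\<^sup>2)\<^sup>2) \<le> 9 * inverse ((1 + (norm z)\<^sup>2)\<^sup>2)"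
      using le p by (simp add: field_simps)
    then have "B * inverse ((1 + (norm ?w)\<^sup>2)\<^sup>2) \<le> B * (9 * inverse ((1 + (norm z)\<^sup>2)\<^sup>2))"
      by (rule mult_left_mono) (rule B)
    then show ?thesis using B(2)[of ?w] by simp
  qed
  have L2: "A \<longlonglongrightarrow> (LINT z|lborel. cis (- (z \<bullet> \<zeta>)) * \<psi> z)"
    unfolding A_def
  proof (rule integral_dominated_convergence)
    show "integrable lborel (\<lambda>z. 9 * B * inverse ((1 + (norm (z::plane))\<^sup>2)\<^sup>2))"
      by (intro integrable_mult_right integrable_weight)
    show "AE z in lborel. (\<lambda>n. cis (- (z \<bullet> \<zeta>)) * ((\<phi> (z + h n *\<^sub>R v) - \<phi> z) / complex_of_real (h n))) \<longlonglongrightarrow> cis (- (z \<bullet> \<zeta>)) * \<psi> z"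
      using quot[OF der[of _ 0]] by (intro AE_I2 tendsto_intros) auto
    show "AE z in lborel. norm (cis (- (z \<bullet> \<zeta>)) * ((\<phi> (z + h n *\<^sub>R v) - \<phi> z) / complex_of_real (h n)))
      \<le> 9 * B * inverse ((1 + (norm z)\<^sup>2)\<^sup>2)" for n
    proof (intro AE_I2)
      fix z
      have "norm (\<phi> (z + h n *\<^sub>R v) - \<phi> (z + 0 *\<^sub>R v)) \<le> (9 * B * inverse ((1 + (norm z)\<^sup>2)\<^sup>2)) * \<bar>h n - 0\<bar>"
        by (rule vector_derivative_bound[OF der near])
          (use h[of n] in \<open>auto simp: closed_segment_eq_real_ivl\<close>)
      then show "norm (cis (- (z \<bullet> \<zeta>)) * ((\<phi> (z + h n *\<^sub>R v) - \<phi> z) / complex_of_real (h n)))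
          \<le> 9 * B * inverse ((1 + (norm z)\<^sup>2)\<^sup>2)"
        using h(1)[of n] by (simp add: norm_mult norm_divide pos_divide_le_eq)
    qed
  qed measurable
  show ?thesis
    using LIMSEQ_unique[OF L1 L2] unfolding fourier_eq by (simp add: mult.assoc)
qed

lemma fourier_pdx:
  assumes "schwartz \<phi>" shows "fourier (pdx \<phi>) \<zeta> = \<i> * complex_of_real (fst \<zeta>) * fourier \<phi> \<zeta>"
proof -
  have "((\<lambda>t. \<phi> (z + t *\<^sub>R (1, 0))) has_vector_derivative pdx \<phi> (z + t *\<^sub>R (1, 0))) (at t)" for z t
  proof -
    have 1: "((\<lambda>t. z + t *\<^sub>R (1, 0)) has_derivative (\<lambda>h. h *\<^sub>R (1, 0))) (at t)"
      by (auto intro!: derivative_eq_intros)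
    show ?thesis
      using has_derivative_compose[OF 1 has_derivative_pd[OF schwartz_differentiable[OF assms]]]
      by (simp add: has_vector_derivative_def)
  qed
  from fourier_directional_derivative[OF assms schwartz_pdx[OF assms] _ this, of \<zeta>]
  show ?thesis by (simp add: inner_prod_def norm_Pair)
qed

lemma fourier_pdy:
  assumes "schwartz \<phi>" shows "fourier (pdy \<phi>) \<zeta> = \<i> * complex_of_real (snd \<zeta>) * fourier \<phi> \<zeta>"
proof -
  have "((\<lambda>t. \<phi> (z + t *\<^sub>R (0, 1))) has_vector_derivative pdy \<phi> (z + t *\<^sub>R (0, 1))) (at t)" for z t
  proof -
    have 1: "((\<lambda>t. z + t *\<^sub>R (0, 1)) has_derivative (\<lambda>h. h *\<^sub>R (0, 1))) (at t)"
      by (auto intro!: derivative_eq_intros)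
    show ?thesis
      using has_derivative_compose[OF 1 has_derivative_pd[OF schwartz_differentiable[OF assms]]]
      by (simp add: has_vector_derivative_def)
  qed
  from fourier_directional_derivative[OF assms schwartz_pdy[OF assms] _ this, of \<zeta>]
  show ?thesis by (simp add: inner_prod_def norm_Pair)
qed

text \<open>Transforms of iterated derivatives are bounded, and differentiation becomes
  multiplication by a coordinate. So powers of either coordinate times the transform are bounded,
  and the norm is at most twice the larger coordinate.\<close>

lemma rapid_fourier:
  assumes "schwartz \<phi>" shows "rapid (fourier \<phi>)"
  unfolding rapid_def
proof
  fix l
  have x: "schwartz ((pdx ^^ l) \<phi>) \<and> (\<forall>\<zeta>. cmod (fourier ((pdx ^^ l) \<phi>) \<zeta>) = \<bar>fst \<zeta>\<bar> ^ l * cmod (fourier \<phi> \<zeta>))" for l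
    by (induction l) (auto simp: assms schwartz_pdx fourier_pdx norm_mult)
  have y: "schwartz ((pdy ^^ l) \<phi>) \<and> (\<forall>\<zeta>. cmod (fourier ((pdy ^^ l) \<phi>) \<zeta>) = \<bar>snd \<zeta>\<bar> ^ l * cmod (fourier \<phi> \<zeta>))" for l
    by (induction l) (auto simp: assms schwartz_pdy fourier_pdy norm_mult)
  obtain A where A: "\<And>\<zeta>. \<bar>fst \<zeta>\<bar> ^ l * cmod (fourier \<phi> \<zeta>) \<le> A"
    using x[of l] fourier_bound schwartz_integrable by metis
  obtain B where B: "\<And>\<zeta>. \<bar>snd \<zeta>\<bar> ^ l * cmod (fourier \<phi> \<zeta>) \<le> B"
    using y[of l] fourier_bound schwartz_integrable by metis
  have "norm \<zeta> ^ l * cmod (fourier \<phi> \<zeta>) \<le> 2 ^ l * (A + B)" for \<zeta>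
  proof -
    have "norm \<zeta> \<le> \<bar>fst \<zeta>\<bar> + \<bar>snd \<zeta>\<bar>" using norm_Pair_le[of "fst \<zeta>" "snd \<zeta>"] by simp
    also have "\<dots> \<le> 2 * max \<bar>fst \<zeta>\<bar> \<bar>snd \<zeta>\<bar>" by simp
    finally have "norm \<zeta> ^ l \<le> (2 * max \<bar>fst \<zeta>\<bar> \<bar>snd \<zeta>\<bar>) ^ l" by (intro power_mono) auto
    also have "\<dots> \<le> 2 ^ l * (\<bar>fst \<zeta>\<bar> ^ l + \<bar>snd \<zeta>\<bar> ^ l)"
      by (auto simp: power_mult_distrib max_def)
    finally have "norm \<zeta> ^ l * cmod (fourier \<phi> \<zeta>) \<le> 2 ^ l * (\<bar>fst \<zeta>\<bar> ^ l + \<bar>snd \<zeta>\<bar> ^ l) * cmod (fourier \<phi> \<zeta>)"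
      by (rule mult_right_mono) simp
    also have "\<dots> = 2 ^ l * (\<bar>fst \<zeta>\<bar> ^ l * cmod (fourier \<phi> \<zeta>) + \<bar>snd \<zeta>\<bar> ^ l * cmod (fourier \<phi> \<zeta>))"
      by (simp add: algebra_simps)
    also have "\<dots> \<le> 2 ^ l * (A + B)"
      by (intro mult_left_mono add_mono A B) auto
    finally show ?thesis .
  qed
  then show "\<exists>B. \<forall>z. norm z ^ l * cmod (fourier \<phi> z) \<le> B" by blast
qed

theorem schwartz_fourier:
  assumes "schwartz \<phi>" shows "schwartz (fourier \<phi>)"
proof (rule schwartz_classI[where \<C> = "fourier ` Collect schwartz"])
  fix \<psi> assume "\<psi> \<in> fourier ` Collect schwartz"
  then obtain \<phi> where \<phi>: "schwartz \<phi>" "\<psi> = fourier \<phi>" by auto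
  show "\<psi> differentiable (at z)" for z
    unfolding \<phi> differentiable_def using fourier_has_derivative[OF \<phi>(1)] by blast
  show "pdx \<psi> \<in> fourier ` Collect schwartz" "pdy \<psi> \<in> fourier ` Collect schwartz"
    using \<phi> by (auto simp: pd_fourier schwartz_mul_x schwartz_mul_y)
  show "\<exists>B. \<forall>z. norm z ^ l * cmod (\<psi> z) \<le> B" for l
    using rapid_fourier[OF \<phi>(1)] unfolding \<phi>(2) rapid_def by blast
qed (use assms in auto)

section \<open>Fourier inversion\<close>

definition gauss :: "plane \<Rightarrow> real" where
  "gauss z = exp (- (norm z)\<^sup>2 / 2)"

lemma gauss_eq: "gauss z = exp (- (fst z)\<^sup>2 / 2) * exp (- (snd z)\<^sup>2 / 2)"
  by (cases z) (simp add: gauss_def norm_Pair exp_add[symmetric] field_simps)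

lemma gauss_measurable [measurable]: "gauss \<in> borel_measurable borel"
  unfolding gauss_def[abs_def] by measurable

lemma std_normal_density_eq: "exp (- (x::real)\<^sup>2 / 2) = sqrt (2 * pi) * std_normal_density x"
  by (simp add: std_normal_density_def)

lemma integrable_exp_square: "integrable lborel (\<lambda>x::real. exp (- x\<^sup>2 / 2))"
  unfolding std_normal_density_eq by (intro integrable_mult_right integrable_normal_density) simp

lemma cis_exp_square:
  "(LINT x|lborel. cis (t * x) * complex_of_real (exp (- x\<^sup>2 / 2))) = complex_of_real (sqrt (2 * pi) * exp (- t\<^sup>2 / 2))"
proof -
  have "(LINT x|lborel. std_normal_density x *\<^sub>R iexp (t * x)) = complex_of_real (exp (- t\<^sup>2 / 2))"
    using fun_cong[OF char_std_normal_distribution, of t] unfolding char_def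
    by (subst (asm) integral_density) (auto simp: normal_density_nonneg)
  then have "complex_of_real (sqrt (2 * pi)) * (LINT x|lborel. std_normal_density x *\<^sub>R iexp (t * x)) = complex_of_real (sqrt (2 * pi) * exp (- t\<^sup>2 / 2))"
    by simp
  then show ?thesis
    unfolding integral_mult_right_zero[symmetric] std_normal_density_eq
    by (simp add: cis_conv_exp scaleR_conv_of_real algebra_simps)
qed

lemma integrable_gauss: "integrable lborel gauss"
  unfolding gauss_eq[abs_def] by (intro integrable_tensor integrable_exp_square)

lemma lborel_integral_tensor:
  fixes f :: "'a::euclidean_space \<Rightarrow> complex" and g :: "'b::euclidean_space \<Rightarrow> complex"
  assumes "integrable lborel f" "integrable lborel g"
  shows "(LINT z|lborel. f (fst z) * g (snd z)) = integral\<^sup>L lborel f * integral\<^sup>L lborel g"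
proof -
  have "integrable (lborel \<Otimes>\<^sub>M lborel) (\<lambda>z. f (fst z) * g (snd z))"
    using integrable_tensor[OF assms] by (simp add: lborel_prod)
  from lborel_pair.integral_fst'[OF this] show ?thesis by (simp add: lborel_prod)
qed

text \<open>The Gaussian factorises, and each factor is the characteristic function of the standard
  normal distribution.\<close>

lemma integral_cis_gauss:
  "(LINT \<zeta>|lborel. cis (z \<bullet> \<zeta>) * complex_of_real (gauss \<zeta>)) = complex_of_real (2 * pi * gauss z)"
proof -
  let ?g = "\<lambda>t x. cis (t * x) * complex_of_real (exp (- x\<^sup>2 / 2))"
  have "integrable lborel (?g t)" for t
    by (intro integrable_cis_mult integrable_of_real integrable_exp_square) measurable
  then have "(LINT \<zeta>|lborel. ?g (fst z) (fst \<zeta>) * ?g (snd z) (snd \<zeta>)) =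
      (LINT x|lborel. ?g (fst z) x) * (LINT x|lborel. ?g (snd z) x)"
    by (intro lborel_integral_tensor)
  also have "\<dots> = complex_of_real (2 * pi * gauss z)"
  proof -
    have f: "sqrt (2 * pi) * a * (sqrt (2 * pi) * b) = 2 * pi * (a * b)" for a b
      using real_sqrt_mult_self[of "2 * pi"] by (simp add: algebra_simps)
    show ?thesis unfolding cis_exp_square of_real_mult[symmetric] gauss_eq f ..
  qed
  finally have "(LINT \<zeta>|lborel. ?g (fst z) (fst \<zeta>) * ?g (snd z) (snd \<zeta>)) = complex_of_real (2 * pi * gauss z)" .
  moreover have "(\<lambda>\<zeta>. ?g (fst z) (fst \<zeta>) * ?g (snd z) (snd \<zeta>)) = (\<lambda>\<zeta>. cis (z \<bullet> \<zeta>) * complex_of_real (gauss \<zeta>))"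
    by (auto simp: gauss_eq inner_prod_def cis_mult[symmetric] algebra_simps)
  ultimately show ?thesis by simp
qed

text \<open>The iterated integral is not absolutely convergent as a double integral. The factor
  \<open>gauss (e n *\<^sub>R \<zeta>)\<close> makes Fubini applicable, and the inner integral
  becomes an explicit Gaussian that concentrates at \<open>z = - w\<close>.\<close>

theorem fourier_inversion:
  assumes s: "schwartz \<phi>"
  shows "fourier (fourier \<phi>) w = \<phi> (- w)"
proof -
  define e where "e n = 1 / real (Suc n)" for n
  have e: "e n > 0" for n by (auto simp: e_def)
  have e0: "e \<longlonglongrightarrow> 0" unfolding e_def using LIMSEQ_Suc[OF lim_1_over_n] by simp
  note [measurable] = schwartz_measurable[OF s] schwartz_measurable[OF schwartz_fourier[OF s]]
  have i: "integrable lborel \<phi>" "integrable lborel (fourier \<phi>)"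
    using s by (auto intro: schwartz_integrable schwartz_fourier)
  have g0: "(\<lambda>n. complex_of_real (gauss (e n *\<^sub>R \<zeta>))) \<longlonglongrightarrow> 1" for \<zeta>
  proof -
    have "(\<lambda>n. exp (- (norm (e n *\<^sub>R \<zeta>))\<^sup>2 / 2)) \<longlonglongrightarrow> exp (- (norm (0 *\<^sub>R \<zeta>))\<^sup>2 / 2)"
      by (intro tendsto_intros e0) auto
    then have "(\<lambda>n. complex_of_real (exp (- (norm (e n *\<^sub>R \<zeta>))\<^sup>2 / 2))) \<longlonglongrightarrow> complex_of_real (exp (- (norm (0 *\<^sub>R \<zeta>))\<^sup>2 / 2))"
      by (rule tendsto_of_real)
    then show ?thesis by (simp add: gauss_def)
  qed
  have g1: "gauss \<zeta> \<le> 1" "gauss \<zeta> \<ge> 0" for \<zeta> by (auto simp: gauss_def)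
  define A where "A n = (LINT \<zeta>|lborel. cis (- (\<zeta> \<bullet> w)) * fourier \<phi> \<zeta> * complex_of_real (gauss (e n *\<^sub>R \<zeta>)))" for n
  have L1: "A \<longlonglongrightarrow> (LINT \<zeta>|lborel. cis (- (\<zeta> \<bullet> w)) * fourier \<phi> \<zeta> * 1)"
    unfolding A_def
  proof (rule integral_dominated_convergence)
    show "integrable lborel (\<lambda>\<zeta>. cmod (fourier \<phi> \<zeta>))" using i by auto
    show "AE \<zeta> in lborel. (\<lambda>n. cis (- (\<zeta> \<bullet> w)) * fourier \<phi> \<zeta> * complex_of_real (gauss (e n *\<^sub>R \<zeta>)))
      \<longlonglongrightarrow> cis (- (\<zeta> \<bullet> w)) * fourier \<phi> \<zeta> * 1"
      by (intro AE_I2 tendsto_intros g0)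
    show "AE \<zeta> in lborel. norm (cis (- (\<zeta> \<bullet> w)) * fourier \<phi> \<zeta> * complex_of_real (gauss (e n *\<^sub>R \<zeta>)))
      \<le> cmod (fourier \<phi> \<zeta>)" for n
      using g1 by (auto simp: norm_mult mult_left_le)
  qed measurable
  \<comment> \<open>After Fubini the inner integral is a Gaussian in \<open>(z + w) / e n\<close>
    with the factor \<open>1 / (e n)^2\<close>. The substitution \<open>z = - w + e n v\<close>
    absorbs this factor and evaluates \<open>\<phi>\<close> ever closer to
    \<open>- w\<close>.\<close>
  have A: "A n = (LINT v|lborel. \<phi> (- w + e n *\<^sub>R v) * complex_of_real (gauss v))" for n
  proof -
    let ?K = "\<lambda>\<zeta> z. cis (- ((z + w) \<bullet> \<zeta>)) * (\<phi> z * complex_of_real (gauss (e n *\<^sub>R \<zeta>)))"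
    have ig: "integrable lborel (\<lambda>\<zeta>. complex_of_real (gauss (e n *\<^sub>R \<zeta>)))"
    proof -
      have "integrable (distr lborel borel (\<lambda>x. 0 + e n *\<^sub>R x)) gauss"
      proof -
        have "integrable (density (distr lborel borel (\<lambda>x. 0 + e n *\<^sub>R x)) (\<lambda>_. ennreal (\<bar>e n\<bar> ^ DIM(plane)))) gauss"
          using integrable_gauss lborel_affine[of "e n" "0::plane"] e[of n] by simp
        then show ?thesis using e[of n] by (subst (asm) integrable_density) auto
      qed
      then show ?thesis by (subst (asm) integrable_distr_eq) auto
    qed
    have "integrable lborel (\<lambda>p. (\<phi> (snd p)) * (\<lambda>\<zeta>. complex_of_real (gauss (e n *\<^sub>R \<zeta>))) (fst p))"
      using integrable_tensor[OF ig i(1)] by (simp add: mult.commute)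
    then have "integrable lborel (\<lambda>p. ?K (fst p) (snd p))"
    proof (rule integrable_cis_mult)
      have "(\<lambda>p::plane \<times> plane. - ((snd p + w) \<bullet> fst p)) \<in> borel_measurable borel"
        by (intro borel_measurable_continuous_onI continuous_intros)
      then show "(\<lambda>p::plane \<times> plane. - ((snd p + w) \<bullet> fst p)) \<in> borel_measurable lborel" by simp
    qed
    then have ip: "integrable (lborel \<Otimes>\<^sub>M lborel) (case_prod ?K)"
      by (simp add: lborel_prod case_prod_beta')
    have inner: "(LINT \<zeta>|lborel. ?K \<zeta> z) = complex_of_real (2 * pi / (e n)\<^sup>2) * (\<phi> z * complex_of_real (gauss ((z + w) /\<^sub>R e n)))" for z
    proof -
      let ?f = "\<lambda>\<zeta>. cis ((- ((z + w) /\<^sub>R e n)) \<bullet> \<zeta>) * complex_of_real (gauss \<zeta>)"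
      have "(\<lambda>\<zeta>. ?K \<zeta> z) = (\<lambda>\<zeta>. \<phi> z * ?f (0 + e n *\<^sub>R \<zeta>))"
      proof
        fix \<zeta>
        have "(- ((z + w) /\<^sub>R e n)) \<bullet> (0 + e n *\<^sub>R \<zeta>) = - ((z + w) \<bullet> \<zeta>)"
          using e[of n] by simp
        then show "?K \<zeta> z = \<phi> z * ?f (0 + e n *\<^sub>R \<zeta>)"
          by (simp only: add_0) (simp only: mult.left_commute)
      qed
      then have "(LINT \<zeta>|lborel. ?K \<zeta> z) = \<phi> z * (LINT \<zeta>|lborel. ?f (0 + e n *\<^sub>R \<zeta>))"
        by (simp only: integral_mult_right_zero)
      also have "(LINT \<zeta>|lborel. ?f (0 + e n *\<^sub>R \<zeta>)) = (LINT \<zeta>|lborel. ?f \<zeta>) /\<^sub>R (e n)\<^sup>2"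
        using e[of n] by (subst lborel_integral_scale[of "e n" ?f 0]) auto
      also have "\<dots> = complex_of_real (2 * pi / (e n)\<^sup>2 * gauss ((z + w) /\<^sub>R e n))"
      proof -
        have "gauss (- ((z + w) /\<^sub>R e n)) = gauss ((z + w) /\<^sub>R e n)"
          by (simp only: gauss_def norm_minus_cancel)
        then show ?thesis
          unfolding integral_cis_gauss by (simp only: scaleR_conv_of_real divide_inverse of_real_mult mult_ac)
      qed
      finally show ?thesis by simp
    qed
    have "complex_of_real (2 * pi) * A n = (LINT \<zeta>|lborel. LINT z|lborel. ?K \<zeta> z)"
    proof -
      have cw: "cis (- ((z + w) \<bullet> \<zeta>)) = cis (- (\<zeta> \<bullet> w)) * cis (- (z \<bullet> \<zeta>))" for z \<zeta>
        by (simp add: inner_add_right cis_mult inner_commute[of _ \<zeta>] algebra_simps)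
      have "(LINT z|lborel. ?K \<zeta> z) = complex_of_real (2 * pi) * (cis (- (\<zeta> \<bullet> w)) * fourier \<phi> \<zeta> * complex_of_real (gauss (e n *\<^sub>R \<zeta>)))" for \<zeta>
      proof -
        have "(\<lambda>z. ?K \<zeta> z) = (\<lambda>z. (cis (- (\<zeta> \<bullet> w)) * complex_of_real (gauss (e n *\<^sub>R \<zeta>))) * (cis (- (z \<bullet> \<zeta>)) * \<phi> z))"
          unfolding cw by (auto simp: algebra_simps)
        then show ?thesis by (simp only: integral_mult_right_zero fourier_eq) (simp add: algebra_simps)
      qed
      then show ?thesis by (simp only: integral_mult_right_zero A_def)
    qed
    also have "\<dots> = (LINT z|lborel. LINT \<zeta>|lborel. ?K \<zeta> z)"
      by (rule lborel_pair.Fubini_integral[OF ip, symmetric])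
    also have "\<dots> = (LINT z|lborel. complex_of_real (2 * pi / (e n)\<^sup>2) * (\<phi> z * complex_of_real (gauss ((z + w) /\<^sub>R e n))))"
      by (simp only: inner)
    also have "(LINT z|lborel. complex_of_real (2 * pi / (e n)\<^sup>2) * (\<phi> z * complex_of_real (gauss ((z + w) /\<^sub>R e n))))
        = complex_of_real (2 * pi / (e n)\<^sup>2) * (LINT z|lborel. \<phi> z * complex_of_real (gauss ((z + w) /\<^sub>R e n)))"
      by (rule integral_mult_right_zero)
    also have "(LINT z|lborel. \<phi> z * complex_of_real (gauss ((z + w) /\<^sub>R e n)))
        = (e n)\<^sup>2 *\<^sub>R (LINT v|lborel. \<phi> (- w + e n *\<^sub>R v) * complex_of_real (gauss v))"
      using e[of n] by (subst lborel_integral_scale[of "e n" _ "- w"]) auto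
    finally show ?thesis using e[of n] by (simp add: scaleR_conv_of_real)
  qed
  obtain B where B: "\<And>z. cmod (\<phi> z) \<le> B" using schwartz_bound[OF s, of 0] by auto
  have cont: "isCont \<phi> z" for z
    by (intro differentiable_imp_continuous_within schwartz_differentiable s)
  have L2: "A \<longlonglongrightarrow> (LINT v|lborel. \<phi> (- w) * complex_of_real (gauss v))"
    unfolding A[abs_def]
  proof (rule integral_dominated_convergence)
    show "integrable lborel (\<lambda>v. B * gauss v)" by (intro integrable_mult_right integrable_gauss)
    have "(\<lambda>n. \<phi> (- w + e n *\<^sub>R v)) \<longlonglongrightarrow> \<phi> (- w)" for v
    proof -
      have "(\<lambda>n. - w + e n *\<^sub>R v) \<longlonglongrightarrow> - w + 0 *\<^sub>R v" by (intro tendsto_intros e0)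
      then show ?thesis by (intro isCont_tendsto_compose[OF cont]) simp
    qed
    then show "AE v in lborel. (\<lambda>n. \<phi> (- w + e n *\<^sub>R v) * complex_of_real (gauss v)) \<longlonglongrightarrow> \<phi> (- w) * complex_of_real (gauss v)"
      by (intro AE_I2 tendsto_intros)
    show "AE v in lborel. norm (\<phi> (- w + e n *\<^sub>R v) * complex_of_real (gauss v)) \<le> B * gauss v" for n
      using g1 B by (intro AE_I2) (simp add: norm_mult mult_right_mono)
  qed measurable
  have "(LINT v|lborel. complex_of_real (gauss v)) = complex_of_real (2 * pi)"
    using integral_cis_gauss[of 0] by (simp add: gauss_def)
  then have g: "(LINT v|lborel. \<phi> (- w) * complex_of_real (gauss v)) = complex_of_real (2 * pi) * \<phi> (- w)"
    unfolding integral_mult_right_zero by (simp only: mult.commute)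
  have "complex_of_real (2 * pi) * fourier (fourier \<phi>) w = complex_of_real (2 * pi) * \<phi> (- w)"
    using LIMSEQ_unique[OF L1 L2] unfolding g mult_1_right fourier_eq .
  then show ?thesis by simp
qed

text \<open>Reflection is the square of the Fourier transform, so no derivative has to be
  computed.\<close>

lemma schwartz_reflect: "schwartz \<phi> \<Longrightarrow> schwartz (\<lambda>z. \<phi> (- z))"
  using schwartz_fourier[OF schwartz_fourier, of \<phi>] fourier_inversion[of \<phi>] by (metis (no_types, lifting) ext)

definition ifourier :: "(plane \<Rightarrow> complex) \<Rightarrow> plane \<Rightarrow> complex" where
  "ifourier f z = (LINT \<zeta>|lborel. cis (z \<bullet> \<zeta>) * f \<zeta>) / complex_of_real (2 * pi)"

lemma ifourier_eq_fourier: "ifourier f z = fourier f (- z)"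
  by (simp add: ifourier_def fourier_def inner_commute)

lemma schwartz_ifourier: "schwartz \<phi> \<Longrightarrow> schwartz (ifourier \<phi>)"
  unfolding ifourier_eq_fourier[abs_def] by (intro schwartz_reflect schwartz_fourier)

lemma ifourier_fourier: "schwartz \<phi> \<Longrightarrow> ifourier (fourier \<phi>) = \<phi>"
  by (simp add: ifourier_eq_fourier[abs_def] fourier_inversion)

lemma fourier_ifourier:
  assumes "schwartz \<phi>" shows "fourier (ifourier \<phi>) = \<phi>"
proof -
  have m: "fourier \<phi> \<in> borel_measurable borel"
    using assms by (intro schwartz_measurable schwartz_fourier)
  have "fourier (ifourier \<phi>) z = fourier (fourier \<phi>) (- z)" for z
    using lborel_integral_affine[of "-1" "\<lambda>\<zeta>. cis (\<zeta> \<bullet> z) * fourier \<phi> \<zeta>" 0] m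
    by (simp add: ifourier_eq_fourier[abs_def] fourier_def[of "fourier \<phi>"] fourier_def[of "\<lambda>z. fourier \<phi> (- z)"])
  then show ?thesis using fourier_inversion[OF assms] by auto
qed

lemma schwartz_fourier_surj:
  assumes "schwartz \<phi>" obtains \<psi> where "schwartz \<psi>" "\<phi> = fourier \<psi>"
  using fourier_ifourier[OF assms] schwartz_ifourier[OF assms] by metis

section \<open>Tempered distributions and their Fourier transforms\<close>

lemma plane_coords_measurable [measurable]:
  "(fst :: plane \<Rightarrow> real) \<in> borel_measurable borel" "(snd :: plane \<Rightarrow> real) \<in> borel_measurable borel"
  by (intro borel_measurable_continuous_onI continuous_intros)+

lemma cnj_measurable [measurable]: "cnj \<in> borel_measurable borel"
  by (intro borel_measurable_continuous_onI continuous_on_cnj continuous_on_id)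

lemma tempered_apply: "tempered (apply_tdist u)"
  using apply_tdist by blast

lemma apply_not_schwartz: "\<not> schwartz \<phi> \<Longrightarrow> apply_tdist u \<phi> = 0"
  using tempered_apply[of u] unfolding tempered_def by blast

lemma apply_linear:
  "schwartz \<phi> \<Longrightarrow> schwartz \<psi> \<Longrightarrow>
    apply_tdist u (\<lambda>z. a * \<phi> z + b * \<psi> z) = a * apply_tdist u \<phi> + b * apply_tdist u \<psi>"
  using tempered_apply[of u] unfolding tempered_def by blast

lemma tdist_eqI: "(\<And>\<phi>. schwartz \<phi> \<Longrightarrow> apply_tdist u \<phi> = apply_tdist v \<phi>) \<Longrightarrow> u = v"
  by (metis apply_tdist_inject apply_not_schwartz ext)

lemma apply_tdist_of:
  assumes "tempered (\<lambda>\<phi>. if schwartz \<phi> then L \<phi> else 0)" "schwartz \<phi>"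
  shows "apply_tdist (tdist_of L) \<phi> = L \<phi>"
  using assms unfolding tdist_of_def by (simp add: Abs_tdist_inverse)

lemma tdist_of_eqI:
  assumes "\<And>\<phi>. schwartz \<phi> \<Longrightarrow> L \<phi> = apply_tdist u \<phi>"
  shows "tdist_of L = u"
proof -
  have "(\<lambda>\<phi>. if schwartz \<phi> then L \<phi> else 0) = apply_tdist u"
    using assms by (auto simp: apply_not_schwartz)
  then show ?thesis by (simp add: tdist_of_def apply_tdist_inverse)
qed

lemma apply_add: "apply_tdist (u + v) \<phi> = apply_tdist u \<phi> + apply_tdist v \<phi>"
  by transfer simp

lemma apply_scaleR: "apply_tdist (c *\<^sub>R u) \<phi> = c *\<^sub>R apply_tdist u \<phi>"
  by transfer simp

lemma apply_zero: "apply_tdist 0 \<phi> = 0"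
  by transfer simp

lemma apply_minus: "apply_tdist (u - v) \<phi> = apply_tdist u \<phi> - apply_tdist v \<phi>"
  unfolding minus_tdist_def uminus_tdist_def apply_add apply_scaleR by simp

lemma temperedI:
  assumes "\<And>\<phi> \<psi> a b. schwartz \<phi> \<Longrightarrow> schwartz \<psi> \<Longrightarrow> L (\<lambda>z. a * \<phi> z + b * \<psi> z) = a * L \<phi> + b * L \<psi>"
    and "\<And>\<phi> B. schwartz \<phi> \<Longrightarrow> (\<forall>j\<le>m. \<forall>k\<le>m. \<forall>l\<le>m. \<forall>z. norm z ^ l * cmod (pderivs j k \<phi> z) \<le> B) \<Longrightarrow> cmod (L \<phi>) \<le> C * B"
  shows "tempered (\<lambda>\<phi>. if schwartz \<phi> then L \<phi> else 0)"
  unfolding tempered_def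
proof (intro conjI exI[of _ C] exI[of _ m] allI impI)
  fix \<phi> B assume "schwartz \<phi>"
    "\<forall>j\<le>m. \<forall>k\<le>m. \<forall>l\<le>m. \<forall>z. norm z ^ l * cmod (pderivs j k \<phi> z) \<le> B"
  from assms(2)[OF this] show "cmod (if schwartz \<phi> then L \<phi> else 0) \<le> C * B"
    using \<open>schwartz \<phi>\<close> by simp
qed (simp_all add: assms(1) schwartz_add schwartz_cmult)

subsection \<open>Bounded densities\<close>

definition bounded_measurable :: "(plane \<Rightarrow> complex) \<Rightarrow> bool" where
  "bounded_measurable g \<longleftrightarrow> g \<in> borel_measurable borel \<and> (\<exists>C. \<forall>z. cmod (g z) \<le> C)"

lemma integrable_bounded_schwartz:
  assumes "bounded_measurable g" "integrable lborel \<phi>"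
  shows "integrable lborel (\<lambda>z. g z * \<phi> z)"
proof -
  obtain C where "\<And>z. cmod (g z) \<le> C" using assms(1) unfolding bounded_measurable_def by blast
  then show ?thesis
    using assms by (intro integrable_bounded_mult[where C = C]) (auto simp: bounded_measurable_def)
qed

lemma tempered_density:
  assumes g: "bounded_measurable g"
  shows "tempered (\<lambda>\<phi>. if schwartz \<phi> then LINT z|lborel. g z * \<phi> z else 0)"
proof -
  obtain C where C: "\<And>z. cmod (g z) \<le> C" using g unfolding bounded_measurable_def by blast
  have C0: "C \<ge> 0" using order_trans[OF norm_ge_zero C] by blast
  let ?W = "LINT z|lborel. inverse ((1 + (norm (z::plane))\<^sup>2)\<^sup>2)"
  show ?thesis
  proof (rule temperedI[where m = 4 and C = "C * (4 * ?W)"])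
    fix \<phi> \<psi> a b assume "schwartz \<phi>" "schwartz \<psi>"
    then have "integrable lborel (\<lambda>z. g z * \<phi> z)" "integrable lborel (\<lambda>z. g z * \<psi> z)"
      using g by (auto intro: integrable_bounded_schwartz schwartz_integrable)
    moreover have "(\<lambda>z. g z * (a * \<phi> z + b * \<psi> z)) = (\<lambda>z. a * (g z * \<phi> z) + b * (g z * \<psi> z))"
      by (auto simp: algebra_simps)
    ultimately show "(LINT z|lborel. g z * (a * \<phi> z + b * \<psi> z)) =
        a * (LINT z|lborel. g z * \<phi> z) + b * (LINT z|lborel. g z * \<psi> z)"
      by simp
  next
    fix \<phi> B assume s: "schwartz \<phi>"
      and B: "\<forall>j\<le>4. \<forall>k\<le>4. \<forall>l\<le>4. \<forall>z. norm z ^ l * cmod (pderivs j k \<phi> z) \<le> B"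
    have "norm z ^ l * cmod (\<phi> z) \<le> B" if "l \<le> 4" for l z
      using B[rule_format, of 0 0 l z] that by (simp add: pderivs_def)
    note dec = decay_of_bounds[OF this]
    have "cmod (LINT z|lborel. g z * \<phi> z) \<le> (LINT z::plane|lborel. C * (4 * B * inverse ((1 + (norm z)\<^sup>2)\<^sup>2)))"
    proof (rule Bochner_Integration.integral_norm_bound_integral)
      show "integrable lborel (\<lambda>z. g z * \<phi> z)"
        using g s by (auto intro: integrable_bounded_schwartz schwartz_integrable)
      show "integrable lborel (\<lambda>z::plane. C * (4 * B * inverse ((1 + (norm z)\<^sup>2)\<^sup>2)))"
        by (intro integrable_mult_right integrable_weight)
      show "norm (g z * \<phi> z) \<le> C * (4 * B * inverse ((1 + (norm z)\<^sup>2)\<^sup>2))" for z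
        unfolding norm_mult by (rule mult_mono[OF C dec C0]) auto
    qed
    then show "cmod (LINT z|lborel. g z * \<phi> z) \<le> C * (4 * ?W) * B"
      by (simp add: algebra_simps)
  qed
qed

definition density_dist :: "(plane \<Rightarrow> complex) \<Rightarrow> tdist" where
  "density_dist g = tdist_of (\<lambda>\<phi>. LINT z|lborel. g z * \<phi> z)"

lemma apply_density_dist:
  "bounded_measurable g \<Longrightarrow> schwartz \<phi> \<Longrightarrow> apply_tdist (density_dist g) \<phi> = (LINT z|lborel. g z * \<phi> z)"
  unfolding density_dist_def by (rule apply_tdist_of[OF tempered_density])

lemma has_density_density_dist: "bounded_measurable g \<Longrightarrow> has_density (density_dist g) g"
  unfolding has_density_def
  by (auto simp: apply_density_dist integrable_bounded_schwartz schwartz_integrable)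
    (simp add: bounded_measurable_def)

lemma AE_eq_if_schwartz_pairings_eq:
  assumes "f \<in> borel_measurable lborel" "g \<in> borel_measurable lborel"
    and "\<And>\<phi>. schwartz \<phi> \<Longrightarrow> integrable lborel (\<lambda>z. f z * \<phi> z)"
    and "\<And>\<phi>. schwartz \<phi> \<Longrightarrow> integrable lborel (\<lambda>z. g z * \<phi> z)"
    and "\<And>\<phi>. schwartz \<phi> \<Longrightarrow> (LINT z|lborel. f z * \<phi> z) = (LINT z|lborel. g z * \<phi> z)"
  shows "AE z in lborel. f z = g z"
proof -
  have "AE z in lborel. f z - g z = 0"
    by (rule AE_eq_0_if_schwartz_orthogonal)
      (use assms in \<open>auto simp: left_diff_distrib\<close>)
  then show ?thesis by simp
qed

lemma has_density_unique: "has_density u f \<Longrightarrow> has_density u g \<Longrightarrow> AE z in lborel. f z = g z"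
  by (rule AE_eq_if_schwartz_pairings_eq) (auto simp: has_density_def)

lemma has_fourier_unique: "has_fourier u f \<Longrightarrow> has_fourier u g \<Longrightarrow> AE z in lborel. f z = g z"
  unfolding has_fourier_def by (rule AE_eq_if_schwartz_pairings_eq) metis+

text \<open>Every Schwartz function is the transform of one, so the values on transforms determine
  the distribution.\<close>

lemma has_fourier_inj:
  assumes "has_fourier u f" "has_fourier v g" "AE z in lborel. f z = g z"
  shows "u = v"
proof (rule tdist_eqI)
  fix \<phi> assume "schwartz \<phi>"
  then obtain \<psi> where \<psi>: "schwartz \<psi>" "\<phi> = fourier \<psi>" using schwartz_fourier_surj by blast
  have "(LINT z|lborel. f z * \<psi> z) = (LINT z|lborel. g z * \<psi> z)"
    by (rule integral_cong_AE) (use assms \<psi> in \<open>auto simp: has_fourier_def schwartz_measurable\<close>)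
  then show "apply_tdist u \<phi> = apply_tdist v \<phi>"
    using assms \<psi> by (simp add: has_fourier_def)
qed

lemma has_fourier_add:
  "has_fourier u f \<Longrightarrow> has_fourier v g \<Longrightarrow> has_fourier (u + v) (\<lambda>z. f z + g z)"
  by (auto simp: has_fourier_def apply_add distrib_right)

lemma has_fourier_scaleR:
  "has_fourier u f \<Longrightarrow> has_fourier (c *\<^sub>R u) (\<lambda>z. complex_of_real c * f z)"
  by (auto simp: has_fourier_def apply_scaleR mult.assoc scaleR_conv_of_real)

lemma has_fourier_minus:
  "has_fourier u f \<Longrightarrow> has_fourier v g \<Longrightarrow> has_fourier (u - v) (\<lambda>z. f z - g z)"
  by (auto simp: has_fourier_def apply_minus left_diff_distrib)

lemma has_fourier_zero: "has_fourier 0 (\<lambda>z. 0)"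
  by (simp add: has_fourier_def apply_zero)

lemma sobolev_norm_eq:
  assumes "has_fourier u f"
  shows "sobolev_norm s u = sqrt (LINT \<zeta>|lborel. (1 + (norm \<zeta>)\<^sup>2) powr s * (cmod (f \<zeta>))\<^sup>2)"
proof -
  define g where "g = (SOME f. has_fourier u f)"
  have g: "has_fourier u g" unfolding g_def by (rule someI[of "has_fourier u", OF assms])
  have "AE z in lborel. f z = g z" by (rule has_fourier_unique[OF assms g])
  then have "(LINT \<zeta>|lborel. (1 + (norm \<zeta>)\<^sup>2) powr s * (cmod (f \<zeta>))\<^sup>2) =
    (LINT \<zeta>|lborel. (1 + (norm \<zeta>)\<^sup>2) powr s * (cmod (g \<zeta>))\<^sup>2)"
    using assms g by (intro integral_cong_AE) (auto simp: has_fourier_def)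
  then show ?thesis unfolding sobolev_norm_def Let_def g_def[symmetric] by simp
qed

lemma sobolev_integrable:
  assumes "has_fourier u f" "u \<in> sobolev s"
  shows "integrable lborel (\<lambda>\<zeta>. (1 + (norm \<zeta>)\<^sup>2) powr s * (cmod (f \<zeta>))\<^sup>2)"
proof -
  obtain g where g: "has_fourier u g" "integrable lborel (\<lambda>\<zeta>. (1 + (norm \<zeta>)\<^sup>2) powr s * (cmod (g \<zeta>))\<^sup>2)"
    using assms(2) unfolding sobolev_def by blast
  have "AE z in lborel. g z = f z" by (rule has_fourier_unique[OF g(1) assms(1)])
  then have "AE \<zeta> in lborel. (1 + (norm \<zeta>)\<^sup>2) powr s * (cmod (g \<zeta>))\<^sup>2 = (1 + (norm \<zeta>)\<^sup>2) powr s * (cmod (f \<zeta>))\<^sup>2"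
    by eventually_elim simp
  then show ?thesis
    using g assms(1) by (subst integrable_cong_AE[symmetric]) (auto simp: has_fourier_def)
qed

subsection \<open>Distributions with integrable Fourier transform\<close>

lemma ifourier_bound:
  assumes "integrable lborel f"
  shows "cmod (ifourier f z) \<le> (LINT z|lborel. cmod (f z)) / (2 * pi)"
  unfolding ifourier_eq_fourier by (rule fourier_bound[OF assms])

lemma ifourier_measurable:
  assumes [measurable]: "f \<in> borel_measurable borel" shows "ifourier f \<in> borel_measurable borel"
proof -
  have "(\<lambda>p::plane\<times>plane. fst p \<bullet> snd p) \<in> borel_measurable borel"
    by (intro borel_measurable_continuous_onI continuous_intros)
  then have "(\<lambda>p::plane\<times>plane. fst p \<bullet> snd p) \<in> borel_measurable (borel \<Otimes>\<^sub>M lborel)"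
    by (simp add: borel_prod cong: measurable_cong_sets sets_pair_measure_cong)
  then have [measurable]: "(\<lambda>(z, \<zeta>). cis (z \<bullet> \<zeta>) * f \<zeta>) \<in> borel_measurable (borel \<Otimes>\<^sub>M lborel)"
    by (simp add: case_prod_beta')
  show ?thesis
    unfolding ifourier_def[abs_def]
    by (intro borel_measurable_divide lborel.borel_measurable_lebesgue_integral) measurable
qed

lemma bounded_measurable_ifourier: "integrable lborel f \<Longrightarrow> bounded_measurable (ifourier f)"
  unfolding bounded_measurable_def using ifourier_bound ifourier_measurable[of f]
  by (auto dest: borel_measurable_integrable)

text \<open>Fubini for the kernel \<open>cis (z \<bullet> \<zeta>)\<close>, which is symmetric in
  its two variables.\<close>

lemma ifourier_duality:
  assumes f: "integrable lborel f" and g: "integrable lborel g"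
  shows "(LINT z|lborel. ifourier f z * g z) = (LINT \<zeta>|lborel. f \<zeta> * ifourier g \<zeta>)"
proof -
  let ?K = "\<lambda>z \<zeta>. cis (z \<bullet> \<zeta>) * (g z * f \<zeta>)"
  have "integrable lborel (\<lambda>p. ?K (fst p) (snd p))"
  proof (rule integrable_cis_mult[OF integrable_tensor[OF g f]])
    have "(\<lambda>p::plane \<times> plane. fst p \<bullet> snd p) \<in> borel_measurable borel"
      by (intro borel_measurable_continuous_onI continuous_intros)
    then show "(\<lambda>p::plane \<times> plane. fst p \<bullet> snd p) \<in> borel_measurable lborel" by simp
  qed
  then have ip: "integrable (lborel \<Otimes>\<^sub>M lborel) (case_prod ?K)"
    by (simp add: lborel_prod case_prod_beta')
  have 1: "(LINT \<zeta>|lborel. ?K z \<zeta>) = complex_of_real (2 * pi) * (ifourier f z * g z)" for z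
  proof -
    have "(\<lambda>\<zeta>. ?K z \<zeta>) = (\<lambda>\<zeta>. g z * (cis (z \<bullet> \<zeta>) * f \<zeta>))" by (auto simp: algebra_simps)
    then show ?thesis by (simp only: integral_mult_right_zero) (simp add: ifourier_def)
  qed
  have 2: "(LINT z|lborel. ?K z \<zeta>) = complex_of_real (2 * pi) * (f \<zeta> * ifourier g \<zeta>)" for \<zeta>
  proof -
    have "(\<lambda>z. ?K z \<zeta>) = (\<lambda>z. f \<zeta> * (cis (\<zeta> \<bullet> z) * g z))" by (auto simp: algebra_simps inner_commute)
    then show ?thesis by (simp only: integral_mult_right_zero) (simp add: ifourier_def)
  qed
  have "complex_of_real (2 * pi) * (LINT z|lborel. ifourier f z * g z) =
      complex_of_real (2 * pi) * (LINT \<zeta>|lborel. f \<zeta> * ifourier g \<zeta>)"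
    using lborel_pair.Fubini_integral[OF ip] unfolding 1 2 integral_mult_right_zero by (rule sym)
  then show ?thesis by simp
qed

text \<open>The distribution with integrable transform \<open>f\<close>. It is a bounded function,
  so its square is pointwise; every element of \<open>H^2\<close> is of this kind.\<close>

definition fdist :: "(plane \<Rightarrow> complex) \<Rightarrow> tdist" where
  "fdist f = density_dist (ifourier f)"

lemma schwartz_bounded_measurable: "schwartz \<phi> \<Longrightarrow> bounded_measurable \<phi>"
  unfolding bounded_measurable_def using schwartz_bound[of \<phi> 0] by (auto simp: schwartz_measurable)

lemma has_fourier_fdist:
  assumes f: "integrable lborel f" shows "has_fourier (fdist f) f"
  unfolding has_fourier_def
proof (intro conjI allI impI)
  fix \<phi> assume s: "schwartz \<phi>"
  show "integrable lborel (\<lambda>\<zeta>. f \<zeta> * \<phi> \<zeta>)"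
    using integrable_bounded_schwartz[OF schwartz_bounded_measurable[OF s] f] by (simp add: mult.commute)
  show "apply_tdist (fdist f) (fourier \<phi>) = (LINT \<zeta>|lborel. f \<zeta> * \<phi> \<zeta>)"
    unfolding fdist_def
    by (simp add: apply_density_dist[OF bounded_measurable_ifourier[OF f] schwartz_fourier[OF s]]
        ifourier_duality[OF f schwartz_integrable[OF schwartz_fourier[OF s]]] ifourier_fourier[OF s])
qed (use f in auto)

lemma eq_fdist: "has_fourier u f \<Longrightarrow> integrable lborel f \<Longrightarrow> u = fdist f"
  by (rule has_fourier_inj[OF _ has_fourier_fdist]) auto

subsection \<open>Derivatives\<close>

lemma pderivs_pd:
  assumes "schwartz \<phi>"
  shows "pderivs j k (pdx \<phi>) = pderivs (Suc j) k \<phi>" "pderivs j k (pdy \<phi>) = pderivs j (Suc k) \<phi>"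
proof -
  have s: "schwartz ((pdy ^^ k) \<phi>)" for k
    by (induction k) (auto simp: assms schwartz_pdy)
  have c: "(pdy ^^ k) (pdx \<phi>) = pdx ((pdy ^^ k) \<phi>)" for k
    by (induction k) (auto simp: schwartz_pdy_pdx s)
  show "pderivs j k (pdx \<phi>) = pderivs (Suc j) k \<phi>"
    unfolding pderivs_def c by (simp add: funpow_swap1)
  show "pderivs j k (pdy \<phi>) = pderivs j (Suc k) \<phi>"
    unfolding pderivs_def by (simp add: funpow_swap1)
qed

text \<open>A derivative shifts the indices of \<open>pderivs\<close> by at most one, so the
  seminorms up to \<open>Suc m\<close> of a test function control those up to \<open>m\<close> of
  its derivative. The operator \<open>P\<close> is abstract in order to serve both coordinate
  directions.\<close>

lemma tempered_derivative:
  assumes s: "\<And>\<phi>. schwartz \<phi> \<Longrightarrow> schwartz (P \<phi>)"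
    and lin: "\<And>\<phi> \<psi> a b. schwartz \<phi> \<Longrightarrow> schwartz \<psi> \<Longrightarrow> P (\<lambda>z. a * \<phi> z + b * \<psi> z) = (\<lambda>z. a * P \<phi> z + b * P \<psi> z)"
    and pd: "\<And>\<phi> j k. schwartz \<phi> \<Longrightarrow> \<exists>j'\<le>Suc j. \<exists>k'\<le>Suc k. pderivs j k (P \<phi>) = pderivs j' k' \<phi>"
  shows "tempered (\<lambda>\<phi>. if schwartz \<phi> then - apply_tdist u (P \<phi>) else 0)"
proof -
  obtain C m where C: "\<And>\<phi> B. schwartz \<phi> \<Longrightarrow>
        (\<forall>j\<le>m. \<forall>k\<le>m. \<forall>l\<le>m. \<forall>z. norm z ^ l * cmod (pderivs j k \<phi> z) \<le> B) \<Longrightarrow>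
        cmod (apply_tdist u \<phi>) \<le> C * B"
    using tempered_apply[of u] unfolding tempered_def by metis
  show ?thesis
  proof (rule temperedI[where m = "Suc m" and C = C])
    fix \<phi> \<psi> a b assume "schwartz \<phi>" "schwartz \<psi>"
    then show "- apply_tdist u (P (\<lambda>z. a * \<phi> z + b * \<psi> z)) = a * - apply_tdist u (P \<phi>) + b * - apply_tdist u (P \<psi>)"
      by (simp add: lin apply_linear s)
  next
    fix \<phi> B assume \<phi>: "schwartz \<phi>"
      and B: "\<forall>j\<le>Suc m. \<forall>k\<le>Suc m. \<forall>l\<le>Suc m. \<forall>z. norm z ^ l * cmod (pderivs j k \<phi> z) \<le> B"
    have "norm z ^ l * cmod (pderivs j k (P \<phi>) z) \<le> B" if "j \<le> m" "k \<le> m" "l \<le> m" for j k l z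
    proof -
      obtain j' k' where "j' \<le> Suc j" "k' \<le> Suc k" "pderivs j k (P \<phi>) = pderivs j' k' \<phi>"
        using pd[OF \<phi>] by blast
      then show ?thesis using B[rule_format, of j' k' l z] that by simp
    qed
    then show "cmod (- apply_tdist u (P \<phi>)) \<le> C * B"
      using C[OF s[OF \<phi>], of B] by simp
  qed
qed

lemma apply_dist_dx: "schwartz \<phi> \<Longrightarrow> apply_tdist (dist_dx u) \<phi> = - apply_tdist u (pdx \<phi>)"
  unfolding dist_dx_def
proof (rule apply_tdist_of, rule tempered_derivative)
  show "pdx (\<lambda>z. a * \<phi> z + b * \<psi> z) = (\<lambda>z. a * pdx \<phi> z + b * pdx \<psi> z)"
    if "schwartz \<phi>" "schwartz \<psi>" for \<phi> \<psi> a b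
    using that by (auto simp: pd_add pd_cmult schwartz_differentiable schwartz_cmult fun_eq_iff)
  show "\<exists>j'\<le>Suc j. \<exists>k'\<le>Suc k. pderivs j k (pdx \<psi>) = pderivs j' k' \<psi>" if "schwartz \<psi>" for \<psi> j k
    unfolding pderivs_pd[OF that] using le_Suc_eq by blast
qed (auto simp: schwartz_pdx)

lemma apply_dist_dy: "schwartz \<phi> \<Longrightarrow> apply_tdist (dist_dy u) \<phi> = - apply_tdist u (pdy \<phi>)"
  unfolding dist_dy_def
proof (rule apply_tdist_of, rule tempered_derivative)
  show "pdy (\<lambda>z. a * \<phi> z + b * \<psi> z) = (\<lambda>z. a * pdy \<phi> z + b * pdy \<psi> z)"
    if "schwartz \<phi>" "schwartz \<psi>" for \<phi> \<psi> a b
    using that by (auto simp: pd_add pd_cmult schwartz_differentiable schwartz_cmult fun_eq_iff)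
  show "\<exists>j'\<le>Suc j. \<exists>k'\<le>Suc k. pderivs j k (pdy \<psi>) = pderivs j' k' \<psi>" if "schwartz \<psi>" for \<psi> j k
    unfolding pderivs_pd[OF that] using le_Suc_eq by blast
qed (auto simp: schwartz_pdy)

lemma has_fourier_dist_dx:
  assumes f: "has_fourier u f"
  shows "has_fourier (dist_dx u) (\<lambda>\<zeta>. \<i> * complex_of_real (fst \<zeta>) * f \<zeta>)"
  unfolding has_fourier_def
proof (intro conjI allI impI)
  have [measurable]: "f \<in> borel_measurable borel" using f by (simp add: has_fourier_def)
  show "(\<lambda>\<zeta>. \<i> * complex_of_real (fst \<zeta>) * f \<zeta>) \<in> borel_measurable lborel"
    by simp
  fix \<phi> assume s: "schwartz \<phi>"
  have e: "(\<lambda>\<zeta>. \<i> * complex_of_real (fst \<zeta>) * f \<zeta> * \<phi> \<zeta>) = (\<lambda>\<zeta>. - (f \<zeta> * mul_x \<phi> \<zeta>))"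
    by (auto simp: mul_x_def)
  show "integrable lborel (\<lambda>\<zeta>. \<i> * complex_of_real (fst \<zeta>) * f \<zeta> * \<phi> \<zeta>)"
    unfolding e using f schwartz_mul_x[OF s] by (auto simp: has_fourier_def)
  show "apply_tdist (dist_dx u) (fourier \<phi>) = (LINT \<zeta>|lborel. \<i> * complex_of_real (fst \<zeta>) * f \<zeta> * \<phi> \<zeta>)"
    unfolding e using f schwartz_mul_x[OF s]
    by (simp add: has_fourier_def apply_dist_dx schwartz_fourier s pd_fourier)
qed

lemma has_fourier_dist_dy:
  assumes f: "has_fourier u f"
  shows "has_fourier (dist_dy u) (\<lambda>\<zeta>. \<i> * complex_of_real (snd \<zeta>) * f \<zeta>)"
  unfolding has_fourier_def
proof (intro conjI allI impI)
  have [measurable]: "f \<in> borel_measurable borel" using f by (simp add: has_fourier_def)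
  show "(\<lambda>\<zeta>. \<i> * complex_of_real (snd \<zeta>) * f \<zeta>) \<in> borel_measurable lborel"
    by simp
  fix \<phi> assume s: "schwartz \<phi>"
  have e: "(\<lambda>\<zeta>. \<i> * complex_of_real (snd \<zeta>) * f \<zeta> * \<phi> \<zeta>) = (\<lambda>\<zeta>. - (f \<zeta> * mul_y \<phi> \<zeta>))"
    by (auto simp: mul_y_def)
  show "integrable lborel (\<lambda>\<zeta>. \<i> * complex_of_real (snd \<zeta>) * f \<zeta> * \<phi> \<zeta>)"
    unfolding e using f schwartz_mul_y[OF s] by (auto simp: has_fourier_def)
  show "apply_tdist (dist_dy u) (fourier \<phi>) = (LINT \<zeta>|lborel. \<i> * complex_of_real (snd \<zeta>) * f \<zeta> * \<phi> \<zeta>)"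
    unfolding e using f schwartz_mul_y[OF s]
    by (simp add: has_fourier_def apply_dist_dy schwartz_fourier s pd_fourier)
qed

definition grad_symbol :: "plane \<Rightarrow> complex" where
  "grad_symbol \<zeta> = \<i> * complex_of_real (fst \<zeta> + snd \<zeta>)"

lemma has_fourier_grad:
  assumes "has_fourier u f"
  shows "has_fourier (dist_dx u + dist_dy u) (\<lambda>\<zeta>. grad_symbol \<zeta> * f \<zeta>)"
  using has_fourier_add[OF has_fourier_dist_dx[OF assms] has_fourier_dist_dy[OF assms]]
  by (simp add: grad_symbol_def algebra_simps)

subsection \<open>Products\<close>

text \<open>The factor \<open>1 / (2 * pi)\<close> belongs to the unitary normalisation of
  \<open>fourier\<close> in two dimensions: with it a product of functions corresponds exactly to
  \<open>conv\<close> of their transforms.\<close>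

definition conv :: "(plane \<Rightarrow> complex) \<Rightarrow> (plane \<Rightarrow> complex) \<Rightarrow> plane \<Rightarrow> complex" where
  "conv f g \<zeta> = (LINT w|lborel. f w * g (\<zeta> - w)) / complex_of_real (2 * pi)"

lemma integrable_conv_kernel:
  fixes f g :: "plane \<Rightarrow> 'c::{banach, second_countable_topology, real_normed_field}"
  assumes f: "integrable lborel f" and g: "integrable lborel g"
  shows "integrable (lborel \<Otimes>\<^sub>M lborel) (\<lambda>(w, \<zeta>). f w * g (\<zeta> - w))"
proof (rule lborel_pair.Fubini_integrable)
  have [measurable]: "f \<in> borel_measurable borel" "g \<in> borel_measurable borel"
    using f g by auto
  show "(\<lambda>(w, \<zeta>). f w * g (\<zeta> - w)) \<in> borel_measurable (lborel \<Otimes>\<^sub>M lborel)" by measurable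
  have sh: "integrable lborel (\<lambda>\<zeta>. g (\<zeta> - w))" for w
    using lborel_integrable_affine[of 1 g "- w"] g by (simp add: algebra_simps)
  have "(LINT \<zeta>|lborel. norm (g (\<zeta> - w))) = (LINT \<zeta>|lborel. norm (g \<zeta>))" for w
    using lborel_integral_affine[of 1 "\<lambda>\<zeta>. norm (g \<zeta>)" "- w"] by (simp add: algebra_simps)
  then show "integrable lborel (\<lambda>w. LINT \<zeta>|lborel. norm (case (w, \<zeta>) of (w, \<zeta>) \<Rightarrow> f w * g (\<zeta> - w)))"
    using f by (simp add: norm_mult)
  show "AE w in lborel. integrable lborel (\<lambda>\<zeta>. case (w, \<zeta>) of (w, \<zeta>) \<Rightarrow> f w * g (\<zeta> - w))"
    using sh by simp
qed

lemma integrable_conv: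
  assumes "integrable lborel f" "integrable lborel g" shows "integrable lborel (conv f g)"
  unfolding conv_def[abs_def]
  by (intro integrable_divide_zero lborel_pair.integrable_snd[OF integrable_conv_kernel[OF assms]])

lemma conv_L1_bound:
  assumes "integrable lborel f" "integrable lborel g"
  shows "(LINT \<zeta>|lborel. cmod (conv f g \<zeta>)) \<le> (LINT \<zeta>|lborel. cmod (f \<zeta>)) * (LINT \<zeta>|lborel. cmod (g \<zeta>)) / (2 * pi)"
proof -
  have n: "integrable lborel (\<lambda>\<zeta>. cmod (f \<zeta>))" "integrable lborel (\<lambda>\<zeta>. cmod (g \<zeta>))" using assms by auto
  note k = integrable_conv_kernel[OF n]
  have [measurable]: "g \<in> borel_measurable borel" using assms by auto
  have "(LINT \<zeta>|lborel. cmod (conv f g \<zeta>)) \<le> (LINT \<zeta>|lborel. (LINT w|lborel. cmod (f w) * cmod (g (\<zeta> - w))) / (2 * pi))"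
  proof (rule integral_mono)
    show "integrable lborel (\<lambda>\<zeta>. cmod (conv f g \<zeta>))" using integrable_conv[OF assms] by auto
    show "integrable lborel (\<lambda>\<zeta>. (LINT w|lborel. cmod (f w) * cmod (g (\<zeta> - w))) / (2 * pi))"
      by (intro integrable_divide_zero lborel_pair.integrable_snd[OF k])
    show "cmod (conv f g \<zeta>) \<le> (LINT w|lborel. cmod (f w) * cmod (g (\<zeta> - w))) / (2 * pi)" for \<zeta>
      using integral_norm_bound[of lborel "\<lambda>w. f w * g (\<zeta> - w)"]
      by (simp add: conv_def norm_divide norm_mult divide_right_mono)
  qed
  also have "\<dots> = (LINT \<zeta>|lborel. LINT w|lborel. cmod (f w) * cmod (g (\<zeta> - w))) / (2 * pi)" by simp
  also have "(LINT \<zeta>|lborel. LINT w|lborel. cmod (f w) * cmod (g (\<zeta> - w))) = (LINT w|lborel. LINT \<zeta>|lborel. cmod (f w) * cmod (g (\<zeta> - w)))"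
    by (rule lborel_pair.Fubini_integral[OF k])
  also have "\<dots> = (LINT w|lborel. cmod (f w) * (LINT \<zeta>|lborel. cmod (g \<zeta>)))"
  proof (rule Bochner_Integration.integral_cong[OF refl])
    fix w
    show "(LINT \<zeta>|lborel. cmod (f w) * cmod (g (\<zeta> - w))) = cmod (f w) * (LINT \<zeta>|lborel. cmod (g \<zeta>))"
      using lborel_integral_affine[of 1 "\<lambda>\<zeta>. cmod (g \<zeta>)" "- w"] by (simp add: algebra_simps)
  qed
  finally show ?thesis by simp
qed

lemma ifourier_conv:
  assumes f: "integrable lborel f" and g: "integrable lborel g"
  shows "ifourier (conv f g) z = ifourier f z * ifourier g z"
proof -
  have [measurable]: "f \<in> borel_measurable borel" "g \<in> borel_measurable borel" using f g by auto
  let ?f = "\<lambda>\<zeta>. cis (z \<bullet> \<zeta>) * f \<zeta>" and ?g = "\<lambda>\<zeta>. cis (z \<bullet> \<zeta>) * g \<zeta>"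
  have i: "integrable lborel ?f" "integrable lborel ?g"
    using f g by (auto intro!: integrable_cis_mult)
  have "cis (z \<bullet> \<zeta>) * conv f g \<zeta> = conv ?f ?g \<zeta>" for \<zeta>
  proof -
    have "(\<lambda>w. ?f w * ?g (\<zeta> - w)) = (\<lambda>w. cis (z \<bullet> \<zeta>) * (f w * g (\<zeta> - w)))"
    proof
      fix w
      have "cis (z \<bullet> \<zeta>) = cis (z \<bullet> w) * cis (z \<bullet> (\<zeta> - w))" by (simp add: cis_mult inner_diff_right)
      then show "?f w * ?g (\<zeta> - w) = cis (z \<bullet> \<zeta>) * (f w * g (\<zeta> - w))" by simp
    qed
    then show ?thesis unfolding conv_def by simp
  qed
  then have "complex_of_real (2 * pi) * ifourier (conv f g) z = (LINT \<zeta>|lborel. conv ?f ?g \<zeta>)"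
    by (simp add: ifourier_def)
  also have "\<dots> = (LINT \<zeta>|lborel. LINT w|lborel. ?f w * ?g (\<zeta> - w)) / complex_of_real (2 * pi)"
    by (simp add: conv_def)
  also have "(LINT \<zeta>|lborel. LINT w|lborel. ?f w * ?g (\<zeta> - w)) = (LINT w|lborel. LINT \<zeta>|lborel. ?f w * ?g (\<zeta> - w))"
    by (rule lborel_pair.Fubini_integral[OF integrable_conv_kernel[OF i]])
  also have "(\<lambda>w. LINT \<zeta>|lborel. ?f w * ?g (\<zeta> - w)) = (\<lambda>w. ?f w * (LINT \<zeta>|lborel. ?g \<zeta>))"
  proof
    fix w
    have "(LINT \<zeta>|lborel. ?g (\<zeta> - w)) = (LINT \<zeta>|lborel. ?g \<zeta>)"
      using lborel_integral_affine[of 1 ?g "- w"] by (simp add: algebra_simps)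
    then show "(LINT \<zeta>|lborel. ?f w * ?g (\<zeta> - w)) = ?f w * (LINT \<zeta>|lborel. ?g \<zeta>)"
      by (simp only: integral_mult_right_zero)
  qed
  also have "(LINT w|lborel. ?f w * (LINT \<zeta>|lborel. ?g \<zeta>)) = (LINT w|lborel. ?f w) * (LINT \<zeta>|lborel. ?g \<zeta>)"
    by (rule integral_mult_left_zero)
  finally show ?thesis by (simp add: ifourier_def field_simps power2_eq_square)
qed

text \<open>The density picked by \<open>SOME\<close> agrees with \<open>ifourier f\<close> only
  almost everywhere, which is enough under the integral.\<close>

lemma dist_square_fdist:
  assumes f: "integrable lborel f" shows "dist_square (fdist f) = fdist (conv f f)"
proof -
  define g where "g = (SOME g. has_density (fdist f) g)"
  have d: "has_density (fdist f) (ifourier f)"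
    unfolding fdist_def by (intro has_density_density_dist bounded_measurable_ifourier f)
  then have g: "has_density (fdist f) g" unfolding g_def by (rule someI[of "has_density (fdist f)"])
  have ae: "AE z in lborel. g z = ifourier f z" by (rule has_density_unique[OF g d])
  have "dist_square (fdist f) = tdist_of (\<lambda>\<phi>. LINT z|lborel. (g z)\<^sup>2 * \<phi> z)"
    by (simp add: dist_square_def g_def)
  also have "\<dots> = fdist (conv f f)"
  proof (rule tdist_of_eqI)
    fix \<phi> assume s: "schwartz \<phi>"
    have [measurable]: "g \<in> borel_measurable borel" "ifourier f \<in> borel_measurable borel" "\<phi> \<in> borel_measurable borel"
      using g d s by (auto simp: has_density_def schwartz_measurable)
    have "(LINT z|lborel. (g z)\<^sup>2 * \<phi> z) = (LINT z|lborel. ifourier (conv f f) z * \<phi> z)"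
      unfolding ifourier_conv[OF f f]
    proof (rule integral_cong_AE)
      show "AE z in lborel. (g z)\<^sup>2 * \<phi> z = ifourier f z * ifourier f z * \<phi> z"
        using ae by eventually_elim (simp add: power2_eq_square)
    qed measurable
    then show "(LINT z|lborel. (g z)\<^sup>2 * \<phi> z) = apply_tdist (fdist (conv f f)) \<phi>"
      by (simp add: fdist_def apply_density_dist[OF bounded_measurable_ifourier[OF integrable_conv[OF f f]] s])
  qed
  finally show ?thesis .
qed

subsection \<open>The propagator and the Duhamel term\<close>

definition airy :: "plane \<Rightarrow> real" where
  "airy \<zeta> = fst \<zeta> ^ 3 + snd \<zeta> ^ 3"

lemma airy_measurable [measurable]: "airy \<in> borel_measurable borel"
  unfolding airy_def[abs_def] by measurable

lemma grad_symbol_measurable [measurable]: "grad_symbol \<in> borel_measurable borel"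
  unfolding grad_symbol_def[abs_def] by measurable

text \<open>\<open>propagator\<close> is a definite description over an unspecified representative
  \<open>f\<close>; it is well defined because representatives agree almost everywhere.\<close>

lemma propagator_eq:
  assumes u: "has_fourier u f" and w: "has_fourier w (\<lambda>\<zeta>. cis (t * airy \<zeta>) * f \<zeta>)"
  shows "propagator t u = w"
  unfolding propagator_def
proof (rule the_equality)
  show "\<exists>f. has_fourier u f \<and> has_fourier w (\<lambda>(\<xi>, \<eta>). cis (t * (\<xi> ^ 3 + \<eta> ^ 3)) * f (\<xi>, \<eta>))"
    using u w by (auto simp: airy_def case_prod_beta')
  fix v assume "\<exists>f. has_fourier u f \<and> has_fourier v (\<lambda>(\<xi>, \<eta>). cis (t * (\<xi> ^ 3 + \<eta> ^ 3)) * f (\<xi>, \<eta>))"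
  then obtain g where g: "has_fourier u g" "has_fourier v (\<lambda>\<zeta>. cis (t * airy \<zeta>) * g \<zeta>)"
    by (auto simp: airy_def case_prod_beta')
  have "AE z in lborel. g z = f z" by (rule has_fourier_unique[OF g(1) u])
  then show "v = w"
    by (intro has_fourier_inj[OF g(2) w]) auto
qed

lemma integrable_cis_airy:
  assumes "integrable lborel f" shows "integrable lborel (\<lambda>\<zeta>. cis (t * airy \<zeta>) * f \<zeta>)"
  by (rule integrable_cis_mult[OF assms]) measurable

lemma propagator_fdist:
  assumes "has_fourier u f" "integrable lborel f"
  shows "has_fourier (propagator t u) (\<lambda>\<zeta>. cis (t * airy \<zeta>) * f \<zeta>)"
  using propagator_eq[OF assms(1) has_fourier_fdist[OF integrable_cis_airy[OF assms(2)]]]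
    has_fourier_fdist[OF integrable_cis_airy[OF assms(2)]] by simp

text \<open>The factor \<open>grad_symbol\<close> can destroy integrability, so the propagated
  distribution is not of the form \<open>fdist\<close>. It is found in the other order: propagate
  \<open>Q\<close>, which stays integrable, and differentiate afterwards.\<close>

lemma has_fourier_propagator_grad:
  assumes "integrable lborel Q"
  shows "has_fourier (propagator t (dist_dx (fdist Q) + dist_dy (fdist Q)))
    (\<lambda>\<zeta>. grad_symbol \<zeta> * (cis (t * airy \<zeta>) * Q \<zeta>))"
proof -
  note 1 = has_fourier_grad[OF has_fourier_fdist[OF assms]]
  note 2 = has_fourier_grad[OF has_fourier_fdist[OF integrable_cis_airy[OF assms, of t]]]
  from 2 show ?thesis
    by (subst propagator_eq[OF 1]) (auto simp: mult.left_commute)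
qed

text \<open>The Duhamel integral at a single frequency. Derivative and constant stay outside, so
  that bounds on \<open>Q\<close> carry over directly.\<close>

definition retarded :: "(real \<Rightarrow> plane \<Rightarrow> complex) \<Rightarrow> real \<Rightarrow> plane \<Rightarrow> complex" where
  "retarded Q t \<zeta> = (LINT t'|lborel. indicator {0..t} t' * (cis ((t - t') * airy \<zeta>) * Q t' \<zeta>))"

text \<open>\<open>duhamel_term\<close> pairs first and integrates in time afterwards, whereas a
  formula for the transform needs the opposite order. The \<open>L^1\<close> bound on
  \<open>Q\<close>, uniform in time, makes the kernel integrable over time and frequency together,
  and Fubini exchanges the two.\<close>

lemma has_fourier_duhamel:
  assumes u: "\<And>t'. t' \<in> {0..t} \<Longrightarrow> has_fourier (u t') (f t')"
    and f: "\<And>t'. t' \<in> {0..t} \<Longrightarrow> integrable lborel (f t')"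
    and Q: "\<And>t'. t' \<in> {0..t} \<Longrightarrow> Q t' = conv (f t') (f t')"
    and Qm: "case_prod Q \<in> borel_measurable (lborel \<Otimes>\<^sub>M lborel)"
    and Qb: "\<And>t'. t' \<in> {0..t} \<Longrightarrow> (LINT \<zeta>|lborel. cmod (Q t' \<zeta>)) \<le> C"
  shows "has_fourier (duhamel_term u t)
    (\<lambda>\<zeta>. complex_of_real (4 powr (- 1 / 3)) * (grad_symbol \<zeta> * retarded Q t \<zeta>))"
proof -
  let ?c = "4 powr (- 1 / 3) :: real"
  note [measurable] = Qm
  have Qi: "integrable lborel (Q t')" if "t' \<in> {0..t}" for t'
    using integrable_conv[OF f f] Q that by simp
  have mm: "(\<lambda>(t', \<zeta>). indicator {0..t} t' * (cis ((t - t') * airy \<zeta>) * Q t' \<zeta>)) \<in> borel_measurable (lborel \<Otimes>\<^sub>M lborel)"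
  proof -
    have "(\<lambda>p. Q (fst p) (snd p)) \<in> borel_measurable (lborel \<Otimes>\<^sub>M lborel)"
      using Qm by (simp add: case_prod_beta')
    then show ?thesis unfolding case_prod_beta' by measurable
  qed
  have ik: "integrable (lborel \<Otimes>\<^sub>M lborel) (\<lambda>(t', \<zeta>). g \<zeta> * (indicator {0..t} t' * (cis ((t - t') * airy \<zeta>) * Q t' \<zeta>)))"
    if g: "bounded_measurable g" for g
  proof (rule lborel_pair.Fubini_integrable)
    have [measurable]: "g \<in> borel_measurable borel" using g by (simp add: bounded_measurable_def)
    obtain D where D: "\<And>z. cmod (g z) \<le> D" using g by (auto simp: bounded_measurable_def)
    show m: "(\<lambda>(t', \<zeta>). g \<zeta> * (indicator {0..t} t' * (cis ((t - t') * airy \<zeta>) * Q t' \<zeta>))) \<in> borel_measurable (lborel \<Otimes>\<^sub>M lborel)"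
      using mm unfolding case_prod_beta' by measurable
    have i1: "integrable lborel (\<lambda>\<zeta>. g \<zeta> * (indicator {0..t} t' * (cis ((t - t') * airy \<zeta>) * Q t' \<zeta>)))" for t'
      using Qi[of t'] integrable_bounded_schwartz[OF g integrable_cis_airy[OF Qi[of t'], of "t - t'"]]
      by (auto simp: indicator_def)
    then show "AE t' in lborel. integrable lborel (\<lambda>\<zeta>. case (t', \<zeta>) of (t', \<zeta>) \<Rightarrow> g \<zeta> * (indicator {0..t} t' * (cis ((t - t') * airy \<zeta>) * Q t' \<zeta>)))"
      by simp
    show "integrable lborel (\<lambda>t'. LINT \<zeta>|lborel. norm (case (t', \<zeta>) of (t', \<zeta>) \<Rightarrow> g \<zeta> * (indicator {0..t} t' * (cis ((t - t') * airy \<zeta>) * Q t' \<zeta>))))"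
    proof (rule Bochner_Integration.integrable_bound)
      show "integrable lborel (\<lambda>t'. indicator {0..t} t' * (D * C) :: real)"
        by (intro integrable_mult_left) (auto intro!: integrable_real_indicator simp: emeasure_lborel_Icc_eq)
      show "(\<lambda>t'. LINT \<zeta>|lborel. norm (case (t', \<zeta>) of (t', \<zeta>) \<Rightarrow> g \<zeta> * (indicator {0..t} t' * (cis ((t - t') * airy \<zeta>) * Q t' \<zeta>)))) \<in> borel_measurable lborel"
        using m by measurable
      have "(LINT \<zeta>|lborel. norm (g \<zeta> * (indicator {0..t} t' * (cis ((t - t') * airy \<zeta>) * Q t' \<zeta>)))) \<le> D * C"
        if t': "t' \<in> {0..t}" for t'
      proof -
        have "(LINT \<zeta>|lborel. norm (g \<zeta> * (indicator {0..t} t' * (cis ((t - t') * airy \<zeta>) * Q t' \<zeta>)))) \<le> (LINT \<zeta>|lborel. D * cmod (Q t' \<zeta>))"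
        proof (rule integral_mono)
          show "integrable lborel (\<lambda>\<zeta>. norm (g \<zeta> * (indicator {0..t} t' * (cis ((t - t') * airy \<zeta>) * Q t' \<zeta>))))"
            by (intro integrable_norm i1)
          show "integrable lborel (\<lambda>\<zeta>. D * cmod (Q t' \<zeta>))"
            by (intro integrable_mult_right integrable_norm Qi t')
        qed (use D t' in \<open>auto simp: norm_mult intro!: mult_right_mono\<close>)
        also have "\<dots> \<le> D * C"
          using Qb[OF t'] order_trans[OF norm_ge_zero D] by (simp add: mult_left_mono)
        finally show ?thesis .
      qed
      then show "AE t' in lborel. norm (LINT \<zeta>|lborel. norm (case (t', \<zeta>) of (t', \<zeta>) \<Rightarrow> g \<zeta> * (indicator {0..t} t' * (cis ((t - t') * airy \<zeta>) * Q t' \<zeta>)))) \<le> norm (indicator {0..t} t' * (D * C))"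
        by (intro AE_I2) (auto simp: indicator_def intro: order_trans[OF _ abs_ge_self])
    qed
  qed
  have b1: "bounded_measurable (\<lambda>_. 1)" by (auto simp: bounded_measurable_def)
  have Vi: "integrable lborel (retarded Q t)"
    using lborel_pair.integrable_snd[OF ik[OF b1]] by (simp add: retarded_def[abs_def])
  let ?W = "?c *\<^sub>R (dist_dx (fdist (retarded Q t)) + dist_dy (fdist (retarded Q t)))"
  have W: "has_fourier ?W (\<lambda>\<zeta>. complex_of_real ?c * (grad_symbol \<zeta> * retarded Q t \<zeta>))"
    by (intro has_fourier_scaleR has_fourier_grad has_fourier_fdist Vi)
  have "duhamel_term u t = ?W"
    unfolding duhamel_term_def
  proof (rule tdist_of_eqI)
    fix \<phi> assume "schwartz \<phi>"
    then obtain \<psi> where \<psi>: "schwartz \<psi>" "\<phi> = fourier \<psi>" using schwartz_fourier_surj by blast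
    \<comment> \<open>The derivative is put on the test function, which remains Schwartz, instead of
      on the merely integrable \<open>Q\<close>.\<close>
    let ?g = "\<lambda>\<zeta>. grad_symbol \<zeta> * \<psi> \<zeta>"
    let ?J = "\<lambda>t'. apply_tdist (propagator (t - t') (dist_dx (dist_square (u t')) + dist_dy (dist_square (u t')))) \<phi>"
    let ?K = "\<lambda>t' \<zeta>. ?g \<zeta> * (indicator {0..t} t' * (cis ((t - t') * airy \<zeta>) * Q t' \<zeta>))"
    have "schwartz ?g"
    proof -
      have "?g = (\<lambda>\<zeta>. \<i> * (complex_of_real (fst \<zeta>) * \<psi> \<zeta>) + \<i> * (complex_of_real (snd \<zeta>) * \<psi> \<zeta>))"
        by (auto simp: grad_symbol_def algebra_simps)
      then show ?thesis using \<psi>(1) by (simp only:) (intro schwartz_add schwartz_cmult schwartz_fst schwartz_snd)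
    qed
    then have g: "bounded_measurable ?g" by (rule schwartz_bounded_measurable)
    have K: "integrable (lborel \<Otimes>\<^sub>M lborel) (\<lambda>(t', \<zeta>). ?K t' \<zeta>)" by (rule ik[OF g])
    have J: "indicator {0..t} t' *\<^sub>R ?J t' = (LINT \<zeta>|lborel. ?K t' \<zeta>)" for t'
    proof (cases "t' \<in> {0..t}")
      case True
      have "u t' = fdist (f t')" by (rule eq_fdist[OF u[OF True] f[OF True]])
      then have "dist_square (u t') = fdist (Q t')"
        using dist_square_fdist[OF f[OF True]] Q[OF True] by simp
      then have "?J t' = (LINT \<zeta>|lborel. grad_symbol \<zeta> * (cis ((t - t') * airy \<zeta>) * Q t' \<zeta>) * \<psi> \<zeta>)"
        using has_fourier_propagator_grad[OF Qi[OF True], of "t - t'"] \<psi> by (simp add: has_fourier_def)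
      also have "\<dots> = (LINT \<zeta>|lborel. ?K t' \<zeta>)"
        using True by (intro Bochner_Integration.integral_cong) auto
      finally show ?thesis using True by simp
    qed simp
    have "integrable lborel (\<lambda>t'. LINT \<zeta>|lborel. ?K t' \<zeta>)"
      by (rule lborel_pair.integrable_fst[OF K])
    then have "set_integrable lborel {0..t} ?J" by (simp add: set_integrable_def J)
    from set_borel_integral_eq_integral(2)[OF this]
    have "integral {0..t} ?J = (LINT t'|lborel. LINT \<zeta>|lborel. ?K t' \<zeta>)"
      by (simp add: set_lebesgue_integral_def J)
    also have "\<dots> = (LINT \<zeta>|lborel. LINT t'|lborel. ?K t' \<zeta>)"
      by (rule lborel_pair.Fubini_integral[OF K, symmetric])
    also have "\<dots> = (LINT \<zeta>|lborel. grad_symbol \<zeta> * retarded Q t \<zeta> * \<psi> \<zeta>)"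
      by (intro Bochner_Integration.integral_cong) (auto simp: retarded_def)
    finally have "complex_of_real ?c * integral {0..t} ?J = complex_of_real ?c * (LINT \<zeta>|lborel. grad_symbol \<zeta> * retarded Q t \<zeta> * \<psi> \<zeta>)"
      by (simp only:)
    also have "\<dots> = (LINT \<zeta>|lborel. (complex_of_real ?c * (grad_symbol \<zeta> * retarded Q t \<zeta>)) * \<psi> \<zeta>)"
      unfolding mult.assoc integral_mult_right_zero ..
    also have "\<dots> = apply_tdist ?W \<phi>"
      using W \<psi> by (simp only: has_fourier_def)
    finally show "complex_of_real ?c * integral {0..t} ?J = apply_tdist ?W \<phi>" .
  qed
  then show ?thesis using W by simp
qed

subsection \<open>Real-valued distributions\<close>

lemma cnj_fourier: "cnj (fourier \<phi> \<zeta>) = fourier (\<lambda>z. cnj (\<phi> (- z))) \<zeta>"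
  if "\<phi> \<in> borel_measurable borel"
proof -
  have "cnj (LINT z|lborel. cis (- (z \<bullet> \<zeta>)) * \<phi> z) = (LINT z|lborel. cis (z \<bullet> \<zeta>) * cnj (\<phi> z))"
    unfolding Bochner_Integration.integral_cnj[symmetric] by (simp add: cis_cnj)
  also have "\<dots> = (LINT z|lborel. cis (- (z \<bullet> \<zeta>)) * cnj (\<phi> (- z)))"
    using lborel_integral_affine[of "-1" "\<lambda>z. cis (z \<bullet> \<zeta>) * cnj (\<phi> z)" 0] that by simp
  finally show ?thesis by (simp add: fourier_def)
qed

text \<open>\<open>real_valued\<close> speaks of real test functions only; a complex one is split
  into its real and imaginary part, which are again Schwartz functions.\<close>

lemma real_valued_cnj:
  assumes u: "real_valued u" and s: "schwartz \<phi>"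
  shows "apply_tdist u (\<lambda>z. cnj (\<phi> z)) = cnj (apply_tdist u \<phi>)"
proof -
  let ?a = "\<lambda>z. (1/2) * \<phi> z + (1/2) * cnj (\<phi> z)" and ?b = "\<lambda>z. (- \<i>/2) * \<phi> z + (\<i>/2) * cnj (\<phi> z)"
  have ab: "schwartz ?a" "schwartz ?b" by (intro schwartz_add schwartz_cmult schwartz_cnj s)+
  have eq: "?a = (\<lambda>z. complex_of_real (Re (\<phi> z)))" "?b = (\<lambda>z. complex_of_real (Im (\<phi> z)))"
    by (auto simp: complex_eq_iff)
  have r: "apply_tdist u ?a \<in> \<real>" "apply_tdist u ?b \<in> \<real>"
  proof -
    have "range ?a \<subseteq> \<real>" "range ?b \<subseteq> \<real>" unfolding eq by auto
    then show "apply_tdist u ?a \<in> \<real>" "apply_tdist u ?b \<in> \<real>"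
      using u[unfolded real_valued_def] ab by blast+
  qed
  have e: "\<phi> = (\<lambda>z. 1 * ?a z + \<i> * ?b z)" "(\<lambda>z. cnj (\<phi> z)) = (\<lambda>z. 1 * ?a z + (- \<i>) * ?b z)"
    by (auto simp: complex_eq_iff)
  have "apply_tdist u \<phi> = 1 * apply_tdist u ?a + \<i> * apply_tdist u ?b"
    by (subst e(1)) (rule apply_linear[OF ab])
  moreover have "apply_tdist u (\<lambda>z. cnj (\<phi> z)) = 1 * apply_tdist u ?a + (- \<i>) * apply_tdist u ?b"
    by (subst e(2)) (rule apply_linear[OF ab])
  ultimately have e: "apply_tdist u \<phi> = 1 * apply_tdist u ?a + \<i> * apply_tdist u ?b"
    "apply_tdist u (\<lambda>z. cnj (\<phi> z)) = 1 * apply_tdist u ?a + (- \<i>) * apply_tdist u ?b"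
    by blast+
  have "cnj (apply_tdist u ?a) = apply_tdist u ?a" "cnj (apply_tdist u ?b) = apply_tdist u ?b"
    using r by (simp_all only: Reals_cnj_iff)
  then show ?thesis
    unfolding e complex_cnj_add complex_cnj_mult complex_cnj_one complex_cnj_i by (simp only:)
qed

lemma real_valued_hermitian:
  assumes u: "real_valued u" and f: "has_fourier u f"
  shows "AE \<zeta> in lborel. f (- \<zeta>) = cnj (f \<zeta>)"
proof -
  have [measurable]: "f \<in> borel_measurable borel" using f by (simp add: has_fourier_def)
  have *: "integrable lborel (\<lambda>\<zeta>. f (- \<zeta>) * \<phi> \<zeta>) \<and> integrable lborel (\<lambda>\<zeta>. cnj (f \<zeta>) * \<phi> \<zeta>) \<and>
    (LINT \<zeta>|lborel. f (- \<zeta>) * \<phi> \<zeta>) = (LINT \<zeta>|lborel. cnj (f \<zeta>) * \<phi> \<zeta>)" if s: "schwartz \<phi>" for \<phi>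
  proof -
    note [measurable] = schwartz_measurable[OF s]
    have sc: "schwartz (\<lambda>z. cnj (\<phi> z))" and sr: "schwartz (\<lambda>z. \<phi> (- z))"
      using s by (auto intro: schwartz_cnj schwartz_reflect)
    have i: "integrable lborel (\<lambda>\<zeta>. f \<zeta> * \<phi> (- \<zeta>))" using f sr by (simp add: has_fourier_def)
    have i2: "integrable lborel (\<lambda>\<zeta>. f \<zeta> * cnj (\<phi> \<zeta>))" using f sc by (simp add: has_fourier_def)
    have 1: "integrable lborel (\<lambda>\<zeta>. f (- \<zeta>) * \<phi> \<zeta>)"
      using i lborel_integrable_affine[of "-1" "\<lambda>\<zeta>. f \<zeta> * \<phi> (- \<zeta>)" 0] by simp
    have 2: "integrable lborel (\<lambda>\<zeta>. cnj (f \<zeta>) * \<phi> \<zeta>)"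
      using integrable_cnj[of lborel "\<lambda>\<zeta>. f \<zeta> * cnj (\<phi> \<zeta>)"] i2 by simp
    have "(LINT \<zeta>|lborel. f (- \<zeta>) * \<phi> \<zeta>) = (LINT \<zeta>|lborel. f \<zeta> * \<phi> (- \<zeta>))"
      using lborel_integral_affine[of "-1" "\<lambda>\<zeta>. f \<zeta> * \<phi> (- \<zeta>)" 0] by simp
    also have "\<dots> = apply_tdist u (fourier (\<lambda>\<zeta>. \<phi> (- \<zeta>)))" using f sr by (simp add: has_fourier_def)
    also have "fourier (\<lambda>\<zeta>. \<phi> (- \<zeta>)) = (\<lambda>\<zeta>. cnj (fourier (\<lambda>z. cnj (\<phi> z)) \<zeta>))"
      by (subst cnj_fourier[OF schwartz_measurable[OF sc]]) simp
    also have "apply_tdist u (\<lambda>\<zeta>. cnj (fourier (\<lambda>z. cnj (\<phi> z)) \<zeta>)) = cnj (apply_tdist u (fourier (\<lambda>z. cnj (\<phi> z))))"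
      by (rule real_valued_cnj[OF u schwartz_fourier[OF sc]])
    also have "\<dots> = (LINT \<zeta>|lborel. cnj (f \<zeta> * cnj (\<phi> \<zeta>)))"
      using f sc by (simp add: has_fourier_def del: complex_cnj_mult)
    finally show ?thesis using 1 2 by simp
  qed
  show ?thesis by (rule AE_eq_if_schwartz_pairings_eq) (use * in auto)
qed

lemma real_valued_fdist:
  assumes f: "integrable lborel f" and h: "\<And>\<zeta>. f (- \<zeta>) = cnj (f \<zeta>)"
  shows "real_valued (fdist f)"
  unfolding real_valued_def
proof (intro allI impI)
  fix \<phi> assume s: "schwartz \<phi>" and r: "range \<phi> \<subseteq> \<real>"
  have [measurable]: "f \<in> borel_measurable borel" using f by auto
  have "cnj (ifourier f z) = ifourier f z" for z
  proof -
    have "cnj (ifourier f z) = (LINT \<zeta>|lborel. cis (z \<bullet> (- \<zeta>)) * f (- \<zeta>)) / complex_of_real (2 * pi)"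
      unfolding ifourier_def by (simp add: Bochner_Integration.integral_cnj[symmetric] h cis_cnj)
    then show ?thesis
      using lborel_integral_affine[of "-1" "\<lambda>\<zeta>. cis (z \<bullet> \<zeta>) * f \<zeta>" 0] by (simp add: ifourier_def)
  qed
  moreover have "cnj (\<phi> z) = \<phi> z" for z using r by (auto simp: Reals_cnj_iff[symmetric])
  ultimately have "cnj (LINT z|lborel. ifourier f z * \<phi> z) = (LINT z|lborel. ifourier f z * \<phi> z)"
    unfolding Bochner_Integration.integral_cnj[symmetric] by simp
  then show "apply_tdist (fdist f) \<phi> \<in> \<real>"
    by (simp add: fdist_def apply_density_dist[OF bounded_measurable_ifourier[OF f] s] Reals_cnj_iff)
qed

section \<open>Square integrable functions\<close>

definition sq_int :: "(plane \<Rightarrow> complex) \<Rightarrow> bool" where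
  "sq_int f \<longleftrightarrow> f \<in> borel_measurable borel \<and> integrable lborel (\<lambda>\<zeta>. (cmod (f \<zeta>))\<^sup>2)"

definition l2 :: "(plane \<Rightarrow> complex) \<Rightarrow> real" where
  "l2 f = sqrt (LINT \<zeta>|lborel. (cmod (f \<zeta>))\<^sup>2)"

lemma l2_nonneg [simp]: "l2 f \<ge> 0"
  by (simp add: l2_def)

lemma l2_power2: "(l2 f)\<^sup>2 = (LINT \<zeta>|lborel. (cmod (f \<zeta>))\<^sup>2)"
  by (simp add: l2_def)

lemma mult_le_sum_squares: "x \<ge> 0 \<Longrightarrow> y \<ge> 0 \<Longrightarrow> x * y \<le> x\<^sup>2 + (y::real)\<^sup>2"
proof -
  assume "x \<ge> 0" "y \<ge> 0"
  then have "0 \<le> x * y" by simp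
  moreover have "2 * (x * y) \<le> x\<^sup>2 + y\<^sup>2" using sum_squares_bound[of x y] by (simp add: mult.assoc)
  ultimately show ?thesis by linarith
qed

lemma sq_int_mult_integrable:
  assumes "sq_int f" "sq_int g"
  shows "integrable lborel (\<lambda>\<zeta>. f \<zeta> * g \<zeta>)"
proof (rule Bochner_Integration.integrable_bound)
  show "integrable lborel (\<lambda>\<zeta>. (cmod (f \<zeta>))\<^sup>2 + (cmod (g \<zeta>))\<^sup>2)"
    using assms by (auto simp: sq_int_def)
  show "(\<lambda>\<zeta>. f \<zeta> * g \<zeta>) \<in> borel_measurable lborel"
    using assms by (auto simp: sq_int_def)
  show "AE \<zeta> in lborel. norm (f \<zeta> * g \<zeta>) \<le> norm ((cmod (f \<zeta>))\<^sup>2 + (cmod (g \<zeta>))\<^sup>2)"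
    by (intro AE_I2) (simp add: norm_mult mult_le_sum_squares)
qed

lemma sq_int_cnj: "sq_int f \<Longrightarrow> sq_int (\<lambda>\<zeta>. cnj (f \<zeta>))"
  by (auto simp: sq_int_def)

lemma norm_mult_integral_le:
  assumes f: "sq_int f" and g: "sq_int g"
  shows "(LINT \<zeta>|lborel. cmod (f \<zeta>) * cmod (g \<zeta>)) \<le> l2 f * l2 g"
proof -
  define a b c where "a = (LINT \<zeta>|lborel. (cmod (f \<zeta>))\<^sup>2)"
    and "b = (LINT \<zeta>|lborel. (cmod (g \<zeta>))\<^sup>2)" and "c = (LINT \<zeta>|lborel. cmod (f \<zeta>) * cmod (g \<zeta>))"
  have i: "integrable lborel (\<lambda>\<zeta>. (cmod (f \<zeta>))\<^sup>2)" "integrable lborel (\<lambda>\<zeta>. (cmod (g \<zeta>))\<^sup>2)"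
    "integrable lborel (\<lambda>\<zeta>. cmod (f \<zeta>) * cmod (g \<zeta>))"
    using f g integrable_norm[OF sq_int_mult_integrable[OF f g]] by (auto simp: sq_int_def norm_mult)
  have nn: "a \<ge> 0" "b \<ge> 0" "c \<ge> 0" by (auto simp: a_def b_def c_def)
  have q: "0 \<le> x\<^sup>2 * a - 2 * x * y * c + y\<^sup>2 * b" for x y
  proof -
    have "0 \<le> (LINT \<zeta>|lborel. (x * cmod (f \<zeta>) - y * cmod (g \<zeta>))\<^sup>2)" by simp
    also have "(\<lambda>\<zeta>. (x * cmod (f \<zeta>) - y * cmod (g \<zeta>))\<^sup>2) = (\<lambda>\<zeta>. x\<^sup>2 * (cmod (f \<zeta>))\<^sup>2 - 2 * x * y * (cmod (f \<zeta>) * cmod (g \<zeta>)) + y\<^sup>2 * (cmod (g \<zeta>))\<^sup>2)"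
      by (auto simp: power2_eq_square algebra_simps)
    also have "integral\<^sup>L lborel \<dots> = x\<^sup>2 * a - 2 * x * y * c + y\<^sup>2 * b"
      using i by (simp add: a_def b_def c_def)
    finally show ?thesis .
  qed
  have "c\<^sup>2 \<le> a * b"
  proof (cases "a = 0")
    case True
    have "c = 0"
    proof (rule ccontr)
      assume "c \<noteq> 0"
      \<comment> \<open>With \<open>a = 0\<close> the quadratic form is affine in \<open>x\<close>;
        at this \<open>x\<close>, with \<open>y = 1\<close>, it equals \<open>- 1\<close>.\<close>
      have "2 * ((b + 1) / (2 * c)) * 1 * c = b + 1" using \<open>c \<noteq> 0\<close> by simp
      with q[of "(b + 1) / (2 * c)" 1] True show False by simp
    qed
    then show ?thesis using True by simp
  next
    case False
    have "0 \<le> c\<^sup>2 * a - 2 * c * a * c + a\<^sup>2 * b" using q[of c a] .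
    then have "0 \<le> a * (a * b - c\<^sup>2)" by (simp add: power2_eq_square algebra_simps)
    then have "0 \<le> a * b - c\<^sup>2" using False nn(1) by (simp add: zero_le_mult_iff)
    then show ?thesis by simp
  qed
  then have "c \<le> sqrt (a * b)" using nn by (intro real_le_rsqrt)
  then show ?thesis by (simp add: l2_def a_def b_def c_def real_sqrt_mult)
qed

lemma cmod_mult_integral_le:
  assumes "sq_int f" "sq_int g"
  shows "cmod (LINT \<zeta>|lborel. f \<zeta> * g \<zeta>) \<le> l2 f * l2 g"
  using order_trans[OF integral_norm_bound[of lborel "\<lambda>\<zeta>. f \<zeta> * g \<zeta>"]] norm_mult_integral_le[OF assms]
  by (simp add: norm_mult)

lemma sq_int_cmult: "sq_int f \<Longrightarrow> sq_int (\<lambda>\<zeta>. c * f \<zeta>)"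
  by (auto simp: sq_int_def norm_mult power_mult_distrib)

lemma l2_cmult: "l2 (\<lambda>\<zeta>. c * f \<zeta>) = cmod c * l2 f"
  by (simp add: l2_def norm_mult power_mult_distrib real_sqrt_mult)

lemma sq_int_add:
  assumes "sq_int f" "sq_int g" shows "sq_int (\<lambda>\<zeta>. f \<zeta> + g \<zeta>)"
  unfolding sq_int_def
proof
  show m: "(\<lambda>\<zeta>. f \<zeta> + g \<zeta>) \<in> borel_measurable borel" using assms by (auto simp: sq_int_def)
  show "integrable lborel (\<lambda>\<zeta>. (cmod (f \<zeta> + g \<zeta>))\<^sup>2)"
  proof (rule Bochner_Integration.integrable_bound)
    show "integrable lborel (\<lambda>\<zeta>. 2 * (cmod (f \<zeta>))\<^sup>2 + 2 * (cmod (g \<zeta>))\<^sup>2)"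
      using assms by (auto simp: sq_int_def)
    show "(\<lambda>\<zeta>. (cmod (f \<zeta> + g \<zeta>))\<^sup>2) \<in> borel_measurable lborel" using m by simp
    have "(cmod (x + y))\<^sup>2 \<le> 2 * (cmod x)\<^sup>2 + 2 * (cmod y)\<^sup>2" for x y
    proof -
      have "(cmod (x + y))\<^sup>2 \<le> (cmod x + cmod y)\<^sup>2" by (intro power_mono norm_triangle_ineq) auto
      then show ?thesis using sum_squares_bound[of "cmod x" "cmod y"] by (simp add: power2_sum)
    qed
    then show "AE \<zeta> in lborel. norm ((cmod (f \<zeta> + g \<zeta>))\<^sup>2) \<le> norm (2 * (cmod (f \<zeta>))\<^sup>2 + 2 * (cmod (g \<zeta>))\<^sup>2)"
      by simp
  qed
qed

lemma sq_int_diff: "sq_int f \<Longrightarrow> sq_int g \<Longrightarrow> sq_int (\<lambda>\<zeta>. f \<zeta> - g \<zeta>)"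
  using sq_int_add[of f "\<lambda>\<zeta>. (-1) * g \<zeta>"] sq_int_cmult[of g "-1"] by simp

lemma l2_triangle:
  assumes f: "sq_int f" and g: "sq_int g"
  shows "l2 (\<lambda>\<zeta>. f \<zeta> + g \<zeta>) \<le> l2 f + l2 g"
proof -
  have i: "integrable lborel (\<lambda>\<zeta>. (cmod (f \<zeta>))\<^sup>2)" "integrable lborel (\<lambda>\<zeta>. (cmod (g \<zeta>))\<^sup>2)"
    "integrable lborel (\<lambda>\<zeta>. cmod (f \<zeta>) * cmod (g \<zeta>))"
    using f g integrable_norm[OF sq_int_mult_integrable[OF f g]] by (auto simp: sq_int_def norm_mult)
  have "(l2 (\<lambda>\<zeta>. f \<zeta> + g \<zeta>))\<^sup>2 \<le> (LINT \<zeta>|lborel. (cmod (f \<zeta>))\<^sup>2 + 2 * (cmod (f \<zeta>) * cmod (g \<zeta>)) + (cmod (g \<zeta>))\<^sup>2)"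
    unfolding l2_power2
  proof (rule integral_mono)
    show "integrable lborel (\<lambda>\<zeta>. (cmod (f \<zeta> + g \<zeta>))\<^sup>2)" using sq_int_add[OF f g] by (simp add: sq_int_def)
    show "integrable lborel (\<lambda>\<zeta>. (cmod (f \<zeta>))\<^sup>2 + 2 * (cmod (f \<zeta>) * cmod (g \<zeta>)) + (cmod (g \<zeta>))\<^sup>2)" using i by auto
    fix \<zeta>
    have "(cmod (f \<zeta> + g \<zeta>))\<^sup>2 \<le> (cmod (f \<zeta>) + cmod (g \<zeta>))\<^sup>2" by (intro power_mono norm_triangle_ineq) auto
    then show "(cmod (f \<zeta> + g \<zeta>))\<^sup>2 \<le> (cmod (f \<zeta>))\<^sup>2 + 2 * (cmod (f \<zeta>) * cmod (g \<zeta>)) + (cmod (g \<zeta>))\<^sup>2"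
      by (simp add: power2_sum)
  qed
  also have "\<dots> = (l2 f)\<^sup>2 + 2 * (LINT \<zeta>|lborel. cmod (f \<zeta>) * cmod (g \<zeta>)) + (l2 g)\<^sup>2"
    using i by (simp add: l2_power2)
  also have "\<dots> \<le> (l2 f + l2 g)\<^sup>2"
    using norm_mult_integral_le[OF f g] by (simp add: power2_sum)
  finally show ?thesis by (rule power2_le_imp_le) simp
qed

lemma sq_int_affine:
  assumes "sq_int f" "\<bar>c\<bar> = 1"
  shows "sq_int (\<lambda>\<zeta>. f (t + c *\<^sub>R \<zeta>))" "l2 (\<lambda>\<zeta>. f (t + c *\<^sub>R \<zeta>)) = l2 f"
proof -
  have [measurable]: "f \<in> borel_measurable borel" using assms by (simp add: sq_int_def)
  show "sq_int (\<lambda>\<zeta>. f (t + c *\<^sub>R \<zeta>))"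
    using lborel_integrable_affine[OF assms(2), of "\<lambda>\<zeta>. (cmod (f \<zeta>))\<^sup>2" t] assms(1)
    by (simp add: sq_int_def)
  show "l2 (\<lambda>\<zeta>. f (t + c *\<^sub>R \<zeta>)) = l2 f"
    using lborel_integral_affine[OF assms(2), of "\<lambda>\<zeta>. (cmod (f \<zeta>))\<^sup>2" t] by (simp add: l2_def)
qed

lemma l2_cong_AE:
  assumes "f \<in> borel_measurable borel" "g \<in> borel_measurable borel" "AE \<zeta> in lborel. f \<zeta> = g \<zeta>"
  shows "l2 f = l2 g"
  unfolding l2_def using assms by (intro arg_cong[of _ _ sqrt] integral_cong_AE) auto

subsection \<open>Sobolev norms as weighted \<open>L\<^sup>2\<close> norms\<close>

text \<open>The square root of the weight in \<open>sobolev\<close>, so that Sobolev norms are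
  \<open>l2\<close> norms of weighted transforms.\<close>

definition sobolev_weight :: "real \<Rightarrow> plane \<Rightarrow> real" where
  "sobolev_weight s \<zeta> = (1 + (norm \<zeta>)\<^sup>2) powr (s / 2)"

lemma sobolev_weight_pos: "sobolev_weight s \<zeta> > 0"
  using add_pos_nonneg[OF zero_less_one zero_le_power2[of "norm \<zeta>"]] by (simp add: sobolev_weight_def)

lemma sobolev_weight_measurable [measurable]: "sobolev_weight s \<in> borel_measurable borel"
  unfolding sobolev_weight_def[abs_def] by measurable

lemma sobolev_weight_power2: "(cmod (complex_of_real (sobolev_weight s \<zeta>) * z))\<^sup>2 = (1 + (norm \<zeta>)\<^sup>2) powr s * (cmod z)\<^sup>2"
proof -
  have "(sobolev_weight s \<zeta>)\<^sup>2 = (1 + (norm \<zeta>)\<^sup>2) powr s"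
    by (simp add: sobolev_weight_def power2_eq_square powr_add[symmetric])
  then show ?thesis by (simp add: norm_mult power_mult_distrib)
qed

lemma sobolev_iff_sq_int:
  assumes "has_fourier u f"
  shows "u \<in> sobolev s \<longleftrightarrow> sq_int (\<lambda>\<zeta>. complex_of_real (sobolev_weight s \<zeta>) * f \<zeta>)"
proof -
  have [measurable]: "f \<in> borel_measurable borel" using assms by (simp add: has_fourier_def)
  show ?thesis
    unfolding sq_int_def sobolev_weight_power2
    using sobolev_integrable[OF assms] assms by (auto simp: sobolev_def)
qed

lemma sobolev_norm_eq_l2:
  assumes "has_fourier u f"
  shows "sobolev_norm s u = l2 (\<lambda>\<zeta>. complex_of_real (sobolev_weight s \<zeta>) * f \<zeta>)"
  unfolding sobolev_norm_eq[OF assms] l2_def sobolev_weight_power2 ..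

lemma sobolevE:
  assumes "u \<in> sobolev s" obtains f where "has_fourier u f"
  using assms unfolding sobolev_def by blast

lemma
  assumes u: "u \<in> sobolev s" and v: "v \<in> sobolev s"
  shows sobolev_norm_triangle: "sobolev_norm s (u + v) \<le> sobolev_norm s u + sobolev_norm s v"
    and sobolev_diff: "u - v \<in> sobolev s"
    and sobolev_norm_diff_triangle: "sobolev_norm s (u - v) \<le> sobolev_norm s u + sobolev_norm s v"
    and sobolev_norm_commute: "sobolev_norm s (u - v) = sobolev_norm s (v - u)"
proof -
  obtain f g where f: "has_fourier u f" and g: "has_fourier v g" using u v by (metis sobolevE)
  let ?w = "\<lambda>f \<zeta>. complex_of_real (sobolev_weight s \<zeta>) * f \<zeta>"
  have sf: "sq_int (?w f)" and sg: "sq_int (?w g)" using u v sobolev_iff_sq_int f g by auto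
  note n = sobolev_norm_eq_l2[OF f] sobolev_norm_eq_l2[OF g]
    sobolev_norm_eq_l2[OF has_fourier_add[OF f g]] sobolev_norm_eq_l2[OF has_fourier_minus[OF f g]]
    sobolev_norm_eq_l2[OF has_fourier_minus[OF g f]]
  show "sobolev_norm s (u + v) \<le> sobolev_norm s u + sobolev_norm s v"
    using l2_triangle[OF sf sg] by (simp add: n distrib_left)
  show "u - v \<in> sobolev s"
    using sq_int_diff[OF sf sg] by (simp add: sobolev_iff_sq_int[OF has_fourier_minus[OF f g]] right_diff_distrib)
  show "sobolev_norm s (u - v) \<le> sobolev_norm s u + sobolev_norm s v"
    using l2_triangle[OF sf sq_int_cmult[OF sg, of "-1"]] l2_cmult[of "-1" "?w g"] by (simp add: n right_diff_distrib)
  show "sobolev_norm s (u - v) = sobolev_norm s (v - u)"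
    unfolding n using l2_cmult[of "-1" "?w (\<lambda>\<zeta>. f \<zeta> - g \<zeta>)"] by (simp add: right_diff_distrib)
qed

lemma sobolev_scaleR:
  assumes u: "u \<in> sobolev s"
  shows "c *\<^sub>R u \<in> sobolev s" "sobolev_norm s (c *\<^sub>R u) = \<bar>c\<bar> * sobolev_norm s u"
proof -
  obtain f where f: "has_fourier u f" using u by (metis sobolevE)
  let ?w = "\<lambda>f \<zeta>. complex_of_real (sobolev_weight s \<zeta>) * f \<zeta>"
  have sf: "sq_int (?w f)" using u sobolev_iff_sq_int f by auto
  show "c *\<^sub>R u \<in> sobolev s"
    using sq_int_cmult[OF sf, of "complex_of_real c"]
    by (simp add: sobolev_iff_sq_int[OF has_fourier_scaleR[OF f]] mult.left_commute)
  show "sobolev_norm s (c *\<^sub>R u) = \<bar>c\<bar> * sobolev_norm s u"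
    using l2_cmult[of "complex_of_real c" "?w f"]
    by (simp add: sobolev_norm_eq_l2[OF has_fourier_scaleR[OF f]] sobolev_norm_eq_l2[OF f] mult.left_commute)
qed

lemma sobolev_zero: "0 \<in> sobolev s" "sobolev_norm s 0 = 0"
  by (simp_all add: sobolev_iff_sq_int[OF has_fourier_zero] sobolev_norm_eq_l2[OF has_fourier_zero] sq_int_def l2_def)

lemma sobolev_norm_nonneg: "u \<in> sobolev s \<Longrightarrow> sobolev_norm s u \<ge> 0"
  by (metis sobolevE sobolev_norm_eq_l2 l2_nonneg)

text \<open>Duality of \<open>H^s\<close> and \<open>H^(-s)\<close>: the weights cancel in the
  product. Evaluation at a fixed test function is thus continuous in the \<open>H^s\<close> norm,
  and this is how the derivatives of the solution map will be read off.\<close>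

lemma sobolev_pairing_bound:
  assumes u: "u \<in> sobolev s" and \<psi>: "schwartz \<psi>" "sq_int (\<lambda>\<zeta>. complex_of_real (sobolev_weight (- s) \<zeta>) * \<psi> \<zeta>)"
  shows "cmod (apply_tdist u (fourier \<psi>)) \<le>
    l2 (\<lambda>\<zeta>. complex_of_real (sobolev_weight (- s) \<zeta>) * \<psi> \<zeta>) * sobolev_norm s u"
proof -
  obtain f where f: "has_fourier u f" using u by (metis sobolevE)
  let ?f = "\<lambda>\<zeta>. complex_of_real (sobolev_weight s \<zeta>) * f \<zeta>"
    and ?g = "\<lambda>\<zeta>. complex_of_real (sobolev_weight (- s) \<zeta>) * \<psi> \<zeta>"
  have "sobolev_weight s \<zeta> * sobolev_weight (- s) \<zeta> = 1" for \<zeta>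
    using add_pos_nonneg[OF zero_less_one zero_le_power2[of "norm \<zeta>"]]
    by (simp add: sobolev_weight_def powr_add[symmetric])
  then have w: "complex_of_real (sobolev_weight s \<zeta>) * complex_of_real (sobolev_weight (- s) \<zeta>) = 1" for \<zeta>
    by (metis of_real_1 of_real_mult)
  have "?f \<zeta> * ?g \<zeta> = f \<zeta> * \<psi> \<zeta>" for \<zeta>
  proof -
    have "?f \<zeta> * ?g \<zeta> = (complex_of_real (sobolev_weight s \<zeta>) * complex_of_real (sobolev_weight (- s) \<zeta>)) * (f \<zeta> * \<psi> \<zeta>)"
      by (simp only: mult_ac)
    then show ?thesis by (simp only: w mult_1)
  qed
  then have "(LINT \<zeta>|lborel. f \<zeta> * \<psi> \<zeta>) = (LINT \<zeta>|lborel. ?f \<zeta> * ?g \<zeta>)"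
    by (simp only:)
  moreover have "apply_tdist u (fourier \<psi>) = (LINT \<zeta>|lborel. f \<zeta> * \<psi> \<zeta>)"
    using f \<psi> unfolding has_fourier_def by blast
  ultimately have "apply_tdist u (fourier \<psi>) = (LINT \<zeta>|lborel. ?f \<zeta> * ?g \<zeta>)"
    by (simp only:)
  also have "cmod \<dots> \<le> l2 ?f * l2 ?g"
    using u \<psi> sobolev_iff_sq_int[OF f] by (intro cmod_mult_integral_le) auto
  finally show ?thesis by (simp add: sobolev_norm_eq_l2[OF f] mult.commute)
qed

section \<open>The quadratic interaction\<close>

lemma conv_bound:
  assumes f: "sq_int f" and g: "sq_int g"
  shows "integrable lborel (\<lambda>w. f w * g (\<zeta> - w))" "cmod (conv f g \<zeta>) \<le> l2 f * l2 g / (2 * pi)"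
proof -
  note s = sq_int_affine[OF g, of "-1" \<zeta>, simplified]
  show "integrable lborel (\<lambda>w. f w * g (\<zeta> - w))" by (rule sq_int_mult_integrable[OF f s(1)])
  show "cmod (conv f g \<zeta>) \<le> l2 f * l2 g / (2 * pi)"
    using cmod_mult_integral_le[OF f s(1)] unfolding s(2) by (simp add: conv_def norm_divide divide_right_mono)
qed

text \<open>A difference of squares splits into two convolutions that each contain the factor
  \<open>f - g\<close>, and a convolution is bounded pointwise by two \<open>L^2\<close> norms.
  Closeness in \<open>L^2\<close> is therefore enough to compare quadratic terms at every
  frequency.\<close>

lemma conv_diff_bound:
  assumes f: "sq_int f" and g: "sq_int g"
  shows "cmod (conv f f \<zeta> - conv g g \<zeta>) \<le> l2 (\<lambda>\<zeta>. f \<zeta> - g \<zeta>) * (l2 f + l2 g)"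
proof -
  let ?d = "\<lambda>\<zeta>. f \<zeta> - g \<zeta>"
  have d: "sq_int ?d" by (rule sq_int_diff[OF f g])
  note i = conv_bound(1)[OF f f] conv_bound(1)[OF g g] conv_bound(1)[OF d f] conv_bound(1)[OF g d]
  have "(LINT w|lborel. f w * f (\<zeta> - w)) - (LINT w|lborel. g w * g (\<zeta> - w)) = (LINT w|lborel. f w * f (\<zeta> - w) - g w * g (\<zeta> - w))"
    using i by (intro Bochner_Integration.integral_diff[symmetric]) auto
  also have "\<dots> = (LINT w|lborel. ?d w * f (\<zeta> - w) + g w * ?d (\<zeta> - w))"
    by (intro Bochner_Integration.integral_cong) (auto simp: algebra_simps)
  also have "\<dots> = (LINT w|lborel. ?d w * f (\<zeta> - w)) + (LINT w|lborel. g w * ?d (\<zeta> - w))"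
    by (rule Bochner_Integration.integral_add[OF i(3,4)])
  finally have "conv f f \<zeta> - conv g g \<zeta> = conv ?d f \<zeta> + conv g ?d \<zeta>"
    by (simp add: conv_def diff_divide_distrib[symmetric] add_divide_distrib[symmetric])
  then have "cmod (conv f f \<zeta> - conv g g \<zeta>) \<le> l2 ?d * l2 f / (2 * pi) + l2 g * l2 ?d / (2 * pi)"
    by (simp only:) (rule norm_triangle_mono[OF conv_bound(2)[OF d f] conv_bound(2)[OF g d]])
  also have "\<dots> = l2 ?d * (l2 f + l2 g) / (2 * pi)"
    by (simp add: add_divide_distrib algebra_simps)
  also have "\<dots> \<le> l2 ?d * (l2 f + l2 g) / 1"
    using pi_ge_two by (intro divide_left_mono mult_nonneg_nonneg add_nonneg_nonneg) auto
  finally show ?thesis by simp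
qed

lemma integrable_reflected_kernel:
  fixes f g :: "plane \<Rightarrow> real"
  assumes f: "integrable lborel f" and g: "integrable lborel g"
  shows "integrable (lborel \<Otimes>\<^sub>M lborel) (\<lambda>(w, \<zeta>). f w * g (- \<zeta> - w))"
proof (rule lborel_pair.Fubini_integrable)
  have [measurable]: "f \<in> borel_measurable borel" "g \<in> borel_measurable borel"
    using f g by auto
  show "(\<lambda>(w, \<zeta>). f w * g (- \<zeta> - w)) \<in> borel_measurable (lborel \<Otimes>\<^sub>M lborel)" by measurable
  have sh: "integrable lborel (\<lambda>\<zeta>. g (- \<zeta> - w))" for w
    using lborel_integrable_affine[of "-1" g "- w"] g by (simp add: algebra_simps)
  have "(LINT \<zeta>|lborel. norm (g (- \<zeta> - w))) = (LINT \<zeta>|lborel. norm (g \<zeta>))" for w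
    using lborel_integral_affine[of "-1" "\<lambda>\<zeta>. norm (g \<zeta>)" "- w"] by (simp add: algebra_simps)
  then show "integrable lborel (\<lambda>w. LINT \<zeta>|lborel. norm (case (w, \<zeta>) of (w, \<zeta>) \<Rightarrow> f w * g (- \<zeta> - w)))"
    using f by (simp add: abs_mult)
  show "AE w in lborel. integrable lborel (\<lambda>\<zeta>. case (w, \<zeta>) of (w, \<zeta>) \<Rightarrow> f w * g (- \<zeta> - w))"
    using sh by simp
qed

text \<open>The product of \<open>grad_symbol \<zeta> * f \<zeta>\<close> and
  \<open>f (\<zeta> - w)\<close> is at most the sum of their squares. Thus \<open>f w\<close> is
  measured in \<open>L^1\<close> and the other two factors in \<open>L^2\<close>.\<close>

lemma trilinear_bound:
  assumes f: "integrable lborel f" "sq_int f" "sq_int (\<lambda>\<zeta>. grad_symbol \<zeta> * f \<zeta>)"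
  shows "integrable lborel (\<lambda>\<zeta>. cnj (f \<zeta>) * (grad_symbol \<zeta> * conv f f \<zeta>))"
    "(LINT \<zeta>|lborel. cmod (cnj (f \<zeta>) * (grad_symbol \<zeta> * conv f f \<zeta>))) \<le>
      (LINT \<zeta>|lborel. cmod (f \<zeta>)) * ((l2 (\<lambda>\<zeta>. grad_symbol \<zeta> * f \<zeta>))\<^sup>2 + (l2 f)\<^sup>2)"
proof -
  have [measurable]: "f \<in> borel_measurable borel" using f by auto
  let ?m = "\<lambda>\<zeta>. grad_symbol \<zeta> * f \<zeta>"
  let ?k = "\<lambda>w \<zeta>. cmod (f w) * ((cmod (?m \<zeta>))\<^sup>2 + (cmod (f (\<zeta> - w)))\<^sup>2)"
  have n: "integrable lborel (\<lambda>w. cmod (f w))" "integrable lborel (\<lambda>w. (cmod (f w))\<^sup>2)" "integrable lborel (\<lambda>w. (cmod (?m w))\<^sup>2)"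
    using f by (auto simp: sq_int_def)
  have k1: "integrable (lborel \<Otimes>\<^sub>M lborel) (\<lambda>p. cmod (f (fst p)) * (cmod (?m (snd p)))\<^sup>2)"
    using integrable_tensor[OF n(1) n(3)] by (simp add: lborel_prod)
  note k2 = integrable_conv_kernel[OF n(1) n(2)]
  have k: "integrable (lborel \<Otimes>\<^sub>M lborel) (\<lambda>(w, \<zeta>). ?k w \<zeta>)"
    using Bochner_Integration.integrable_add[OF k1 k2] by (simp add: case_prod_beta' distrib_left)
  have ki: "integrable lborel (\<lambda>\<zeta>. LINT w|lborel. ?k w \<zeta>)" by (rule lborel_pair.integrable_snd[OF k])
  have pt: "cmod (cnj (f \<zeta>) * (grad_symbol \<zeta> * conv f f \<zeta>)) \<le> (LINT w|lborel. ?k w \<zeta>)" if i: "integrable lborel (\<lambda>w. ?k w \<zeta>)" for \<zeta>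
  proof -
    have "cmod (cnj (f \<zeta>) * (grad_symbol \<zeta> * conv f f \<zeta>)) = cmod (LINT w|lborel. ?m \<zeta> * (f w * f (\<zeta> - w))) / (2 * pi)"
      by (simp add: norm_mult conv_def norm_divide)
    also have "\<dots> \<le> cmod (LINT w|lborel. ?m \<zeta> * (f w * f (\<zeta> - w))) / 1"
      using pi_ge_two by (intro divide_left_mono) auto
    also have "\<dots> \<le> (LINT w|lborel. ?k w \<zeta>) / 1"
    proof (rule divide_right_mono, rule Bochner_Integration.integral_norm_bound_integral)
      show "integrable lborel (\<lambda>w. ?m \<zeta> * (f w * f (\<zeta> - w)))"
        by (intro integrable_mult_right conv_bound(1) f)
      show "norm (?m \<zeta> * (f w * f (\<zeta> - w))) \<le> ?k w \<zeta>" for w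
      proof -
        have "cmod (?m \<zeta>) * cmod (f (\<zeta> - w)) \<le> (cmod (?m \<zeta>))\<^sup>2 + (cmod (f (\<zeta> - w)))\<^sup>2"
          by (rule mult_le_sum_squares) auto
        then have "cmod (f w) * (cmod (?m \<zeta>) * cmod (f (\<zeta> - w))) \<le> ?k w \<zeta>" by (rule mult_left_mono) simp
        then show ?thesis by (simp add: norm_mult mult_ac)
      qed
    qed (use i in auto)
    finally show ?thesis by simp
  qed
  have ae: "AE \<zeta> in lborel. norm (cnj (f \<zeta>) * (grad_symbol \<zeta> * conv f f \<zeta>)) \<le> (LINT w|lborel. ?k w \<zeta>)"
    using lborel_pair.AE_integrable_snd[OF k] by eventually_elim (rule pt)
  have cm: "conv f f \<in> borel_measurable borel" using integrable_conv[OF f(1) f(1)] by auto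
  show i: "integrable lborel (\<lambda>\<zeta>. cnj (f \<zeta>) * (grad_symbol \<zeta> * conv f f \<zeta>))"
    by (rule Bochner_Integration.integrable_bound[OF ki])
      (use cm ae in \<open>auto elim!: eventually_mono intro: order_trans[OF _ abs_ge_self]\<close>)
  have "(LINT \<zeta>|lborel. cmod (cnj (f \<zeta>) * (grad_symbol \<zeta> * conv f f \<zeta>))) \<le> (LINT \<zeta>|lborel. LINT w|lborel. ?k w \<zeta>)"
    using i ki ae by (intro integral_mono_AE) auto
  also have "\<dots> = (LINT w|lborel. LINT \<zeta>|lborel. ?k w \<zeta>)" by (rule lborel_pair.Fubini_integral[OF k])
  also have "\<dots> = (LINT w|lborel. cmod (f w) * ((l2 ?m)\<^sup>2 + (l2 f)\<^sup>2))"
  proof (rule Bochner_Integration.integral_cong[OF refl])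
    fix w
    have "integrable lborel (\<lambda>\<zeta>. (cmod (f (\<zeta> - w)))\<^sup>2)" "(LINT \<zeta>|lborel. (cmod (f (\<zeta> - w)))\<^sup>2) = (LINT \<zeta>|lborel. (cmod (f \<zeta>))\<^sup>2)"
      using lborel_integrable_affine[of 1 "\<lambda>\<zeta>. (cmod (f \<zeta>))\<^sup>2" "- w"] lborel_integral_affine[of 1 "\<lambda>\<zeta>. (cmod (f \<zeta>))\<^sup>2" "- w"] n(2)
      by (simp_all add: algebra_simps)
    then show "(LINT \<zeta>|lborel. ?k w \<zeta>) = cmod (f w) * ((l2 ?m)\<^sup>2 + (l2 f)\<^sup>2)"
      using n(3) by (simp add: l2_power2)
  qed
  finally show "(LINT \<zeta>|lborel. cmod (cnj (f \<zeta>) * (grad_symbol \<zeta> * conv f f \<zeta>))) \<le>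
      (LINT \<zeta>|lborel. cmod (f \<zeta>)) * ((l2 ?m)\<^sup>2 + (l2 f)\<^sup>2)" by simp
qed

text \<open>
  On the hyperplane \<open>\<zeta> + w + v = 0\<close> the product \<open>f \<zeta> f w f v\<close> is symmetric and the linear symbol
  satisfies \<open>m \<zeta> + m w + m v = 0\<close>.
\<close>

lemma trilinear_cancellation:
  assumes f: "integrable lborel f" "sq_int f" "sq_int (\<lambda>\<zeta>. grad_symbol \<zeta> * f \<zeta>)"
    and h: "AE \<zeta> in lborel. f (- \<zeta>) = cnj (f \<zeta>)"
  shows "(LINT \<zeta>|lborel. cnj (f \<zeta>) * (grad_symbol \<zeta> * conv f f \<zeta>)) = 0"
proof -
  have [measurable]: "f \<in> borel_measurable borel" "conv f f \<in> borel_measurable borel"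
    using f integrable_conv[OF f(1) f(1)] by auto
  let ?m = "\<lambda>\<zeta>. grad_symbol \<zeta> * f \<zeta>"
  let ?K = "\<lambda>w \<zeta>. ?m \<zeta> * (f w * f (- \<zeta> - w))"
  have n: "integrable lborel (\<lambda>w. cmod (f w))" "integrable lborel (\<lambda>w. (cmod (f w))\<^sup>2)" "integrable lborel (\<lambda>w. (cmod (?m w))\<^sup>2)"
    using f by (auto simp: sq_int_def)
  have k1: "integrable (lborel \<Otimes>\<^sub>M lborel) (\<lambda>p. cmod (f (fst p)) * (cmod (?m (snd p)))\<^sup>2)"
    using integrable_tensor[OF n(1) n(3)] by (simp add: lborel_prod)
  note k2 = integrable_reflected_kernel[OF n(1) n(2)]
  have k: "integrable (lborel \<Otimes>\<^sub>M lborel) (\<lambda>(w, \<zeta>). ?K w \<zeta>)"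
  proof (rule Bochner_Integration.integrable_bound[OF Bochner_Integration.integrable_add[OF k1 k2]])
    have "(\<lambda>p. f (- snd p - fst p)) \<in> borel_measurable (lborel \<Otimes>\<^sub>M lborel)" by measurable
    then show "(\<lambda>(w, \<zeta>). ?K w \<zeta>) \<in> borel_measurable (lborel \<Otimes>\<^sub>M lborel)"
      unfolding case_prod_beta' by measurable
    have "norm (?K w \<zeta>) \<le> cmod (f w) * (cmod (?m \<zeta>))\<^sup>2 + cmod (f w) * (cmod (f (- \<zeta> - w)))\<^sup>2" for w \<zeta>
    proof -
      have "cmod (?m \<zeta>) * cmod (f (- \<zeta> - w)) \<le> (cmod (?m \<zeta>))\<^sup>2 + (cmod (f (- \<zeta> - w)))\<^sup>2"
        by (rule mult_le_sum_squares) auto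
      then have "cmod (f w) * (cmod (?m \<zeta>) * cmod (f (- \<zeta> - w))) \<le> cmod (f w) * ((cmod (?m \<zeta>))\<^sup>2 + (cmod (f (- \<zeta> - w)))\<^sup>2)"
        by (rule mult_left_mono) simp
      then show ?thesis by (simp add: norm_mult mult_ac distrib_left)
    qed
    then show "AE p in lborel \<Otimes>\<^sub>M lborel. norm (case p of (w, \<zeta>) \<Rightarrow> ?K w \<zeta>) \<le>
       norm (cmod (f (fst p)) * (cmod (?m (snd p)))\<^sup>2 + (case p of (w, \<zeta>) \<Rightarrow> cmod (f w) * (cmod (f (- \<zeta> - w)))\<^sup>2))"
      by (intro AE_I2) (auto intro: order_trans[OF _ abs_ge_self])
  qed
  define J where "J = (LINT w|lborel. LINT \<zeta>|lborel. ?K w \<zeta>)"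
  have J1: "J = (LINT \<zeta>|lborel. LINT w|lborel. ?K w \<zeta>)"
    unfolding J_def by (rule lborel_pair.Fubini_integral[OF k, symmetric])
  have ae1: "AE w in lborel. integrable lborel (\<lambda>\<zeta>. ?K w \<zeta>)" by (rule lborel_pair.AE_integrable_fst[OF k])
  have ae2: "AE \<zeta> in lborel. integrable lborel (\<lambda>w. ?K w \<zeta>)" by (rule lborel_pair.AE_integrable_snd[OF k])
  have int1: "integrable lborel (\<lambda>w. LINT \<zeta>|lborel. ?K w \<zeta>)" by (rule lborel_pair.integrable_fst[OF k])
  have int2: "integrable lborel (\<lambda>\<zeta>. LINT w|lborel. ?K w \<zeta>)" by (rule lborel_pair.integrable_snd[OF k])
  \<comment> \<open>With \<open>w\<close> fixed, the substitution
    \<open>\<zeta> \<mapsto> - w - \<zeta>\<close> exchanges the other two frequencies and trades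
    the symbol for minus the sum of the remaining ones. Integrated over \<open>w\<close> it gives
    \<open>J = - J - J\<close>.\<close>
  have sub: "(LINT \<zeta>|lborel. ?K w \<zeta>) = - (LINT \<zeta>|lborel. ?K w \<zeta>) - (LINT \<zeta>|lborel. ?K \<zeta> w)"
    if i: "integrable lborel (\<lambda>\<zeta>. ?K w \<zeta>)" "integrable lborel (\<lambda>\<zeta>. ?K \<zeta> w)" for w
  proof -
    have "(LINT \<zeta>|lborel. ?K w \<zeta>) = (LINT \<zeta>|lborel. ?K w (- w - \<zeta>))"
      using lborel_integral_affine[of "-1" "\<lambda>\<zeta>. ?K w \<zeta>" "- w"] by simp
    also have "\<dots> = (LINT \<zeta>|lborel. - ?K w \<zeta> - ?K \<zeta> w)"
    proof (rule Bochner_Integration.integral_cong[OF refl])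
      fix \<zeta>
      have e: "- (- w - \<zeta>) - w = \<zeta>" "- \<zeta> - w = - w - \<zeta>" by (auto simp: algebra_simps)
      show "?K w (- w - \<zeta>) = - ?K w \<zeta> - ?K \<zeta> w"
        unfolding e by (simp add: grad_symbol_def algebra_simps)
    qed
    also have "\<dots> = - (LINT \<zeta>|lborel. ?K w \<zeta>) - (LINT \<zeta>|lborel. ?K \<zeta> w)"
      using i by (simp del: minus_mult_left minus_mult_right)
    finally show ?thesis .
  qed
  have "J = (LINT w|lborel. - (LINT \<zeta>|lborel. ?K w \<zeta>) - (LINT \<zeta>|lborel. ?K \<zeta> w))"
    unfolding J_def
  proof (rule integral_cong_AE)
    show "AE w in lborel. (LINT \<zeta>|lborel. ?K w \<zeta>) = - (LINT \<zeta>|lborel. ?K w \<zeta>) - (LINT \<zeta>|lborel. ?K \<zeta> w)"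
      using ae1 ae2 by eventually_elim (rule sub)
  qed (use int1 int2 in auto)
  also have "\<dots> = (LINT w|lborel. - (LINT \<zeta>|lborel. ?K w \<zeta>)) - (LINT w|lborel. LINT \<zeta>|lborel. ?K \<zeta> w)"
    by (rule Bochner_Integration.integral_diff[OF Bochner_Integration.integrable_minus[OF int1] int2])
  also have "\<dots> = - J - J"
    by (simp only: Bochner_Integration.integral_minus J_def[symmetric] J1[symmetric])
  finally have "3 * J = 0" by (simp add: algebra_simps)
  then have "J = 0" by simp
  \<comment> \<open>Hermitian symmetry turns \<open>cnj (f \<zeta>)\<close> into
    \<open>f (- \<zeta>)\<close>; reflecting \<open>\<zeta>\<close> then produces the symmetric
    kernel \<open>?K\<close>.\<close>
  have "(LINT \<zeta>|lborel. cnj (f \<zeta>) * (grad_symbol \<zeta> * conv f f \<zeta>)) = (LINT \<zeta>|lborel. f (- \<zeta>) * (grad_symbol \<zeta> * conv f f \<zeta>))"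
    by (rule integral_cong_AE) (use h in \<open>auto elim!: eventually_mono\<close>)
  also have "\<dots> = (LINT \<zeta>|lborel. f \<zeta> * (grad_symbol (- \<zeta>) * conv f f (- \<zeta>)))"
    using lborel_integral_affine[of "-1" "\<lambda>\<zeta>. f (- \<zeta>) * (grad_symbol \<zeta> * conv f f \<zeta>)" 0] by simp
  also have "\<dots> = (LINT \<zeta>|lborel. (- 1 / complex_of_real (2 * pi)) * (LINT w|lborel. ?K w \<zeta>))"
  proof (rule Bochner_Integration.integral_cong[OF refl])
    fix \<zeta>
    have e: "(LINT w|lborel. ?K w \<zeta>) = ?m \<zeta> * (LINT w|lborel. f w * f (- \<zeta> - w))" by (rule integral_mult_right_zero)
    have o: "grad_symbol (- \<zeta>) = - grad_symbol \<zeta>" by (simp add: grad_symbol_def algebra_simps)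
    show "f \<zeta> * (grad_symbol (- \<zeta>) * conv f f (- \<zeta>)) = (- 1 / complex_of_real (2 * pi)) * (LINT w|lborel. ?K w \<zeta>)"
      unfolding e o conv_def by simp
  qed
  also have "\<dots> = 0" using \<open>J = 0\<close> J1 by (simp only: integral_mult_right_zero mult_zero_right)
  finally show ?thesis .
qed

text \<open>Such a function is the limit of its values at the grid times
  \<open>\<lfloor>(n + 1) t\<rfloor> / (n + 1)\<close>, and these approximations are countable
  gluings of measurable functions. It provides the joint measurability for Fubini in time and
  frequency.\<close>

lemma measurable_continuous_first:
  fixes F :: "real \<Rightarrow> plane \<Rightarrow> complex"
  assumes m: "\<And>t. F t \<in> borel_measurable borel" and c: "\<And>\<zeta>. continuous_on UNIV (\<lambda>t. F t \<zeta>)"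
  shows "case_prod F \<in> borel_measurable (lborel \<Otimes>\<^sub>M lborel)"
proof -
  define r where "r n t = real_of_int \<lfloor>real (Suc n) * t\<rfloor> / real (Suc n)" for n t
  have lim: "(\<lambda>n. r n t) \<longlonglongrightarrow> t" for t
  proof (rule LIMSEQ_I)
    fix e :: real assume "e > 0"
    then obtain N where N: "1 / real (Suc N) < e" using nat_approx_posE by blast
    have "norm (r n t - t) < e" if "n \<ge> N" for n
    proof -
      have "\<bar>real_of_int \<lfloor>real (Suc n) * t\<rfloor> - real (Suc n) * t\<bar> \<le> 1"
        using of_int_floor_le[of "real (Suc n) * t"] floor_correct[of "real (Suc n) * t"] by linarith
      then have "\<bar>real_of_int \<lfloor>real (Suc n) * t\<rfloor> - real (Suc n) * t\<bar> / real (Suc n) \<le> 1 / real (Suc n)"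
        by (rule divide_right_mono) simp
      moreover have "r n t - t = (real_of_int \<lfloor>real (Suc n) * t\<rfloor> - real (Suc n) * t) / real (Suc n)"
        unfolding r_def diff_divide_distrib by simp
      ultimately have "\<bar>r n t - t\<bar> \<le> 1 / real (Suc n)"
        by (simp add: abs_divide)
      also have "\<dots> \<le> 1 / real (Suc N)" using that by (intro divide_left_mono) auto
      finally show ?thesis using N by simp
    qed
    then show "\<exists>no. \<forall>n\<ge>no. norm (r n t - t) < e" by blast
  qed
  show ?thesis
  proof (rule borel_measurable_LIMSEQ_metric)
    show "(\<lambda>p. F (r n (fst p)) (snd p)) \<in> borel_measurable (lborel \<Otimes>\<^sub>M lborel)" for n
      unfolding r_def
    proof (rule measurable_compose_countable[where f = "\<lambda>i p. F (real_of_int i / real (Suc n)) (snd p)"])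
      show "(\<lambda>p. F (real_of_int i / real (Suc n)) (snd p)) \<in> borel_measurable (lborel \<Otimes>\<^sub>M lborel)" for i
        using m by measurable
    qed measurable
    show "(\<lambda>n. F (r n (fst p)) (snd p)) \<longlonglongrightarrow> case_prod F p" for p
    proof -
      have "isCont (\<lambda>t. F t (snd p)) (fst p)" using c by (simp add: continuous_on_eq_continuous_at)
      from isCont_tendsto_compose[OF this lim] show ?thesis by (simp add: case_prod_beta')
    qed
  qed
qed

section \<open>Paths in Sobolev spaces\<close>

lemma real_valued_minus: "real_valued u \<Longrightarrow> real_valued v \<Longrightarrow> real_valued (u - v)"
  by (auto simp: real_valued_def apply_minus)

lemma real_valued_scaleR: "real_valued u \<Longrightarrow> real_valued (c *\<^sub>R u)"
  by (auto simp: real_valued_def apply_scaleR scaleR_conv_of_real)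

lemma real_sobolev_diff: "u \<in> real_sobolev s \<Longrightarrow> v \<in> real_sobolev s \<Longrightarrow> u - v \<in> real_sobolev s"
  by (auto simp: real_sobolev_def sobolev_diff real_valued_minus)

lemma real_sobolev_scaleR: "u \<in> real_sobolev s \<Longrightarrow> c *\<^sub>R u \<in> real_sobolev s"
  by (auto simp: real_sobolev_def sobolev_scaleR real_valued_scaleR)

lemma paths_sobolev: "u \<in> paths s T \<Longrightarrow> t \<in> {0..T} \<Longrightarrow> u t \<in> sobolev s"
  by (auto simp: paths_def real_sobolev_def)

lemma paths_norm_continuous:
  assumes u: "u \<in> paths s T"
  shows "continuous_on {0..T} (\<lambda>t. sobolev_norm s (u t))"
  unfolding continuous_on_def
proof
  fix t assume t: "t \<in> {0..T}"
  show "((\<lambda>t. sobolev_norm s (u t)) \<longlongrightarrow> sobolev_norm s (u t)) (at t within {0..T})"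
  proof (rule Lim_transform_bound[THEN Lim_null[THEN iffD2]])
    show "((\<lambda>t'. sobolev_norm s (u t' - u t)) \<longlongrightarrow> 0) (at t within {0..T})"
      using u t unfolding paths_def by blast
    show "\<forall>\<^sub>F t' in at t within {0..T}. norm (sobolev_norm s (u t') - sobolev_norm s (u t)) \<le> norm (sobolev_norm s (u t' - u t))"
      unfolding eventually_at_filter
    proof (intro always_eventually allI impI)
      fix t' assume "t' \<in> {0..T}"
      then have s: "u t \<in> sobolev s" "u t' \<in> sobolev s" using u t by (auto intro: paths_sobolev)
      have "sobolev_norm s (u t') \<le> sobolev_norm s (u t' - u t) + sobolev_norm s (u t)"
        using sobolev_norm_triangle[OF sobolev_diff[OF s(2,1)] s(1)] by simp
      moreover have "sobolev_norm s (u t) \<le> sobolev_norm s (u t' - u t) + sobolev_norm s (u t')"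
        using sobolev_norm_triangle[OF sobolev_diff[OF s(1,2)] s(2)] sobolev_norm_commute[OF s] by simp
      ultimately show "norm (sobolev_norm s (u t') - sobolev_norm s (u t)) \<le> norm (sobolev_norm s (u t' - u t))"
        by simp
    qed
  qed
qed

text \<open>Without boundedness the supremum in \<open>paths_norm\<close> would not be known to
  dominate the norms at single times.\<close>

lemma paths_bdd_above:
  assumes "u \<in> paths s T" shows "bdd_above ((\<lambda>t. sobolev_norm s (u t)) ` {0..T})"
  by (intro bounded_imp_bdd_above compact_imp_bounded compact_continuous_image
      paths_norm_continuous[OF assms] compact_Icc)

lemma sobolev_norm_le_paths_norm:
  "u \<in> paths s T \<Longrightarrow> t \<in> {0..T} \<Longrightarrow> sobolev_norm s (u t) \<le> paths_norm s T u"
  unfolding paths_norm_def by (intro cSUP_upper paths_bdd_above)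

lemma paths_diff:
  assumes u: "u \<in> paths s T" and v: "v \<in> paths s T"
  shows "u - v \<in> paths s T"
  unfolding paths_def mem_Collect_eq
proof (intro conjI ballI allI impI)
  fix t assume t: "t \<in> {0..T}"
  show "(u - v) t \<in> real_sobolev s"
    using u v t by (auto simp: paths_def fun_diff_def intro!: real_sobolev_diff)
  have lim: "((\<lambda>t'. sobolev_norm s (u t' - u t) + sobolev_norm s (v t' - v t)) \<longlongrightarrow> 0 + 0) (at t within {0..T})"
    using u v t unfolding paths_def by (intro tendsto_add) blast+
  show "((\<lambda>t'. sobolev_norm s ((u - v) t' - (u - v) t)) \<longlongrightarrow> 0) (at t within {0..T})"
  proof (rule Lim_null_comparison)
    show "((\<lambda>t'. sobolev_norm s (u t' - u t) + sobolev_norm s (v t' - v t)) \<longlongrightarrow> 0) (at t within {0..T})"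
      using lim by simp
    show "\<forall>\<^sub>F t' in at t within {0..T}. norm (sobolev_norm s ((u - v) t' - (u - v) t)) \<le> sobolev_norm s (u t' - u t) + sobolev_norm s (v t' - v t)"
      unfolding eventually_at_filter
    proof (intro always_eventually allI impI)
      fix t' assume t': "t' \<in> {0..T}"
      have a: "u t' - u t \<in> sobolev s" "v t' - v t \<in> sobolev s"
        by (rule sobolev_diff[OF paths_sobolev[OF u t'] paths_sobolev[OF u t]],
            rule sobolev_diff[OF paths_sobolev[OF v t'] paths_sobolev[OF v t]])
      have e: "(u - v) t' - (u - v) t = (u t' - u t) - (v t' - v t)"
        by (simp add: fun_diff_def)
      show "norm (sobolev_norm s ((u - v) t' - (u - v) t)) \<le> sobolev_norm s (u t' - u t) + sobolev_norm s (v t' - v t)"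
        unfolding e using sobolev_norm_diff_triangle[OF a] sobolev_norm_nonneg[OF sobolev_diff[OF a]] by simp
    qed
  qed
next
  fix t assume "t \<notin> {0..T}"
  then have "u t = 0" "v t = 0" using u v unfolding paths_def by blast+
  then show "(u - v) t = 0" by (simp add: fun_diff_def)
qed

section \<open>Regular solutions on the Fourier side\<close>

lemma sq_int_mono:
  assumes g: "sq_int g" and m: "f \<in> borel_measurable borel" and le: "\<And>\<zeta>. cmod (f \<zeta>) \<le> cmod (g \<zeta>)"
  shows "sq_int f" "l2 f \<le> l2 g"
proof -
  have le2: "(cmod (f \<zeta>))\<^sup>2 \<le> (cmod (g \<zeta>))\<^sup>2" for \<zeta> by (intro power_mono le) auto
  have "integrable lborel (\<lambda>\<zeta>. (cmod (f \<zeta>))\<^sup>2)"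
    by (rule Bochner_Integration.integrable_bound[of _ "\<lambda>\<zeta>. (cmod (g \<zeta>))\<^sup>2"]) (use g m le2 in \<open>auto simp: sq_int_def\<close>)
  then show "sq_int f" using m by (simp add: sq_int_def)
  then show "l2 f \<le> l2 g"
    unfolding l2_def using g le2 by (intro real_sqrt_le_mono integral_mono) (auto simp: sq_int_def)
qed

lemma sobolev_weight_2: "sobolev_weight 2 \<zeta> = 1 + (norm \<zeta>)\<^sup>2"
  using add_pos_nonneg[OF zero_less_one zero_le_power2[of "norm \<zeta>"]] by (simp add: sobolev_weight_def)

lemma grad_symbol_le: "cmod (grad_symbol \<zeta>) \<le> 1 + (norm \<zeta>)\<^sup>2"
proof -
  have "cmod (grad_symbol \<zeta>) \<le> \<bar>fst \<zeta>\<bar> + \<bar>snd \<zeta>\<bar>"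
    by (simp add: grad_symbol_def norm_mult del: of_real_add)
  also have "\<dots> \<le> norm \<zeta> + norm \<zeta>"
    using norm_fst_le[of "fst \<zeta>" "snd \<zeta>"] norm_snd_le[of "snd \<zeta>" "fst \<zeta>"] by (intro add_mono) auto
  also have "\<dots> \<le> 1 + (norm \<zeta>)\<^sup>2"
    using sum_squares_bound[of "norm \<zeta>" 1] by simp
  finally show ?thesis .
qed

text \<open>In the plane \<open>1 / (1 + (norm \<zeta>)^2)\<close> is square integrable, so
  \<open>f\<close>, the product of this function with the weighted transform, is integrable. The
  same weight absorbs the one derivative of the equation by \<open>grad_symbol_le\<close>.\<close>

lemma weight_2_consequences:
  fixes f :: "plane \<Rightarrow> complex"
  assumes [measurable]: "f \<in> borel_measurable borel"
    and w: "sq_int (\<lambda>\<zeta>. complex_of_real (sobolev_weight 2 \<zeta>) * f \<zeta>)"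
  defines "n \<equiv> l2 (\<lambda>\<zeta>. complex_of_real (sobolev_weight 2 \<zeta>) * f \<zeta>)"
  shows "integrable lborel f"
    and "(LINT \<zeta>|lborel. cmod (f \<zeta>)) \<le> (LINT \<zeta>::plane|lborel. inverse ((1 + (norm \<zeta>)\<^sup>2)\<^sup>2)) + n\<^sup>2"
    and "sq_int f" "l2 f \<le> n" "sq_int (\<lambda>\<zeta>. grad_symbol \<zeta> * f \<zeta>)" "l2 (\<lambda>\<zeta>. grad_symbol \<zeta> * f \<zeta>) \<le> n"
proof -
  let ?g = "\<lambda>\<zeta>. complex_of_real (sobolev_weight 2 \<zeta>) * f \<zeta>"
  have c: "cmod (?g \<zeta>) = (1 + (norm \<zeta>)\<^sup>2) * cmod (f \<zeta>)" for \<zeta>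
    by (simp add: norm_mult sobolev_weight_2 del: of_real_add)
  have 1: "cmod (f \<zeta>) \<le> cmod (?g \<zeta>)" for \<zeta>
    unfolding c by (simp add: mult_le_cancel_right1)
  have 2: "cmod (grad_symbol \<zeta> * f \<zeta>) \<le> cmod (?g \<zeta>)" for \<zeta>
    unfolding c norm_mult[of "grad_symbol \<zeta>"] by (intro mult_right_mono grad_symbol_le) auto
  show "sq_int f" "l2 f \<le> n" unfolding n_def by (rule sq_int_mono[OF w _ 1], measurable)+
  show "sq_int (\<lambda>\<zeta>. grad_symbol \<zeta> * f \<zeta>)" "l2 (\<lambda>\<zeta>. grad_symbol \<zeta> * f \<zeta>) \<le> n"
    unfolding n_def by (rule sq_int_mono[OF w _ 2], measurable)+
  have b: "cmod (f \<zeta>) \<le> inverse ((1 + (norm \<zeta>)\<^sup>2)\<^sup>2) + (cmod (?g \<zeta>))\<^sup>2" for \<zeta>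
  proof -
    have p: "1 + (norm \<zeta>)\<^sup>2 > 0" by (intro add_pos_nonneg) auto
    have "cmod (f \<zeta>) = inverse (1 + (norm \<zeta>)\<^sup>2) * cmod (?g \<zeta>)"
      unfolding c using p by (simp add: field_simps)
    also have "\<dots> \<le> (inverse (1 + (norm \<zeta>)\<^sup>2))\<^sup>2 + (cmod (?g \<zeta>))\<^sup>2"
      using p by (intro mult_le_sum_squares) auto
    finally show ?thesis by (simp add: power_inverse)
  qed
  have i: "integrable lborel (\<lambda>\<zeta>::plane. inverse ((1 + (norm \<zeta>)\<^sup>2)\<^sup>2) + (cmod (?g \<zeta>))\<^sup>2)"
    using w by (intro Bochner_Integration.integrable_add integrable_weight) (simp add: sq_int_def)
  show f: "integrable lborel f"
    by (rule Bochner_Integration.integrable_bound[OF i]) (use b in \<open>auto intro: order_trans[OF _ abs_ge_self]\<close>)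
  have "(LINT \<zeta>|lborel. cmod (f \<zeta>)) \<le> (LINT \<zeta>|lborel. inverse ((1 + (norm \<zeta>)\<^sup>2)\<^sup>2) + (cmod (?g \<zeta>))\<^sup>2)"
    using f i b by (intro integral_mono) auto
  also have "\<dots> = (LINT \<zeta>::plane|lborel. inverse ((1 + (norm \<zeta>)\<^sup>2)\<^sup>2)) + n\<^sup>2"
    using w integrable_weight by (simp add: n_def l2_power2 sq_int_def)
  finally show "(LINT \<zeta>|lborel. cmod (f \<zeta>)) \<le> (LINT \<zeta>::plane|lborel. inverse ((1 + (norm \<zeta>)\<^sup>2)\<^sup>2)) + n\<^sup>2" .
qed

text \<open>Factoring out \<open>cis (t * airy \<zeta>)\<close> leaves an integrand that does not
  contain the upper limit \<open>t\<close>, so the integral can be differentiated in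
  \<open>t\<close>.\<close>

lemma retarded_eq:
  assumes c: "continuous_on UNIV (\<lambda>t. Q t \<zeta>)"
  shows "retarded Q t \<zeta> = cis (t * airy \<zeta>) * integral {0..t} (\<lambda>t'. cis (- (t' * airy \<zeta>)) * Q t' \<zeta>)"
proof -
  let ?q = "\<lambda>t'. cis (- (t' * airy \<zeta>)) * Q t' \<zeta>"
  have "continuous_on {0..t} ?q"
    by (intro continuous_intros continuous_on_cis continuous_on_subset[OF c]) auto
  then have "set_integrable lborel {0..t} ?q" by (rule borel_integrable_atLeastAtMost')
  from set_borel_integral_eq_integral(2)[OF this]
  have q: "(LINT t'|lborel. indicator {0..t} t' *\<^sub>R ?q t') = integral {0..t} ?q"
    by (simp add: set_lebesgue_integral_def)
  have "indicator {0..t} t' * (cis ((t - t') * airy \<zeta>) * Q t' \<zeta>) = cis (t * airy \<zeta>) * (indicator {0..t} t' *\<^sub>R ?q t')" for t'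
  proof -
    have "cis ((t - t') * airy \<zeta>) = cis (t * airy \<zeta>) * cis (- (t' * airy \<zeta>))"
      by (simp add: cis_mult left_diff_distrib)
    then show ?thesis by (simp add: indicator_def)
  qed
  then have "retarded Q t \<zeta> = (LINT t'|lborel. cis (t * airy \<zeta>) * (indicator {0..t} t' *\<^sub>R ?q t'))"
    by (simp only: retarded_def)
  also have "\<dots> = cis (t * airy \<zeta>) * (LINT t'|lborel. indicator {0..t} t' *\<^sub>R ?q t')"
    by (rule integral_mult_right_zero)
  finally show ?thesis unfolding q .
qed

lemma retarded_diff_bound:
  assumes c: "continuous_on UNIV (\<lambda>t. Q t \<zeta>)" "continuous_on UNIV (\<lambda>t. R t \<zeta>)" and t: "t \<ge> 0"
    and B: "\<And>t'. t' \<in> {0..t} \<Longrightarrow> cmod (Q t' \<zeta> - R t' \<zeta>) \<le> B"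
  shows "cmod (retarded Q t \<zeta> - retarded R t \<zeta>) \<le> B * t"
proof -
  let ?q = "\<lambda>Q t'. cis (- (t' * airy \<zeta>)) * Q t' \<zeta>"
  have cq: "continuous_on {0..t} (?q Q)" "continuous_on {0..t} (?q R)"
    by (intro continuous_intros continuous_on_cis continuous_on_subset[OF c(1)] continuous_on_subset[OF c(2)]; simp)+
  have "retarded Q t \<zeta> - retarded R t \<zeta> = cis (t * airy \<zeta>) * (integral {0..t} (?q Q) - integral {0..t} (?q R))"
    unfolding retarded_eq[of Q, OF c(1)] retarded_eq[of R, OF c(2)] by (simp add: right_diff_distrib)
  also have "integral {0..t} (?q Q) - integral {0..t} (?q R) = integral {0..t} (\<lambda>t'. ?q Q t' - ?q R t')"
    by (rule Henstock_Kurzweil_Integration.integral_diff[symmetric]) (intro integrable_continuous_real cq)+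
  also have "cmod (cis (t * airy \<zeta>) * integral {0..t} (\<lambda>t'. ?q Q t' - ?q R t')) = cmod (integral {0..t} (\<lambda>t'. ?q Q t' - ?q R t'))"
    by (simp add: norm_mult)
  also have "\<dots> \<le> B * (t - 0)"
  proof (rule integral_bound[OF t])
    show "continuous_on {0..t} (\<lambda>t'. ?q Q t' - ?q R t')" by (intro continuous_intros cq)
    show "norm (?q Q t' - ?q R t') \<le> B" if "t' \<in> {0..t}" for t'
      using B[OF that] by (simp add: right_diff_distrib[symmetric] norm_mult)
  qed
  finally show ?thesis by simp
qed

lemma retarded_bound:
  assumes c: "continuous_on UNIV (\<lambda>t. Q t \<zeta>)" and t: "t \<ge> 0"
    and B: "\<And>t'. t' \<in> {0..t} \<Longrightarrow> cmod (Q t' \<zeta>) \<le> B"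
  shows "cmod (retarded Q t \<zeta>) \<le> B * t"
  using retarded_diff_bound[of Q \<zeta> "\<lambda>_ _. 0" t B] assms by (simp add: retarded_def)

locale regular_flow =
  fixes T :: real and u :: "real \<Rightarrow> tdist" and u\<^sub>0 :: tdist and f\<^sub>0 :: "plane \<Rightarrow> complex"
  assumes T: "T > 0" and reg: "regular_solution T u\<^sub>0 u"
    and f0: "has_fourier u\<^sub>0 f\<^sub>0" "integrable lborel f\<^sub>0" "sq_int f\<^sub>0"
begin

text \<open>Extends the path constantly beyond \<open>[0, T]\<close>, because
  \<open>measurable_continuous_first\<close> asks for continuity on the whole line.\<close>

definition clamp_time :: "real \<Rightarrow> real" where "clamp_time t = max 0 (min T t)"

definition F :: "real \<Rightarrow> plane \<Rightarrow> complex" where "F t = (SOME f. has_fourier (u (clamp_time t)) f)"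

definition Q :: "real \<Rightarrow> plane \<Rightarrow> complex" where "Q t = conv (F t) (F t)"

definition kappa :: complex where "kappa = complex_of_real (4 powr (- 1 / 3))"

text \<open>The choice in \<open>F\<close> fixes a transform only up to null sets that may vary with
  time, so \<open>F t \<zeta>\<close> has no known regularity in \<open>t\<close>. The Duhamel
  formula gives a representative that is continuous in time at every frequency; pointwise identities
  are proved for it and norms are taken of \<open>F\<close>.\<close>

definition G :: "real \<Rightarrow> plane \<Rightarrow> complex" where
  "G t \<zeta> = cis (t * airy \<zeta>) * f\<^sub>0 \<zeta> + kappa * (grad_symbol \<zeta> * retarded Q t \<zeta>)"

lemma clamp_time: "clamp_time t \<in> {0..T}" "t \<in> {0..T} \<Longrightarrow> clamp_time t = t"
  "\<bar>clamp_time t' - clamp_time t\<bar> \<le> \<bar>t' - t\<bar>"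
  using T by (auto simp: clamp_time_def)

lemma path: "u \<in> paths 2 T"
  using reg by (simp add: regular_solution_def)

lemma F: "has_fourier (u (clamp_time t)) (F t)"
proof -
  have "u (clamp_time t) \<in> sobolev 2" using path clamp_time(1) by (rule paths_sobolev)
  then obtain f where "has_fourier (u (clamp_time t)) f" by (rule sobolevE)
  then show ?thesis unfolding F_def by (rule someI[of "has_fourier (u (clamp_time t))"])
qed

lemma F_measurable [measurable]: "F t \<in> borel_measurable borel"
  using F[of t] by (simp add: has_fourier_def)

lemma F_weight: "sq_int (\<lambda>\<zeta>. complex_of_real (sobolev_weight 2 \<zeta>) * F t \<zeta>)"
  using sobolev_iff_sq_int[OF F] paths_sobolev[OF path clamp_time(1)] by blast

lemmas F_props = weight_2_consequences[OF F_measurable F_weight]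

text \<open>A single constant for all times, from the sup norm of the path in \<open>H^2\<close>. It
  only serves the Fubini arguments of one solution and may depend on that solution.\<close>

lemma F_bounds:
  obtains C where "C \<ge> 0" "\<And>t. l2 (F t) \<le> C" "\<And>t. (LINT \<zeta>|lborel. cmod (F t \<zeta>)) \<le> C"
    "\<And>t. l2 (\<lambda>\<zeta>. grad_symbol \<zeta> * F t \<zeta>) \<le> C"
proof -
  let ?W = "LINT \<zeta>::plane|lborel. inverse ((1 + (norm \<zeta>)\<^sup>2)\<^sup>2)"
  let ?n = "\<lambda>t. l2 (\<lambda>\<zeta>. complex_of_real (sobolev_weight 2 \<zeta>) * F t \<zeta>)"
  define M where "M = paths_norm 2 T u"
  have n: "?n t \<le> M" for t
    using sobolev_norm_le_paths_norm[OF path clamp_time(1), of t] sobolev_norm_eq_l2[OF F[of t], of 2]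
    by (simp add: M_def)
  have M0: "M \<ge> 0" using order_trans[OF l2_nonneg n] .
  have W0: "?W \<ge> 0" by simp
  show ?thesis
  proof (rule that[of "?W + M\<^sup>2 + M"])
    show "0 \<le> ?W + M\<^sup>2 + M" using M0 W0 by simp
    fix t
    have "?W + M\<^sup>2 \<ge> 0" using W0 by simp
    then show "l2 (F t) \<le> ?W + M\<^sup>2 + M" "l2 (\<lambda>\<zeta>. grad_symbol \<zeta> * F t \<zeta>) \<le> ?W + M\<^sup>2 + M"
      using F_props(4)[of t] F_props(6)[of t] n[of t] by linarith+
    have "(?n t)\<^sup>2 \<le> M\<^sup>2" by (intro power_mono n) auto
    then show "(LINT \<zeta>|lborel. cmod (F t \<zeta>)) \<le> ?W + M\<^sup>2 + M"
      using F_props(2)[of t] M0 by linarith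
  qed
qed

lemma F_continuous:
  assumes "e > 0"
  obtains d where "d > 0" "\<And>t'. \<bar>t' - t\<bar> < d \<Longrightarrow> l2 (\<lambda>\<zeta>. F t' \<zeta> - F t \<zeta>) < e"
proof -
  have "((\<lambda>t'. sobolev_norm 2 (u t' - u (clamp_time t))) \<longlongrightarrow> 0) (at (clamp_time t) within {0..T})"
    using path clamp_time(1)[of t] unfolding paths_def by blast
  from tendstoD[OF this assms] obtain d where d: "d > 0"
    "\<And>x. x \<in> {0..T} \<Longrightarrow> x \<noteq> clamp_time t \<Longrightarrow> dist x (clamp_time t) < d \<Longrightarrow> dist (sobolev_norm 2 (u x - u (clamp_time t))) 0 < e"
    unfolding eventually_at by auto
  have "l2 (\<lambda>\<zeta>. F t' \<zeta> - F t \<zeta>) < e" if t': "\<bar>t' - t\<bar> < d" for t'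
  proof -
    have fd: "has_fourier (u (clamp_time t') - u (clamp_time t)) (\<lambda>\<zeta>. F t' \<zeta> - F t \<zeta>)"
      by (rule has_fourier_minus[OF F F])
    have "u (clamp_time t') - u (clamp_time t) \<in> sobolev 2"
      by (intro sobolev_diff paths_sobolev[OF path] clamp_time)
    then have w: "sq_int (\<lambda>\<zeta>. complex_of_real (sobolev_weight 2 \<zeta>) * (F t' \<zeta> - F t \<zeta>))"
      using sobolev_iff_sq_int[OF fd] by blast
    have "l2 (\<lambda>\<zeta>. F t' \<zeta> - F t \<zeta>) \<le> sobolev_norm 2 (u (clamp_time t') - u (clamp_time t))"
      unfolding sobolev_norm_eq_l2[OF fd] by (rule weight_2_consequences(4)[OF _ w]) measurable
    also have "\<dots> < e"
    proof (cases "clamp_time t' = clamp_time t")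
      case True then show ?thesis using assms sobolev_zero(2)[of 2] by simp
    next
      case False
      then show ?thesis
        using d(2)[of "clamp_time t'"] clamp_time(1)[of t'] clamp_time(3)[of t' t] t' by (auto simp: dist_real_def)
    qed
    finally show ?thesis .
  qed
  then show ?thesis using d(1) that by blast
qed

lemma Q_integrable: "integrable lborel (Q t)"
  unfolding Q_def by (intro integrable_conv F_props)

lemma Q_measurable [measurable]: "Q t \<in> borel_measurable borel"
  using Q_integrable[of t] by auto

text \<open>\<open>conv\<close> ignores null sets and is continuous with respect to
  \<open>L^2\<close>, so \<open>Q\<close> is continuous in time at each frequency although its
  argument \<open>F\<close> need not be.\<close>

lemma Q_continuous: "continuous_on UNIV (\<lambda>t. Q t \<zeta>)"
  unfolding continuous_on_iff
proof (intro ballI allI impI)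
  fix t e :: real assume e: "e > 0"
  obtain C where C: "C \<ge> 0" "\<And>t. l2 (F t) \<le> C" using F_bounds by metis
  obtain d where d: "d > 0" "\<And>t'. \<bar>t' - t\<bar> < d \<Longrightarrow> l2 (\<lambda>\<zeta>. F t' \<zeta> - F t \<zeta>) < e / (2 * C + 1)"
    using F_continuous[of "e / (2 * C + 1)" t] e C(1) by (metis add_nonneg_pos divide_pos_pos mult_nonneg_nonneg zero_le_numeral zero_less_one)
  have "dist (Q t' \<zeta>) (Q t \<zeta>) < e" if "dist t' t < d" for t'
  proof -
    have "cmod (Q t' \<zeta> - Q t \<zeta>) \<le> l2 (\<lambda>\<zeta>. F t' \<zeta> - F t \<zeta>) * (l2 (F t') + l2 (F t))"
      unfolding Q_def by (rule conv_diff_bound[OF F_props(3) F_props(3)])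
    also have "\<dots> \<le> l2 (\<lambda>\<zeta>. F t' \<zeta> - F t \<zeta>) * (2 * C + 1)"
      using C(2)[of t'] C(2)[of t] by (intro mult_left_mono) auto
    also have "\<dots> < e / (2 * C + 1) * (2 * C + 1)"
      using d(2)[of t'] that C(1) by (intro mult_strict_right_mono) (auto simp: dist_real_def)
    also have "\<dots> = e" using C(1) by simp
    finally show ?thesis by (simp add: dist_norm)
  qed
  then show "\<exists>d>0. \<forall>t'\<in>UNIV. dist t' t < d \<longrightarrow> dist (Q t' \<zeta>) (Q t \<zeta>) < e"
    using d(1) by blast
qed

lemma Q_jointly_measurable: "case_prod Q \<in> borel_measurable (lborel \<Otimes>\<^sub>M lborel)"
  by (rule measurable_continuous_first[OF Q_measurable Q_continuous])

lemma Q_bound: "cmod (Q t \<zeta>) \<le> (l2 (F t))\<^sup>2"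
proof -
  have "cmod (Q t \<zeta>) \<le> l2 (F t) * l2 (F t) / (2 * pi)"
    unfolding Q_def by (rule conv_bound(2)[OF F_props(3) F_props(3)])
  also have "\<dots> \<le> l2 (F t) * l2 (F t) / 1"
    using pi_ge_two by (intro divide_left_mono) auto
  finally show ?thesis by (simp add: power2_eq_square)
qed

lemma has_fourier_G:
  assumes t: "t \<in> {0..T}" shows "has_fourier (u t) (G t)"
proof -
  obtain C where C: "C \<ge> 0" "\<And>t. (LINT \<zeta>|lborel. cmod (F t \<zeta>)) \<le> C" using F_bounds by metis
  have "has_fourier (duhamel_term u t) (\<lambda>\<zeta>. kappa * (grad_symbol \<zeta> * retarded Q t \<zeta>))"
    unfolding kappa_def
  proof (rule has_fourier_duhamel[where f = F and C = "C * C"])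
    fix t' assume t': "t' \<in> {0..t}"
    then have "clamp_time t' = t'" using t by (intro clamp_time) auto
    then show "has_fourier (u t') (F t')" using F[of t'] by simp
    show "integrable lborel (F t')" by (rule F_props)
    show "Q t' = conv (F t') (F t')" by (rule Q_def)
    have "(LINT \<zeta>|lborel. cmod (Q t' \<zeta>)) \<le> (LINT \<zeta>|lborel. cmod (F t' \<zeta>)) * (LINT \<zeta>|lborel. cmod (F t' \<zeta>)) / (2 * pi)"
      unfolding Q_def by (intro conv_L1_bound F_props)
    also have "\<dots> \<le> (LINT \<zeta>|lborel. cmod (F t' \<zeta>)) * (LINT \<zeta>|lborel. cmod (F t' \<zeta>)) / 1"
      using pi_ge_two by (intro divide_left_mono mult_nonneg_nonneg) auto
    also have "\<dots> \<le> C * C" using C(2)[of t'] C(1) by (auto intro!: mult_mono)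
    finally show "(LINT \<zeta>|lborel. cmod (Q t' \<zeta>)) \<le> C * C" .
  qed (rule Q_jointly_measurable)
  moreover have "has_fourier (propagator t u\<^sub>0) (\<lambda>\<zeta>. cis (t * airy \<zeta>) * f\<^sub>0 \<zeta>)"
    by (rule propagator_fdist[OF f0(1,2)])
  moreover have "u t = propagator t u\<^sub>0 + duhamel_term u t"
    using reg t by (simp add: regular_solution_def)
  ultimately show ?thesis
    using has_fourier_add[of "propagator t u\<^sub>0" _ "duhamel_term u t"] by (simp add: G_def[abs_def])
qed

lemma G_measurable [measurable]: "t \<in> {0..T} \<Longrightarrow> G t \<in> borel_measurable borel"
  using has_fourier_G by (auto simp: has_fourier_def)

lemma F_eq_G: "t \<in> {0..T} \<Longrightarrow> AE \<zeta> in lborel. F t \<zeta> = G t \<zeta>"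
  using has_fourier_unique[OF F[of t]] has_fourier_G[of t] clamp_time(2)[of t] by simp

lemma F_hermitian: "AE \<zeta> in lborel. F t (- \<zeta>) = cnj (F t \<zeta>)"
proof (rule real_valued_hermitian[OF _ F])
  show "real_valued (u (clamp_time t))"
    using path clamp_time(1)[of t] unfolding paths_def real_sobolev_def by blast
qed

section \<open>Conservation of the \<open>L^2\<close> norm\<close>

definition energy_rate :: "real \<Rightarrow> plane \<Rightarrow> real" where
  "energy_rate t \<zeta> = 2 * Re (cnj (G t \<zeta>) * (kappa * (grad_symbol \<zeta> * Q t \<zeta>)))"

lemma G_continuous: "continuous_on {0..T} (\<lambda>t. G t \<zeta>)"
proof -
  let ?q = "\<lambda>t'. cis (- (t' * airy \<zeta>)) * Q t' \<zeta>"
  have cq: "continuous_on {0..T} ?q"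
    by (intro continuous_intros continuous_on_cis continuous_on_subset[OF Q_continuous]) auto
  have "continuous_on {0..T} (\<lambda>t. integral {0..t} ?q)"
    by (intro indefinite_integral_continuous_1 integrable_continuous_real cq)
  then show ?thesis
    unfolding G_def retarded_eq[OF Q_continuous]
    by (intro continuous_intros continuous_on_cis)
qed

text \<open>The phase drops out of \<open>|G|^2\<close>, and the remaining amplitude
  \<open>a\<close> is differentiable in time with derivative \<open>?b * ?q t\<close>. The identity
  is the fundamental theorem of calculus for \<open>a \<bullet> a\<close>, whose derivative is
  \<open>energy_rate\<close>.\<close>

lemma energy_density:
  assumes t: "t \<in> {0..T}"
  shows "(LINT t'|lborel. indicator {0..t} t' * energy_rate t' \<zeta>) = (cmod (G t \<zeta>))\<^sup>2 - (cmod (f\<^sub>0 \<zeta>))\<^sup>2"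
proof -
  let ?q = "\<lambda>t'. cis (- (t' * airy \<zeta>)) * Q t' \<zeta>"
  let ?b = "kappa * grad_symbol \<zeta>"
  define a where "a t = f\<^sub>0 \<zeta> + ?b * integral {0..t} ?q" for t
  have Ga: "G t \<zeta> = cis (t * airy \<zeta>) * a t" for t
    unfolding G_def retarded_eq[OF Q_continuous] a_def by (simp add: algebra_simps)
  have cq: "continuous_on {0..t} ?q"
    by (intro continuous_intros continuous_on_cis continuous_on_subset[OF Q_continuous]) auto
  have da: "(a has_vector_derivative ?b * ?q t') (at t' within {0..t})" if "t' \<in> {0..t}" for t'
    unfolding a_def
    using has_vector_derivative_add[OF has_vector_derivative_const
        has_vector_derivative_mult_right[OF integral_has_vector_derivative[OF cq that], of ?b]]
    by simp
  have "((\<lambda>t'. a t' \<bullet> (?b * ?q t') + (?b * ?q t') \<bullet> a t') has_integral (a t \<bullet> a t - a 0 \<bullet> a 0)) {0..t}"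
  proof (rule fundamental_theorem_of_calculus)
    show "0 \<le> t" using t by simp
    show "((\<lambda>t. a t \<bullet> a t) has_vector_derivative a t' \<bullet> (?b * ?q t') + (?b * ?q t') \<bullet> a t') (at t' within {0..t})"
      if "t' \<in> {0..t}" for t'
      by (rule bounded_bilinear.has_vector_derivative[OF bounded_bilinear_inner da da]) (rule that)+
  qed
  moreover have "a t' \<bullet> (?b * ?q t') + (?b * ?q t') \<bullet> a t' = energy_rate t' \<zeta>" for t'
  proof -
    have i: "x \<bullet> y = Re (cnj x * y)" for x y :: complex by (simp add: inner_complex_def)
    have c: "cnj (cis \<theta> * x) * y = cnj x * (cis (- \<theta>) * y)" for \<theta> x y
      by (simp add: cis_cnj)
    have "energy_rate t' \<zeta> = 2 * Re (cnj (a t') * (?b * ?q t'))"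
      unfolding energy_rate_def Ga c by (simp add: mult_ac)
    then show ?thesis by (simp add: inner_commute[of _ "a t'"] i[of "a t'"])
  qed
  ultimately have "((\<lambda>t'. energy_rate t' \<zeta>) has_integral (a t \<bullet> a t - a 0 \<bullet> a 0)) {0..t}"
    by simp
  then have int: "integral {0..t} (\<lambda>t'. energy_rate t' \<zeta>) = (cmod (a t))\<^sup>2 - (cmod (a 0))\<^sup>2"
    by (simp add: integral_unique power2_norm_eq_inner)
  have "continuous_on {0..t} (\<lambda>t'. energy_rate t' \<zeta>)"
    unfolding energy_rate_def
    using t by (intro continuous_intros continuous_on_cnj continuous_on_subset[OF G_continuous] continuous_on_subset[OF Q_continuous]) auto
  then have "set_integrable lborel {0..t} (\<lambda>t'. energy_rate t' \<zeta>)" by (rule borel_integrable_atLeastAtMost')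
  from set_borel_integral_eq_integral(2)[OF this]
  show ?thesis using int by (simp add: set_lebesgue_integral_def Ga norm_mult a_def)
qed

text \<open>At a fixed time \<open>G\<close> may be replaced by \<open>F\<close> almost everywhere,
  which turns the rate into the trilinear form; the cancellation then applies. The bound on the
  absolute value prepares the exchange of integrals.\<close>

lemma energy_rate_integral:
  assumes t: "t \<in> {0..T}"
  shows "integrable lborel (energy_rate t)" "(LINT \<zeta>|lborel. energy_rate t \<zeta>) = 0"
    "(LINT \<zeta>|lborel. \<bar>energy_rate t \<zeta>\<bar>) \<le>
      2 * cmod kappa * ((LINT \<zeta>|lborel. cmod (F t \<zeta>)) * ((l2 (\<lambda>\<zeta>. grad_symbol \<zeta> * F t \<zeta>))\<^sup>2 + (l2 (F t))\<^sup>2))"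
proof -
  have [measurable]: "G t \<in> borel_measurable borel" using t by (rule G_measurable)
  let ?k = "\<lambda>\<zeta>. cnj (F t \<zeta>) * (grad_symbol \<zeta> * conv (F t) (F t) \<zeta>)"
  note tb = trilinear_bound[OF F_props(1,3,5), of t]
  have km: "?k \<in> borel_measurable lborel" using tb(1) by auto
  have ae: "AE \<zeta> in lborel. energy_rate t \<zeta> = 2 * Re (kappa * ?k \<zeta>)"
    using F_eq_G[OF t] by eventually_elim (simp add: energy_rate_def Q_def mult_ac)
  have em: "energy_rate t \<in> borel_measurable lborel" unfolding energy_rate_def[abs_def] by measurable
  have ik: "integrable lborel (\<lambda>\<zeta>. 2 * Re (kappa * ?k \<zeta>))"
    using tb(1) by (intro integrable_mult_right integrable_Re)
  show "integrable lborel (energy_rate t)"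
    using integrable_cong_AE[OF em _ ae] ik by auto
  have "(LINT \<zeta>|lborel. energy_rate t \<zeta>) = (LINT \<zeta>|lborel. 2 * Re (kappa * ?k \<zeta>))"
    using integral_cong_AE[OF em _ ae] ik by auto
  also have "\<dots> = 2 * Re (kappa * (LINT \<zeta>|lborel. ?k \<zeta>))"
    using tb(1) integral_Re[of lborel "\<lambda>\<zeta>. kappa * ?k \<zeta>"] by (simp only: integral_mult_right_zero integrable_mult_right)
  also have "\<dots> = 0"
    unfolding trilinear_cancellation[OF F_props(1,3,5) F_hermitian] by simp
  finally show "(LINT \<zeta>|lborel. energy_rate t \<zeta>) = 0" .
  have "(LINT \<zeta>|lborel. \<bar>energy_rate t \<zeta>\<bar>) \<le> (LINT \<zeta>|lborel. 2 * cmod kappa * cmod (?k \<zeta>))"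
  proof (rule integral_mono_AE)
    show "integrable lborel (\<lambda>\<zeta>. \<bar>energy_rate t \<zeta>\<bar>)" using \<open>integrable lborel (energy_rate t)\<close> by auto
    show "integrable lborel (\<lambda>\<zeta>. 2 * cmod kappa * cmod (?k \<zeta>))" using tb(1) by (intro integrable_mult_right integrable_norm)
    show "AE \<zeta> in lborel. \<bar>energy_rate t \<zeta>\<bar> \<le> 2 * cmod kappa * cmod (?k \<zeta>)"
      using ae
    proof eventually_elim
      case (elim \<zeta>)
      have "\<bar>Re (kappa * ?k \<zeta>)\<bar> \<le> cmod kappa * cmod (?k \<zeta>)"
        using abs_Re_le_cmod[of "kappa * ?k \<zeta>"] unfolding norm_mult .
      then show ?case unfolding elim by linarith
    qed
  qed
  also have "\<dots> = 2 * cmod kappa * (LINT \<zeta>|lborel. cmod (?k \<zeta>))" by (rule integral_mult_right_zero)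
  also have "\<dots> \<le> 2 * cmod kappa * ((LINT \<zeta>|lborel. cmod (F t \<zeta>)) * ((l2 (\<lambda>\<zeta>. grad_symbol \<zeta> * F t \<zeta>))\<^sup>2 + (l2 (F t))\<^sup>2))"
    by (intro mult_left_mono tb(2)) auto
  finally show "(LINT \<zeta>|lborel. \<bar>energy_rate t \<zeta>\<bar>) \<le>
      2 * cmod kappa * ((LINT \<zeta>|lborel. cmod (F t \<zeta>)) * ((l2 (\<lambda>\<zeta>. grad_symbol \<zeta> * F t \<zeta>))\<^sup>2 + (l2 (F t))\<^sup>2))" .
qed

text \<open>No time derivative of the norm is taken. The energy identity at each frequency is
  integrated over frequencies, and Fubini moves this integral inside the time integral, where it
  vanishes at every time.\<close>

theorem l2_conservation:
  assumes t: "t \<in> {0..T}" shows "l2 (F t) = l2 f\<^sub>0"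
proof -
  obtain C where C: "C \<ge> 0" "\<And>t. l2 (F t) \<le> C" "\<And>t. (LINT \<zeta>|lborel. cmod (F t \<zeta>)) \<le> C"
    "\<And>t. l2 (\<lambda>\<zeta>. grad_symbol \<zeta> * F t \<zeta>) \<le> C" using F_bounds by metis
  define B where "B = 2 * cmod kappa * (C * (C\<^sup>2 + C\<^sup>2))"
  have B0: "B \<ge> 0" using C(1) by (simp add: B_def)
  let ?R = "\<lambda>t' \<zeta>. indicator {0..t} t' * energy_rate t' \<zeta>"
  have Gm: "case_prod (\<lambda>t'. G (clamp_time t')) \<in> borel_measurable (lborel \<Otimes>\<^sub>M lborel)"
  proof (rule measurable_continuous_first)
    show "G (clamp_time t') \<in> borel_measurable borel" for t' by (intro G_measurable clamp_time)
    have "continuous_on UNIV clamp_time" unfolding clamp_time_def by (intro continuous_intros)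
    then show "continuous_on UNIV (\<lambda>t'. G (clamp_time t') \<zeta>)" for \<zeta>
      using clamp_time(1) by (intro continuous_on_compose2[OF G_continuous]) auto
  qed
  have Rm: "(\<lambda>(t', \<zeta>). ?R t' \<zeta>) \<in> borel_measurable (lborel \<Otimes>\<^sub>M lborel)"
  proof -
    have [measurable]: "(\<lambda>p. G (clamp_time (fst p)) (snd p)) \<in> borel_measurable (lborel \<Otimes>\<^sub>M lborel)"
      "(\<lambda>p. Q (fst p) (snd p)) \<in> borel_measurable (lborel \<Otimes>\<^sub>M lborel)"
      using Gm Q_jointly_measurable by (simp_all add: case_prod_beta')
    \<comment> \<open>The indicator restricts \<open>t'\<close> to \<open>[0, t]\<close>, where
      clamping changes nothing, and joint measurability is known for the clamped version of
      \<open>G\<close>.\<close>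
    have "(\<lambda>(t', \<zeta>). ?R t' \<zeta>) = (\<lambda>p. indicator {0..t} (fst p) * (2 * Re (cnj (G (clamp_time (fst p)) (snd p)) * (kappa * (grad_symbol (snd p) * Q (fst p) (snd p))))))"
      using t clamp_time(2) by (auto simp: energy_rate_def indicator_def fun_eq_iff)
    then show ?thesis by simp
  qed
  have i1: "integrable lborel (\<lambda>\<zeta>. ?R t' \<zeta>)" for t'
    using energy_rate_integral(1)[of t'] t by (cases "t' \<in> {0..t}") auto
  have RI: "integrable (lborel \<Otimes>\<^sub>M lborel) (\<lambda>(t', \<zeta>). ?R t' \<zeta>)"
  proof (rule lborel_pair.Fubini_integrable[OF Rm])
    show "integrable lborel (\<lambda>t'. LINT \<zeta>|lborel. norm (case (t', \<zeta>) of (t', \<zeta>) \<Rightarrow> ?R t' \<zeta>))"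
    proof (rule Bochner_Integration.integrable_bound)
      show "integrable lborel (\<lambda>t'. indicator {0..t} t' * B :: real)"
        by (intro integrable_mult_left) (auto intro!: integrable_real_indicator simp: emeasure_lborel_Icc_eq)
      show "(\<lambda>t'. LINT \<zeta>|lborel. norm (case (t', \<zeta>) of (t', \<zeta>) \<Rightarrow> ?R t' \<zeta>)) \<in> borel_measurable lborel"
        using Rm by measurable
      have le: "(LINT \<zeta>|lborel. \<bar>energy_rate t' \<zeta>\<bar>) \<le> B" if "t' \<in> {0..t}" for t'
      proof -
        have "(LINT \<zeta>|lborel. cmod (F t' \<zeta>)) * ((l2 (\<lambda>\<zeta>. grad_symbol \<zeta> * F t' \<zeta>))\<^sup>2 + (l2 (F t'))\<^sup>2) \<le> C * (C\<^sup>2 + C\<^sup>2)"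
          using C by (intro mult_mono add_mono power_mono) auto
        then have "2 * cmod kappa * ((LINT \<zeta>|lborel. cmod (F t' \<zeta>)) * ((l2 (\<lambda>\<zeta>. grad_symbol \<zeta> * F t' \<zeta>))\<^sup>2 + (l2 (F t'))\<^sup>2)) \<le> B"
          unfolding B_def by (rule mult_left_mono) simp
        then show ?thesis using energy_rate_integral(3)[of t'] that t by auto
      qed
      then show "AE t' in lborel. norm (LINT \<zeta>|lborel. norm (case (t', \<zeta>) of (t', \<zeta>) \<Rightarrow> ?R t' \<zeta>)) \<le> norm (indicator {0..t} t' * B)"
        using B0 by (intro AE_I2) (auto simp: indicator_def)
    qed
    show "AE t' in lborel. integrable lborel (\<lambda>\<zeta>. case (t', \<zeta>) of (t', \<zeta>) \<Rightarrow> ?R t' \<zeta>)"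
      using i1 by simp
  qed
  have "(LINT \<zeta>|lborel. (cmod (G t \<zeta>))\<^sup>2 - (cmod (f\<^sub>0 \<zeta>))\<^sup>2) = (LINT \<zeta>|lborel. LINT t'|lborel. ?R t' \<zeta>)"
    by (simp only: energy_density[OF t])
  also have "\<dots> = (LINT t'|lborel. LINT \<zeta>|lborel. ?R t' \<zeta>)"
    by (rule lborel_pair.Fubini_integral[OF RI])
  also have "(\<lambda>t'. LINT \<zeta>|lborel. ?R t' \<zeta>) = (\<lambda>t'. 0)"
  proof
    fix t'
    show "(LINT \<zeta>|lborel. ?R t' \<zeta>) = 0"
      using energy_rate_integral(2)[of t'] t by (cases "t' \<in> {0..t}") auto
  qed
  finally have z: "(LINT \<zeta>|lborel. (cmod (G t \<zeta>))\<^sup>2 - (cmod (f\<^sub>0 \<zeta>))\<^sup>2) = 0" by simp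
  have [measurable]: "G t \<in> borel_measurable borel" using t by (rule G_measurable)
  have l: "l2 (F t) = l2 (G t)" by (rule l2_cong_AE[OF _ _ F_eq_G[OF t]]) measurable
  have "AE \<zeta> in lborel. (cmod (F t \<zeta>))\<^sup>2 = (cmod (G t \<zeta>))\<^sup>2"
    using F_eq_G[OF t] by eventually_elim simp
  then have "integrable lborel (\<lambda>\<zeta>. (cmod (G t \<zeta>))\<^sup>2)"
    using F_props(3)[of t] unfolding sq_int_def by (subst integrable_cong_AE[symmetric]) auto
  then have "(l2 (G t))\<^sup>2 = (l2 f\<^sub>0)\<^sup>2"
    using z f0(3) by (simp add: l2_power2 sq_int_def)
  then show ?thesis unfolding l by simp
qed

end

section \<open>The second Picard iterate\<close>

definition free_flow :: "(plane \<Rightarrow> complex) \<Rightarrow> real \<Rightarrow> plane \<Rightarrow> complex" where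
  "free_flow h t \<zeta> = cis (t * airy \<zeta>) * h \<zeta>"

text \<open>The coefficient of \<open>\<tau>^2\<close> in the solution with datum
  \<open>\<tau> h\<close>; the second derivative of the solution map is twice this.\<close>

definition picard2 :: "(plane \<Rightarrow> complex) \<Rightarrow> real \<Rightarrow> plane \<Rightarrow> complex" where
  "picard2 h t \<zeta> = complex_of_real (4 powr (- 1 / 3)) *
     (grad_symbol \<zeta> * retarded (\<lambda>t'. conv (free_flow h t') (free_flow h t')) t \<zeta>)"

lemma sq_int_free_flow:
  assumes "sq_int h" shows "sq_int (free_flow h t)" "l2 (free_flow h t) = l2 h"
proof -
  have [measurable]: "h \<in> borel_measurable borel" using assms by (simp add: sq_int_def)
  have "(\<lambda>\<zeta>. cis (t * airy \<zeta>) * h \<zeta>) \<in> borel_measurable borel" by measurable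
  then show "sq_int (free_flow h t)"
    using assms by (simp add: sq_int_def free_flow_def[abs_def] norm_mult)
  show "l2 (free_flow h t) = l2 h" by (simp add: l2_def free_flow_def norm_mult)
qed

lemma conv_free_flow_continuous:
  assumes h: "sq_int h"
  shows "continuous_on UNIV (\<lambda>t. conv (free_flow h t) (free_flow h t) \<zeta>)"
proof -
  have "isCont (\<lambda>t. LINT w|lborel. free_flow h t w * free_flow h t (\<zeta> - w)) t" for t
    unfolding continuous_at_sequentially comp_def
  proof (intro allI impI)
    fix x :: "nat \<Rightarrow> real" assume x: "x \<longlonglongrightarrow> t"
    have m: "(\<lambda>w. free_flow h t w * free_flow h t (\<zeta> - w)) \<in> borel_measurable lborel" for t
      using conv_bound(1)[OF sq_int_free_flow(1)[OF h] sq_int_free_flow(1)[OF h]] by (rule borel_measurable_integrable)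
    show "(\<lambda>n. LINT w|lborel. free_flow h (x n) w * free_flow h (x n) (\<zeta> - w)) \<longlonglongrightarrow>
        (LINT w|lborel. free_flow h t w * free_flow h t (\<zeta> - w))"
    proof (rule integral_dominated_convergence[OF m m])
      show "integrable lborel (\<lambda>w. cmod (h w * h (\<zeta> - w)))"
        by (intro integrable_norm conv_bound(1) h)
      have "(\<lambda>n. cis (x n * y)) \<longlonglongrightarrow> cis (t * y)" for y
        unfolding cis_conv_exp by (intro tendsto_intros x)
      then show "AE w in lborel. (\<lambda>n. free_flow h (x n) w * free_flow h (x n) (\<zeta> - w)) \<longlonglongrightarrow> free_flow h t w * free_flow h t (\<zeta> - w)"
        unfolding free_flow_def by (intro AE_I2 tendsto_mult tendsto_const)
      show "AE w in lborel. norm (free_flow h (x n) w * free_flow h (x n) (\<zeta> - w)) \<le> cmod (h w * h (\<zeta> - w))" for n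
        by (simp add: free_flow_def norm_mult)
    qed
  qed
  then show ?thesis
    unfolding conv_def by (intro continuous_intros) (auto simp: continuous_on_eq_continuous_at)
qed

lemma retarded_cmult: "retarded (\<lambda>t \<zeta>. c * Q t \<zeta>) t \<zeta> = c * retarded Q t \<zeta>"
proof -
  have "(\<lambda>t'. indicator {0..t} t' * (cis ((t - t') * airy \<zeta>) * (c * Q t' \<zeta>))) =
    (\<lambda>t'. c * (indicator {0..t} t' * (cis ((t - t') * airy \<zeta>) * Q t' \<zeta>)))"
    by (auto simp: mult_ac)
  then show ?thesis unfolding retarded_def by (simp only: integral_mult_right_zero)
qed

lemma conv_cmult: "conv (\<lambda>\<zeta>. c * f \<zeta>) (\<lambda>\<zeta>. c * f \<zeta>) \<zeta> = c * c * conv f f \<zeta>"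
proof -
  have "(\<lambda>w. (c * f w) * (c * f (\<zeta> - w))) = (\<lambda>w. (c * c) * (f w * f (\<zeta> - w)))" by (auto simp: mult_ac)
  then show ?thesis unfolding conv_def by (simp only: integral_mult_right_zero) simp
qed

lemma retarded_measurable:
  assumes [measurable]: "case_prod Q \<in> borel_measurable (lborel \<Otimes>\<^sub>M lborel)"
  shows "retarded Q t \<in> borel_measurable borel"
proof -
  have "(\<lambda>p. case_prod Q (snd p, fst p)) \<in> borel_measurable (lborel \<Otimes>\<^sub>M lborel)" by measurable
  then have [measurable]: "(\<lambda>p. Q (snd p) (fst p)) \<in> borel_measurable (lborel \<Otimes>\<^sub>M lborel)" by simp
  have "(\<lambda>(\<zeta>, t'). indicator {0..t} t' * (cis ((t - t') * airy \<zeta>) * Q t' \<zeta>)) \<in> borel_measurable (lborel \<Otimes>\<^sub>M lborel)"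
    unfolding case_prod_beta' by measurable
  from lborel.borel_measurable_lebesgue_integral[OF this]
  show ?thesis by (simp add: retarded_def[abs_def])
qed

lemma picard2_measurable:
  assumes h: "integrable lborel h" "sq_int h"
  shows "picard2 h t \<in> borel_measurable borel"
proof -
  let ?Q = "\<lambda>t'. conv (free_flow h t') (free_flow h t')"
  have "?Q t' \<in> borel_measurable borel" for t'
    using integrable_conv[OF integrable_cis_airy[OF h(1)] integrable_cis_airy[OF h(1)], of t' t']
    unfolding free_flow_def[abs_def] by auto
  then have "case_prod ?Q \<in> borel_measurable (lborel \<Otimes>\<^sub>M lborel)"
    by (rule measurable_continuous_first[OF _ conv_free_flow_continuous[OF h(2)]])
  note [measurable] = retarded_measurable[OF this]
  show ?thesis unfolding picard2_def[abs_def] by measurable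
qed

text \<open>A crude bound with linear growth in the frequency; it makes pairings with Schwartz
  functions finite.\<close>

lemma picard2_bound:
  assumes h: "sq_int h" and t: "t \<in> {0..T}"
  shows "cmod (picard2 h t \<zeta>) \<le> 4 powr (- 1 / 3) * ((l2 h)\<^sup>2 * T) * cmod (grad_symbol \<zeta>)"
proof -
  let ?Q = "\<lambda>t'. conv (free_flow h t') (free_flow h t')"
  have "cmod (?Q t' \<zeta>) \<le> (l2 h)\<^sup>2" for t'
  proof -
    have "cmod (?Q t' \<zeta>) \<le> l2 h * l2 h / (2 * pi)"
      using conv_bound(2)[OF sq_int_free_flow(1)[OF h] sq_int_free_flow(1)[OF h]] by (simp add: sq_int_free_flow(2)[OF h])
    also have "\<dots> \<le> l2 h * l2 h / 1" using pi_ge_two by (intro divide_left_mono) auto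
    finally show ?thesis by (simp add: power2_eq_square)
  qed
  then have "cmod (retarded ?Q t \<zeta>) \<le> (l2 h)\<^sup>2 * t"
    using t by (intro retarded_bound conv_free_flow_continuous h) auto
  also have "\<dots> \<le> (l2 h)\<^sup>2 * T" using t by (intro mult_left_mono) auto
  finally have "4 powr (- 1 / 3) * (cmod (grad_symbol \<zeta>) * cmod (retarded ?Q t \<zeta>)) \<le> 4 powr (- 1 / 3) * (cmod (grad_symbol \<zeta>) * ((l2 h)\<^sup>2 * T))"
    by (intro mult_left_mono) auto
  then show ?thesis unfolding picard2_def norm_mult norm_of_real by (simp add: mult_ac)
qed

text \<open>The solution is within \<open>O(|\<tau>|^(3/2))\<close> of the free flow in
  \<open>L^2\<close>, and the second factor of the quadratic term contributes another power, so the
  remainder is \<open>O(|\<tau>|^(5/2))\<close>. The constant is uniform in \<open>\<tau>\<close>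
  and in the solution because it is built from \<open>T\<close> and norms of \<open>h\<close>, not
  from the \<open>H^2\<close> norm of the solution.\<close>

lemma regular_solution_expansion:
  assumes h: "integrable lborel h" "sq_int h" "integrable lborel (\<lambda>\<zeta>. grad_symbol \<zeta> * h \<zeta>)"
    and T: "T > 0"
  obtains C where "C \<ge> 0" "\<And>\<tau> u t. regular_solution T (\<tau> *\<^sub>R fdist h) u \<Longrightarrow> t \<in> {0..T} \<Longrightarrow>
    \<exists>g. has_fourier (u t) g \<and> (\<forall>\<zeta>. cmod (g \<zeta> - \<tau> * free_flow h t \<zeta> - complex_of_real (\<tau>\<^sup>2) * picard2 h t \<zeta>)
      \<le> C * (\<tau>\<^sup>2 * sqrt \<bar>\<tau>\<bar>) * cmod (grad_symbol \<zeta>))"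
proof -
  define k :: real where "k = 4 powr (- 1 / 3)"
  define H where "H = l2 h"
  define I where "I = (LINT \<zeta>|lborel. cmod (grad_symbol \<zeta> * h \<zeta>))"
  \<comment> \<open>\<open>K^2\<close> is twice the bound \<open>d1\<close> paired with
    \<open>h\<close>, stripped of its powers of \<open>\<tau>\<close>; the growth of
    \<open>d1\<close> in the frequency is what \<open>I\<close> measures against
    \<open>h\<close>.\<close>
  define K where "K = sqrt (2 * (k * (H\<^sup>2 * T) * I))"
  have nn: "k \<ge> 0" "H \<ge> 0" "I \<ge> 0" "K \<ge> 0"
    by (auto simp: k_def H_def I_def K_def T less_imp_le)
  have hm [measurable]: "h \<in> borel_measurable borel" using h(1) by auto
  show ?thesis
  proof (rule that[of "k * (2 * H * K * T)"])
    show "k * (2 * H * K * T) \<ge> 0" using nn T by simp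
    fix \<tau> :: real and u t
    assume reg: "regular_solution T (\<tau> *\<^sub>R fdist h) u" and t: "t \<in> {0..T}"
    let ?h = "\<lambda>\<zeta>. complex_of_real \<tau> * h \<zeta>"
    interpret regular_flow T u "\<tau> *\<^sub>R fdist h" ?h
      by unfold_locales
        (use T reg h in \<open>auto intro: has_fourier_scaleR has_fourier_fdist sq_int_cmult\<close>)
    have kap: "kappa = complex_of_real k" by (simp add: kappa_def k_def)
    have lF: "l2 (F t') = \<bar>\<tau>\<bar> * H" if "t' \<in> {0..T}" for t'
      using l2_conservation[OF that] by (simp add: l2_cmult H_def)
    let ?f = "\<lambda>t' \<zeta>. complex_of_real \<tau> * free_flow h t' \<zeta>"
    have f: "sq_int (?f t')" "l2 (?f t') = \<bar>\<tau>\<bar> * H" for t'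
      using sq_int_free_flow[OF h(2)] by (auto simp: l2_cmult H_def intro: sq_int_cmult)
    have Gd: "G t' \<zeta> - ?f t' \<zeta> = complex_of_real k * (grad_symbol \<zeta> * retarded Q t' \<zeta>)" for t' \<zeta>
      by (simp add: G_def kap free_flow_def)
    \<comment> \<open>The convolution is bounded by the conserved norm, so at each frequency the
      Duhamel term is quadratic in \<open>\<tau>\<close>, with a loss of one power of the
      frequency.\<close>
    have d1: "cmod (G t' \<zeta> - ?f t' \<zeta>) \<le> k * (\<tau>\<^sup>2 * H\<^sup>2 * T) * cmod (grad_symbol \<zeta>)" if t': "t' \<in> {0..T}" for t' \<zeta>
    proof -
      have "cmod (retarded Q t' \<zeta>) \<le> (\<tau>\<^sup>2 * H\<^sup>2) * t'"
      proof (rule retarded_bound[OF Q_continuous])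
        show "t' \<ge> 0" using t' by simp
        show "cmod (Q t'' \<zeta>) \<le> \<tau>\<^sup>2 * H\<^sup>2" if "t'' \<in> {0..t'}" for t''
          using Q_bound[of t'' \<zeta>] lF[of t''] that t' by (simp add: power_mult_distrib)
      qed
      also have "\<dots> \<le> \<tau>\<^sup>2 * H\<^sup>2 * T" using t' by (intro mult_left_mono) auto
      finally have "k * (cmod (grad_symbol \<zeta>) * cmod (retarded Q t' \<zeta>)) \<le> k * (cmod (grad_symbol \<zeta>) * (\<tau>\<^sup>2 * H\<^sup>2 * T))"
        using nn by (intro mult_left_mono) auto
      then show ?thesis unfolding Gd norm_mult norm_of_real using nn by (simp add: mult_ac)
    qed
    \<comment> \<open>Since both norms equal \<open>|\<tau>| H\<close>, the identity
      \<open>pt\<close> leaves only a pairing with the free flow, where \<open>h\<close> absorbs the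
      growth in \<open>d1\<close>. The pairing is \<open>O(|\<tau>|^3)\<close>, and its square root
      is the rate.\<close>
    have d2: "l2 (\<lambda>\<zeta>. F t' \<zeta> - ?f t' \<zeta>) \<le> K * (\<bar>\<tau>\<bar> * sqrt \<bar>\<tau>\<bar>)" if t': "t' \<in> {0..T}" for t'
    proof -
      note [measurable] = G_measurable[OF t']
      have fm [measurable]: "?f t' \<in> borel_measurable borel" using f(1)[of t'] by (simp add: sq_int_def)
      let ?d = "\<lambda>\<zeta>. F t' \<zeta> - ?f t' \<zeta>"
      have sd: "sq_int ?d" by (rule sq_int_diff[OF F_props(3) f(1)])
      have ip: "integrable lborel (\<lambda>\<zeta>. ?d \<zeta> * cnj (?f t' \<zeta>))"
        by (rule sq_int_mult_integrable[OF sd sq_int_cnj[OF f(1)]])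
      have pt: "(cmod (a - b))\<^sup>2 = (cmod a)\<^sup>2 - (cmod b)\<^sup>2 - 2 * Re ((a - b) * cnj b)" for a b
        unfolding cmod_power2 by (simp add: algebra_simps power2_eq_square)
      have "(l2 ?d)\<^sup>2 = (LINT \<zeta>|lborel. (cmod (F t' \<zeta>))\<^sup>2 - (cmod (?f t' \<zeta>))\<^sup>2 - 2 * Re (?d \<zeta> * cnj (?f t' \<zeta>)))"
        unfolding l2_power2 pt ..
      also have "\<dots> = (l2 (F t'))\<^sup>2 - (l2 (?f t'))\<^sup>2 - 2 * Re (LINT \<zeta>|lborel. ?d \<zeta> * cnj (?f t' \<zeta>))"
      proof -
        have i: "integrable lborel (\<lambda>\<zeta>. (cmod (F t' \<zeta>))\<^sup>2)" "integrable lborel (\<lambda>\<zeta>. (cmod (?f t' \<zeta>))\<^sup>2)"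
          "integrable lborel (\<lambda>\<zeta>. 2 * Re (?d \<zeta> * cnj (?f t' \<zeta>)))"
          by (rule F_props(3)[unfolded sq_int_def, THEN conjunct2], rule f(1)[unfolded sq_int_def, THEN conjunct2],
              rule integrable_mult_right[OF integrable_Re[OF ip]])
        show ?thesis
          unfolding l2_power2 Bochner_Integration.integral_diff[OF Bochner_Integration.integrable_diff[OF i(1,2)] i(3)]
            Bochner_Integration.integral_diff[OF i(1,2)] integral_mult_right_zero integral_Re[OF ip] ..
      qed
      also have "\<dots> = - 2 * Re (LINT \<zeta>|lborel. ?d \<zeta> * cnj (?f t' \<zeta>))"
        using lF[OF t'] f(2)[of t'] by simp
      also have "\<dots> \<le> 2 * cmod (LINT \<zeta>|lborel. ?d \<zeta> * cnj (?f t' \<zeta>))"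
        using abs_Re_le_cmod[of "LINT \<zeta>|lborel. ?d \<zeta> * cnj (?f t' \<zeta>)"] by linarith
      also have "\<dots> \<le> 2 * (LINT \<zeta>|lborel. (k * (\<tau>\<^sup>2 * H\<^sup>2 * T) * \<bar>\<tau>\<bar>) * cmod (grad_symbol \<zeta> * h \<zeta>))"
      proof -
        have "(LINT \<zeta>|lborel. ?d \<zeta> * cnj (?f t' \<zeta>)) = (LINT \<zeta>|lborel. (G t' \<zeta> - ?f t' \<zeta>) * cnj (?f t' \<zeta>))"
        proof (rule integral_cong_AE)
          show "AE \<zeta> in lborel. ?d \<zeta> * cnj (?f t' \<zeta>) = (G t' \<zeta> - ?f t' \<zeta>) * cnj (?f t' \<zeta>)"
            using F_eq_G[OF t'] by eventually_elim simp
        qed measurable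
        also have "cmod \<dots> \<le> (LINT \<zeta>|lborel. (k * (\<tau>\<^sup>2 * H\<^sup>2 * T) * \<bar>\<tau>\<bar>) * cmod (grad_symbol \<zeta> * h \<zeta>))"
        proof (rule Bochner_Integration.integral_norm_bound_integral)
          show "integrable lborel (\<lambda>\<zeta>. (G t' \<zeta> - ?f t' \<zeta>) * cnj (?f t' \<zeta>))"
          proof (rule integrable_cong_AE[THEN iffD1, OF _ _ _ ip])
            show "AE \<zeta> in lborel. ?d \<zeta> * cnj (?f t' \<zeta>) = (G t' \<zeta> - ?f t' \<zeta>) * cnj (?f t' \<zeta>)"
              using F_eq_G[OF t'] by eventually_elim simp
          qed measurable
          show "integrable lborel (\<lambda>\<zeta>. (k * (\<tau>\<^sup>2 * H\<^sup>2 * T) * \<bar>\<tau>\<bar>) * cmod (grad_symbol \<zeta> * h \<zeta>))"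
            by (intro integrable_mult_right integrable_norm h(3))
          show "norm ((G t' \<zeta> - ?f t' \<zeta>) * cnj (?f t' \<zeta>)) \<le> (k * (\<tau>\<^sup>2 * H\<^sup>2 * T) * \<bar>\<tau>\<bar>) * cmod (grad_symbol \<zeta> * h \<zeta>)" for \<zeta>
          proof -
            have "norm ((G t' \<zeta> - ?f t' \<zeta>) * cnj (?f t' \<zeta>)) = cmod (G t' \<zeta> - ?f t' \<zeta>) * (\<bar>\<tau>\<bar> * cmod (h \<zeta>))"
              by (simp only: norm_mult complex_mod_cnj free_flow_def norm_cis norm_of_real mult_1)
            also have "\<dots> \<le> (k * (\<tau>\<^sup>2 * H\<^sup>2 * T) * cmod (grad_symbol \<zeta>)) * (\<bar>\<tau>\<bar> * cmod (h \<zeta>))"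
              by (intro mult_right_mono d1 t') auto
            finally show ?thesis by (simp add: norm_mult mult_ac)
          qed
        qed
        finally show ?thesis by simp
      qed
      also have "\<dots> = (K * (\<bar>\<tau>\<bar> * sqrt \<bar>\<tau>\<bar>))\<^sup>2"
      proof -
        have "(K * (\<bar>\<tau>\<bar> * sqrt \<bar>\<tau>\<bar>))\<^sup>2 = K\<^sup>2 * (\<tau>\<^sup>2 * \<bar>\<tau>\<bar>)" by (simp add: power_mult_distrib)
        also have "K\<^sup>2 = 2 * (k * (H\<^sup>2 * T) * I)"
          unfolding K_def using nn T by (intro real_sqrt_pow2) auto
        finally show ?thesis unfolding integral_mult_right_zero I_def[symmetric] by (simp add: mult_ac)
      qed
      finally show ?thesis
        by (rule power2_le_imp_le) (use nn in simp)
    qed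
    let ?Q0 = "\<lambda>t'. conv (free_flow h t') (free_flow h t')"
    have "cmod (G t \<zeta> - \<tau> * free_flow h t \<zeta> - complex_of_real (\<tau>\<^sup>2) * picard2 h t \<zeta>)
      \<le> k * (2 * H * K * T) * (\<tau>\<^sup>2 * sqrt \<bar>\<tau>\<bar>) * cmod (grad_symbol \<zeta>)" for \<zeta>
    proof -
      have "cmod (retarded Q t \<zeta> - retarded (\<lambda>t' \<zeta>. complex_of_real (\<tau>\<^sup>2) * ?Q0 t' \<zeta>) t \<zeta>) \<le> (K * (\<bar>\<tau>\<bar> * sqrt \<bar>\<tau>\<bar>) * (2 * (\<bar>\<tau>\<bar> * H))) * t"
      proof (rule retarded_diff_bound[OF Q_continuous])
        show "continuous_on UNIV (\<lambda>t. complex_of_real (\<tau>\<^sup>2) * ?Q0 t \<zeta>)"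
          by (intro continuous_intros conv_free_flow_continuous h)
        show "t \<ge> 0" using t by simp
        fix t' assume "t' \<in> {0..t}"
        then have t': "t' \<in> {0..T}" using t by auto
        have "cmod (Q t' \<zeta> - conv (?f t') (?f t') \<zeta>) \<le> l2 (\<lambda>\<zeta>. F t' \<zeta> - ?f t' \<zeta>) * (l2 (F t') + l2 (?f t'))"
          unfolding Q_def by (rule conv_diff_bound[OF F_props(3) f(1)])
        also have "\<dots> \<le> K * (\<bar>\<tau>\<bar> * sqrt \<bar>\<tau>\<bar>) * (2 * (\<bar>\<tau>\<bar> * H))"
          unfolding lF[OF t'] f(2) using d2[OF t'] nn by (intro mult_mono) auto
        finally show "cmod (Q t' \<zeta> - complex_of_real (\<tau>\<^sup>2) * ?Q0 t' \<zeta>) \<le> K * (\<bar>\<tau>\<bar> * sqrt \<bar>\<tau>\<bar>) * (2 * (\<bar>\<tau>\<bar> * H))"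
          unfolding conv_cmult by (simp add: power2_eq_square)
      qed
      also have "\<dots> \<le> (K * (\<bar>\<tau>\<bar> * sqrt \<bar>\<tau>\<bar>) * (2 * (\<bar>\<tau>\<bar> * H))) * T"
        using t nn by (intro mult_left_mono) auto
      also have "\<dots> = (2 * H * K * T) * (\<tau>\<^sup>2 * sqrt \<bar>\<tau>\<bar>)"
      proof -
        have "\<bar>\<tau>\<bar> * \<bar>\<tau>\<bar> = \<tau>\<^sup>2" by (simp add: power2_eq_square)
        then show ?thesis by (metis (no_types, opaque_lifting) mult.assoc mult.commute)
      qed
      finally have le: "cmod (retarded Q t \<zeta> - complex_of_real (\<tau>\<^sup>2) * retarded ?Q0 t \<zeta>) \<le> (2 * H * K * T) * (\<tau>\<^sup>2 * sqrt \<bar>\<tau>\<bar>)"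
        unfolding retarded_cmult .
      have "G t \<zeta> - \<tau> * free_flow h t \<zeta> - complex_of_real (\<tau>\<^sup>2) * picard2 h t \<zeta> =
          complex_of_real k * (grad_symbol \<zeta> * (retarded Q t \<zeta> - complex_of_real (\<tau>\<^sup>2) * retarded ?Q0 t \<zeta>))"
        unfolding Gd by (simp add: picard2_def k_def right_diff_distrib mult_ac)
      then have "cmod (G t \<zeta> - \<tau> * free_flow h t \<zeta> - complex_of_real (\<tau>\<^sup>2) * picard2 h t \<zeta>) =
          k * (cmod (grad_symbol \<zeta>) * cmod (retarded Q t \<zeta> - complex_of_real (\<tau>\<^sup>2) * retarded ?Q0 t \<zeta>))"
        using nn by (simp only: norm_mult norm_of_real abs_of_nonneg)
      also have "\<dots> \<le> k * (cmod (grad_symbol \<zeta>) * ((2 * H * K * T) * (\<tau>\<^sup>2 * sqrt \<bar>\<tau>\<bar>)))"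
        using nn by (intro mult_left_mono le) auto
      finally show ?thesis by (simp add: mult_ac)
    qed
    then show "\<exists>g. has_fourier (u t) g \<and> (\<forall>\<zeta>. cmod (g \<zeta> - \<tau> * free_flow h t \<zeta> - complex_of_real (\<tau>\<^sup>2) * picard2 h t \<zeta>)
      \<le> k * (2 * H * K * T) * (\<tau>\<^sup>2 * sqrt \<bar>\<tau>\<bar>) * cmod (grad_symbol \<zeta>))"
      using has_fourier_G[OF t] by blast
  qed
qed

section \<open>Consequences of differentiability\<close>

text \<open>An expansion to second order does not by itself produce a second derivative, but it
  determines one that exists. Its linear term gives \<open>d 0 = a\<close>; integrating
  \<open>d \<sigma> = a + \<sigma> q + o(\<sigma>)\<close> gives a second expansion of
  \<open>\<theta>\<close>, and the two are compared at one small \<open>\<tau>\<close>.\<close>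

lemma second_derivative_eq:
  fixes \<theta> :: "real \<Rightarrow> complex" and a b :: complex
  assumes "\<delta> > 0"
    and \<theta>': "\<And>\<tau>. \<bar>\<tau>\<bar> < \<delta> \<Longrightarrow> (\<theta> has_vector_derivative d \<tau>) (at \<tau>)"
    and d': "(d has_vector_derivative q) (at 0)"
    and exp: "\<And>\<tau>. \<bar>\<tau>\<bar> < \<delta> \<Longrightarrow> cmod (\<theta> \<tau> - \<tau> * a - complex_of_real (\<tau>\<^sup>2) * b) \<le> C * (\<tau>\<^sup>2 * sqrt \<bar>\<tau>\<bar>)" and "C \<ge> 0"
  shows "q = 2 * b"
proof -
  have \<theta>0: "\<theta> 0 = 0" using exp[of 0] \<open>\<delta> > 0\<close> by simp
  \<comment> \<open>\<open>h^2 * M\<close> bounds the deviation of \<open>\<theta>\<close> from its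
    linear term; the summand 1 keeps \<open>M\<close> positive for the quotient
    \<open>e / M\<close>.\<close>
  define M where "M = C * sqrt \<delta> + cmod b + 1"
  have M: "M > 0" using \<open>C \<ge> 0\<close> \<open>\<delta> > 0\<close> by (simp add: M_def add_nonneg_pos)
  have "cmod (d 0 - a) \<le> e" if "e > 0" for e
  proof (rule vector_derivative_close[OF \<theta>'])
    show "0 < min \<delta> (e / M)" using \<open>\<delta> > 0\<close> M that by simp
    fix h :: real assume h: "\<bar>h\<bar> < min \<delta> (e / M)"
    have "cmod (\<theta> h - h * a) \<le> cmod (\<theta> h - h * a - complex_of_real (h\<^sup>2) * b) + cmod (complex_of_real (h\<^sup>2) * b)"
      using norm_triangle_ineq[of "\<theta> h - h * a - complex_of_real (h\<^sup>2) * b" "complex_of_real (h\<^sup>2) * b"] by simp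
    also have "\<dots> \<le> C * (h\<^sup>2 * sqrt \<delta>) + h\<^sup>2 * cmod b"
    proof (rule add_mono)
      have "C * (h\<^sup>2 * sqrt \<bar>h\<bar>) \<le> C * (h\<^sup>2 * sqrt \<delta>)"
        using h \<open>C \<ge> 0\<close> by (intro mult_left_mono) auto
      then show "cmod (\<theta> h - h * a - complex_of_real (h\<^sup>2) * b) \<le> C * (h\<^sup>2 * sqrt \<delta>)" using exp[of h] h by simp
      show "cmod (complex_of_real (h\<^sup>2) * b) \<le> h\<^sup>2 * cmod b" by (simp add: norm_mult del: of_real_power)
    qed
    also have "\<dots> \<le> h\<^sup>2 * M" by (simp add: M_def algebra_simps)
    also have "\<dots> \<le> e * \<bar>h\<bar>"
    proof -
      have "\<bar>h\<bar> * M \<le> e" using h M by (simp add: field_simps)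
      then have "\<bar>h\<bar> * (\<bar>h\<bar> * M) \<le> \<bar>h\<bar> * e" by (intro mult_left_mono) auto
      then show ?thesis by (simp add: power2_eq_square mult_ac abs_mult_self_eq)
    qed
    finally show "norm (\<theta> (0 + h) - \<theta> 0 - h *\<^sub>R a) \<le> e * \<bar>h\<bar>" using \<theta>0 by (simp add: scaleR_conv_of_real)
  qed (use \<open>\<delta> > 0\<close> in auto)
  then have "cmod (d 0 - a) \<le> 0" by (rule dense_ge)
  then have d0: "d 0 = a" by simp
  have "cmod (q - 2 * b) \<le> e" if e: "e > 0" for e
  proof -
    have "((\<lambda>h. norm (d (0 + h) - d 0 - h *\<^sub>R q) / norm h) \<longlongrightarrow> 0) (at 0)"
      using d' unfolding has_vector_derivative_def has_derivative_at by blast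
    from tendstoD[OF this, of "e / 4"] e obtain r where r: "r > 0"
      "\<And>h. h \<noteq> 0 \<Longrightarrow> dist h 0 < r \<Longrightarrow> dist (norm (d (0 + h) - d 0 - h *\<^sub>R q) / norm h) 0 < e / 4"
      unfolding eventually_at by (auto simp del: dist_norm)
    have r': "cmod (d h - a - h *\<^sub>R q) \<le> e / 4 * \<bar>h\<bar>" if "\<bar>h\<bar> < r" for h
    proof (cases "h = 0")
      case False
      then show ?thesis using r(2)[of h] that d0 by (simp add: pos_divide_less_eq)
    qed (simp add: d0)
    \<comment> \<open>The first two bounds keep \<open>\<tau>\<close> where both expansions hold,
      the third makes \<open>C * sqrt \<tau>\<close> at most \<open>e / 4\<close>. Writing
      \<open>C + 1\<close> covers the case \<open>C = 0\<close>.\<close>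
    define \<tau> where "\<tau> = min (min (\<delta> / 2) (r / 2)) ((e / (4 * (C + 1)))\<^sup>2)"
    have \<tau>: "\<tau> > 0" "\<tau> < \<delta>" "\<tau> < r" "\<tau> \<le> (e / (4 * (C + 1)))\<^sup>2"
      using \<open>\<delta> > 0\<close> r(1) e \<open>C \<ge> 0\<close> by (auto simp: \<tau>_def min_def)
    have sq: "C * sqrt \<tau> \<le> e / 4"
    proof -
      have "sqrt \<tau> \<le> e / (4 * (C + 1))"
        using \<tau>(4) e \<open>C \<ge> 0\<close> by (intro real_le_lsqrt) auto
      then have "C * sqrt \<tau> \<le> C * (e / (4 * (C + 1)))" using \<open>C \<ge> 0\<close> by (intro mult_left_mono) auto
      also have "\<dots> = (C / (C + 1)) * (e / 4)" by simp
      also have "\<dots> \<le> 1 * (e / 4)" using e \<open>C \<ge> 0\<close> by (intro mult_right_mono) auto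
      finally show ?thesis by simp
    qed
    let ?g = "\<lambda>\<sigma>. \<theta> \<sigma> - \<sigma> *\<^sub>R a - (\<sigma>\<^sup>2 / 2) *\<^sub>R q"
    have "norm (?g \<tau> - ?g 0) \<le> (e / 4 * \<tau>) * \<bar>\<tau> - 0\<bar>"
    proof (rule vector_derivative_bound[where g' = "\<lambda>\<sigma>. d \<sigma> - a - \<sigma> *\<^sub>R q"])
      fix \<sigma> assume "\<sigma> \<in> closed_segment 0 \<tau>"
      then have \<sigma>: "\<bar>\<sigma>\<bar> \<le> \<tau>" using \<tau>(1) by (auto simp: closed_segment_eq_real_ivl)
      have q2: "((\<lambda>\<sigma>. (\<sigma>\<^sup>2 / 2) *\<^sub>R q) has_vector_derivative \<sigma> *\<^sub>R q) (at \<sigma>)"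
        by (auto intro!: derivative_eq_intros)
      have a1: "((\<lambda>\<sigma>. \<sigma> *\<^sub>R a) has_vector_derivative a) (at \<sigma>)"
        by (auto intro!: derivative_eq_intros)
      show "(?g has_vector_derivative d \<sigma> - a - \<sigma> *\<^sub>R q) (at \<sigma>)"
        using \<theta>'[of \<sigma>] \<sigma> \<tau> by (intro has_vector_derivative_diff q2 a1) auto
      have "cmod (d \<sigma> - a - \<sigma> *\<^sub>R q) \<le> e / 4 * \<bar>\<sigma>\<bar>" using r'[of \<sigma>] \<sigma> \<tau> by simp
      also have "\<dots> \<le> e / 4 * \<tau>" using \<sigma> e by (intro mult_left_mono) auto
      finally show "norm (d \<sigma> - a - \<sigma> *\<^sub>R q) \<le> e / 4 * \<tau>" .
    qed
    then have 1: "cmod (\<theta> \<tau> - \<tau> * a - (\<tau>\<^sup>2 / 2) *\<^sub>R q) \<le> e / 4 * \<tau>\<^sup>2"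
      using \<theta>0 \<tau>(1) by (simp add: scaleR_conv_of_real power2_eq_square)
    have "cmod (\<theta> \<tau> - \<tau> * a - complex_of_real (\<tau>\<^sup>2) * b) \<le> C * (\<tau>\<^sup>2 * sqrt \<bar>\<tau>\<bar>)" using exp[of \<tau>] \<tau> by simp
    also have "\<dots> = (C * sqrt \<tau>) * \<tau>\<^sup>2" using \<tau>(1) by simp
    also have "\<dots> \<le> e / 4 * \<tau>\<^sup>2" by (intro mult_right_mono sq) simp
    finally have 2: "cmod (\<theta> \<tau> - \<tau> * a - complex_of_real (\<tau>\<^sup>2) * b) \<le> e / 4 * \<tau>\<^sup>2" .
    have "(\<tau>\<^sup>2 / 2) *\<^sub>R (q - 2 * b) = (\<theta> \<tau> - \<tau> * a - complex_of_real (\<tau>\<^sup>2) * b) - (\<theta> \<tau> - \<tau> * a - (\<tau>\<^sup>2 / 2) *\<^sub>R q)"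
      by (simp add: scaleR_conv_of_real field_simps)
    then have "cmod ((\<tau>\<^sup>2 / 2) *\<^sub>R (q - 2 * b)) \<le> e / 4 * \<tau>\<^sup>2 + e / 4 * \<tau>\<^sup>2"
      by (metis norm_triangle_le_diff add_mono 1 2)
    then have "\<tau>\<^sup>2 / 2 * cmod (q - 2 * b) \<le> \<tau>\<^sup>2 / 2 * e"
      unfolding norm_scaleR by (simp add: mult.commute)
    then show ?thesis using \<tau>(1) by (simp add: mult_le_cancel_left_pos)
  qed
  then have "cmod (q - 2 * b) \<le> 0" by (rule dense_ge)
  then show ?thesis by simp
qed

text \<open>Decay of order \<open>2 * n\<close> beats the weight, with \<open>n\<close> chosen to
  leave a spare factor \<open>1 + (norm \<zeta>)^2\<close>; squared, this factor is the integrable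
  planar weight.\<close>

lemma sq_int_weight_schwartz:
  assumes s: "schwartz \<psi>"
  shows "sq_int (\<lambda>\<zeta>. complex_of_real (sobolev_weight \<sigma> \<zeta>) * \<psi> \<zeta>)"
  unfolding sq_int_def
proof
  note [measurable] = schwartz_measurable[OF s]
  show "(\<lambda>\<zeta>. complex_of_real (sobolev_weight \<sigma> \<zeta>) * \<psi> \<zeta>) \<in> borel_measurable borel" by measurable
  obtain n :: nat where n: "\<sigma> / 2 + 1 \<le> real n" using real_arch_simple by blast
  obtain A where A: "\<And>z. norm z ^ 0 * cmod (\<psi> z) \<le> A" using schwartz_bound[OF s, of 0] by blast
  obtain B where B: "\<And>z. norm z ^ (2 * n) * cmod (\<psi> z) \<le> B" using schwartz_bound[OF s, of "2 * n"] by blast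
  define M where "M = 2 ^ n * (A + B)"
  have w: "(1 + (norm \<zeta>)\<^sup>2) * (sobolev_weight \<sigma> \<zeta> * cmod (\<psi> \<zeta>)) \<le> M" for \<zeta>
  proof -
    let ?x = "1 + (norm \<zeta>)\<^sup>2"
    have x: "?x \<ge> 1" by simp
    have "?x * sobolev_weight \<sigma> \<zeta> = ?x powr (\<sigma> / 2 + 1)"
      using x by (simp add: sobolev_weight_def powr_add)
    also have "\<dots> \<le> ?x powr real n" using x n by (intro powr_mono) auto
    also have "\<dots> = ?x ^ n" using x by (intro powr_realpow) linarith
    also have "\<dots> \<le> (2 * max 1 ((norm \<zeta>)\<^sup>2)) ^ n" by (intro power_mono) auto
    also have "\<dots> \<le> 2 ^ n * (norm \<zeta> ^ 0 + norm \<zeta> ^ (2 * n))"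
      by (auto simp: power_mult_distrib max_def power_mult)
    finally have "?x * sobolev_weight \<sigma> \<zeta> * cmod (\<psi> \<zeta>) \<le> 2 ^ n * (norm \<zeta> ^ 0 + norm \<zeta> ^ (2 * n)) * cmod (\<psi> \<zeta>)"
      by (rule mult_right_mono) simp
    also have "\<dots> = 2 ^ n * (norm \<zeta> ^ 0 * cmod (\<psi> \<zeta>) + norm \<zeta> ^ (2 * n) * cmod (\<psi> \<zeta>))"
      by (simp add: algebra_simps)
    also have "\<dots> \<le> M" unfolding M_def by (intro mult_left_mono add_mono A B) auto
    finally show ?thesis by (simp add: mult.assoc)
  qed
  show "integrable lborel (\<lambda>\<zeta>. (cmod (complex_of_real (sobolev_weight \<sigma> \<zeta>) * \<psi> \<zeta>))\<^sup>2)"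
  proof (rule integrable_weight_bound[where B = "M\<^sup>2"])
    fix \<zeta> :: plane
    let ?x = "1 + (norm \<zeta>)\<^sup>2"
    have x: "?x > 0" by (intro add_pos_nonneg) auto
    have c: "cmod (complex_of_real (sobolev_weight \<sigma> \<zeta>) * \<psi> \<zeta>) = sobolev_weight \<sigma> \<zeta> * cmod (\<psi> \<zeta>)"
      using sobolev_weight_pos[of \<sigma> \<zeta>] by (simp add: norm_mult)
    have "(?x * (sobolev_weight \<sigma> \<zeta> * cmod (\<psi> \<zeta>)))\<^sup>2 \<le> M\<^sup>2"
      using x sobolev_weight_pos[of \<sigma> \<zeta>] by (intro power_mono w) auto
    then have "?x\<^sup>2 * (sobolev_weight \<sigma> \<zeta> * cmod (\<psi> \<zeta>))\<^sup>2 \<le> M\<^sup>2" unfolding power_mult_distrib .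
    moreover have "?x\<^sup>2 > 0" using x by simp
    ultimately show "norm ((cmod (complex_of_real (sobolev_weight \<sigma> \<zeta>) * \<psi> \<zeta>))\<^sup>2) \<le> M\<^sup>2 * inverse (?x\<^sup>2)"
      unfolding c by (simp add: field_simps)
  qed measurable
qed

text \<open>Data to which the whole chain applies: the symmetry makes the distribution real-valued,
  membership in all Sobolev spaces triggers the literal Duhamel equation in \<open>solution\<close>,
  and the integrable derivative keeps the constant of the expansion finite.\<close>

definition admissible_datum :: "(plane \<Rightarrow> complex) \<Rightarrow> bool" where
  "admissible_datum h \<longleftrightarrow> integrable lborel h \<and> sq_int h \<and>
     integrable lborel (\<lambda>\<zeta>. grad_symbol \<zeta> * h \<zeta>) \<and> (\<forall>\<zeta>. h (- \<zeta>) = cnj (h \<zeta>)) \<and>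
     (\<forall>\<sigma>. sq_int (\<lambda>\<zeta>. complex_of_real (sobolev_weight \<sigma> \<zeta>) * h \<zeta>))"

text \<open>Pairing \<open>\<Phi> (\<tau> v)\<close> at a fixed time with a fixed Schwartz function
  gives a scalar function of \<open>\<tau>\<close> whose second derivative at 0 is the pairing of
  \<open>D2 0 v v\<close>. The expansion identifies it as twice the pairing with
  \<open>picard2\<close>; as the test function is arbitrary, the transform of
  \<open>D2 0 v v t\<close> is \<open>2 * picard2 h t\<close>. Boundedness of \<open>D2 0\<close> is
  then the estimate, with \<open>K\<close> independent of \<open>h\<close> and
  \<open>t\<close>.\<close>

lemma picard2_estimate:
  fixes s T :: real and \<Phi> :: "tdist \<Rightarrow> real \<Rightarrow> tdist"
  assumes T: "T > 0"
    and sol: "\<And>u\<^sub>0. u\<^sub>0 \<in> real_sobolev s \<Longrightarrow> sobolev_norm s u\<^sub>0 < 1 \<Longrightarrow> solution s T u\<^sub>0 (\<Phi> u\<^sub>0)"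
    and C2: "C2_at (real_sobolev s) (sobolev_norm s) (paths s T) (paths_norm s T) 0 \<Phi>"
  obtains K where "\<And>h t. admissible_datum h \<Longrightarrow> t \<in> {0..T} \<Longrightarrow>
    sq_int (\<lambda>\<zeta>. complex_of_real (sobolev_weight s \<zeta>) * picard2 h t \<zeta>) \<and>
    l2 (\<lambda>\<zeta>. complex_of_real (sobolev_weight s \<zeta>) * picard2 h t \<zeta>)
      \<le> K * (l2 (\<lambda>\<zeta>. complex_of_real (sobolev_weight s \<zeta>) * h \<zeta>))\<^sup>2"
proof -
  let ?X = "real_sobolev s" and ?nX = "sobolev_norm s" and ?Y = "paths s T" and ?nY = "paths_norm s T"
  obtain r where r: "r > 0" and C2on: "C2_on ?X ?nX ?Y ?nY {x \<in> ?X. ?nX (x - 0) < r} \<Phi>"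
    using C2 unfolding C2_at_def by blast
  let ?U = "{x \<in> ?X. ?nX (x - 0) < r}"
  obtain D D2 where D0: "\<forall>x\<in>?U.
     \<Phi> x \<in> ?Y \<and>
     bounded_linear_between ?X ?nX ?Y ?nY (D x) \<and>
     bounded_bilinear_between ?X ?nX ?Y ?nY (D2 x) \<and>
     (\<forall>e>0. \<exists>d>0. \<forall>h\<in>?X. ?nX h < d \<and> x + h \<in> ?U \<longrightarrow>
        ?nY (\<Phi> (x + h) - \<Phi> x - D x h) \<le> e * ?nX h) \<and>
     (\<forall>e>0. \<exists>d>0. \<forall>h\<in>?X. ?nX h < d \<and> x + h \<in> ?U \<longrightarrow>
        (\<forall>k\<in>?X. ?nY (D (x + h) k - D x k - D2 x h k) \<le> e * ?nX h * ?nX k)) \<and>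
     (\<forall>e>0. \<exists>d>0. \<forall>y\<in>?U. ?nX (y - x) < d \<longrightarrow>
        (\<forall>h\<in>?X. \<forall>k\<in>?X. ?nY (D2 y h k - D2 x h k) \<le> e * ?nX h * ?nX k))"
    using C2on[unfolded C2_on_def] by (elim exE) (rule that)
  have DD: "\<Phi> x \<in> ?Y \<and>
     bounded_linear_between ?X ?nX ?Y ?nY (D x) \<and>
     bounded_bilinear_between ?X ?nX ?Y ?nY (D2 x) \<and>
     (\<forall>e>0. \<exists>d>0. \<forall>h\<in>?X. ?nX h < d \<and> x + h \<in> ?U \<longrightarrow>
        ?nY (\<Phi> (x + h) - \<Phi> x - D x h) \<le> e * ?nX h) \<and>
     (\<forall>e>0. \<exists>d>0. \<forall>h\<in>?X. ?nX h < d \<and> x + h \<in> ?U \<longrightarrow>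
        (\<forall>k\<in>?X. ?nY (D (x + h) k - D x k - D2 x h k) \<le> e * ?nX h * ?nX k))" if "x \<in> ?U" for x
    using bspec[OF D0 that] by (elim conjE) (intro conjI)
  have zero: "0 \<in> ?U" using r by (auto simp: real_sobolev_def sobolev_zero real_valued_def apply_zero)
  have DY: "\<Phi> x \<in> ?Y" and DL: "bounded_linear_between ?X ?nX ?Y ?nY (D x)"
    and DB: "bounded_bilinear_between ?X ?nX ?Y ?nY (D2 x)"
    and DF: "\<forall>e>0. \<exists>d>0. \<forall>h\<in>?X. ?nX h < d \<and> x + h \<in> ?U \<longrightarrow>
        ?nY (\<Phi> (x + h) - \<Phi> x - D x h) \<le> e * ?nX h"
    and DG: "\<forall>e>0. \<exists>d>0. \<forall>h\<in>?X. ?nX h < d \<and> x + h \<in> ?U \<longrightarrow>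
        (\<forall>k\<in>?X. ?nY (D (x + h) k - D x k - D2 x h k) \<le> e * ?nX h * ?nX k)" if "x \<in> ?U" for x
    using DD[OF that] by - (elim conjE, assumption)+
  have lin: "D x (c *\<^sub>R k) = c *\<^sub>R D x k" "D x k \<in> ?Y" if "x \<in> ?U" "k \<in> ?X" for x c k
    using DL[OF that(1)] that(2) unfolding bounded_linear_between_def by simp_all
  note B0 = DB[OF zero, unfolded bounded_bilinear_between_def]
  obtain K where K0: "\<forall>h\<in>?X. \<forall>k\<in>?X. ?nY (D2 0 h k) \<le> K * ?nX h * ?nX k"
    using conjunct2[OF conjunct2[OF B0]] by (elim exE)
  then have K: "?nY (D2 0 h k) \<le> K * ?nX h * ?nX k" if "h \<in> ?X" "k \<in> ?X" for h k
    using that by simp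
  show ?thesis
  proof (rule that[of "K / 2"])
    fix h t assume h: "admissible_datum h" and t: "t \<in> {0..T}"
    have hi: "integrable lborel h" "sq_int h" "integrable lborel (\<lambda>\<zeta>. grad_symbol \<zeta> * h \<zeta>)"
      using h by (auto simp: admissible_datum_def)
    define v where "v = fdist h"
    have fv: "has_fourier v h" unfolding v_def by (rule has_fourier_fdist[OF hi(1)])
    have vs: "v \<in> sobolev \<sigma>" for \<sigma>
      using h by (simp add: sobolev_iff_sq_int[OF fv] admissible_datum_def)
    have vX: "v \<in> ?X"
      using vs real_valued_fdist[OF hi(1)] h by (auto simp: real_sobolev_def admissible_datum_def v_def)
    have scX: "\<tau> *\<^sub>R v \<in> ?X" for \<tau> by (rule real_sobolev_scaleR[OF vX])
    have scn: "?nX (\<tau> *\<^sub>R v) = \<bar>\<tau>\<bar> * ?nX v" for \<tau> by (rule sobolev_scaleR(2)[OF vs])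
    \<comment> \<open>Positive even for \<open>v = 0\<close>, hence a safe divisor.\<close>
    define n where "n = ?nX v + 1"
    have n: "n > 0" "?nX v < n" "?nX v \<ge> 0" using sobolev_norm_nonneg[OF vs[of s]] by (auto simp: n_def)
    \<comment> \<open>The bound 1 is where \<open>sol\<close> applies, the bound \<open>r\<close>
      where the derivatives exist.\<close>
    define \<delta> where "\<delta> = min 1 r / n"
    have \<delta>: "\<delta> > 0" using r n by (simp add: \<delta>_def)
    have small: "?nX (\<tau> *\<^sub>R v) < min 1 r" if "\<bar>\<tau>\<bar> < \<delta>" for \<tau>
    proof -
      have "\<bar>\<tau>\<bar> * ?nX v \<le> \<bar>\<tau>\<bar> * n" using n by (intro mult_left_mono) auto
      also have "\<dots> < \<delta> * n" using that n by (intro mult_strict_right_mono) auto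
      also have "\<dots> = min 1 r" using n by (simp add: \<delta>_def)
      finally show ?thesis by (simp add: scn)
    qed
    have inU: "\<tau> *\<^sub>R v \<in> ?U" if "\<bar>\<tau>\<bar> < \<delta>" for \<tau> using small[OF that] scX by simp
    \<comment> \<open>\<open>\<tau> v\<close> lies in every Sobolev space, so the clause of
      \<open>solution\<close> for smooth data makes \<open>\<Phi> (\<tau> v)\<close> a literal
      solution.\<close>
    have reg: "regular_solution T (\<tau> *\<^sub>R fdist h) (\<Phi> (\<tau> *\<^sub>R v))" if "\<bar>\<tau>\<bar> < \<delta>" for \<tau>
    proof -
      have "solution s T (\<tau> *\<^sub>R v) (\<Phi> (\<tau> *\<^sub>R v))" using small[OF that] by (intro sol scX) auto
      moreover have "\<tau> *\<^sub>R v \<in> sobolev \<sigma>" for \<sigma> by (rule sobolev_scaleR(1)[OF vs])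
      ultimately show ?thesis by (simp add: solution_def v_def)
    qed
    obtain C where C: "C \<ge> 0" "\<And>\<tau> u t. regular_solution T (\<tau> *\<^sub>R fdist h) u \<Longrightarrow> t \<in> {0..T} \<Longrightarrow>
      \<exists>g. has_fourier (u t) g \<and> (\<forall>\<zeta>. cmod (g \<zeta> - \<tau> * free_flow h t \<zeta> - complex_of_real (\<tau>\<^sup>2) * picard2 h t \<zeta>)
        \<le> C * (\<tau>\<^sup>2 * sqrt \<bar>\<tau>\<bar>) * cmod (grad_symbol \<zeta>))"
      using regular_solution_expansion[OF hi T] by metis
    have "bounded_linear_between ?X ?nX ?Y ?nY (\<lambda>k. D2 0 k v)"
      using conjunct1[OF conjunct2[OF B0]] vX by simp
    then have bil: "D2 0 (c *\<^sub>R v) v = c *\<^sub>R D2 0 v v" "D2 0 k v \<in> ?Y" if "k \<in> ?X" for c k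
      using vX that unfolding bounded_linear_between_def by simp_all
    have picm: "picard2 h t \<in> borel_measurable borel" by (rule picard2_measurable[OF hi(1,2)])
    define w where "w = D2 0 v v t"
    have wY: "D2 0 v v \<in> ?Y" by (rule bil(2)[OF vX])
    have wS: "w \<in> sobolev s" unfolding w_def by (rule paths_sobolev[OF wY t])
    have pair: "apply_tdist w (fourier \<psi>) = 2 * (LINT \<zeta>|lborel. picard2 h t \<zeta> * \<psi> \<zeta>)"
      and pint: "integrable lborel (\<lambda>\<zeta>. picard2 h t \<zeta> * \<psi> \<zeta>)" if \<psi>: "schwartz \<psi>" for \<psi>
    proof -
      note [measurable] = schwartz_measurable[OF \<psi>] picm
      have "schwartz (\<lambda>\<zeta>. grad_symbol \<zeta> * \<psi> \<zeta>)"
      proof -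
        have "(\<lambda>\<zeta>. grad_symbol \<zeta> * \<psi> \<zeta>) = (\<lambda>\<zeta>. \<i> * (complex_of_real (fst \<zeta>) * \<psi> \<zeta>) + \<i> * (complex_of_real (snd \<zeta>) * \<psi> \<zeta>))"
          by (auto simp: grad_symbol_def algebra_simps)
        then show ?thesis using \<psi> by (simp only:) (intro schwartz_add schwartz_cmult schwartz_fst schwartz_snd)
      qed
      then have gi: "integrable lborel (\<lambda>\<zeta>. cmod (grad_symbol \<zeta> * \<psi> \<zeta>))"
        by (intro integrable_norm schwartz_integrable)
      show pint: "integrable lborel (\<lambda>\<zeta>. picard2 h t \<zeta> * \<psi> \<zeta>)"
      proof (rule Bochner_Integration.integrable_bound[OF integrable_mult_right[OF gi]])
        show "AE \<zeta> in lborel. norm (picard2 h t \<zeta> * \<psi> \<zeta>) \<le> norm (4 powr (- 1 / 3) * ((l2 h)\<^sup>2 * T) * cmod (grad_symbol \<zeta> * \<psi> \<zeta>))"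
        proof (rule AE_I2)
          fix \<zeta>
          have "norm (picard2 h t \<zeta> * \<psi> \<zeta>) \<le> 4 powr (- 1 / 3) * ((l2 h)\<^sup>2 * T) * cmod (grad_symbol \<zeta>) * cmod (\<psi> \<zeta>)"
            unfolding norm_mult by (intro mult_right_mono picard2_bound hi t) auto
          then show "norm (picard2 h t \<zeta> * \<psi> \<zeta>) \<le> norm (4 powr (- 1 / 3) * ((l2 h)\<^sup>2 * T) * cmod (grad_symbol \<zeta> * \<psi> \<zeta>))"
            by (simp add: norm_mult mult.assoc)
        qed
      qed measurable
      have fint: "integrable lborel (\<lambda>\<zeta>. free_flow h t \<zeta> * \<psi> \<zeta>)"
        using integrable_bounded_schwartz[OF schwartz_bounded_measurable[OF \<psi>] integrable_cis_airy[OF hi(1), of t]]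
        by (simp add: free_flow_def mult.commute)
      define c where "c = l2 (\<lambda>\<zeta>. complex_of_real (sobolev_weight (- s) \<zeta>) * \<psi> \<zeta>)"
      have c0: "c \<ge> 0" by (simp add: c_def)
      \<comment> \<open>Pairing at time \<open>t\<close> is a bounded functional on paths; it
        carries the Frechet estimates over to scalar functions.\<close>
      have pb: "cmod (apply_tdist (p t) (fourier \<psi>)) \<le> c * ?nY p" if "p \<in> ?Y" for p
      proof -
        have "cmod (apply_tdist (p t) (fourier \<psi>)) \<le> c * ?nX (p t)"
          unfolding c_def by (rule sobolev_pairing_bound[OF paths_sobolev[OF that t] \<psi> sq_int_weight_schwartz[OF \<psi>]])
        also have "\<dots> \<le> c * ?nY p" by (intro mult_left_mono sobolev_norm_le_paths_norm that t c0)
        finally show ?thesis .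
      qed
      define \<theta> where "\<theta> \<tau> = apply_tdist (\<Phi> (\<tau> *\<^sub>R v) t) (fourier \<psi>)" for \<tau>
      define d where "d \<tau> = apply_tdist (D (\<tau> *\<^sub>R v) v t) (fourier \<psi>)" for \<tau>
      define q where "q = apply_tdist w (fourier \<psi>)"
      \<comment> \<open>The interval \<open>(- \<delta>, \<delta>)\<close> is open, so increments
        that stay inside it decide the derivative at its points.\<close>
      have frechet: "(f has_vector_derivative f') (at \<tau>)"
        if "\<bar>\<tau>\<bar> < \<delta>" and *: "\<And>e. e > 0 \<Longrightarrow> \<exists>r>0. \<forall>\<sigma>. \<bar>\<sigma>\<bar> < r \<and> \<bar>\<tau> + \<sigma>\<bar> < \<delta> \<longrightarrow> cmod (f (\<tau> + \<sigma>) - f \<tau> - \<sigma> *\<^sub>R f') \<le> e * \<bar>\<sigma>\<bar>"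
        for f :: "real \<Rightarrow> complex" and f' \<tau>
        unfolding has_vector_derivative_def has_derivative_within_alt
      proof (intro conjI allI impI bounded_linear_scaleR_left)
        fix e :: real assume "e > 0"
        then obtain r where r: "r > 0" "\<And>\<sigma>. \<bar>\<sigma>\<bar> < r \<Longrightarrow> \<bar>\<tau> + \<sigma>\<bar> < \<delta> \<Longrightarrow> cmod (f (\<tau> + \<sigma>) - f \<tau> - \<sigma> *\<^sub>R f') \<le> e * \<bar>\<sigma>\<bar>"
          using * by blast
        have "norm (f y - f \<tau> - (y - \<tau>) *\<^sub>R f') \<le> e * norm (y - \<tau>)" if "norm (y - \<tau>) < min r (\<delta> - \<bar>\<tau>\<bar>)" for y
          using r(2)[of "y - \<tau>"] that by auto
        then show "\<exists>d>0. \<forall>y\<in>UNIV. norm (y - \<tau>) < d \<longrightarrow> norm (f y - f \<tau> - (y - \<tau>) *\<^sub>R f') \<le> e * norm (y - \<tau>)"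
          using r(1) \<open>\<bar>\<tau>\<bar> < \<delta>\<close> by (intro exI[of _ "min r (\<delta> - \<bar>\<tau>\<bar>)"]) auto
      qed
      have "q = 2 * (LINT \<zeta>|lborel. picard2 h t \<zeta> * \<psi> \<zeta>)"
      proof (rule second_derivative_eq[OF \<delta>])
        show "(\<theta> has_vector_derivative d \<tau>) (at \<tau>)" if \<tau>: "\<bar>\<tau>\<bar> < \<delta>" for \<tau>
        proof (rule frechet[OF \<tau>])
          fix e :: real assume e: "e > 0"
          \<comment> \<open>\<open>c + 1\<close> and \<open>n\<close> are positive and bound the
            pairing constant and the norm of \<open>v\<close>; their product is the loss in passing
            from \<open>\<Phi>\<close> to \<open>\<theta>\<close>.\<close>
          define e' where "e' = e / ((c + 1) * n)"
          have e': "e' > 0" using e c0 n by (simp add: e'_def)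
          obtain d0 where d00: "d0 > 0" "\<forall>k\<in>?X. ?nX k < d0 \<and> \<tau> *\<^sub>R v + k \<in> ?U \<longrightarrow>
              ?nY (\<Phi> (\<tau> *\<^sub>R v + k) - \<Phi> (\<tau> *\<^sub>R v) - D (\<tau> *\<^sub>R v) k) \<le> e' * ?nX k"
            using DF[OF inU[OF \<tau>], rule_format, OF e'] by (elim exE conjE) (rule that)
          then have d0: "d0 > 0" "\<And>k. k \<in> ?X \<Longrightarrow> ?nX k < d0 \<Longrightarrow> \<tau> *\<^sub>R v + k \<in> ?U \<Longrightarrow>
              ?nY (\<Phi> (\<tau> *\<^sub>R v + k) - \<Phi> (\<tau> *\<^sub>R v) - D (\<tau> *\<^sub>R v) k) \<le> e' * ?nX k"
            by blast+
          show "\<exists>r>0. \<forall>\<sigma>. \<bar>\<sigma>\<bar> < r \<and> \<bar>\<tau> + \<sigma>\<bar> < \<delta> \<longrightarrow> cmod (\<theta> (\<tau> + \<sigma>) - \<theta> \<tau> - \<sigma> *\<^sub>R d \<tau>) \<le> e * \<bar>\<sigma>\<bar>"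
          proof (intro exI[of _ "d0 / n"] conjI allI impI)
            show "d0 / n > 0" using d0 n by simp
            fix \<sigma> assume \<sigma>: "\<bar>\<sigma>\<bar> < d0 / n \<and> \<bar>\<tau> + \<sigma>\<bar> < \<delta>"
            let ?p = "\<Phi> (\<tau> *\<^sub>R v + \<sigma> *\<^sub>R v) - \<Phi> (\<tau> *\<^sub>R v) - D (\<tau> *\<^sub>R v) (\<sigma> *\<^sub>R v)"
            have in2: "\<tau> *\<^sub>R v + \<sigma> *\<^sub>R v \<in> ?U" using inU[of "\<tau> + \<sigma>"] \<sigma> by (simp add: scaleR_add_left)
            have "\<bar>\<sigma>\<bar> * ?nX v \<le> \<bar>\<sigma>\<bar> * n" using n by (intro mult_left_mono) auto
            also have "\<dots> < d0" using \<sigma> n by (simp add: pos_less_divide_eq)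
            finally have le: "?nY ?p \<le> e' * (\<bar>\<sigma>\<bar> * ?nX v)" using d0(2)[OF scX _ in2] by (simp add: scn)
            have pY: "?p \<in> ?Y"
              by (intro paths_diff DY[OF inU[OF \<tau>]] DY[OF in2] lin(2)[OF inU[OF \<tau>] scX])
            have "\<theta> (\<tau> + \<sigma>) - \<theta> \<tau> - \<sigma> *\<^sub>R d \<tau> = apply_tdist (?p t) (fourier \<psi>)"
              using lin(1)[OF inU[OF \<tau>] vX, of \<sigma>]
              by (simp add: \<theta>_def d_def scaleR_add_left fun_diff_def apply_minus scaleR_fun_def apply_scaleR)
            then have "cmod (\<theta> (\<tau> + \<sigma>) - \<theta> \<tau> - \<sigma> *\<^sub>R d \<tau>) \<le> c * ?nY ?p" using pb[OF pY] by simp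
            also have "\<dots> \<le> (c + 1) * (e' * (\<bar>\<sigma>\<bar> * n))"
            proof -
              have "e' * (\<bar>\<sigma>\<bar> * ?nX v) \<le> e' * (\<bar>\<sigma>\<bar> * n)" using e' n by (intro mult_left_mono) auto
              then have "c * ?nY ?p \<le> c * (e' * (\<bar>\<sigma>\<bar> * n))" using le c0 by (intro mult_left_mono) auto
              also have "\<dots> \<le> (c + 1) * (e' * (\<bar>\<sigma>\<bar> * n))" using e' n by (intro mult_right_mono) auto
              finally show ?thesis .
            qed
            also have "\<dots> = e * \<bar>\<sigma>\<bar>" using c0 n by (simp add: e'_def)
            finally show "cmod (\<theta> (\<tau> + \<sigma>) - \<theta> \<tau> - \<sigma> *\<^sub>R d \<tau>) \<le> e * \<bar>\<sigma>\<bar>" .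
          qed
        qed
        show "(d has_vector_derivative q) (at 0)"
        proof (rule frechet)
          show "\<bar>0\<bar> < \<delta>" using \<delta> by simp
          fix e :: real assume e: "e > 0"
          define e' where "e' = e / ((c + 1) * n * n)"
          have e': "e' > 0" using e c0 n by (simp add: e'_def)
          obtain d0 where d00: "d0 > 0" "\<forall>k\<in>?X. ?nX k < d0 \<and> 0 + k \<in> ?U \<longrightarrow>
              (\<forall>m\<in>?X. ?nY (D (0 + k) m - D 0 m - D2 0 k m) \<le> e' * ?nX k * ?nX m)"
            using DG[OF zero, rule_format, OF e'] by (elim exE conjE) (rule that)
          then have d0: "d0 > 0" "\<And>k m. k \<in> ?X \<Longrightarrow> ?nX k < d0 \<Longrightarrow> 0 + k \<in> ?U \<Longrightarrow> m \<in> ?X \<Longrightarrow>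
              ?nY (D (0 + k) m - D 0 m - D2 0 k m) \<le> e' * ?nX k * ?nX m"
            by blast+
          show "\<exists>r>0. \<forall>\<sigma>. \<bar>\<sigma>\<bar> < r \<and> \<bar>0 + \<sigma>\<bar> < \<delta> \<longrightarrow> cmod (d (0 + \<sigma>) - d 0 - \<sigma> *\<^sub>R q) \<le> e * \<bar>\<sigma>\<bar>"
          proof (intro exI[of _ "d0 / n"] conjI allI impI)
            show "d0 / n > 0" using d0 n by simp
            fix \<sigma> assume \<sigma>: "\<bar>\<sigma>\<bar> < d0 / n \<and> \<bar>0 + \<sigma>\<bar> < \<delta>"
            let ?p = "D (0 + \<sigma> *\<^sub>R v) v - D 0 v - D2 0 (\<sigma> *\<^sub>R v) v"
            have in2: "0 + \<sigma> *\<^sub>R v \<in> ?U" using inU[of "\<sigma>"] \<sigma> by simp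
            have "\<bar>\<sigma>\<bar> * ?nX v \<le> \<bar>\<sigma>\<bar> * n" using n by (intro mult_left_mono) auto
            also have "\<dots> < d0" using \<sigma> n by (simp add: pos_less_divide_eq)
            finally have le: "?nY ?p \<le> e' * (\<bar>\<sigma>\<bar> * ?nX v) * ?nX v" using d0(2)[OF scX _ in2 vX] by (simp add: scn)
            have pY: "?p \<in> ?Y"
              by (intro paths_diff lin(2)[OF in2 vX] lin(2)[OF zero vX] bil(2)[OF scX])
            have "d (0 + \<sigma>) - d 0 - \<sigma> *\<^sub>R q = apply_tdist (?p t) (fourier \<psi>)"
              using bil(1)[OF vX, of \<sigma>]
              by (simp add: d_def q_def w_def fun_diff_def apply_minus scaleR_fun_def apply_scaleR)
            then have "cmod (d (0 + \<sigma>) - d 0 - \<sigma> *\<^sub>R q) \<le> c * ?nY ?p" using pb[OF pY] by simp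
            also have "\<dots> \<le> (c + 1) * (e' * (\<bar>\<sigma>\<bar> * n) * n)"
            proof -
              have "e' * (\<bar>\<sigma>\<bar> * ?nX v) * ?nX v \<le> e' * (\<bar>\<sigma>\<bar> * n) * n" using e' n by (intro mult_mono) auto
              then have "c * ?nY ?p \<le> c * (e' * (\<bar>\<sigma>\<bar> * n) * n)" using le c0 by (intro mult_left_mono) auto
              also have "\<dots> \<le> (c + 1) * (e' * (\<bar>\<sigma>\<bar> * n) * n)" using e' n by (intro mult_right_mono) auto
              finally show ?thesis .
            qed
            also have "\<dots> = e * \<bar>\<sigma>\<bar>" using c0 n by (simp add: e'_def)
            finally show "cmod (d (0 + \<sigma>) - d 0 - \<sigma> *\<^sub>R q) \<le> e * \<bar>\<sigma>\<bar>" .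
          qed
        qed
        define I where "I = (LINT \<zeta>|lborel. cmod (grad_symbol \<zeta> * \<psi> \<zeta>))"
        show "C * I \<ge> 0" using C(1) by (simp add: I_def)
        fix \<tau> :: real assume \<tau>: "\<bar>\<tau>\<bar> < \<delta>"
        obtain g where g: "has_fourier (\<Phi> (\<tau> *\<^sub>R v) t) g" "\<And>\<zeta>. cmod (g \<zeta> - \<tau> * free_flow h t \<zeta> - complex_of_real (\<tau>\<^sup>2) * picard2 h t \<zeta>)
        \<le> C * (\<tau>\<^sup>2 * sqrt \<bar>\<tau>\<bar>) * cmod (grad_symbol \<zeta>)"
          using C(2)[OF reg[OF \<tau>] t] by blast
        have gi': "integrable lborel (\<lambda>\<zeta>. g \<zeta> * \<psi> \<zeta>)" and \<theta>g: "\<theta> \<tau> = (LINT \<zeta>|lborel. g \<zeta> * \<psi> \<zeta>)"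
          using g(1) \<psi> by (auto simp: has_fourier_def \<theta>_def)
        have "\<theta> \<tau> - \<tau> * (LINT \<zeta>|lborel. free_flow h t \<zeta> * \<psi> \<zeta>) - complex_of_real (\<tau>\<^sup>2) * (LINT \<zeta>|lborel. picard2 h t \<zeta> * \<psi> \<zeta>)
          = (LINT \<zeta>|lborel. g \<zeta> * \<psi> \<zeta> - \<tau> * (free_flow h t \<zeta> * \<psi> \<zeta>) - complex_of_real (\<tau>\<^sup>2) * (picard2 h t \<zeta> * \<psi> \<zeta>))"
          unfolding \<theta>g using gi' fint pint
          by (simp add: Bochner_Integration.integral_diff)
        also have "cmod \<dots> \<le> (LINT \<zeta>|lborel. C * (\<tau>\<^sup>2 * sqrt \<bar>\<tau>\<bar>) * cmod (grad_symbol \<zeta> * \<psi> \<zeta>))"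
        proof (rule Bochner_Integration.integral_norm_bound_integral)
          show "integrable lborel (\<lambda>\<zeta>. g \<zeta> * \<psi> \<zeta> - \<tau> * (free_flow h t \<zeta> * \<psi> \<zeta>) - complex_of_real (\<tau>\<^sup>2) * (picard2 h t \<zeta> * \<psi> \<zeta>))"
            using gi' fint pint by (intro Bochner_Integration.integrable_diff integrable_mult_right)
          show "integrable lborel (\<lambda>\<zeta>. C * (\<tau>\<^sup>2 * sqrt \<bar>\<tau>\<bar>) * cmod (grad_symbol \<zeta> * \<psi> \<zeta>))"
            by (intro integrable_mult_right gi)
          fix \<zeta>
          have "g \<zeta> * \<psi> \<zeta> - \<tau> * (free_flow h t \<zeta> * \<psi> \<zeta>) - complex_of_real (\<tau>\<^sup>2) * (picard2 h t \<zeta> * \<psi> \<zeta>) =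
            (g \<zeta> - \<tau> * free_flow h t \<zeta> - complex_of_real (\<tau>\<^sup>2) * picard2 h t \<zeta>) * \<psi> \<zeta>"
            by (simp add: algebra_simps)
          also have "cmod \<dots> \<le> (C * (\<tau>\<^sup>2 * sqrt \<bar>\<tau>\<bar>) * cmod (grad_symbol \<zeta>)) * cmod (\<psi> \<zeta>)"
            unfolding norm_mult[of _ "\<psi> \<zeta>"] by (intro mult_right_mono g(2)) auto
          finally show "norm (g \<zeta> * \<psi> \<zeta> - \<tau> * (free_flow h t \<zeta> * \<psi> \<zeta>) - complex_of_real (\<tau>\<^sup>2) * (picard2 h t \<zeta> * \<psi> \<zeta>)) \<le> C * (\<tau>\<^sup>2 * sqrt \<bar>\<tau>\<bar>) * cmod (grad_symbol \<zeta> * \<psi> \<zeta>)"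
            by (simp add: norm_mult mult.assoc)
        qed
        also have "\<dots> = C * I * (\<tau>\<^sup>2 * sqrt \<bar>\<tau>\<bar>)"
          unfolding integral_mult_right_zero I_def by (simp add: mult_ac)
        finally show "cmod (\<theta> \<tau> - \<tau> * (LINT \<zeta>|lborel. free_flow h t \<zeta> * \<psi> \<zeta>) - complex_of_real (\<tau>\<^sup>2) * (LINT \<zeta>|lborel. picard2 h t \<zeta> * \<psi> \<zeta>)) \<le> C * I * (\<tau>\<^sup>2 * sqrt \<bar>\<tau>\<bar>)" .
      qed
      then show "apply_tdist w (fourier \<psi>) = 2 * (LINT \<zeta>|lborel. picard2 h t \<zeta> * \<psi> \<zeta>)" by (simp add: q_def)
    qed
    have fw: "has_fourier w (\<lambda>\<zeta>. 2 * picard2 h t \<zeta>)"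
      unfolding has_fourier_def using pair pint picm by (auto simp: mult.assoc)
    let ?w = "\<lambda>\<zeta>. complex_of_real (sobolev_weight s \<zeta>) * picard2 h t \<zeta>"
    have e2: "(\<lambda>\<zeta>. complex_of_real (sobolev_weight s \<zeta>) * (2 * picard2 h t \<zeta>)) = (\<lambda>\<zeta>. 2 * ?w \<zeta>)" by auto
    have sq: "sq_int (\<lambda>\<zeta>. 2 * ?w \<zeta>)" using wS sobolev_iff_sq_int[OF fw, of s] unfolding e2 by simp
    have "2 * l2 ?w = sobolev_norm s w"
      unfolding sobolev_norm_eq_l2[OF fw] e2 by (simp add: l2_cmult)
    also have "\<dots> \<le> ?nY (D2 0 v v)" unfolding w_def by (rule sobolev_norm_le_paths_norm[OF wY t])
    also have "\<dots> \<le> K * ?nX v * ?nX v" by (rule K[OF vX vX])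
    finally have "l2 ?w \<le> K / 2 * (?nX v)\<^sup>2" by (simp add: power2_eq_square)
    moreover have "sq_int ?w" using sq_int_cmult[OF sq, of "1/2"] by simp
    ultimately show "sq_int ?w \<and> l2 ?w \<le> K / 2 * (l2 (\<lambda>\<zeta>. complex_of_real (sobolev_weight s \<zeta>) * h \<zeta>))\<^sup>2"
      by (simp add: sobolev_norm_eq_l2[OF fv])
  qed
qed

section \<open>A nearly resonant interaction\<close>

text \<open>A continuous weight is bounded on the bounded set \<open>S\<close>, so each required
  integral is dominated by a multiple of the indicator of a ball. As the indicator is real, symmetry
  of \<open>S\<close> is the hermitian condition.\<close>

lemma admissible_datum_indicator:
  assumes S: "S \<in> sets borel" "bounded S" and sym: "\<And>\<zeta>. - \<zeta> \<in> S \<longleftrightarrow> \<zeta> \<in> S"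
  shows "admissible_datum (indicator S)"
proof -
  obtain R where "\<forall>x\<in>S. norm x \<le> R" using S(2) unfolding bounded_iff by (elim exE)
  then have R: "S \<subseteq> cball 0 R" by auto
  have int: "integrable lborel (\<lambda>\<zeta>. w \<zeta> * indicator S \<zeta>)" if w: "continuous_on UNIV w" for w :: "plane \<Rightarrow> complex"
  proof -
    have "compact (w ` cball 0 R)" by (intro compact_continuous_image continuous_on_subset[OF w]) auto
    then obtain C where C: "\<And>\<zeta>. \<zeta> \<in> cball 0 R \<Longrightarrow> cmod (w \<zeta>) \<le> C"
      using compact_imp_bounded bounded_iff by (metis imageI)
    have [measurable]: "w \<in> borel_measurable borel" using w by (rule borel_measurable_continuous_onI)
    note [measurable] = S(1)
    show ?thesis
    proof (rule Bochner_Integration.integrable_bound)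
      show "integrable lborel (\<lambda>\<zeta>::plane. C * indicator (cball 0 R) \<zeta> :: real)"
        using emeasure_bounded_finite[OF bounded_cball, of "0 :: plane" R]
        by (intro integrable_mult_right integrable_real_indicator) auto
      show "(\<lambda>\<zeta>. w \<zeta> * indicator S \<zeta>) \<in> borel_measurable lborel" by measurable
      show "AE \<zeta> in lborel. norm (w \<zeta> * indicator S \<zeta>) \<le> norm (C * indicator (cball 0 R) \<zeta> :: real)"
      proof (rule AE_I2)
        fix \<zeta>
        show "norm (w \<zeta> * indicator S \<zeta>) \<le> norm (C * indicator (cball 0 R) \<zeta> :: real)"
        proof (cases "\<zeta> \<in> S")
          case True
          then have "\<zeta> \<in> cball 0 R" using R by auto
          then show ?thesis using C[of \<zeta>] True by (simp add: indicator_def)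
        qed simp
      qed
    qed
  qed
  have sq: "sq_int (\<lambda>\<zeta>. w \<zeta> * indicator S \<zeta>)" if w: "continuous_on UNIV w" for w :: "plane \<Rightarrow> complex"
  proof -
    have e: "(cmod (w \<zeta> * indicator S \<zeta>))\<^sup>2 = cmod (complex_of_real ((cmod (w \<zeta>))\<^sup>2) * indicator S \<zeta>)" for \<zeta>
      by (auto simp: indicator_def norm_mult norm_power)
    have "integrable lborel (\<lambda>\<zeta>. complex_of_real ((cmod (w \<zeta>))\<^sup>2) * indicator S \<zeta>)"
      by (intro int continuous_intros w)
    then have "integrable lborel (\<lambda>\<zeta>. (cmod (w \<zeta> * indicator S \<zeta>))\<^sup>2)"
      unfolding e by (rule integrable_norm)
    then show ?thesis using int[OF w] by (auto simp: sq_int_def)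
  qed
  have one: "integrable lborel (indicator S :: plane \<Rightarrow> complex)" "sq_int (indicator S)"
    using int[of "\<lambda>_. 1"] sq[of "\<lambda>_. 1"] by auto
  have g: "integrable lborel (\<lambda>\<zeta>. grad_symbol \<zeta> * indicator S \<zeta>)"
    unfolding grad_symbol_def by (intro int continuous_intros)
  have wt: "sq_int (\<lambda>\<zeta>. complex_of_real (sobolev_weight \<sigma> \<zeta>) * indicator S \<zeta>)" for \<sigma>
  proof (intro sq continuous_intros)
    have "1 + (norm \<zeta>)\<^sup>2 \<noteq> 0" for \<zeta> :: plane
      using add_pos_nonneg[OF zero_less_one zero_le_power2[of "norm \<zeta>"]] by simp
    then show "continuous_on UNIV (sobolev_weight \<sigma>)"
      unfolding sobolev_weight_def[abs_def] by (intro continuous_intros) auto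
  qed
  show ?thesis
    unfolding admissible_datum_def using one g wt sym by (auto simp: indicator_def)
qed

text \<open>A parallelogram with vertical sides: half-width \<open>a\<close>, and half-height
  \<open>b\<close> around the line of slope \<open>m\<close> through \<open>c\<close>. Its vertical
  sections have length \<open>2 b\<close>, so shearing keeps the area at
  \<open>4 a b\<close>.\<close>

definition sheared_box :: "real \<Rightarrow> real \<Rightarrow> real \<Rightarrow> plane \<Rightarrow> plane set" where
  "sheared_box m a b c = {\<zeta>. \<bar>fst \<zeta> - fst c\<bar> \<le> a \<and> \<bar>snd \<zeta> - snd c - m * (fst \<zeta> - fst c)\<bar> \<le> b}"

lemma closed_sheared_box: "closed (sheared_box m a b c)"
proof -
  have "sheared_box m a b c = {\<zeta>. \<bar>fst \<zeta> - fst c\<bar> \<le> a} \<inter> {\<zeta>. \<bar>snd \<zeta> - snd c - m * (fst \<zeta> - fst c)\<bar> \<le> b}"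
    by (auto simp: sheared_box_def)
  then show ?thesis by (simp only:) (intro closed_Int closed_Collect_le continuous_intros)
qed

lemma sheared_box_measurable [measurable]: "sheared_box m a b c \<in> sets borel"
  by (rule borel_closed[OF closed_sheared_box])

lemma bounded_sheared_box: "bounded (sheared_box m a b c)"
proof -
  have "sheared_box m a b c \<subseteq> {fst c - a..fst c + a} \<times> {snd c - (\<bar>m\<bar> * a + b)..snd c + (\<bar>m\<bar> * a + b)}"
  proof
    fix \<zeta> assume z: "\<zeta> \<in> sheared_box m a b c"
    have "\<bar>m * (fst \<zeta> - fst c)\<bar> \<le> \<bar>m\<bar> * a"
      using z by (auto simp: sheared_box_def abs_mult intro!: mult_left_mono)
    then show "\<zeta> \<in> {fst c - a..fst c + a} \<times> {snd c - (\<bar>m\<bar> * a + b)..snd c + (\<bar>m\<bar> * a + b)}"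
      using z by (auto simp: sheared_box_def mem_Times_iff abs_le_iff)
  qed
  then show ?thesis by (rule bounded_subset[rotated]) (intro bounded_Times bounded_closed_interval)
qed

lemma emeasure_sheared_box:
  assumes "a \<ge> 0" "b \<ge> 0"
  shows "emeasure lborel (sheared_box m a b c) = ennreal (4 * a * b)"
proof -
  have s: "sheared_box m a b c \<in> sets (lborel \<Otimes>\<^sub>M lborel)"
    unfolding lborel_prod using sheared_box_measurable[of m a b c] by simp
  have "emeasure lborel (sheared_box m a b c) = emeasure (lborel \<Otimes>\<^sub>M lborel) (sheared_box m a b c)"
    by (simp add: lborel_prod)
  also have "\<dots> = (\<integral>\<^sup>+x. emeasure lborel (Pair x -` sheared_box m a b c) \<partial>lborel)"
    by (rule lborel.emeasure_pair_measure_alt[OF s])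
  also have "\<dots> = (\<integral>\<^sup>+x. ennreal (2 * b) * indicator {fst c - a..fst c + a} x \<partial>lborel)"
  proof (rule nn_integral_cong)
    fix x
    show "emeasure lborel (Pair x -` sheared_box m a b c) = ennreal (2 * b) * indicator {fst c - a..fst c + a} x"
    proof (cases "x \<in> {fst c - a..fst c + a}")
      case True
      let ?y = "snd c + m * (x - fst c)"
      have "Pair x -` sheared_box m a b c = {?y - b..?y + b}"
        using True by (auto simp: sheared_box_def abs_le_iff)
      then show ?thesis using True assms by (simp add: emeasure_lborel_Icc_eq)
    next
      case False
      then have "Pair x -` sheared_box m a b c = {}" by (auto simp: sheared_box_def abs_le_iff)
      then show ?thesis using False by simp
    qed
  qed
  also have "\<dots> = ennreal (2 * b) * ennreal (2 * a)"
    using assms by (subst nn_integral_cmult_indicator) (auto simp: emeasure_lborel_Icc_eq)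
  also have "\<dots> = ennreal (4 * a * b)"
    using assms by (simp add: ennreal_mult[symmetric] mult_ac)
  finally show ?thesis .
qed

lemma
  assumes "a \<ge> 0" "b \<ge> 0"
  shows integrable_sheared_box: "integrable lborel (indicator (sheared_box m a b c) :: plane \<Rightarrow> real)"
    and measure_sheared_box: "measure lborel (sheared_box m a b c) = 4 * a * b"
proof -
  show "integrable lborel (indicator (sheared_box m a b c) :: plane \<Rightarrow> real)"
    by (rule integrable_real_indicator) (simp_all add: emeasure_sheared_box[OF assms])
  show "measure lborel (sheared_box m a b c) = 4 * a * b"
    using assms by (simp add: measure_def emeasure_sheared_box)
qed

text \<open>
  With \<open>\<xi>\<close>-components \<open>2, 1\<close> and \<open>\<eta>\<close>-components \<open>- 4 \<kappa> / 5, \<kappa>\<close> the resonance function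
  \<open>3 (\<xi>\<^sub>1 \<xi>\<^sub>2 (\<xi>\<^sub>1 + \<xi>\<^sub>2) + \<eta>\<^sub>1 \<eta>\<^sub>2 (\<eta>\<^sub>1 + \<eta>\<^sub>2))\<close> vanishes exactly when \<open>\<kappa>^3 = 75 / 2\<close>, and then its gradients
  with respect to the two frequencies are both orthogonal to \<open>(1, 2 \<kappa> / 9)\<close>.
\<close>

definition res_slope :: real where "res_slope = root 3 (75 / 2)"

lemma res_slope_cube: "res_slope ^ 3 = 75 / 2"
  by (simp add: res_slope_def)

lemma res_slope_bounds: "3 < res_slope" "res_slope < 4"
proof -
  have p: "res_slope \<ge> 0" by (simp add: res_slope_def)
  show "3 < res_slope" by (rule power_less_imp_less_base[of _ 3]) (use p res_slope_cube in auto)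
  show "res_slope < 4" by (rule power_less_imp_less_base[of _ 3]) (use res_slope_cube in auto)
qed

abbreviation "res_shear \<equiv> 2 / 9 * res_slope"

definition center1 :: "real \<Rightarrow> plane" where "center1 d = (2 / d\<^sup>2, - (4 / 5) * res_slope / d\<^sup>2)"

definition center2 :: "real \<Rightarrow> plane" where "center2 d = (1 / d\<^sup>2, res_slope / d\<^sup>2)"

text \<open>With \<open>N = d^(-2)\<close> the box has size \<open>N^(-1/2)\<close> along the
  direction \<open>(1, res_shear)\<close> and \<open>N^(-2)\<close> across. The parameter
  \<open>d\<close> keeps all exponents integral.\<close>

definition freq1 :: "real \<Rightarrow> plane set" where "freq1 d = sheared_box res_shear d (d ^ 4) (center1 d)"

definition freq2 :: "real \<Rightarrow> plane set" where "freq2 d = sheared_box res_shear d (d ^ 4) (center2 d)"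

text \<open>Half the size of the input boxes: for \<open>\<zeta>\<close> in this box and
  \<open>w\<close> in the half-size copy around \<open>center1 d\<close>, the difference
  \<open>\<zeta> - w\<close> still lies in \<open>freq2 d\<close>.\<close>

definition freq_out :: "real \<Rightarrow> plane set" where
  "freq_out d = sheared_box res_shear (d / 2) (d ^ 4 / 2) (center1 d + center2 d)"

definition freqs :: "real \<Rightarrow> plane set" where
  "freqs d = {\<zeta>. \<zeta> \<in> freq1 d \<or> \<zeta> \<in> freq2 d \<or> - \<zeta> \<in> freq1 d \<or> - \<zeta> \<in> freq2 d}"

lemma abs_mult_le: "\<bar>x\<bar> \<le> a \<Longrightarrow> \<bar>y\<bar> \<le> b \<Longrightarrow> \<bar>x * y\<bar> \<le> a * (b::real)"
  unfolding abs_mult by (intro mult_mono) auto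

text \<open>Let the first coordinates be \<open>2 N + p\<close> and \<open>N + q\<close>, and the
  second ones, divided by \<open>res_slope\<close>, be \<open>- 4/5 N + y\<close> and
  \<open>N + z\<close>. The leading terms \<open>6 N^3\<close> and \<open>- 6 N^3\<close> cancel;
  for \<open>y = 2/9 p + e\<close> and \<open>z = 2/9 q + f\<close> the gradient terms
  \<open>5 p + 8 q\<close> cancel against \<open>- 45/2 y - 36 z\<close> except for \<open>e\<close>
  and \<open>f\<close>. There remain \<open>N^2\<close> times transverse terms of size
  \<open>d^4\<close>, \<open>N\<close> times quadratic terms of size \<open>d^2\<close>, and small
  cubic terms, all of them bounded.\<close>

lemma resonance_bound:
  assumes d: "0 < d" "d \<le> 1 / 2" and w: "w \<in> freq1 d" and v: "v \<in> freq2 d"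
  shows "\<bar>airy (w + v) - airy w - airy v\<bar> \<le> 5000"
proof -
  define N where "N = 1 / d\<^sup>2"
  have Nd: "N * d\<^sup>2 = 1" "N > 0" using d by (auto simp: N_def)
  define p q where "p = fst w - 2 * N" and "q = fst v - N"
  define e f where "e = (snd w + (4 / 5) * res_slope * N - res_shear * p) / res_slope"
    and "f = (snd v - res_slope * N - res_shear * q) / res_slope"
  note \<kappa> = res_slope_bounds
  have pq: "\<bar>p\<bar> \<le> d" "\<bar>q\<bar> \<le> d"
    using w v by (auto simp: freq1_def freq2_def sheared_box_def center1_def center2_def p_def q_def N_def)
  have ef: "\<bar>e\<bar> \<le> d ^ 4" "\<bar>f\<bar> \<le> d ^ 4"
  proof -
    have "\<bar>snd w + (4 / 5) * res_slope * N - res_shear * p\<bar> \<le> d ^ 4"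
      "\<bar>snd v - res_slope * N - res_shear * q\<bar> \<le> d ^ 4"
      using w v by (auto simp: freq1_def freq2_def sheared_box_def center1_def center2_def p_def q_def N_def)
    moreover have "\<bar>x / res_slope\<bar> \<le> \<bar>x\<bar>" for x
      using \<kappa> by (simp add: abs_divide divide_le_eq mult_le_cancel_left1)
    ultimately show "\<bar>e\<bar> \<le> d ^ 4" "\<bar>f\<bar> \<le> d ^ 4" unfolding e_def f_def by (meson order_trans)+
  qed
  define y z where "y = 2 / 9 * p + e" and "z = 2 / 9 * q + f"
  have d4: "d ^ 4 \<le> d"
    using power_decreasing[of 1 4 d] d by simp
  have yz: "\<bar>y\<bar> \<le> 2 * d" "\<bar>z\<bar> \<le> 2 * d"
    using pq ef d4 unfolding y_def z_def by linarith+
  have coords: "fst w = 2 * N + p" "fst v = N + q" "snd w = res_slope * (- 4 / 5 * N + y)" "snd v = res_slope * (N + z)"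
    using \<kappa> by (simp_all add: p_def q_def y_def z_def e_def f_def field_simps)
  have cube: "(a + b) ^ 3 - a ^ 3 - b ^ 3 = 3 * (a * b * (a + b))" for a b :: real
    by (simp add: power3_eq_cube algebra_simps)
  have "airy (w + v) - airy w - airy v = ((fst w + fst v) ^ 3 - fst w ^ 3 - fst v ^ 3) + ((snd w + snd v) ^ 3 - snd w ^ 3 - snd v ^ 3)"
    by (simp add: airy_def)
  also have "\<dots> = 3 * ((2 * N + p) * (N + q) * ((2 * N + p) + (N + q)) +
      res_slope ^ 3 * ((- 4 / 5 * N + y) * (N + z) * ((- 4 / 5 * N + y) + (N + z))))"
    unfolding cube coords by (simp add: power3_eq_cube algebra_simps)
  also have "(2 * N + p) * (N + q) * ((2 * N + p) + (N + q)) +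
      res_slope ^ 3 * ((- 4 / 5 * N + y) * (N + z) * ((- 4 / 5 * N + y) + (N + z))) =
    N\<^sup>2 * (- (45 / 2) * e - 36 * f) +
    N * (p * p + 6 * (p * q) + 2 * (q * q) + 15 / 2 * (y * z) - 30 * (z * (y + z)) + 75 / 2 * (y * (y + z))) +
    (p * q) * (p + q) + 75 / 2 * ((y * z) * (y + z))"
    unfolding res_slope_cube y_def z_def by (simp add: power2_eq_square power3_eq_cube field_simps)
  finally have eq: "airy (w + v) - airy w - airy v = 3 * (N\<^sup>2 * (- (45 / 2) * e - 36 * f) +
    N * (p * p + 6 * (p * q) + 2 * (q * q) + 15 / 2 * (y * z) - 30 * (z * (y + z)) + 75 / 2 * (y * (y + z))) +
    (p * q) * (p + q) + 75 / 2 * ((y * z) * (y + z)))" .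
  have yz2: "\<bar>y + z\<bar> \<le> 4 * d" and pq2: "\<bar>p + q\<bar> \<le> 2 * d" using yz pq by linarith+
  have b1: "\<bar>N\<^sup>2 * (- (45 / 2) * e - 36 * f)\<bar> \<le> 59"
  proof -
    have "\<bar>- (45 / 2) * e - 36 * f\<bar> \<le> 59 * d ^ 4" using ef zero_le_power[of d 4] d by linarith
    then have "\<bar>N\<^sup>2 * (- (45 / 2) * e - 36 * f)\<bar> \<le> N\<^sup>2 * (59 * d ^ 4)" by (intro abs_mult_le) auto
    also have "\<dots> = 59 * (N * d\<^sup>2)\<^sup>2" by (simp add: power_mult_distrib)
    finally show ?thesis unfolding Nd by simp
  qed
  have b2: "\<bar>N * (p * p + 6 * (p * q) + 2 * (q * q) + 15 / 2 * (y * z) - 30 * (z * (y + z)) + 75 / 2 * (y * (y + z)))\<bar> \<le> 600"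
  proof -
    have m: "\<bar>p * p\<bar> \<le> d * d" "\<bar>p * q\<bar> \<le> d * d" "\<bar>q * q\<bar> \<le> d * d" "\<bar>y * z\<bar> \<le> 2 * d * (2 * d)"
      "\<bar>z * (y + z)\<bar> \<le> 2 * d * (4 * d)" "\<bar>y * (y + z)\<bar> \<le> 2 * d * (4 * d)"
      by (intro abs_mult_le pq yz yz2)+
    have "\<bar>p * p + 6 * (p * q) + 2 * (q * q) + 15 / 2 * (y * z) - 30 * (z * (y + z)) + 75 / 2 * (y * (y + z))\<bar> \<le> 600 * d\<^sup>2"
      using m zero_le_square[of d] unfolding power2_eq_square abs_le_iff by (intro conjI; linarith)
    then have "\<bar>N * (p * p + 6 * (p * q) + 2 * (q * q) + 15 / 2 * (y * z) - 30 * (z * (y + z)) + 75 / 2 * (y * (y + z)))\<bar> \<le> N * (600 * d\<^sup>2)"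
      using Nd by (intro abs_mult_le) auto
    also have "\<dots> = 600 * (N * d\<^sup>2)" by simp
    finally show ?thesis unfolding Nd by simp
  qed
  have dd: "\<bar>p * q\<bar> \<le> 1" "\<bar>p + q\<bar> \<le> 1" "\<bar>y * z\<bar> \<le> 1" "\<bar>y + z\<bar> \<le> 2"
  proof -
    have "d * d \<le> 1 / 2 * (1 / 2)" using d by (intro mult_mono) auto
    then show "\<bar>p * q\<bar> \<le> 1" "\<bar>y * z\<bar> \<le> 1"
      using abs_mult_le[OF pq] abs_mult_le[OF yz] by linarith+
  qed (use yz2 pq2 d in linarith)+
  have b3: "\<bar>(p * q) * (p + q)\<bar> \<le> 1" "\<bar>(y * z) * (y + z)\<bar> \<le> 2"
    using abs_mult_le[OF dd(1,2)] abs_mult_le[OF dd(3,4)] by simp_all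
  \<comment> \<open>The sum is at most \<open>3 * (59 + 600 + 1 + 75) = 2205\<close>; 5000 is a
    round bound, and its inverse becomes the admissible time.\<close>
  have tri: "\<bar>3 * (a + b + x + 75 / 2 * y)\<bar> \<le> 5000" if "\<bar>a\<bar> \<le> 59" "\<bar>b\<bar> \<le> 600" "\<bar>x\<bar> \<le> 1" "\<bar>y\<bar> \<le> 2" for a b x y :: real
    using that unfolding abs_le_iff by auto
  show ?thesis unfolding eq by (rule tri[OF b1 b2 b3])
qed

text \<open>The first coordinates in the four boxes are near \<open>2 N\<close>, \<open>N\<close>,
  \<open>- N\<close> and \<open>- 2 N\<close>; a sum near \<open>3 N\<close> arises only as
  \<open>2 N + N\<close>.\<close>

lemma freqs_interaction:
  assumes d: "0 < d" "d \<le> 1 / 2" and \<zeta>: "\<zeta> \<in> freq_out d" and w: "w \<in> freqs d" "\<zeta> - w \<in> freqs d"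
  shows "w \<in> freq1 d \<and> \<zeta> - w \<in> freq2 d \<or> w \<in> freq2 d \<and> \<zeta> - w \<in> freq1 d"
proof -
  define N where "N = 1 / d\<^sup>2"
  have "d\<^sup>2 \<le> (1 / 2)\<^sup>2" using d by (intro power_mono) auto
  then have N: "N \<ge> 4" using d by (simp add: N_def field_simps power2_eq_square)
  have z: "\<bar>fst \<zeta> - 3 * N\<bar> \<le> d / 2"
    using \<zeta> by (simp add: freq_out_def sheared_box_def center1_def center2_def N_def add_divide_distrib[symmetric])
  have f1: "2 * N - d \<le> fst x" "fst x \<le> 2 * N + d" if "x \<in> freq1 d" for x
    using that by (auto simp: freq1_def sheared_box_def center1_def N_def abs_le_iff)
  have f2: "N - d \<le> fst x" "fst x \<le> N + d" if "x \<in> freq2 d" for x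
    using that by (auto simp: freq2_def sheared_box_def center2_def N_def abs_le_iff)
  have z: "3 * N - d / 2 \<le> fst \<zeta>" "fst \<zeta> \<le> 3 * N + d / 2" using z by linarith+
  have sum: "fst \<zeta> = fst w + fst (\<zeta> - w)" by simp
  have neg: "fst (- x) = - fst x" for x :: plane by simp
  have n1: "- x \<notin> freq1 d" "- x \<notin> freq2 d" if "x = w \<or> x = \<zeta> - w" for x
  proof -
    have up: "fst y \<le> 2 * N + d" if "y \<in> freqs d" for y
    proof -
      from that consider "y \<in> freq1 d" | "y \<in> freq2 d" | "- y \<in> freq1 d" | "- y \<in> freq2 d"
        unfolding freqs_def by blast
      then show ?thesis
      proof cases
        case 1 then show ?thesis by (rule f1)
      next
        case 2 from f2(2)[OF 2] N show ?thesis by linarith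
      next
        case 3 from f1(1)[OF 3] N d show ?thesis unfolding neg by linarith
      next
        case 4 from f2(1)[OF 4] N d show ?thesis unfolding neg by linarith
      qed
    qed
    have low: "fst x \<ge> N - 3 / 2 * d"
      using that
    proof
      assume "x = w"
      moreover have "fst w \<ge> N - 3 / 2 * d" using up[OF w(2)] z sum by linarith
      ultimately show ?thesis by simp
    next
      assume "x = \<zeta> - w"
      moreover have "fst (\<zeta> - w) \<ge> N - 3 / 2 * d" using up[OF w(1)] z sum by linarith
      ultimately show ?thesis by (simp only:)
    qed
    show "- x \<notin> freq1 d"
    proof
      assume "- x \<in> freq1 d" from f1(1)[OF this] show False using low N d unfolding neg by linarith
    qed
    show "- x \<notin> freq2 d"
    proof
      assume "- x \<in> freq2 d" from f2(1)[OF this] show False using low N d unfolding neg by linarith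
    qed
  qed
  have "w \<in> freq1 d \<or> w \<in> freq2 d" "\<zeta> - w \<in> freq1 d \<or> \<zeta> - w \<in> freq2 d"
    using w n1 unfolding freqs_def by blast+
  moreover have "\<not> (w \<in> freq1 d \<and> \<zeta> - w \<in> freq1 d)"
    using f1(1)[of w] f1(1)[of "\<zeta> - w"] z sum N d by linarith
  moreover have "\<not> (w \<in> freq2 d \<and> \<zeta> - w \<in> freq2 d)"
    using f2(2)[of w] f2(2)[of "\<zeta> - w"] z sum N d by linarith
  ultimately show ?thesis by blast
qed

lemma freqs_measurable [measurable]: "freqs d \<in> sets borel"
proof -
  have "(\<lambda>\<zeta>::plane. - \<zeta>) -` freq1 d \<in> sets borel" "(\<lambda>\<zeta>::plane. - \<zeta>) -` freq2 d \<in> sets borel"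
    unfolding freq1_def freq2_def
    by (intro borel_closed closed_vimage closed_sheared_box continuous_intros)+
  moreover have "freqs d = freq1 d \<union> freq2 d \<union> (\<lambda>\<zeta>. - \<zeta>) -` freq1 d \<union> (\<lambda>\<zeta>. - \<zeta>) -` freq2 d"
    by (auto simp: freqs_def)
  ultimately show ?thesis by (simp add: freq1_def freq2_def)
qed

lemma admissible_freqs: "admissible_datum (indicator (freqs d))"
proof (rule admissible_datum_indicator[OF freqs_measurable])
  have "freqs d \<subseteq> freq1 d \<union> freq2 d \<union> uminus ` freq1 d \<union> uminus ` freq2 d"
  proof
    fix \<zeta> assume "\<zeta> \<in> freqs d"
    moreover have "\<zeta> \<in> uminus ` X" if "- \<zeta> \<in> X" for X by (rule image_eqI[OF _ that]) simp
    ultimately show "\<zeta> \<in> freq1 d \<union> freq2 d \<union> uminus ` freq1 d \<union> uminus ` freq2 d"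
      unfolding freqs_def by blast
  qed
  moreover have "bounded (freq1 d \<union> freq2 d \<union> uminus ` freq1 d \<union> uminus ` freq2 d)"
    by (auto simp: freq1_def freq2_def bounded_sheared_box bounded_uminus)
  ultimately show "bounded (freqs d)" by (rule bounded_subset[rotated])
  show "- \<zeta> \<in> freqs d \<longleftrightarrow> \<zeta> \<in> freqs d" for \<zeta> by (auto simp: freqs_def)
qed

section \<open>Lower bound for the interaction on the output box\<close>

lemma cos_ge_half: "\<bar>x\<bar> \<le> 1 \<Longrightarrow> cos (x::real) \<ge> 1 / 2"
proof -
  assume "\<bar>x\<bar> \<le> 1"
  then have "x\<^sup>2 \<le> 1" using abs_le_square_iff[of x 1] by simp
  have "\<bar>Re (cis x - 1 - \<i> * x)\<bar> \<le> x\<^sup>2 / 2" using abs_Re_le_cmod cmod_cis_approx order_trans by blast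
  then show ?thesis using \<open>x\<^sup>2 \<le> 1\<close> by simp
qed

text \<open>On the support of the integrand the phase is \<open>t\<close> times the resonance
  function, hence at most 1, so the cosine is at least \<open>1 / 2\<close> and nothing cancels. The
  half-size box \<open>?A\<close> of area \<open>d^5\<close> lies in the support, which gives
  \<open>1 / 2 * d^5 / (2 * pi)\<close>.\<close>

lemma conv_lower_bound:
  assumes d: "0 < d" "d \<le> 1 / 2" and \<zeta>: "\<zeta> \<in> freq_out d" and t: "0 \<le> t" "t \<le> 1 / 5000"
  defines "h \<equiv> indicator (freqs d) :: plane \<Rightarrow> complex"
  shows "Re (cis (- (t * airy \<zeta>)) * conv (free_flow h t) (free_flow h t) \<zeta>) \<ge> d ^ 5 / (4 * pi)"
proof -
  let ?f = "free_flow h t"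
  let ?A = "sheared_box res_shear (d / 2) (d ^ 4 / 2) (center1 d)"
  have h: "sq_int h" using admissible_freqs[of d] by (simp add: h_def admissible_datum_def)
  note f = sq_int_free_flow(1)[OF h, of t]
  have i: "integrable lborel (\<lambda>w. cis (- (t * airy \<zeta>)) * (?f w * ?f (\<zeta> - w)))"
    by (intro integrable_mult_right conv_bound(1) f)
  have e: "Re (cis (- (t * airy \<zeta>)) * (?f w * ?f (\<zeta> - w))) =
      cos (t * (airy \<zeta> - airy w - airy (\<zeta> - w))) * (indicator (freqs d) w * indicator (freqs d) (\<zeta> - w))" for w
  proof -
    have "cis (- (t * airy \<zeta>)) * (?f w * ?f (\<zeta> - w)) = cis (- (t * (airy \<zeta> - airy w - airy (\<zeta> - w)))) * (h w * h (\<zeta> - w))"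
    proof -
      have "cis (- (t * (airy \<zeta> - airy w - airy (\<zeta> - w)))) = cis (- (t * airy \<zeta>)) * (cis (t * airy w) * cis (t * airy (\<zeta> - w)))"
        by (simp add: cis_mult algebra_simps)
      then show ?thesis by (simp add: free_flow_def mult_ac)
    qed
    also have "Re \<dots> = cos (t * (airy \<zeta> - airy w - airy (\<zeta> - w))) * (indicator (freqs d) w * indicator (freqs d) (\<zeta> - w))"
      by (auto simp: h_def indicator_def)
    finally show ?thesis .
  qed
  have "1 / 2 * (LINT w|lborel. indicator ?A w :: real) \<le> (LINT w|lborel. Re (cis (- (t * airy \<zeta>)) * (?f w * ?f (\<zeta> - w))))"
    unfolding integral_mult_right_zero[symmetric]
  proof (rule integral_mono)
    show "integrable lborel (\<lambda>w. 1 / 2 * indicator ?A w :: real)"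
      using d by (intro integrable_mult_right integrable_sheared_box) auto
    show "integrable lborel (\<lambda>w. Re (cis (- (t * airy \<zeta>)) * (?f w * ?f (\<zeta> - w))))"
      by (rule integrable_Re[OF i])
    fix w
    show "1 / 2 * indicator ?A w \<le> Re (cis (- (t * airy \<zeta>)) * (?f w * ?f (\<zeta> - w)))"
    proof (cases "w \<in> freqs d \<and> \<zeta> - w \<in> freqs d")
      case True
      have "\<bar>airy \<zeta> - airy w - airy (\<zeta> - w)\<bar> \<le> 5000"
        using freqs_interaction[OF d \<zeta> conjunct1[OF True] conjunct2[OF True]]
      proof (elim disjE conjE)
        assume "w \<in> freq1 d" "\<zeta> - w \<in> freq2 d"
        from resonance_bound[OF d this] show ?thesis by simp
      next
        assume "w \<in> freq2 d" "\<zeta> - w \<in> freq1 d"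
        from resonance_bound[OF d this(2,1)] show ?thesis by (simp add: algebra_simps)
      qed
      then have "\<bar>t * (airy \<zeta> - airy w - airy (\<zeta> - w))\<bar> \<le> 1 / 5000 * 5000"
        using t by (intro abs_mult_le) auto
      then have "cos (t * (airy \<zeta> - airy w - airy (\<zeta> - w))) \<ge> 1 / 2" by (intro cos_ge_half) simp
      then show ?thesis unfolding e using True by (simp add: indicator_def)
    next
      case False
      have "w \<notin> ?A"
      proof
        assume w: "w \<in> ?A"
        have "w \<in> freq1 d"
        proof -
          have "0 \<le> d ^ 4" using d by simp
          then show ?thesis using w d unfolding sheared_box_def freq1_def mem_Collect_eq by (elim conjE; intro conjI; linarith)
        qed
        moreover have "\<zeta> - w \<in> freq2 d"
        proof -
          have "\<bar>fst (\<zeta> - w) - fst (center2 d)\<bar> \<le> d"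
          proof -
            have "\<bar>fst w - fst (center1 d)\<bar> \<le> d / 2" "\<bar>fst \<zeta> - fst (center1 d + center2 d)\<bar> \<le> d / 2"
              using w \<zeta> unfolding sheared_box_def freq_out_def by blast+
            then show ?thesis unfolding fst_add fst_diff by linarith
          qed
          moreover have "snd (\<zeta> - w) - snd (center2 d) - m * (fst (\<zeta> - w) - fst (center2 d)) =
              (snd \<zeta> - snd (center1 d + center2 d) - m * (fst \<zeta> - fst (center1 d + center2 d))) -
              (snd w - snd (center1 d) - m * (fst w - fst (center1 d)))" for m
            by (simp add: algebra_simps)
          moreover have "\<bar>snd \<zeta> - snd (center1 d + center2 d) - res_shear * (fst \<zeta> - fst (center1 d + center2 d))\<bar> \<le> d ^ 4 / 2"
            "\<bar>snd w - snd (center1 d) - res_shear * (fst w - fst (center1 d))\<bar> \<le> d ^ 4 / 2"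
            using w \<zeta> unfolding sheared_box_def freq_out_def by blast+
          ultimately show ?thesis unfolding freq2_def sheared_box_def mem_Collect_eq by (simp only: simp_thms)
        qed
        ultimately show False using False by (simp add: freqs_def)
      qed
      then show ?thesis unfolding e using False by (auto simp: indicator_def)
    qed
  qed
  also have "(LINT w|lborel. indicator ?A w :: real) = d ^ 5"
    using d by (simp add: measure_sheared_box eval_nat_numeral)
  also have "(LINT w|lborel. Re (cis (- (t * airy \<zeta>)) * (?f w * ?f (\<zeta> - w)))) = Re (LINT w|lborel. cis (- (t * airy \<zeta>)) * (?f w * ?f (\<zeta> - w)))"
    by (rule integral_Re[OF i])
  also have "(LINT w|lborel. cis (- (t * airy \<zeta>)) * (?f w * ?f (\<zeta> - w))) = complex_of_real (2 * pi) * (cis (- (t * airy \<zeta>)) * conv ?f ?f \<zeta>)"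
    by (simp add: conv_def)
  also have "Re \<dots> = 2 * pi * Re (cis (- (t * airy \<zeta>)) * conv ?f ?f \<zeta>)"
    by (simp only: Re_complex_of_real Im_complex_of_real times_complex.simps)
  finally show ?thesis by (simp add: field_simps)
qed

text \<open>The output centre is \<open>(3 N, res_slope * N / 5)\<close> with both coordinates
  positive, so their sum keeps size \<open>N\<close> and the derivative in the nonlinearity gains a
  full factor \<open>N\<close>.\<close>

lemma freq_out_bounds:
  assumes d: "0 < d" "d \<le> 1 / 2" and \<zeta>: "\<zeta> \<in> freq_out d"
  shows "cmod (grad_symbol \<zeta>) \<ge> 1 / d\<^sup>2" "1 + (norm \<zeta>)\<^sup>2 \<le> 100 / d ^ 4"
proof -
  define N where "N = 1 / d\<^sup>2"
  have "d\<^sup>2 \<le> (1 / 2)\<^sup>2" using d by (intro power_mono) auto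
  then have N: "N \<ge> 4" using d by (simp add: N_def field_simps power2_eq_square)
  note \<kappa> = res_slope_bounds
  define p where "p = fst \<zeta> - 3 * N"
  have c: "center1 d + center2 d = (3 * N, res_slope * N / 5)"
    by (simp add: center1_def center2_def N_def add_divide_distrib[symmetric] algebra_simps)
  have z: "\<bar>p\<bar> \<le> d / 2" "\<bar>snd \<zeta> - res_slope * N / 5 - res_shear * p\<bar> \<le> d ^ 4 / 2"
    using \<zeta> unfolding freq_out_def sheared_box_def c p_def by simp_all
  have "d ^ 4 \<le> 1" using d by (intro power_le_one) auto
  have "\<bar>res_shear * p\<bar> \<le> 1 * (1 / 4)" using z(1) \<kappa> d by (intro abs_mult_le) auto
  moreover have "0 \<le> res_slope * N" "res_slope * N \<le> 4 * N" using \<kappa> N by (auto intro!: mult_right_mono)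
  ultimately have b: "fst \<zeta> \<ge> 3 * N - 1" "fst \<zeta> \<le> 3 * N + 1" "snd \<zeta> \<ge> - 1" "snd \<zeta> \<le> N + 1"
    using z \<open>d ^ 4 \<le> 1\<close> d N unfolding p_def by linarith+
  have "\<bar>fst \<zeta> + snd \<zeta>\<bar> \<ge> N" using b N by linarith
  then show "cmod (grad_symbol \<zeta>) \<ge> 1 / d\<^sup>2"
    by (simp add: grad_symbol_def norm_mult N_def del: of_real_add)
  have "(norm \<zeta>)\<^sup>2 = \<bar>fst \<zeta>\<bar>\<^sup>2 + \<bar>snd \<zeta>\<bar>\<^sup>2" by (cases \<zeta>) (simp add: norm_Pair)
  also have "\<dots> \<le> (4 * N)\<^sup>2 + (4 * N)\<^sup>2" using b N by (intro add_mono power_mono) auto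
  finally have "1 + (norm \<zeta>)\<^sup>2 \<le> 1 + 32 * N\<^sup>2" by (simp add: power_mult_distrib)
  also have "\<dots> \<le> 100 * N\<^sup>2"
  proof -
    have "1 \<le> N\<^sup>2" using power_mono[of 1 N 2] N by simp
    then show ?thesis by linarith
  qed
  also have "\<dots> = 100 / d ^ 4" by (simp add: N_def power_divide)
  finally show "1 + (norm \<zeta>)\<^sup>2 \<le> 100 / d ^ 4" .
qed

section \<open>Sobolev norms of the datum and of the second iterate\<close>

lemma freqs_bounds:
  assumes d: "0 < d" "d \<le> 1 / 2" and \<zeta>: "\<zeta> \<in> freqs d"
  shows "1 / (4 * d ^ 4) \<le> 1 + (norm \<zeta>)\<^sup>2"
proof -
  define N where "N = 1 / d\<^sup>2"
  have "d\<^sup>2 \<le> (1 / 2)\<^sup>2" using d by (intro power_mono) auto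
  then have N: "N \<ge> 4" using d by (simp add: N_def field_simps power2_eq_square)
  have "\<bar>fst x\<bar> \<ge> N / 2" if "x \<in> freq1 d \<or> x \<in> freq2 d" for x
    using that N d by (auto simp: freq1_def freq2_def sheared_box_def center1_def center2_def N_def)
  from this[of \<zeta>] this[of "- \<zeta>"] \<zeta> have "\<bar>fst \<zeta>\<bar> \<ge> N / 2" by (auto simp: freqs_def)
  then have "(N / 2)\<^sup>2 \<le> \<bar>fst \<zeta>\<bar>\<^sup>2" using N by (intro power_mono) auto
  also have "\<dots> \<le> (norm \<zeta>)\<^sup>2" by (cases \<zeta>) (simp add: norm_Pair)
  finally show ?thesis by (simp add: N_def power_divide)
qed

lemma freqs_volume:
  assumes d: "0 < d"
  shows "(LINT \<zeta>|lborel. indicator (freqs d) \<zeta> :: real) \<le> 16 * d ^ 5"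
    and "integrable lborel (indicator (freqs d) :: plane \<Rightarrow> real)"
proof -
  have i: "integrable lborel (indicator (freq1 d) :: plane \<Rightarrow> real)" "integrable lborel (indicator (freq2 d) :: plane \<Rightarrow> real)"
    using d by (auto simp: freq1_def freq2_def intro!: integrable_sheared_box)
  have v: "(LINT \<zeta>|lborel. indicator (freq1 d) \<zeta> :: real) = 4 * d ^ 5" "(LINT \<zeta>|lborel. indicator (freq2 d) \<zeta> :: real) = 4 * d ^ 5"
    using d by (simp_all add: freq1_def freq2_def measure_sheared_box eval_nat_numeral)
  have m [measurable]: "freq1 d \<in> sets borel" "freq2 d \<in> sets borel" by (auto simp: freq1_def freq2_def)
  have ri: "integrable lborel (\<lambda>\<zeta>::plane. indicator A (- \<zeta>) :: real)" "(LINT \<zeta>|lborel. indicator A (- \<zeta>) :: real) = (LINT \<zeta>::plane|lborel. indicator A \<zeta>)"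
    if "integrable lborel (indicator A :: plane \<Rightarrow> real)" "A \<in> sets borel" for A :: "plane set"
    using lborel_integrable_affine[of "-1" "indicator A :: plane \<Rightarrow> real" 0] lborel_integral_affine[of "-1" "indicator A :: plane \<Rightarrow> real" 0] that
    by auto
  let ?s = "\<lambda>\<zeta>. indicator (freq1 d) \<zeta> + indicator (freq2 d) \<zeta> + indicator (freq1 d) (- \<zeta>) + indicator (freq2 d) (- \<zeta>) :: real"
  have si: "integrable lborel ?s" using i ri[OF i(1) m(1)] ri[OF i(2) m(2)] by auto
  have le: "indicator (freqs d) \<zeta> \<le> ?s \<zeta>" for \<zeta> by (auto simp: freqs_def indicator_def)
  show fi: "integrable lborel (indicator (freqs d) :: plane \<Rightarrow> real)"
    by (rule Bochner_Integration.integrable_bound[OF si]) (use le in \<open>auto intro: order_trans[OF _ abs_ge_self]\<close>)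
  have "(LINT \<zeta>|lborel. indicator (freqs d) \<zeta> :: real) \<le> (LINT \<zeta>|lborel. ?s \<zeta>)"
    by (intro integral_mono fi si le)
  also have "\<dots> = 16 * d ^ 5"
    using i v ri[OF i(1) m(1)] ri[OF i(2) m(2)] by simp
  finally show "(LINT \<zeta>|lborel. indicator (freqs d) \<zeta> :: real) \<le> 16 * d ^ 5" .
qed

text \<open>For negative \<open>s\<close> the weight decreases, so the upper bound for the datum
  uses the smallest frequency, just as the lower bound for the output uses the largest one.\<close>

lemma l2_datum_bound:
  assumes d: "0 < d" "d \<le> 1 / 2" and s: "s < 0"
  shows "(l2 (\<lambda>\<zeta>. complex_of_real (sobolev_weight s \<zeta>) * indicator (freqs d) \<zeta>))\<^sup>2
    \<le> (1 / (4 * d ^ 4)) powr s * (16 * d ^ 5)"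
proof -
  have "(l2 (\<lambda>\<zeta>. complex_of_real (sobolev_weight s \<zeta>) * indicator (freqs d) \<zeta>))\<^sup>2
    \<le> (LINT \<zeta>|lborel. (1 / (4 * d ^ 4)) powr s * indicator (freqs d) \<zeta>)"
    unfolding l2_power2
  proof (rule integral_mono)
    show "integrable lborel (\<lambda>\<zeta>. (cmod (complex_of_real (sobolev_weight s \<zeta>) * indicator (freqs d) \<zeta>))\<^sup>2)"
      using admissible_freqs[of d] by (simp add: admissible_datum_def sq_int_def)
    show "integrable lborel (\<lambda>\<zeta>. (1 / (4 * d ^ 4)) powr s * indicator (freqs d) \<zeta> :: real)"
      by (intro integrable_mult_right freqs_volume d)
    fix \<zeta>
    have "(1 + (norm \<zeta>)\<^sup>2) powr s \<le> (1 / (4 * d ^ 4)) powr s" if "\<zeta> \<in> freqs d"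
      using freqs_bounds[OF d that] d s by (intro powr_mono2') auto
    then show "(cmod (complex_of_real (sobolev_weight s \<zeta>) * indicator (freqs d) \<zeta>))\<^sup>2 \<le> (1 / (4 * d ^ 4)) powr s * indicator (freqs d) \<zeta>"
      unfolding sobolev_weight_power2 by (auto simp: indicator_def)
  qed
  also have "\<dots> \<le> (1 / (4 * d ^ 4)) powr s * (16 * d ^ 5)"
    unfolding integral_mult_right_zero by (intro mult_left_mono freqs_volume d) auto
  finally show ?thesis .
qed

text \<open>After removal of the phase at \<open>\<zeta>\<close> the real part is positive
  throughout \<open>[0, t]\<close>, so the time integral does not cancel either. The convolution
  contributes \<open>d^5\<close> and the derivative \<open>d^(-2)\<close>.\<close>

lemma picard2_lower_bound:
  assumes d: "0 < d" "d \<le> 1 / 2" and \<zeta>: "\<zeta> \<in> freq_out d" and t: "0 \<le> t" "t \<le> 1 / 5000"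
  shows "cmod (picard2 (indicator (freqs d)) t \<zeta>) \<ge> 4 powr (- 1 / 3) * t / (4 * pi) * d ^ 3"
proof -
  let ?h = "indicator (freqs d) :: plane \<Rightarrow> complex"
  let ?Q = "\<lambda>t'. conv (free_flow ?h t') (free_flow ?h t')"
  let ?q = "\<lambda>t'. cis (- (t' * airy \<zeta>)) * ?Q t' \<zeta>"
  have h: "sq_int ?h" using admissible_freqs[of d] by (simp add: admissible_datum_def)
  note c = conv_free_flow_continuous[OF h, of \<zeta>]
  have cq: "continuous_on {0..t} ?q"
    by (intro continuous_intros continuous_on_cis continuous_on_subset[OF c]) auto
  have "d ^ 5 / (4 * pi) * t = integral {0..t} (\<lambda>_. d ^ 5 / (4 * pi))" using t by simp
  also have "\<dots> \<le> integral {0..t} (\<lambda>t'. Re (?q t'))"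
  proof (rule integral_le)
    show "(\<lambda>t'. Re (?q t')) integrable_on {0..t}" by (intro integrable_continuous_real continuous_intros cq)
    show "d ^ 5 / (4 * pi) \<le> Re (?q t')" if "t' \<in> {0..t}" for t'
      using conv_lower_bound[OF d \<zeta>, of t'] that t by simp
  qed auto
  also have "\<dots> = Re (integral {0..t} ?q)"
    using integral_linear[OF integrable_continuous_real[OF cq] bounded_linear_Re] by (simp add: o_def)
  also have "\<dots> \<le> cmod (integral {0..t} ?q)" by (rule complex_Re_le_cmod)
  also have "\<dots> = cmod (retarded ?Q t \<zeta>)"
    unfolding retarded_eq[of ?Q, OF c] by (simp add: norm_mult)
  finally have r: "d ^ 5 / (4 * pi) * t \<le> cmod (retarded ?Q t \<zeta>)" .
  have "4 powr (- 1 / 3) * (1 / d\<^sup>2 * (d ^ 5 / (4 * pi) * t)) \<le> 4 powr (- 1 / 3) * (cmod (grad_symbol \<zeta>) * cmod (retarded ?Q t \<zeta>))"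
    using freq_out_bounds[OF d \<zeta>] r d t by (intro mult_left_mono mult_mono) auto
  then show ?thesis
    using d by (simp add: picard2_def norm_mult power2_eq_square eval_nat_numeral field_simps)
qed

lemma l2_picard2_lower_bound:
  assumes d: "0 < d" "d \<le> 1 / 2" and s: "s < 0" and t: "0 \<le> t" "t \<le> 1 / 5000"
    and sq: "sq_int (\<lambda>\<zeta>. complex_of_real (sobolev_weight s \<zeta>) * picard2 (indicator (freqs d)) t \<zeta>)"
  shows "(l2 (\<lambda>\<zeta>. complex_of_real (sobolev_weight s \<zeta>) * picard2 (indicator (freqs d)) t \<zeta>))\<^sup>2
    \<ge> (100 / d ^ 4) powr s * (4 powr (- 1 / 3) * t / (4 * pi) * d ^ 3)\<^sup>2 * d ^ 5"
proof -
  let ?c = "(100 / d ^ 4) powr s * (4 powr (- 1 / 3) * t / (4 * pi) * d ^ 3)\<^sup>2"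
  have v: "integrable lborel (indicator (freq_out d) :: plane \<Rightarrow> real)" "(LINT \<zeta>|lborel. indicator (freq_out d) \<zeta> :: real) = d ^ 5"
    using d by (simp_all add: freq_out_def measure_sheared_box integrable_sheared_box eval_nat_numeral)
  have "?c * d ^ 5 = (LINT \<zeta>|lborel. ?c * indicator (freq_out d) \<zeta>)"
    unfolding integral_mult_right_zero v ..
  also have "\<dots> \<le> (LINT \<zeta>|lborel. (cmod (complex_of_real (sobolev_weight s \<zeta>) * picard2 (indicator (freqs d)) t \<zeta>))\<^sup>2)"
  proof (rule integral_mono)
    show "integrable lborel (\<lambda>\<zeta>. ?c * indicator (freq_out d) \<zeta>)" by (intro integrable_mult_right v)
    show "integrable lborel (\<lambda>\<zeta>. (cmod (complex_of_real (sobolev_weight s \<zeta>) * picard2 (indicator (freqs d)) t \<zeta>))\<^sup>2)"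
      using sq by (simp add: sq_int_def)
    fix \<zeta>
    show "?c * indicator (freq_out d) \<zeta> \<le> (cmod (complex_of_real (sobolev_weight s \<zeta>) * picard2 (indicator (freqs d)) t \<zeta>))\<^sup>2"
    proof (cases "\<zeta> \<in> freq_out d")
      case True
      have "(100 / d ^ 4) powr s \<le> (1 + (norm \<zeta>)\<^sup>2) powr s"
        using freq_out_bounds(2)[OF d True] s by (intro powr_mono2') (auto intro: add_pos_nonneg)
      moreover have "(4 powr (- 1 / 3) * t / (4 * pi) * d ^ 3)\<^sup>2 \<le> (cmod (picard2 (indicator (freqs d)) t \<zeta>))\<^sup>2"
        using picard2_lower_bound[OF d True t] d t by (intro power_mono) auto
      ultimately show ?thesis
        unfolding sobolev_weight_power2 using True by (simp add: mult_mono)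
    qed simp
  qed
  finally show ?thesis unfolding l2_power2 .
qed

theorem theorem1p3:
  fixes s T :: real
  assumes "s < - 1 / 4" and "T > 0"
  shows "\<not> (\<exists>\<Phi> :: tdist \<Rightarrow> real \<Rightarrow> tdist.
    (\<forall>u\<^sub>0\<in>real_sobolev s. sobolev_norm s u\<^sub>0 < 1 \<longrightarrow> solution s T u\<^sub>0 (\<Phi> u\<^sub>0)) \<and>
    C2_at (real_sobolev s) (sobolev_norm s) (paths s T) (paths_norm s T) 0 \<Phi>)"
proof
  assume "\<exists>\<Phi> :: tdist \<Rightarrow> real \<Rightarrow> tdist.
    (\<forall>u\<^sub>0\<in>real_sobolev s. sobolev_norm s u\<^sub>0 < 1 \<longrightarrow> solution s T u\<^sub>0 (\<Phi> u\<^sub>0)) \<and>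
    C2_at (real_sobolev s) (sobolev_norm s) (paths s T) (paths_norm s T) 0 \<Phi>"
  then obtain \<Phi> :: "tdist \<Rightarrow> real \<Rightarrow> tdist" where
    sol0: "\<forall>u\<^sub>0\<in>real_sobolev s. sobolev_norm s u\<^sub>0 < 1 \<longrightarrow> solution s T u\<^sub>0 (\<Phi> u\<^sub>0)"
    and C2: "C2_at (real_sobolev s) (sobolev_norm s) (paths s T) (paths_norm s T) 0 \<Phi>"
    by (elim exE conjE) (rule that)
  have sol: "solution s T u\<^sub>0 (\<Phi> u\<^sub>0)" if "u\<^sub>0 \<in> real_sobolev s" "sobolev_norm s u\<^sub>0 < 1" for u\<^sub>0
    using sol0 that by simp
  show False
  proof (rule picard2_estimate[OF assms(2) sol C2])
    fix K
    assume K: "\<And>h t. admissible_datum h \<Longrightarrow> t \<in> {0..T} \<Longrightarrow>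
      sq_int (\<lambda>\<zeta>. complex_of_real (sobolev_weight s \<zeta>) * picard2 h t \<zeta>) \<and>
      l2 (\<lambda>\<zeta>. complex_of_real (sobolev_weight s \<zeta>) * picard2 h t \<zeta>)
        \<le> K * (l2 (\<lambda>\<zeta>. complex_of_real (sobolev_weight s \<zeta>) * h \<zeta>))\<^sup>2"
    have s: "s < 0" using assms(1) by simp
    \<comment> \<open>A fixed positive time on which the interaction stays coherent; it does not
      shrink with \<open>d\<close>.\<close>
    define t where "t = min T (1 / 5000)"
    have t: "0 < t" "t \<le> 1 / 5000" "t \<in> {0..T}" using assms(2) by (auto simp: t_def)
    define c where "c = 100 powr s * (4 powr (- 1 / 3) * t / (4 * pi))\<^sup>2"
    \<comment> \<open>The summand 1 keeps \<open>c'\<close> positive even for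
      \<open>K = 0\<close>.\<close>
    define c' where "c' = K\<^sup>2 * ((1 / 4) powr s * 16)\<^sup>2 + 1"
    have c: "c > 0" "c' > 0" using t by (auto simp: c_def c'_def intro: add_nonneg_pos)
    \<comment> \<open>The squared output norm contributes \<open>d^(- 4 s) * d^6 * d^5\<close>, the
      fourth power of the datum norm \<open>(d^(- 4 s) * d^5)^2\<close>; the quotient of the second
      by the first is \<open>d^(- 4 s - 1)\<close>.\<close>
    have main: "c \<le> c' * d powr (- 4 * s - 1)" if d: "0 < d" "d \<le> 1 / 2" for d
    proof -
      let ?h = "indicator (freqs d) :: plane \<Rightarrow> complex"
      let ?n = "l2 (\<lambda>\<zeta>. complex_of_real (sobolev_weight s \<zeta>) * ?h \<zeta>)"
      let ?p = "l2 (\<lambda>\<zeta>. complex_of_real (sobolev_weight s \<zeta>) * picard2 ?h t \<zeta>)"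
      note k = K[OF admissible_freqs t(3), of d]
      have "(100 / d ^ 4) powr s * (4 powr (- 1 / 3) * t / (4 * pi) * d ^ 3)\<^sup>2 * d ^ 5 \<le> ?p\<^sup>2"
        using t k by (intro l2_picard2_lower_bound d s) auto
      also have "\<dots> \<le> (K * ?n\<^sup>2)\<^sup>2" using k by (intro power_mono) auto
      also have "\<dots> = K\<^sup>2 * (?n\<^sup>2)\<^sup>2" by (rule power_mult_distrib)
      also have "\<dots> \<le> K\<^sup>2 * ((1 / (4 * d ^ 4)) powr s * (16 * d ^ 5))\<^sup>2"
        by (intro mult_left_mono power_mono l2_datum_bound d s) auto
      finally have le: "(100 / d ^ 4) powr s * (4 powr (- 1 / 3) * t / (4 * pi) * d ^ 3)\<^sup>2 * d ^ 5
        \<le> K\<^sup>2 * ((1 / (4 * d ^ 4)) powr s * (16 * d ^ 5))\<^sup>2" .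
      have "1 / d ^ 4 = d powr (- 4)" using d by (simp add: powr_minus_divide)
      then have dp: "(1 / d ^ 4) powr s = d powr (- 4 * s)" by (simp add: powr_powr)
      have "(100 / d ^ 4) powr s * (4 powr (- 1 / 3) * t / (4 * pi) * d ^ 3)\<^sup>2 * d ^ 5 = c * (d powr (- 4 * s) * d ^ 11)"
      proof -
        have "(100 / d ^ 4) powr s = 100 powr s * (1 / d ^ 4) powr s"
          using powr_mult[of 100 "1 / d ^ 4" s] d by simp
        then show ?thesis unfolding dp c_def by (simp add: power_mult_distrib eval_nat_numeral)
      qed
      moreover have "K\<^sup>2 * ((1 / (4 * d ^ 4)) powr s * (16 * d ^ 5))\<^sup>2 = (K\<^sup>2 * ((1 / 4) powr s * 16)\<^sup>2) * ((d powr (- 4 * s))\<^sup>2 * d ^ 10)"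
      proof -
        have "(1 / (4 * d ^ 4)) powr s = (1 / 4) powr s * (1 / d ^ 4) powr s"
          using powr_mult[of "1 / 4" "1 / d ^ 4" s] d by simp
        then show ?thesis unfolding dp by (simp add: power_mult_distrib eval_nat_numeral)
      qed
      moreover have "(K\<^sup>2 * ((1 / 4) powr s * 16)\<^sup>2) * ((d powr (- 4 * s))\<^sup>2 * d ^ 10) \<le> c' * ((d powr (- 4 * s))\<^sup>2 * d ^ 10)"
        using d by (intro mult_right_mono) (auto simp: c'_def)
      ultimately have "c * (d powr (- 4 * s) * d ^ 11) \<le> c' * ((d powr (- 4 * s))\<^sup>2 * d ^ 10)" using le by linarith
      also have "(d powr (- 4 * s))\<^sup>2 * d ^ 10 = (d powr (- 4 * s) * d ^ 11) * d powr (- 4 * s - 1)"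
      proof -
        have "d powr (- 4 * s) = d powr (- 4 * s - 1) * d" using d by (simp add: powr_diff)
        then show ?thesis by (simp add: power2_eq_square eval_nat_numeral)
      qed
      finally have "(d powr (- 4 * s) * d ^ 11) * c \<le> (d powr (- 4 * s) * d ^ 11) * (c' * d powr (- 4 * s - 1))"
        by (simp only: mult_ac)
      moreover have "0 < d powr (- 4 * s) * d ^ 11" using d by simp
      ultimately show ?thesis by (simp only: mult_le_cancel_left_pos)
    qed
    \<comment> \<open>Positive exactly when \<open>s < - 1 / 4\<close>; then the right side of
      \<open>main\<close> tends to 0 with \<open>d\<close>.\<close>
    define e where "e = - 4 * s - 1"
    have e: "e > 0" using assms(1) by (simp add: e_def)
    \<comment> \<open>Solves \<open>c' * d powr e = c / 2\<close>, capped at \<open>1 / 2\<close>,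
      up to which the box estimates hold.\<close>
    define d where "d = min (1 / 2) ((c / (2 * c')) powr (1 / e))"
    have d: "0 < d" "d \<le> 1 / 2" using c by (auto simp: d_def)
    have "d powr e \<le> ((c / (2 * c')) powr (1 / e)) powr e"
      using d e by (intro powr_mono2) (auto simp: d_def)
    also have "\<dots> = c / (2 * c')" using c e by (simp add: powr_powr)
    finally have "c' * d powr e \<le> c / 2" using c by (simp add: field_simps)
    then show False using main[OF d] c unfolding e_def by simp
  qed
qed

end
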